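(* Let $\alpha\in(0,1)$. For every $\xi_0\in C^{2+\alpha}(\mathbb S^1;\mathbb R^d)$ with $|\partial_s\xi_0(s)|=1$ for all $s$ and $\int_0^1\xi_0(s)\,ds=0$, there exists $T>0$, depending on $\|\xi_0\|_{C^{2+\alpha}(\mathbb S^1)}$, such that the Cauchy problem $$\partial_t\xi=\partial_s(\sigma\partial_s\xi)+\xi,\qquad \partial_{ss}\sigma-|\partial_{ss}\xi|^2\sigma=-1,\qquad \xi(0,s)=\xi_0(s)$$ has a unique solution $\xi\in C^{2+\alpha,\alpha/2}([0,T]\times\mathbb S^1)$ with $\partial_t\xi\in C^{\alpha,\alpha/2}([0,T]\times\mathbb S^1)$.
   Context: $\mathbb S^1=\mathbb R/\mathbb Z$, $d\ge2$. For $\alpha,\beta\in[0,1)$, $T>0$, $k\in\mathbb N\cup\{0\}$, $C^{k+\alpha,\beta}([0,T]\times\mathbb S^1)$ is the space of $\xi:[0,T]\times\mathbb S^1\to\mathbb R^d$ with finite norm $\|\xi\|_{k+\alpha,\beta}=\sup_t\|\xi(t,\cdot)\|_{C^{k+\alpha}(\mathbb S^1)}+\sup_s\sum_{j=0}^k\|\partial_s^j\xi(\cdot,s)\|_{C^\beta([0,T])}$, where $C^{k+\alpha}(\mathbb S^1)$ and $C^\beta([0,T])$ are the usual Hölder spaces. In the Cauchy problem, $\sigma(t,\cdot)$ is a periodic function on $\mathbb S^1$ for each $t$. *)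

theory Defs
  imports "HOL-Analysis.Analysis"
begin

text \<open>Functions on S^1 = R/Z are represented as 1-periodic functions on the real line.
  Space-time functions are written xi t s (time t, arclength parameter s).\<close>

definition periodic1 :: "(real \<Rightarrow> 'a) \<Rightarrow> bool" where
  "periodic1 f \<longleftrightarrow> (\<forall>s. f (s + 1) = f s)"

definition circ_dist :: "real \<Rightarrow> real \<Rightarrow> real" where
  "circ_dist x y = \<bar>x - y - of_int (round (x - y))\<bar>"

fun dpow :: "nat \<Rightarrow> (real \<Rightarrow> 'a::real_normed_vector) \<Rightarrow> real \<Rightarrow> 'a" where
  "dpow 0 f = f"
| "dpow (Suc k) f = (\<lambda>s. vector_derivative (dpow k f) (at s))"

definition holder_quot_S1 :: "real \<Rightarrow> (real \<Rightarrow> 'a::real_normed_vector) \<Rightarrow> real set" where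
  "holder_quot_S1 a f =
     (\<lambda>(x, y). norm (f x - f y) / circ_dist x y powr a) ` {(x, y). circ_dist x y \<noteq> 0}"

definition holder_quot :: "real set \<Rightarrow> real \<Rightarrow> (real \<Rightarrow> 'a::real_normed_vector) \<Rightarrow> real set" where
  "holder_quot S b f =
     (\<lambda>(x, y). norm (f x - f y) / \<bar>x - y\<bar> powr b) ` {(x, y). x \<in> S \<and> y \<in> S \<and> x \<noteq> y}"

definition C_S1 :: "nat \<Rightarrow> real \<Rightarrow> (real \<Rightarrow> 'a::real_normed_vector) \<Rightarrow> bool" where
  "C_S1 k a f \<longleftrightarrow> periodic1 f
     \<and> (\<forall>j<k. \<forall>s. (dpow j f has_vector_derivative dpow (Suc j) f s) (at s))
     \<and> continuous_on UNIV (dpow k f)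
     \<and> bdd_above (holder_quot_S1 a (dpow k f))"

definition norm_S1 :: "nat \<Rightarrow> real \<Rightarrow> (real \<Rightarrow> 'a::real_normed_vector) \<Rightarrow> real" where
  "norm_S1 k a f = (\<Sum>j\<le>k. (SUP s. norm (dpow j f s))) + Sup (holder_quot_S1 a (dpow k f))"

definition C_int :: "real \<Rightarrow> real \<Rightarrow> (real \<Rightarrow> 'a::real_normed_vector) \<Rightarrow> bool" where
  "C_int T b f \<longleftrightarrow> continuous_on {0..T} f \<and> bdd_above (holder_quot {0..T} b f)"

definition norm_int :: "real \<Rightarrow> real \<Rightarrow> (real \<Rightarrow> 'a::real_normed_vector) \<Rightarrow> real" where
  "norm_int T b f = (SUP t\<in>{0..T}. norm (f t)) + Sup (holder_quot {0..T} b f)"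

definition C_par :: "nat \<Rightarrow> real \<Rightarrow> real \<Rightarrow> real \<Rightarrow> (real \<Rightarrow> real \<Rightarrow> 'a::real_normed_vector) \<Rightarrow> bool" where
  "C_par k a b T xi \<longleftrightarrow>
     (\<forall>t\<in>{0..T}. C_S1 k a (xi t))
     \<and> bdd_above ((\<lambda>t. norm_S1 k a (xi t)) ` {0..T})
     \<and> (\<forall>s. \<forall>j\<le>k. C_int T b (\<lambda>t. dpow j (xi t) s))
     \<and> bdd_above ((\<lambda>s. \<Sum>j\<le>k. norm_int T b (\<lambda>t. dpow j (xi t) s)) ` UNIV)"

definition dt :: "real \<Rightarrow> (real \<Rightarrow> real \<Rightarrow> 'a::real_normed_vector) \<Rightarrow> real \<Rightarrow> real \<Rightarrow> 'a" where
  "dt T xi t s = vector_derivative (\<lambda>\<tau>. xi \<tau> s) (at t within {0..T})"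

definition is_solution :: "real \<Rightarrow> real \<Rightarrow> (real \<Rightarrow> 'a::real_normed_vector)
    \<Rightarrow> (real \<Rightarrow> real \<Rightarrow> 'a) \<Rightarrow> bool" where
  "is_solution a T xi0 xi \<longleftrightarrow>
     C_par 2 a (a / 2) T xi
     \<and> (\<forall>t\<in>{0..T}. \<forall>s. (\<lambda>\<tau>. xi \<tau> s) differentiable (at t within {0..T}))
     \<and> C_par 0 a (a / 2) T (dt T xi)
     \<and> (\<exists>\<sigma> :: real \<Rightarrow> real \<Rightarrow> real.
          (\<forall>t\<in>{0..T}. periodic1 (\<sigma> t)
             \<and> (\<forall>s. (\<sigma> t has_vector_derivative dpow 1 (\<sigma> t) s) (at s))
             \<and> (\<forall>s. (dpow 1 (\<sigma> t) has_vector_derivative dpow 2 (\<sigma> t) s) (at s))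
             \<and> (\<forall>s. dpow 2 (\<sigma> t) s - (norm (dpow 2 (xi t) s))\<^sup>2 * \<sigma> t s = -1)
             \<and> (\<forall>s. ((\<lambda>r. \<sigma> t r *\<^sub>R dpow 1 (xi t) r)
                      has_vector_derivative (dt T xi t s - xi t s)) (at s))))
     \<and> (\<forall>s. xi 0 s = xi0 s)"

end

theory Submission
  imports Defs "HOL-Probability.Sinc_Integral"
begin

text \<open>Given a closed curve, the tension is determined by a linear elliptic equation that is uniquely solvable as soon as the
  curve is not a straight line, and it gains two derivatives over the squared curvature. Hence the problem is a
  quasilinear heat equation whose coefficients depend on the curve only at the same time.

  Existence: freeze the leading coefficient at the initial tension, straighten it by a change of the space variable, and
  solve the resulting heat equation with Duhamel's formula. The solution operator maps forcings bounded in C^a, uniformly in time,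
  to solutions whose second derivatives are bounded in C^a and of size t^(a/2) in the supremum norm. This last smallness makes the
  map from a forcing to the remaining nonlinearity a contraction on a time interval controlled by the norm of the
  initial curve. Regularity in time follows by interpolation.

  Uniqueness: the H^1 norm of the difference of two solutions satisfies a Gronwall inequality. The tension
  difference depends on second derivatives of the curve difference, but only tested against Hoelder functions, so it is controlled by a
  small multiple of the dissipation plus first-order terms.\<close>

section \<open>Bounded functions with a Hoelder modulus\<close>

text \<open>The unknown of the fixed point is the forcing, not the curve. Second derivatives of the
  correction stay merely bounded in C^a; only their supremum becomes small. This suffices because in
  a difference of two nonlinearities the second-order difference is multiplied by \<sigma> - c
  alone, and the C^a norm of a tension difference is controlled by the sup norm of the difference of
  squared curvatures.

  The curvature may vanish on arcs, so coercivity of the tension equation rests on the mean squared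
  curvature. Initially this mean is at least 1, since a closed unit-speed curve must turn; on the
  lifespan it stays above 1/2. For uniqueness the solutions are arbitrary: solvability of the
  tension equation excludes straight lines at each time, and compactness in time gives a positive
  lower bound.

  The energy is H^1 because the Hoelder weights in the tension difference do not allow a complete
  integration by parts: a small multiple of second derivatives remains, and the dissipation must
  contain them.\<close>

definition holder :: "real \<Rightarrow> real \<Rightarrow> (real \<Rightarrow> 'v::real_normed_vector) \<Rightarrow> bool" where
  "holder a M g \<longleftrightarrow> (\<forall>x. norm (g x) \<le> M) \<and> (\<forall>x y. norm (g x - g y) \<le> M * \<bar>x - y\<bar> powr a)"

lemma holderI:
  assumes "\<And>x. norm (g x) \<le> M" "\<And>x y. norm (g x - g y) \<le> M * \<bar>x - y\<bar> powr a"
  shows "holder a M g"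
  using assms by (auto simp: holder_def)

lemma holderD1: "holder a M g \<Longrightarrow> norm (g x) \<le> M"
  and holderD2: "holder a M g \<Longrightarrow> norm (g x - g y) \<le> M * \<bar>x - y\<bar> powr a"
  by (auto simp: holder_def)

lemma holder_nonneg: "holder a M g \<Longrightarrow> 0 \<le> M"
  using holderD1[of a M g undefined] norm_ge_zero order_trans by blast

lemma holder_mono: "holder a M g \<Longrightarrow> M \<le> N \<Longrightarrow> holder a N g"
  unfolding holder_def by (meson mult_right_mono order_trans powr_ge_zero)

lemma holder_zero: "0 \<le> M \<Longrightarrow> holder a M (\<lambda>x. 0)"
  by (auto simp: holder_def)

lemma holder_add:
  assumes "holder a A f" "holder a B g" shows "holder a (A + B) (\<lambda>x. f x + g x)"
proof (rule holderI)
  fix x y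
  show "norm (f x + g x) \<le> A + B"
    using assms by (meson holderD1 norm_triangle_le add_mono)
  have "norm ((f x + g x) - (f y + g y)) \<le> norm (f x - f y) + norm (g x - g y)"
    by (simp add: norm_diff_triangle_ineq)
  also have "\<dots> \<le> (A + B) * \<bar>x - y\<bar> powr a"
    using holderD2[OF assms(1), of x y] holderD2[OF assms(2), of x y] by (simp add: distrib_right)
  finally show "norm ((f x + g x) - (f y + g y)) \<le> (A + B) * \<bar>x - y\<bar> powr a" .
qed

lemma holder_minus: "holder a A f \<Longrightarrow> holder a A (\<lambda>x. - f x)"
  unfolding holder_def by (metis (no_types, lifting) minus_diff_minus norm_minus_cancel)

lemma holder_diff:
  assumes "holder a A f" "holder a B g" shows "holder a (A + B) (\<lambda>x. f x - g x)"
  using holder_add[OF assms(1) holder_minus[OF assms(2)]] by simp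

text \<open>As one constant bounds both the supremum and the Hoelder quotient, the product rule
  yields two equal terms \<open>A * B\<close>, whence the factor 2.\<close>

lemma holder_scaleR:
  fixes f :: "real \<Rightarrow> real"
  assumes "holder a A f" "holder a B g" shows "holder a (2 * A * B) (\<lambda>x. f x *\<^sub>R g x)"
proof (rule holderI)
  fix x y
  have A: "0 \<le> A" "0 \<le> B" using assms holder_nonneg by auto
  have "norm (f x *\<^sub>R g x) \<le> A * B"
    using holderD1[OF assms(1), of x] holderD1[OF assms(2), of x] A by (simp add: mult_mono)
  also have "\<dots> \<le> 2 * A * B" using mult_nonneg_nonneg[OF A] by simp
  finally show "norm (f x *\<^sub>R g x) \<le> 2 * A * B" .
  have "f x *\<^sub>R g x - f y *\<^sub>R g y = (f x - f y) *\<^sub>R g x + f y *\<^sub>R (g x - g y)"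
    by (simp add: algebra_simps)
  then have "norm (f x *\<^sub>R g x - f y *\<^sub>R g y) \<le> \<bar>f x - f y\<bar> * norm (g x) + \<bar>f y\<bar> * norm (g x - g y)"
    by (metis norm_scaleR norm_triangle_ineq)
  also have "\<dots> \<le> (A * \<bar>x - y\<bar> powr a) * B + A * (B * \<bar>x - y\<bar> powr a)"
    using holderD1[OF assms(1), of y] holderD1[OF assms(2), of x] holderD2[OF assms(1), of x y] holderD2[OF assms(2), of x y] A
    by (intro add_mono mult_mono) auto
  also have "\<dots> = 2 * A * B * \<bar>x - y\<bar> powr a" by simp
  finally show "norm (f x *\<^sub>R g x - f y *\<^sub>R g y) \<le> 2 * A * B * \<bar>x - y\<bar> powr a" .
qed

lemma lipschitz_vector_derivative:
  fixes f :: "real \<Rightarrow> 'v::real_normed_vector"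
  assumes "\<And>x. (f has_vector_derivative f' x) (at x)" "\<And>x. norm (f' x) \<le> B"
  shows "norm (f x - f y) \<le> B * \<bar>x - y\<bar>"
proof -
  have *: "norm (f x - f y) \<le> B * norm (x - y)"
  proof (rule differentiable_bound[where S = UNIV and f' = "\<lambda>x h. h *\<^sub>R f' x"])
    show "(f has_derivative (\<lambda>h. h *\<^sub>R f' x)) (at x within UNIV)" for x
      using assms(1)[of x] by (simp add: has_vector_derivative_def)
    show "onorm (\<lambda>h. h *\<^sub>R f' x) \<le> B" for x
    proof (rule onorm_bound)
      show "0 \<le> B" using assms(2)[of x] norm_ge_zero order_trans by blast
      show "norm (h *\<^sub>R f' x) \<le> B * norm h" for h
        using mult_right_mono[OF assms(2)[of x], of "\<bar>h\<bar>"] by (simp add: mult.commute)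
    qed
  qed auto
  then show ?thesis by simp
qed

text \<open>Up to distance 1 the distance is below its power \<open>a\<close>; beyond 1, twice the
  sup bound suffices.\<close>

lemma holder_lipschitz:
  fixes g :: "real \<Rightarrow> 'v::real_normed_vector"
  assumes a: "0 < a" "a \<le> 1" and b: "\<And>x. norm (g x) \<le> M" and l: "\<And>x y. norm (g x - g y) \<le> M * \<bar>x - y\<bar>"
  shows "holder a (2 * M) g"
proof (rule holderI)
  have M: "0 \<le> M" using b[of 0] norm_ge_zero order_trans by blast
  show "norm (g x) \<le> 2 * M" for x using b[of x] M by linarith
  fix x y
  show "norm (g x - g y) \<le> 2 * M * \<bar>x - y\<bar> powr a"
  proof (cases "\<bar>x - y\<bar> \<le> 1")
    case True
    then have "\<bar>x - y\<bar> \<le> \<bar>x - y\<bar> powr a"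
      using powr_mono'[of a 1 "\<bar>x - y\<bar>"] a by simp
    then have "M * \<bar>x - y\<bar> \<le> 2 * M * \<bar>x - y\<bar> powr a"
      using M by (simp add: mult_mono)
    then show ?thesis using l[of x y] by linarith
  next
    case False
    then have "1 \<le> \<bar>x - y\<bar> powr a" using a by (simp add: ge_one_powr_ge_zero)
    then have "2 * M \<le> 2 * M * \<bar>x - y\<bar> powr a" using M by (simp add: mult_le_cancel_left1)
    moreover have "norm (g x - g y) \<le> 2 * M"
      using norm_triangle_ineq4[of "g x" "g y"] b[of x] b[of y] by linarith
    ultimately show ?thesis by linarith
  qed
qed

lemma holder_C1:
  fixes g :: "real \<Rightarrow> 'v::real_normed_vector"
  assumes "0 < a" "a \<le> 1" "\<And>x. norm (g x) \<le> M"
    "\<And>x. (g has_vector_derivative g' x) (at x)" "\<And>x. norm (g' x) \<le> M"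
  shows "holder a (2 * M) g"
  using assms by (intro holder_lipschitz lipschitz_vector_derivative) auto

lemma holder_continuous:
  fixes g :: "real \<Rightarrow> 'v::real_normed_vector"
  assumes "0 < a" "holder a M g" shows "continuous_on UNIV g"
  unfolding continuous_on_def
proof
  fix x :: real
  have "((\<lambda>y. M * \<bar>y - x\<bar> powr a) \<longlongrightarrow> M * \<bar>x - x\<bar> powr a) (at x)"
    using assms by (intro tendsto_intros) auto
  then have "((\<lambda>y. M * \<bar>y - x\<bar> powr a) \<longlongrightarrow> 0) (at x)" by simp
  then have "((\<lambda>y. g y - g x) \<longlongrightarrow> 0) (at x)"
    by (rule Lim_null_comparison[rotated]) (simp add: holderD2[OF assms(2)])
  then show "(g \<longlongrightarrow> g x) (at x within UNIV)" by (simp add: LIM_zero_cancel)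
qed

section \<open>Functions of period 1 on the line\<close>

lemma periodic1_int: assumes "periodic1 f" shows "f (s + of_int n) = f s"
proof -
  have nat: "f (s + real k) = f s" for s k
  proof (induction k)
    case (Suc k)
    have "f (s + real (Suc k)) = f ((s + real k) + 1)" by (simp add: algebra_simps)
    also have "\<dots> = f (s + real k)" using assms unfolding periodic1_def by blast
    finally show ?case using Suc.IH by simp
  qed simp
  show ?thesis
  proof (cases "n \<ge> 0")
    case True
    then show ?thesis using nat[of s "nat n"] by simp
  next
    case False
    then show ?thesis using nat[of "s + of_int n" "nat (- n)"] by simp
  qed
qed

lemma periodic1_frac: "periodic1 f \<Longrightarrow> f (frac s) = f s"
  using periodic1_int[of f s "- \<lfloor>s\<rfloor>"] by (simp add: frac_def)

lemma frac_01: "frac s \<in> {0..1::real}"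
  by (simp add: frac_ge_0 less_imp_le[OF frac_lt_1])

text \<open>Transfers what compactness or integration gives on [0,1] to the whole line.\<close>

lemma periodic1_all: "periodic1 f \<Longrightarrow> (\<And>s. s \<in> {0..1} \<Longrightarrow> P (f s)) \<Longrightarrow> P (f s)"
  by (metis frac_01 periodic1_frac)

lemma periodic1_has_vector_derivative:
  fixes f :: "real \<Rightarrow> 'v::real_normed_vector"
  assumes "periodic1 f" "\<And>s. (f has_vector_derivative f' s) (at s)"
  shows "periodic1 f'"
  unfolding periodic1_def
proof
  fix s
  have "((\<lambda>r. r + 1) has_real_derivative 1) (at s)" by (auto intro!: derivative_eq_intros)
  then have "((f \<circ> (\<lambda>r. r + 1)) has_vector_derivative 1 *\<^sub>R f' (s + 1)) (at s)"
    using assms(2) by (intro vector_diff_chain_at) (auto simp: has_real_derivative_iff_has_vector_derivative)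
  moreover have "f \<circ> (\<lambda>r. r + 1) = f" using assms(1) by (auto simp: periodic1_def)
  ultimately have "(f has_vector_derivative f' (s + 1)) (at s)" by simp
  then show "f' (s + 1) = f' s"
    by (rule vector_derivative_unique_at[OF _ assms(2)])
qed

lemma continuous_on_of_vector_derivative:
  fixes f :: "real \<Rightarrow> 'v::real_normed_vector"
  assumes "\<And>s. (f has_vector_derivative f' s) (at s)"
  shows "continuous_on S f"
  using assms by (meson continuous_at_imp_continuous_on has_vector_derivative_continuous)

section \<open>Integral inequalities over one period\<close>

lemma integral_by_parts_periodic:
  fixes f g :: "real \<Rightarrow> 'v::euclidean_space"
  assumes f: "\<And>s. (f has_vector_derivative f' s) (at s)" and g: "\<And>s. (g has_vector_derivative g' s) (at s)"
    and c: "continuous_on UNIV f'" "continuous_on UNIV g'" and p: "f 1 = f 0" "g 1 = g 0"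
  shows "integral {0..1} (\<lambda>s. f' s \<bullet> g s) = - integral {0..1} (\<lambda>s. f s \<bullet> g' s)"
proof -
  have cf: "continuous_on S f" "continuous_on S g" for S
    using f g continuous_on_of_vector_derivative by blast+
  have c': "continuous_on S f'" "continuous_on S g'" for S
    using c continuous_on_subset by blast+
  have "((\<lambda>s. f' s \<bullet> g s + f s \<bullet> g' s) has_integral (f 1 \<bullet> g 1 - f 0 \<bullet> g 0)) {0..1}"
  proof (rule fundamental_theorem_of_calculus)
    fix s :: real
    have "((\<lambda>s. f s \<bullet> g s) has_vector_derivative (f s \<bullet> g' s + f' s \<bullet> g s)) (at s within {0..1})"
      using bounded_bilinear.has_vector_derivative[OF bounded_bilinear_inner
        has_vector_derivative_at_within[OF f] has_vector_derivative_at_within[OF g]] by simp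
    then show "((\<lambda>s. f s \<bullet> g s) has_vector_derivative (f' s \<bullet> g s + f s \<bullet> g' s)) (at s within {0..1})"
      by (simp add: add.commute)
  qed simp
  then have "integral {0..1} (\<lambda>s. f' s \<bullet> g s + f s \<bullet> g' s) = 0"
    using p by (simp add: integral_unique)
  moreover have "integral {0..1} (\<lambda>s. f' s \<bullet> g s + f s \<bullet> g' s)
     = integral {0..1} (\<lambda>s. f' s \<bullet> g s) + integral {0..1} (\<lambda>s. f s \<bullet> g' s)"
    by (intro integral_add integrable_continuous_interval continuous_intros cf c')
  ultimately show ?thesis by linarith
qed

text \<open>Jensen's inequality on a unit interval, obtained by integrating the square of the norm
  minus its mean.\<close>

lemma integral_norm_square_le:
  fixes h :: "real \<Rightarrow> 'v::euclidean_space"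
  assumes "continuous_on {0..1} h"
  shows "(integral {0..1} (\<lambda>s. norm (h s)))\<^sup>2 \<le> integral {0..1} (\<lambda>s. (norm (h s))\<^sup>2)"
proof -
  define c where "c = integral {0..1} (\<lambda>s. norm (h s))"
  have i: "(\<lambda>s. (norm (h s))\<^sup>2) integrable_on {0..1}" "(\<lambda>s. norm (h s)) integrable_on {0..1}"
    by (intro integrable_continuous_interval continuous_intros assms)+
  have "0 \<le> integral {0..1} (\<lambda>s. (norm (h s))\<^sup>2 - (2 * c) * norm (h s) + c\<^sup>2)"
  proof (rule integral_nonneg)
    show "(\<lambda>s. (norm (h s))\<^sup>2 - 2 * c * norm (h s) + c\<^sup>2) integrable_on {0..1}"
      by (intro integrable_continuous_interval continuous_intros assms)
    show "0 \<le> (norm (h s))\<^sup>2 - 2 * c * norm (h s) + c\<^sup>2" for s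
      using zero_le_power2[of "norm (h s) - c"] by (simp add: power2_diff algebra_simps)
  qed
  also have "\<dots> = integral {0..1} (\<lambda>s. (norm (h s))\<^sup>2) - (2 * c) * c + c\<^sup>2"
  proof -
    have "((\<lambda>s. (norm (h s))\<^sup>2 - (2 * c) * norm (h s) + c\<^sup>2) has_integral
      (integral {0..1} (\<lambda>s. (norm (h s))\<^sup>2) - (2 * c) * c + c\<^sup>2)) {0..1}"
      using has_integral_const_real[of "c\<^sup>2" 0 1] i
      by (intro has_integral_add has_integral_diff has_integral_mult_right) (auto simp: c_def integrable_integral)
    then show ?thesis by (simp add: integral_unique)
  qed
  finally show ?thesis by (simp add: c_def power2_eq_square)
qed

lemma norm_diff_le_integral:
  fixes f :: "real \<Rightarrow> 'v::euclidean_space"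
  assumes f: "\<And>s. (f has_vector_derivative f' s) (at s)" and c: "continuous_on UNIV f'"
    and xy: "x \<in> {0..1}" "y \<in> {0..1}"
  shows "norm (f x - f y) \<le> integral {0..1} (\<lambda>s. norm (f' s))"
proof -
  have c': "continuous_on S f'" for S
    using c continuous_on_subset by blast
  have *: "norm (f y - f x) \<le> integral {0..1} (\<lambda>s. norm (f' s))" if "x \<le> y" "0 \<le> x" "y \<le> 1" for x y
  proof -
    have "(f' has_integral (f y - f x)) {x..y}"
      using that f by (intro fundamental_theorem_of_calculus) (auto intro: has_vector_derivative_at_within)
    then have "norm (f y - f x) = norm (integral {x..y} f')" by (simp add: integral_unique)
    also have "\<dots> \<le> integral {x..y} (\<lambda>s. norm (f' s))"
      by (intro integral_norm_bound_integral integrable_continuous_interval continuous_intros c') auto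
    also have "\<dots> \<le> integral {0..1} (\<lambda>s. norm (f' s))"
      using that by (intro integral_subset_le integrable_continuous_interval continuous_intros c') auto
    finally show ?thesis .
  qed
  show ?thesis
    using *[of x y] *[of y x] xy by (cases "x \<le> y") (auto simp: norm_minus_commute)
qed

section \<open>A priori estimates for the periodic elliptic equation\<close>

text \<open>Either the Dirichlet energy \<open>D\<close> is already at least a quarter of
  \<open>(\<sigma> z)\<^sup>2\<close>, or by Cauchy-Schwarz the oscillation of \<sigma> is below
  half of \<open>\<bar>\<sigma> z\<bar>\<close>. In the second case the square of \<sigma> is at
  least that quarter on the whole period, and the potential term gives \<open>m\<close> times it.
  Only the mean of \<open>p\<close> enters, since a curvature may vanish on arcs.\<close>

lemma elliptic_coercive:
  fixes \<sigma> :: "real \<Rightarrow> real"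
  assumes per: "periodic1 \<sigma>" and d: "\<And>s. (\<sigma> has_vector_derivative \<sigma>1 s) (at s)"
    and c: "continuous_on UNIV \<sigma>1" "continuous_on UNIV p"
    and p: "\<And>s. 0 \<le> p s" "m \<le> integral {0..1} p" and m: "0 < m" "m \<le> 1"
  shows "m / 4 * (\<sigma> x)\<^sup>2 \<le> integral {0..1} (\<lambda>s. (\<sigma>1 s)\<^sup>2 + p s * (\<sigma> s)\<^sup>2)"
proof -
  define z where "z = frac x"
  have z: "z \<in> {0..1}" "\<sigma> x = \<sigma> z" using frac_01 periodic1_frac[OF per] by (auto simp: z_def)
  have cs: "continuous_on S \<sigma>1" "continuous_on S p" "continuous_on S \<sigma>" for S
    using c continuous_on_subset continuous_on_of_vector_derivative[OF d] by blast+
  define D where "D = integral {0..1} (\<lambda>s. (\<sigma>1 s)\<^sup>2)"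
  define E where "E = integral {0..1} (\<lambda>s. p s * (\<sigma> s)\<^sup>2)"
  have i: "(\<lambda>s. p s * (\<sigma> s)\<^sup>2) integrable_on {0..1}" "(\<lambda>s. (\<sigma>1 s)\<^sup>2) integrable_on {0..1}" "p integrable_on {0..1}"
    by (intro integrable_continuous_interval continuous_intros cs)+
  have s: "integral {0..1} (\<lambda>s. (\<sigma>1 s)\<^sup>2 + p s * (\<sigma> s)\<^sup>2) = D + E"
    unfolding D_def E_def by (intro integral_add i)
  have E0: "0 \<le> E" unfolding E_def using p(1) by (intro integral_nonneg i) auto
  have D0: "0 \<le> D" unfolding D_def by (intro integral_nonneg i) auto
  show ?thesis
  proof (cases "(\<sigma> z)\<^sup>2 / 4 \<le> D")
    case True
    have "m / 4 * (\<sigma> z)\<^sup>2 \<le> (\<sigma> z)\<^sup>2 / 4" using m by (simp add: mult_left_le_one_le)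
    then show ?thesis unfolding s z(2) using True E0 by linarith
  next
    case False
    have low: "(\<sigma> z)\<^sup>2 / 4 \<le> (\<sigma> y)\<^sup>2" if "y \<in> {0..1}" for y
    proof -
      have "norm (\<sigma> z - \<sigma> y) \<le> integral {0..1} (\<lambda>s. norm (\<sigma>1 s))"
        by (intro norm_diff_le_integral d c z that)
      then have "(norm (\<sigma> z - \<sigma> y))\<^sup>2 \<le> (integral {0..1} (\<lambda>s. norm (\<sigma>1 s)))\<^sup>2"
        by (intro power_mono) auto
      also have "\<dots> \<le> D" using integral_norm_square_le[OF cs(1)] by (simp add: D_def)
      finally have "\<bar>\<sigma> z - \<sigma> y\<bar>\<^sup>2 < (\<bar>\<sigma> z\<bar> / 2)\<^sup>2" using False by (simp add: power_divide)
      then have "\<bar>\<sigma> z - \<sigma> y\<bar> < \<bar>\<sigma> z\<bar> / 2" using power2_less_imp_less by fastforce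
      then have "\<bar>\<sigma> z\<bar> / 2 \<le> \<bar>\<sigma> y\<bar>" by linarith
      then have "(\<bar>\<sigma> z\<bar> / 2)\<^sup>2 \<le> \<bar>\<sigma> y\<bar>\<^sup>2" by (intro power_mono) auto
      then show ?thesis by (simp add: power_divide)
    qed
    have "m * ((\<sigma> z)\<^sup>2 / 4) \<le> integral {0..1} p * ((\<sigma> z)\<^sup>2 / 4)"
      using p(2) by (intro mult_right_mono) auto
    also have "\<dots> = integral {0..1} (\<lambda>s. p s * ((\<sigma> z)\<^sup>2 / 4))" by simp
    also have "\<dots> \<le> E" unfolding E_def
      using p(1) low by (intro integral_le i integrable_on_mult_left mult_left_mono) auto
    finally show ?thesis using D0 s z by simp
  qed
qed

lemma periodic1_attains_sup_norm:
  fixes f :: "real \<Rightarrow> 'v::real_normed_vector"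
  assumes "periodic1 f" "continuous_on UNIV f"
  obtains z where "\<And>x. norm (f x) \<le> norm (f z)"
proof -
  have "\<exists>z\<in>{0..1}. \<forall>x\<in>{0..1}. norm (f x) \<le> norm (f z)"
    by (intro continuous_attains_sup continuous_intros continuous_on_subset[OF assms(2)]) auto
  then obtain z where "\<And>x. x \<in> {0..1} \<Longrightarrow> norm (f x) \<le> norm (f z)" by blast
  then show ?thesis using that periodic1_all[OF assms(1), of "\<lambda>v. norm v \<le> norm (f z)"] by blast
qed

text \<open>The weak form: the equation is multiplied by \<sigma> and integrated over the
  period.\<close>

lemma elliptic_energy:
  fixes \<sigma> :: "real \<Rightarrow> real"
  assumes per: "periodic1 \<sigma>" and d: "\<And>s. (\<sigma> has_vector_derivative \<sigma>1 s) (at s)"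
    and d2: "\<And>s. (\<sigma>1 has_vector_derivative (p s * \<sigma> s - g s)) (at s)"
    and c: "continuous_on UNIV p" "continuous_on UNIV g"
  shows "integral {0..1} (\<lambda>s. (\<sigma>1 s)\<^sup>2 + p s * (\<sigma> s)\<^sup>2) = integral {0..1} (\<lambda>s. g s * \<sigma> s)"
proof -
  have cs: "continuous_on S \<sigma>1" "continuous_on S \<sigma>" "continuous_on S p" "continuous_on S g" for S
    using c continuous_on_subset continuous_on_of_vector_derivative[OF d] continuous_on_of_vector_derivative[OF d2]
    by blast+
  have per1: "periodic1 \<sigma>1" using periodic1_has_vector_derivative[OF per d] .
  have "integral {0..1} (\<lambda>s. \<sigma>1 s \<bullet> \<sigma>1 s) = - integral {0..1} (\<lambda>s. \<sigma> s \<bullet> (p s * \<sigma> s - g s))"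
  proof (rule integral_by_parts_periodic[OF d d2])
    show "\<sigma> 1 = \<sigma> 0" "\<sigma>1 1 = \<sigma>1 0"
      using per per1 unfolding periodic1_def by (metis add_0)+
  qed (intro continuous_intros cs)+
  moreover have "integral {0..1} (\<lambda>s. (\<sigma>1 s)\<^sup>2 + p s * (\<sigma> s)\<^sup>2) =
      integral {0..1} (\<lambda>s. \<sigma>1 s \<bullet> \<sigma>1 s) + integral {0..1} (\<lambda>s. p s * (\<sigma> s)\<^sup>2)"
    unfolding power2_eq_square inner_real_def
    by (intro integral_add integrable_continuous_interval continuous_intros cs)
  moreover have "integral {0..1} (\<lambda>s. \<sigma> s \<bullet> (p s * \<sigma> s - g s)) = integral {0..1} (\<lambda>s. p s * (\<sigma> s)\<^sup>2 - g s * \<sigma> s)"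
    by (intro integral_cong) (simp add: algebra_simps power2_eq_square)
  moreover have "integral {0..1} (\<lambda>s. p s * (\<sigma> s)\<^sup>2 - g s * \<sigma> s) =
     integral {0..1} (\<lambda>s. p s * (\<sigma> s)\<^sup>2) - integral {0..1} (\<lambda>s. g s * \<sigma> s)"
    by (intro integral_diff integrable_continuous_interval continuous_intros cs)
  ultimately show ?thesis by linarith
qed

text \<open>Coercivity at a point \<open>z\<close> where the modulus of \<sigma> is maximal bounds
  the energy below quadratically in this maximum, while the source bounds it above linearly; one
  factor cancels.\<close>

lemma elliptic_apriori:
  fixes \<sigma> :: "real \<Rightarrow> real"
  assumes per: "periodic1 \<sigma>" and d: "\<And>s. (\<sigma> has_vector_derivative \<sigma>1 s) (at s)"
    and d2: "\<And>s. (\<sigma>1 has_vector_derivative (p s * \<sigma> s - g s)) (at s)"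
    and c: "continuous_on UNIV p" "continuous_on UNIV g"
    and p: "\<And>s. 0 \<le> p s" "m \<le> integral {0..1} p" and m: "0 < m" "m \<le> 1" and g: "\<And>s. \<bar>g s\<bar> \<le> G"
  shows "\<bar>\<sigma> x\<bar> \<le> 4 * G / m"
proof -
  have cs: "continuous_on S \<sigma>1" "continuous_on S \<sigma>" "continuous_on S p" "continuous_on S g" for S
    using c continuous_on_subset continuous_on_of_vector_derivative[OF d] continuous_on_of_vector_derivative[OF d2]
    by blast+
  obtain z where z: "\<And>x. norm (\<sigma> x) \<le> norm (\<sigma> z)"
    using periodic1_attains_sup_norm[OF per cs(2)] by blast
  define \<mu> where "\<mu> = norm (\<sigma> z)"
  have G: "0 \<le> G" using g[of 0] by linarith
  have "m / 4 * (\<sigma> z)\<^sup>2 \<le> integral {0..1} (\<lambda>s. g s * \<sigma> s)"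
    using elliptic_coercive[OF per d cs(1) c(1) p m] elliptic_energy[OF per d d2 c] by simp
  also have "\<dots> \<le> integral {0..1::real} (\<lambda>s. G * \<mu>)"
  proof (intro integral_le)
    show "(\<lambda>s. g s * \<sigma> s) integrable_on {0..1}" "(\<lambda>s. G * \<mu>) integrable_on {0..1::real}"
      by (intro integrable_continuous_interval continuous_intros cs)+
    fix s
    have "g s * \<sigma> s \<le> \<bar>g s\<bar> * \<bar>\<sigma> s\<bar>" by (metis abs_ge_self abs_mult)
    also have "\<dots> \<le> G * \<mu>" using g z[of s] G by (intro mult_mono) (auto simp: \<mu>_def)
    finally show "g s * \<sigma> s \<le> G * \<mu>" .
  qed
  finally have *: "m / 4 * \<mu>\<^sup>2 \<le> G * \<mu>" by (simp add: \<mu>_def)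
  have "\<mu> \<le> 4 * G / m"
  proof (cases "\<mu> = 0")
    case True then show ?thesis using G m by simp
  next
    case False
    then have "0 < \<mu>" by (simp add: \<mu>_def)
    then have "m / 4 * \<mu> \<le> G" using * by (simp add: power2_eq_square)
    then show ?thesis using m by (simp add: field_simps)
  qed
  then show ?thesis using z[of x] by (simp add: \<mu>_def)
qed

text \<open>By Rolle \<sigma>1 vanishes somewhere in the period, and no point of [0,1] is further
  than 1 from that zero.\<close>

lemma periodic1_derivative_bound:
  fixes \<sigma> :: "real \<Rightarrow> real"
  assumes per: "periodic1 \<sigma>" and d: "\<And>s. (\<sigma> has_vector_derivative \<sigma>1 s) (at s)"
    and d2: "\<And>s. (\<sigma>1 has_vector_derivative \<sigma>2 s) (at s)" and B: "\<And>s. \<bar>\<sigma>2 s\<bar> \<le> B"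
  shows "\<bar>\<sigma>1 x\<bar> \<le> B"
proof -
  have "\<sigma> 0 = \<sigma> 1" using per unfolding periodic1_def by (metis add_0)
  then obtain z where z: "0 < z" "z < 1" "\<sigma>1 z = 0"
    using Rolle_deriv[of 0 1 \<sigma> "\<lambda>x h. h * \<sigma>1 x"] continuous_on_of_vector_derivative[OF d] d
    by (auto simp: has_vector_derivative_def fun_eq_iff)
  have "norm (\<sigma>1 s) \<le> B" if "s \<in> {0..1}" for s
  proof -
    have "norm (\<sigma>1 s - \<sigma>1 z) \<le> B * \<bar>s - z\<bar>"
      using lipschitz_vector_derivative[OF d2] B by simp
    also have "\<dots> \<le> B * 1" using that z B[of 0] by (intro mult_left_mono) auto
    finally show ?thesis using z by simp
  qed
  then have "norm (\<sigma>1 x) \<le> B"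
    using periodic1_all[OF periodic1_has_vector_derivative[OF per d], of "\<lambda>v. norm v \<le> B"] by blast
  then show ?thesis by simp
qed

text \<open>At a minimum the second derivative is nonnegative, so \<open>p * \<sigma>\<close> is at
  least 1 there. This positivity of the tension is what makes the evolution parabolic.\<close>

lemma elliptic_lower_bound:
  fixes \<sigma> :: "real \<Rightarrow> real"
  assumes per: "periodic1 \<sigma>" and d: "\<And>s. (\<sigma> has_vector_derivative \<sigma>1 s) (at s)"
    and d2: "\<And>s. (\<sigma>1 has_vector_derivative (p s * \<sigma> s - 1)) (at s)"
    and p: "\<And>s. 0 \<le> p s" "\<And>s. p s \<le> P"
  shows "1 / P \<le> \<sigma> x"
proof -
  have "\<exists>z\<in>{0..1}. \<forall>x\<in>{0..1}. \<sigma> z \<le> \<sigma> x"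
    by (intro continuous_attains_inf continuous_on_of_vector_derivative[OF d]) auto
  then obtain z where z: "\<And>x. \<sigma> z \<le> \<sigma> x"
    using periodic1_all[OF per] by metis
  have D: "(\<sigma> has_real_derivative \<sigma>1 s) (at s)" "(\<sigma>1 has_real_derivative (p s * \<sigma> s - 1)) (at s)" for s
    using d d2 by (auto simp: has_real_derivative_iff_has_vector_derivative)
  have s0: "\<sigma>1 z = 0"
    using DERIV_local_min[OF D(1)[of z], of 1] z by auto
  \<comment> \<open>The second derivative test by hand: were the value negative, \<sigma>1 would be
    negative just to the right of \<open>z\<close>, and the mean value theorem over a step e/2 would
    give a value below the minimum.\<close>
  have "0 \<le> p z * \<sigma> z - 1"
  proof (rule ccontr)
    assume "\<not> ?thesis"
    then obtain e where e: "e > 0" "\<And>h. 0 < h \<Longrightarrow> h < e \<Longrightarrow> \<sigma>1 (z + h) < \<sigma>1 z"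
      using DERIV_neg_dec_right[OF D(2)[of z]] by auto
    obtain \<xi> where x: "z < \<xi>" "\<xi> < z + e/2" "\<sigma> (z + e/2) - \<sigma> z = (z + e/2 - z) * \<sigma>1 \<xi>"
      using MVT2[of z "z + e/2" \<sigma> \<sigma>1] D(1) e(1) by auto
    have "\<sigma>1 \<xi> < 0" using e(2)[of "\<xi> - z"] x s0 e(1) by auto
    then have "(e/2) * \<sigma>1 \<xi> < 0" using e(1) by (simp add: mult_pos_neg)
    then have "\<sigma> (z + e/2) < \<sigma> z" using x(3) by simp
    then show False using z[of "z + e/2"] by linarith
  qed
  then have 1: "1 \<le> p z * \<sigma> z" by simp
  have "0 < \<sigma> z"
    using 1 p(1)[of z] by (metis less_eq_real_def mult_nonneg_nonpos not_le not_one_le_zero order_trans)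
  then have "1 \<le> P * \<sigma> z" using 1 p(2)[of z] by (meson mult_right_mono less_imp_le order_trans)
  moreover have "0 < P" using 1 p(1)[of z] p(2)[of z] \<open>0 < \<sigma> z\<close>
    by (metis calculation less_le_trans mult_nonpos_nonneg not_le not_one_le_zero less_imp_le order_trans)
  ultimately have "1 / P \<le> \<sigma> z" by (simp add: field_simps)
  then show ?thesis using z[of x] by linarith
qed

section \<open>The elliptic equation on the circle\<close>

lemma has_antiderivative:
  fixes h :: "real \<Rightarrow> 'v::euclidean_space"
  assumes "continuous_on UNIV h"
  shows "\<exists>J. \<forall>x. (J has_vector_derivative h x) (at x)"
  using einterval_antiderivative[of "-\<infinity>" "\<infinity>" h] assms
  by (auto simp: continuous_on_eq_continuous_at)

text \<open>The periodic Green function cosh (k (r - 1/2)) / (2 k sinh (k/2)) of k^2 - d^2/ds^2, split into exponentials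
  so that derivatives in the parameter reduce to the fundamental theorem of calculus.\<close>

definition green :: "real \<Rightarrow> (real \<Rightarrow> real) \<Rightarrow> real \<Rightarrow> real" where
  "green k q s = (exp (- k * s) * integral {s..s+1} (\<lambda>x. exp (k * x) * q x)
     + exp k * exp (k * s) * integral {s..s+1} (\<lambda>x. exp (- k * x) * q x)) / (2 * k * (exp k - 1))"

lemma green_derivatives:
  assumes k: "0 < k" and c: "continuous_on UNIV q" and per: "periodic1 q"
  obtains w1 where "\<And>s. (green k q has_real_derivative w1 s) (at s)"
    "\<And>s. (w1 has_real_derivative (k\<^sup>2 * green k q s - q s)) (at s)"
proof -
  have "continuous_on UNIV (\<lambda>x. exp (k * x) * q x)" by (intro continuous_intros c)
  then obtain J1 where J1: "\<And>x. (J1 has_vector_derivative (exp (k * x) * q x)) (at x)"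
    using has_antiderivative by blast
  have "continuous_on UNIV (\<lambda>x. exp (- k * x) * q x)" by (intro continuous_intros c)
  then obtain J2 where J2: "\<And>x. (J2 has_vector_derivative (exp (- k * x) * q x)) (at x)"
    using has_antiderivative by blast
  have i1: "integral {s..s+1} (\<lambda>x. exp (k * x) * q x) = J1 (s + 1) - J1 s" for s
    by (intro integral_unique fundamental_theorem_of_calculus) (auto intro: has_vector_derivative_at_within[OF J1])
  have i2: "integral {s..s+1} (\<lambda>x. exp (- k * x) * q x) = J2 (s + 1) - J2 s" for s
    by (intro integral_unique fundamental_theorem_of_calculus has_vector_derivative_at_within[OF J2]) simp
  have D: "(J1 has_real_derivative (exp (k * x) * q x)) (at x)" "(J2 has_real_derivative (exp (- k * x) * q x)) (at x)" for x
    using J1 J2 by (auto simp: has_real_derivative_iff_has_vector_derivative)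
  have sh: "((\<lambda>s. J (s + 1)) has_real_derivative J' (s + 1)) (at s)"
    if "\<And>x. (J has_real_derivative J' x) (at x)" for J J' and s :: real
    using DERIV_shift[of J "J' (s+1)" s 1] that by simp
  define d where "d = 2 * k * (exp k - 1)"
  have d: "d \<noteq> 0" using k by (simp add: d_def)
  define c where "c = 1 / d"
  have cd: "c * d = 1" using d by (simp add: c_def)
  define w1 where "w1 s = (- k * exp (- k * s) * (J1 (s + 1) - J1 s)
     + k * exp k * exp (k * s) * (J2 (s + 1) - J2 s)) * c" for s
  have q1: "q (s + 1) = q s" for s using per by (simp add: periodic1_def)
  have g: "green k q = (\<lambda>s. (exp (- k * s) * (J1 (s + 1) - J1 s)
     + exp k * exp (k * s) * (J2 (s + 1) - J2 s)) * c)"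
    unfolding green_def i1 i2 c_def d_def by (rule ext) simp
  \<comment> \<open>Terms produced by differentiating the limits of integration. \<open>e1\<close>
    and \<open>e2\<close> are opposite, so they cancel in the first derivative; in the second they
    carry the factors -k and k, add up, and leave exactly -q after division by
    \<open>d\<close>.\<close>
  have e1: "exp (- k * s) * (exp (k * (s + 1)) * q s - exp (k * s) * q s) = (exp k - 1) * q s" for s
    by (simp add: exp_add exp_minus field_simps ring_distribs)
  have e2: "exp k * exp (k * s) * (exp (- k * (s + 1)) * q s - exp (- k * s) * q s) = - (exp k - 1) * q s" for s
    by (simp add: exp_add exp_minus exp_diff field_simps ring_distribs)
  show thesis
  proof (rule that[of w1])
    fix s
    have "(green k q has_real_derivative
       ((- k * exp (- k * s)) * (J1 (s + 1) - J1 s) + exp (- k * s) * (exp (k * (s + 1)) * q (s + 1) - exp (k * s) * q s)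
      + (exp k * (k * exp (k * s)) * (J2 (s + 1) - J2 s) + exp k * exp (k * s) * (exp (- k * (s + 1)) * q (s + 1) - exp (- k * s) * q s))) * c) (at s)"
      unfolding g by (rule derivative_eq_intros D sh[OF D(1)] sh[OF D(2)] refl)+ (simp add: algebra_simps)
    then show "(green k q has_real_derivative w1 s) (at s)"
      unfolding q1 e1 e2 w1_def by (simp add: algebra_simps)
    have "(w1 has_real_derivative
       ((- k * (- k * exp (- k * s))) * (J1 (s + 1) - J1 s) + - k * (exp (- k * s) * (exp (k * (s + 1)) * q (s + 1) - exp (k * s) * q s))
      + (k * exp k * (k * exp (k * s)) * (J2 (s + 1) - J2 s) + k * (exp k * exp (k * s) * (exp (- k * (s + 1)) * q (s + 1) - exp (- k * s) * q s)))) * c) (at s)"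
      unfolding w1_def by (rule derivative_eq_intros D sh[OF D(1)] sh[OF D(2)] refl)+ (simp add: algebra_simps)
    moreover have "((- k * (- k * exp (- k * s))) * (J1 (s + 1) - J1 s) + - k * ((exp k - 1) * q s)
      + (k * exp k * (k * exp (k * s)) * (J2 (s + 1) - J2 s) + k * (- (exp k - 1) * q s))) * c = k\<^sup>2 * green k q s - q s"
    proof -
      have "(- k * ((exp k - 1) * q s) + k * (- (exp k - 1) * q s)) = - q s * d"
        by (simp add: d_def algebra_simps)
      moreover have "((- k * (- k * exp (- k * s))) * (J1 (s + 1) - J1 s)
        + (k * exp k * (k * exp (k * s)) * (J2 (s + 1) - J2 s))) = k\<^sup>2 * green k q s * d"
        using cd by (simp add: g power2_eq_square) algebra
      ultimately have "((- k * (- k * exp (- k * s))) * (J1 (s + 1) - J1 s) + - k * ((exp k - 1) * q s)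
      + (k * exp k * (k * exp (k * s)) * (J2 (s + 1) - J2 s) + k * (- (exp k - 1) * q s))) = (k\<^sup>2 * green k q s - q s) * d"
        by (simp add: algebra_simps)
      then show ?thesis using cd by (simp add: mult.assoc mult.commute[of d])
    qed
    ultimately show "(w1 has_real_derivative (k\<^sup>2 * green k q s - q s)) (at s)"
      unfolding q1 e1 e2 by simp
  qed
qed

lemma green_continuous: "0 < k \<Longrightarrow> continuous_on UNIV q \<Longrightarrow> periodic1 q \<Longrightarrow> continuous_on UNIV (green k q)"
  by (metis DERIV_continuous_on green_derivatives DERIV_subset top_greatest)

lemma periodic1_green:
  assumes "periodic1 q" shows "periodic1 (green k q)"
proof -
  have sh: "integral {s+1..s+1+1} h = integral {s..s+1} (\<lambda>x. h (x + 1))" for h :: "real \<Rightarrow> real" and s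
    using integral_shift_Icc_real[of s "s+1" h 1] by (simp add: comp_def add.commute)
  have q: "q (x + 1) = q x" for x using assms by (simp add: periodic1_def)
  have e1: "exp (k * (x + 1)) * q x = exp k * (exp (k * x) * q x)"
       "exp (- k * (x + 1)) * q x = exp (- k) * (exp (- k * x) * q x)" for k x :: real
    by (simp_all add: distrib_left exp_add exp_diff exp_minus divide_inverse)
  have e2: "exp (k * (x + 1)) = exp k * exp (k * x)"
       "exp (- k * (x + 1)) = exp (- k) * exp (- k * x)" for k x :: real
    by (simp_all add: distrib_left exp_add exp_diff exp_minus divide_inverse)
  have e3: "exp (- k) * x * (exp k * y) = x * y" "exp k * (exp k * x) * (exp (- k) * y) = exp k * x * y" for x y :: real
    by (auto simp: exp_minus field_simps)
  show ?thesis
    unfolding periodic1_def green_def sh q e1 integral_mult_right unfolding e2 e3 by simp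
qed

lemma norm_integral_mult_le:
  fixes q r e :: "real \<Rightarrow> real"
  assumes "continuous_on UNIV q" "continuous_on UNIV r" "continuous_on UNIV e" "\<And>x. \<bar>q x\<bar> \<le> r x" "\<And>x. 0 \<le> e x"
  shows "\<bar>integral {a..b} (\<lambda>x. e x * q x)\<bar> \<le> integral {a..b} (\<lambda>x. e x * r x)"
proof -
  have c: "continuous_on S q" "continuous_on S r" "continuous_on S e" for S
    using assms continuous_on_subset by blast+
  have "norm (integral {a..b} (\<lambda>x. e x * q x)) \<le> integral {a..b} (\<lambda>x. e x * r x)"
    using assms(4,5)
    by (intro integral_norm_bound_integral integrable_continuous_interval continuous_intros c)
       (auto simp: abs_mult intro: mult_left_mono)
  then show ?thesis by simp
qed

text \<open>Both exponential weights are positive, which is the maximum principle for k^2 -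
  d^2/ds^2; it converts pointwise bounds of sources into bounds of solutions.\<close>

lemma green_abs_le:
  assumes "0 < k" "continuous_on UNIV q" "continuous_on UNIV r" "\<And>x. \<bar>q x\<bar> \<le> r x"
  shows "\<bar>green k q s\<bar> \<le> green k r s"
proof -
  define d where "d = 2 * k * (exp k - 1)"
  have d: "d > 0" using assms(1) by (simp add: d_def)
  have n: "\<bar>integral {s..s+1} (\<lambda>x. exp (c * x) * q x)\<bar> \<le> integral {s..s+1} (\<lambda>x. exp (c * x) * r x)" for c
    using assms by (intro norm_integral_mult_le continuous_intros) auto
  have "\<bar>exp (- k * s) * integral {s..s+1} (\<lambda>x. exp (k * x) * q x)
     + exp k * exp (k * s) * integral {s..s+1} (\<lambda>x. exp (- k * x) * q x)\<bar>
     \<le> exp (- k * s) * \<bar>integral {s..s+1} (\<lambda>x. exp (k * x) * q x)\<bar>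
     + exp k * exp (k * s) * \<bar>integral {s..s+1} (\<lambda>x. exp (- k * x) * q x)\<bar>"
    by (rule order_trans[OF abs_triangle_ineq]) (simp add: abs_mult)
  also have "\<dots> \<le> exp (- k * s) * integral {s..s+1} (\<lambda>x. exp (k * x) * r x)
     + exp k * exp (k * s) * integral {s..s+1} (\<lambda>x. exp (- k * x) * r x)"
    using n[of k] n[of "- k"] by (intro add_mono mult_left_mono) auto
  finally show ?thesis using d
    unfolding green_def d_def[symmetric] by (simp add: divide_right_mono)
qed

lemma green_diff:
  assumes "continuous_on UNIV q" "continuous_on UNIV r"
  shows "green k (\<lambda>x. q x - r x) s = green k q s - green k r s"
proof -
  have c: "continuous_on S q" "continuous_on S r" for S
    using assms continuous_on_subset by blast+
  have "integral {s..s+1} (\<lambda>x. exp (c * x) * (q x - r x)) =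
      integral {s..s+1} (\<lambda>x. exp (c * x) * q x) - integral {s..s+1} (\<lambda>x. exp (c * x) * r x)" for c
    unfolding right_diff_distrib by (intro integral_diff integrable_continuous_interval continuous_intros c)
  from this[of k] this[of "- k"] show ?thesis unfolding green_def
    by (simp only: right_diff_distrib diff_divide_distrib add_divide_distrib)
qed

lemma green_const:
  assumes "0 < k" shows "green k (\<lambda>x. c) s = c / k\<^sup>2"
proof -
  have I: "integral {s..s+1} (\<lambda>x. exp (j * x) * c) = c * (exp (j * (s + 1)) - exp (j * s)) / j" if "j \<noteq> 0" for j
  proof -
    have "((\<lambda>x. exp (j * x) * c) has_integral (c * exp (j * (s + 1)) / j - c * exp (j * s) / j)) {s..s+1}"
      using that by (intro fundamental_theorem_of_calculus)
       (auto intro!: derivative_eq_intros simp: has_real_derivative_iff_has_vector_derivative[symmetric])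
    from integral_unique[OF this] show ?thesis by (simp only: diff_divide_distrib right_diff_distrib)
  qed
  define E where "E = exp (k * s)"
  define F where "F = exp k"
  have p: "E > 0" "F > 1" using assms by (auto simp: E_def F_def)
  have e: "exp (k * (s + 1)) = F * E" "exp (- k * (s + 1)) = 1 / (F * E)" "exp (- k * s) = 1 / E" "exp (k * s) = E" "exp k = F"
    by (simp_all add: E_def F_def distrib_left exp_add exp_minus exp_diff divide_inverse)
  have "green k (\<lambda>x. c) s = (1 / E * (c * (F * E - E) / k) + F * E * (c * (1 / (F * E) - 1 / E) / (- k))) / (2 * k * (F - 1))"
    unfolding green_def using I[of k] I[of "- k"] assms e by simp
  also have "\<dots> = (c * (F - 1) / k + c * (F - 1) / k) / (2 * k * (F - 1))"
    using p assms by (simp add: field_simps)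
  also have "\<dots> = c / k\<^sup>2" using p assms by (simp add: field_simps power2_eq_square)
  finally show ?thesis .
qed

lemma integral_period:
  fixes p :: "real \<Rightarrow> real"
  assumes "continuous_on UNIV p" "periodic1 p"
  shows "integral {s..s+1} p = integral {0..1} p"
proof -
  obtain J where J: "\<And>x. (J has_vector_derivative p x) (at x)"
    using has_antiderivative[OF assms(1)] by blast
  have i: "integral {s..s+1} p = J (s + 1) - J s" for s
    by (intro integral_unique fundamental_theorem_of_calculus) (auto intro: has_vector_derivative_at_within[OF J])
  have D: "(J has_real_derivative p x) (at x)" for x
    using J by (simp add: has_real_derivative_iff_has_vector_derivative)
  have "((\<lambda>s. J (s + 1) - J s) has_real_derivative (p (s + 1) - p s)) (at s)" for s
    using DERIV_shift[of J "p (s+1)" s 1] D by (auto intro!: derivative_intros)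
  then have "\<forall>s. ((\<lambda>s. J (s + 1) - J s) has_real_derivative 0) (at s)"
    using assms(2) by (simp add: periodic1_def)
  from DERIV_isconst_all[OF this] have "J (s + 1) - J s = J (0 + 1) - J 0" by blast
  then show ?thesis using i[of s] i[of 0] by simp
qed

text \<open>One of the two nonnegative exponential terms is dropped; in the other the weight exp (k
  (x - s)) is at least 1 on [s, s + 1]. This keeps the contraction factor of the existence proof
  strictly below 1 although \<open>p\<close> may have zeros.\<close>

lemma green_lower_bound:
  assumes k: "0 < k" and c: "continuous_on UNIV p" and per: "periodic1 p" and p: "\<And>x. 0 \<le> p x"
  shows "integral {0..1} p / (2 * k * (exp k - 1)) \<le> green k p s"
proof -
  define d where "d = 2 * k * (exp k - 1)"
  have d: "d > 0" using k by (simp add: d_def)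
  have c': "continuous_on S p" for S
    using c continuous_on_subset by blast
  have "integral {0..1} p = exp (- k * s) * (exp (k * s) * integral {s..s+1} p)"
    by (simp add: integral_period[OF c per] exp_minus)
  also have "\<dots> = exp (- k * s) * integral {s..s+1} (\<lambda>x. exp (k * s) * p x)" by simp
  also have "\<dots> \<le> exp (- k * s) * integral {s..s+1} (\<lambda>x. exp (k * x) * p x)"
    using p k by (intro mult_left_mono integral_le integrable_continuous_interval continuous_intros c')
      (auto intro!: mult_right_mono)
  also have "\<dots> \<le> exp (- k * s) * integral {s..s+1} (\<lambda>x. exp (k * x) * p x)
     + exp k * exp (k * s) * integral {s..s+1} (\<lambda>x. exp (- k * x) * p x)"
    using p by (simp add: integral_nonneg integrable_continuous_interval continuous_intros c')
  finally show ?thesis using d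
    unfolding green_def d_def[symmetric] by (simp add: divide_right_mono)
qed

text \<open>Rewrite the equation as k^2 w - w'' = 1 + (k^2 - p) w with k^2 above sup p. The Green operator is positive and maps the
  constant k^2 to 1, so the affine map on the right has Lipschitz constant at most sup (1 - green k p), which is below 1.\<close>

lemma elliptic_exists:
  fixes p :: "real \<Rightarrow> real"
  assumes c: "continuous_on UNIV p" and per: "periodic1 p" and p: "\<And>x. 0 \<le> p x" and m: "0 < integral {0..1} p"
  obtains \<sigma> \<sigma>1 where "periodic1 \<sigma>" "\<And>s. (\<sigma> has_vector_derivative \<sigma>1 s) (at s)"
    "\<And>s. (\<sigma>1 has_vector_derivative (p s * \<sigma> s - 1)) (at s)"
proof -
  obtain z where z: "\<And>x. norm (p x) \<le> norm (p z)"
    using periodic1_attains_sup_norm[OF per c] by blast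
  \<comment> \<open>With k^2 = sup p + 1 the coefficient k^2 - p is positive, so positivity of the
    Green operator applies to it.\<close>
  define k where "k = sqrt (p z + 1)"
  have k: "k > 0" "k\<^sup>2 = p z + 1" using p[of z] by (auto simp: k_def)
  have kp: "0 \<le> k\<^sup>2 - p x" for x using z[of x] p k(2) by simp
  define r where "r w x = 1 + (k\<^sup>2 - p x) * apply_bcontfun w x" for w x
  have cr: "continuous_on UNIV (r w)" for w unfolding r_def
    by (intro continuous_intros c continuous_on_apply_bcontfun)
  define q where "q w = green k (r w)" for w
  \<comment> \<open>The periodic functions form a closed subset of the complete space of bounded
    continuous functions; the fixed point is sought there.\<close>
  define S where "S = {w. periodic1 (apply_bcontfun w :: real \<Rightarrow> real)}"
  define \<theta> where "\<theta> = 1 - integral {0..1} p / (2 * k * (exp k - 1))"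
  have g1: "green k (\<lambda>x. k\<^sup>2 - p x) s \<le> \<theta>" for s
    using green_diff[OF continuous_on_const c, of k "k\<^sup>2" s] green_const[OF k(1), of "k\<^sup>2" s] k(1)
      green_lower_bound[OF k(1) c per p, of s] by (simp add: \<theta>_def)
  have g0: "0 \<le> green k (\<lambda>x. k\<^sup>2 - p x) s" for s
    using green_abs_le[OF k(1), of "\<lambda>x. k\<^sup>2 - p x" "\<lambda>x. k\<^sup>2 - p x" s] kp c
    by (fastforce intro!: continuous_intros)
  have th: "0 \<le> \<theta>" using g0 g1 order_trans by blast
  have th1: "\<theta> < 1" using k(1) m by (simp add: \<theta>_def)
  have perr: "periodic1 (r w)" if "w \<in> S" for w
    using that per by (simp add: S_def r_def periodic1_def)
  \<comment> \<open>A crude bound, only to see that \<open>q w\<close> is bounded, so that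
    \<open>Bcontfun\<close> may be applied to it.\<close>
  have qb: "q w \<in> bcontfun" if "w \<in> S" for w
  proof (rule bcontfun_normI)
    show "continuous_on UNIV (q w)"
      unfolding q_def using that by (intro green_continuous k cr perr)
    show "norm (q w s) \<le> (1 + (k\<^sup>2 + norm (p z)) * norm w) / k\<^sup>2" for s
    proof -
      have "\<bar>green k (r w) s\<bar> \<le> green k (\<lambda>x. 1 + (k\<^sup>2 + norm (p z)) * norm w) s"
      proof (rule green_abs_le[OF k(1) cr])
        fix x
        have "p x \<le> 2 * k\<^sup>2 + p z" using z[of x] p[of x] p[of z] k(2) by simp
        have "\<bar>r w x\<bar> \<le> 1 + \<bar>k\<^sup>2 - p x\<bar> * \<bar>w x\<bar>" unfolding r_def
          by (rule order_trans[OF abs_triangle_ineq]) (simp add: abs_mult)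
        also have "\<dots> \<le> 1 + (k\<^sup>2 + norm (p z)) * norm w"
          using norm_bounded[of w x] z[of x] p[of x] p[of z] \<open>p x \<le> 2 * k\<^sup>2 + p z\<close>
          by (intro add_left_mono mult_mono) (auto simp: abs_le_iff)
        finally show "\<bar>r w x\<bar> \<le> 1 + (k\<^sup>2 + norm (p z)) * norm w" .
      qed simp
      then show ?thesis using green_const[OF k(1)] by (simp add: q_def)
    qed
  qed
  have "\<exists>!w\<in>S. Bcontfun (q w) = w"
  proof (rule Banach_fix[OF _ _ th th1])
    have "closed S"
    proof -
      have ev: "continuous_on UNIV (\<lambda>w. apply_bcontfun w s)" for s :: real
        unfolding continuous_on_iff by (meson dist_bounded le_less_trans)
      have "S = (\<Inter>s. {w. apply_bcontfun w (s + 1) = apply_bcontfun w s})" by (auto simp: S_def periodic1_def)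
      also have "closed \<dots>" by (intro closed_INT ballI closed_Collect_eq ev)
      finally show ?thesis .
    qed
    then show "complete S" by (simp add: complete_eq_closed)
    have "const_bcontfun 0 \<in> S" by (simp add: S_def periodic1_def)
    then show "S \<noteq> {}" by blast
    show "(\<lambda>w. Bcontfun (q w)) ` S \<subseteq> S"
    proof clarify
      fix w assume w: "w \<in> S"
      show "Bcontfun (q w) \<in> S"
        using periodic1_green[OF perr[OF w]] by (simp add: S_def Bcontfun_inverse[OF qb[OF w]]) (simp add: q_def)
    qed
    fix v w assume vw: "v \<in> S" "w \<in> S"
    show "dist (Bcontfun (q v)) (Bcontfun (q w)) \<le> \<theta> * dist v w"
    proof (rule dist_bound)
      fix s
      have "\<bar>q v s - q w s\<bar> = \<bar>green k (\<lambda>x. r v x - r w x) s\<bar>"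
        by (simp add: q_def green_diff[OF cr cr])
      also have "\<dots> \<le> green k (\<lambda>x. (k\<^sup>2 - p x) * dist v w) s"
      proof (rule green_abs_le[OF k(1)])
        show "continuous_on UNIV (\<lambda>x. r v x - r w x)" by (intro continuous_intros cr)
        show "continuous_on UNIV (\<lambda>x. (k\<^sup>2 - p x) * dist v w)" by (intro continuous_intros c)
        fix x
        have "\<bar>r v x - r w x\<bar> = (k\<^sup>2 - p x) * dist (v x) (w x)"
          using kp[of x] by (simp add: r_def dist_real_def abs_mult flip: right_diff_distrib)
        also have "\<dots> \<le> (k\<^sup>2 - p x) * dist v w" by (intro mult_left_mono dist_bounded kp)
        finally show "\<bar>r v x - r w x\<bar> \<le> (k\<^sup>2 - p x) * dist v w" .
      qed
      also have "\<dots> = green k (\<lambda>x. k\<^sup>2 - p x) s * dist v w"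
        unfolding green_def mult.assoc[symmetric] integral_mult_left by (simp add: algebra_simps add_divide_distrib)
      also have "\<dots> \<le> \<theta> * dist v w" by (intro mult_right_mono g1) auto
      finally show "dist (Bcontfun (q v) s) (Bcontfun (q w) s) \<le> \<theta> * dist v w"
        by (simp add: Bcontfun_inverse qb vw dist_real_def)
    qed
  qed
  then obtain w where w: "w \<in> S" "Bcontfun (q w) = w" by blast
  then have wq: "apply_bcontfun w = q w" by (metis Bcontfun_inverse qb)
  obtain w1 where w1: "\<And>s. (green k (r w) has_real_derivative w1 s) (at s)"
    "\<And>s. (w1 has_real_derivative (k\<^sup>2 * green k (r w) s - r w s)) (at s)"
    using green_derivatives[OF k(1) cr perr[OF w(1)]] by blast
  have "k\<^sup>2 * q w s - r w s = p s * q w s - 1" for s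
    by (simp add: r_def wq algebra_simps)
  moreover have "periodic1 (q w)" using w(1) wq by (simp add: S_def)
  ultimately show thesis
    using that[of "q w" w1] w1 by (simp add: q_def has_real_derivative_iff_has_vector_derivative)
qed

section \<open>Gaussian kernels\<close>

lemma has_vector_derivative_of_quotient_limit:
  fixes f :: "real \<Rightarrow> 'v::real_normed_vector"
  assumes "((\<lambda>s. (f s - f t) /\<^sub>R (s - t)) \<longlongrightarrow> D) (at t within S)"
  shows "(f has_vector_derivative D) (at t within S)"
proof -
  have "((\<lambda>s. norm ((f s - f t) /\<^sub>R (s - t) - D)) \<longlongrightarrow> 0) (at t within S)"
    using assms by (simp add: LIM_zero tendsto_norm_zero)
  then have "((\<lambda>s. norm ((f s - (f t + (s - t) *\<^sub>R D)) /\<^sub>R norm (s - t))) \<longlongrightarrow> 0) (at t within S)"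
  proof (rule Lim_transform_eventually)
    show "\<forall>\<^sub>F s in at t within S. norm ((f s - f t) /\<^sub>R (s - t) - D) = norm ((f s - (f t + (s - t) *\<^sub>R D)) /\<^sub>R norm (s - t))"
      unfolding eventually_at_filter
    proof (rule always_eventually, intro allI impI)
      fix s assume s: "s \<noteq> t"
      have "(f s - f t) /\<^sub>R (s - t) - D = (f s - (f t + (s - t) *\<^sub>R D)) /\<^sub>R (s - t)"
        using s by (simp add: scaleR_right_diff_distrib flip: diff_diff_eq)
      then show "norm ((f s - f t) /\<^sub>R (s - t) - D) = norm ((f s - (f t + (s - t) *\<^sub>R D)) /\<^sub>R norm (s - t))"
        by simp
    qed
  qed
  then have "((\<lambda>s. (f s - (f t + (s - t) *\<^sub>R D)) /\<^sub>R norm (s - t)) \<longlongrightarrow> 0) (at t within S)"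
    by (rule tendsto_norm_zero_cancel)
  then show ?thesis
    by (simp add: has_vector_derivative_def has_derivative_within bounded_linear_scaleR_left diff_diff_eq divide_inverse)
qed

text \<open>The mean value inequality turns the bound \<open>m\<close> on the derivative into the
  same bound on all difference quotients, so dominated convergence applies along every sequence
  tending to \<open>t\<close>. Measurability of the derivative follows, as it is a pointwise limit
  of these quotients.\<close>

lemma has_vector_derivative_integral_dominated:
  fixes F :: "real \<Rightarrow> 'm \<Rightarrow> 'v::{banach,second_countable_topology}"
  assumes t: "a < t" "t < b"
    and int: "\<And>s. a < s \<Longrightarrow> s < b \<Longrightarrow> integrable M (F s)"
    and der: "\<And>s x. a < s \<Longrightarrow> s < b \<Longrightarrow> x \<in> space M \<Longrightarrow> ((\<lambda>s. F s x) has_vector_derivative F' s x) (at s)"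
    and dom: "\<And>s x. a < s \<Longrightarrow> s < b \<Longrightarrow> x \<in> space M \<Longrightarrow> norm (F' s x) \<le> m x"
    and m: "integrable M m"
  shows "((\<lambda>s. \<integral>x. F s x \<partial>M) has_vector_derivative (\<integral>x. F' t x \<partial>M)) (at t)"
proof -
  have U: "at t within {a<..<b} = at t" using t by (intro at_within_open) auto
  have "((\<lambda>s. ((\<integral>x. F s x \<partial>M) - (\<integral>x. F t x \<partial>M)) /\<^sub>R (s - t)) \<longlongrightarrow> (\<integral>x. F' t x \<partial>M)) (at t within {a<..<b})"
    unfolding tendsto_at_iff_sequentially
  proof (intro allI impI)
    fix X :: "nat \<Rightarrow> real"
    assume X: "\<forall>i. X i \<in> {a<..<b} - {t}" "X \<longlonglongrightarrow> t"
    define q where "q i x = (F (X i) x - F t x) /\<^sub>R (X i - t)" for i x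
    have qm: "q i \<in> borel_measurable M" for i
    proof -
      have "integrable M (F (X i))" "integrable M (F t)" using X(1) t by (auto intro!: int)
      then have "integrable M (q i)" by (simp add: q_def[abs_def])
      then show ?thesis by (rule borel_measurable_integrable)
    qed
    have ql: "(\<lambda>i. q i x) \<longlonglongrightarrow> F' t x" if x: "x \<in> space M" for x
    proof -
      have "((\<lambda>s. (F s x - F t x) /\<^sub>R (s - t)) \<longlongrightarrow> F' t x) (at t)"
      proof -
        have "((\<lambda>s. ((F s x - F t x) - (s - t) *\<^sub>R F' t x) /\<^sub>R norm (s - t)) \<longlongrightarrow> 0) (at t)"
          using der[OF t x] by (simp add: has_vector_derivative_def has_derivative_within diff_diff_eq divide_inverse)
        then have "((\<lambda>s. norm (((F s x - F t x) - (s - t) *\<^sub>R F' t x) /\<^sub>R norm (s - t))) \<longlongrightarrow> 0) (at t)"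
          by (rule tendsto_norm_zero)
        then have "((\<lambda>s. norm ((F s x - F t x) /\<^sub>R (s - t) - F' t x)) \<longlongrightarrow> 0) (at t)"
        proof (rule Lim_transform_eventually)
          show "\<forall>\<^sub>F s in at t. norm (((F s x - F t x) - (s - t) *\<^sub>R F' t x) /\<^sub>R norm (s - t)) = norm ((F s x - F t x) /\<^sub>R (s - t) - F' t x)"
            unfolding eventually_at_filter
          proof (rule always_eventually, intro allI impI)
            fix s assume s: "s \<noteq> t"
            have "(F s x - F t x) /\<^sub>R (s - t) - F' t x = ((F s x - F t x) - (s - t) *\<^sub>R F' t x) /\<^sub>R (s - t)"
              using s by (simp add: scaleR_right_diff_distrib)
            then show "norm (((F s x - F t x) - (s - t) *\<^sub>R F' t x) /\<^sub>R norm (s - t)) = norm ((F s x - F t x) /\<^sub>R (s - t) - F' t x)"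
              by simp
          qed
        qed
        then show ?thesis by (rule LIM_zero_cancel[OF tendsto_norm_zero_cancel])
      qed
      then show ?thesis
        using X unfolding tendsto_at_iff_sequentially q_def comp_def by simp
    qed
    have qb: "norm (q i x) \<le> m x" if x: "x \<in> space M" for i x
    proof -
      have "norm (F (X i) x - F t x) \<le> m x * norm (X i - t)"
      proof (rule differentiable_bound[where S = "{a<..<b}" and f' = "\<lambda>s h. h *\<^sub>R F' s x"])
        show "((\<lambda>s. F s x) has_derivative (\<lambda>h. h *\<^sub>R F' s x)) (at s within {a<..<b})" if "s \<in> {a<..<b}" for s
          using der[of s x] that x by (auto simp: has_vector_derivative_def intro: has_derivative_at_withinI)
        show "onorm (\<lambda>h. h *\<^sub>R F' s x) \<le> m x" if "s \<in> {a<..<b}" for s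
        proof (rule onorm_bound)
          have *: "norm (F' s x) \<le> m x" using that x by (intro dom) auto
          then show "0 \<le> m x" using norm_ge_zero order_trans by blast
          show "norm (h *\<^sub>R F' s x) \<le> m x * norm h" for h
            using mult_left_mono[OF *, of "norm h"] by (simp add: mult.commute)
        qed
      qed (use X(1) t in auto)
      moreover have "norm (q i x) = norm (F (X i) x - F t x) / \<bar>X i - t\<bar>"
        by (simp add: q_def divide_inverse mult.commute)
      ultimately show ?thesis using X(1) by (simp add: divide_le_eq)
    qed
    have lm: "F' t \<in> borel_measurable M"
      using borel_measurable_LIMSEQ_metric[OF qm ql] .
    have "(\<lambda>i. \<integral>x. q i x \<partial>M) \<longlonglongrightarrow> (\<integral>x. F' t x \<partial>M)"
      by (rule integral_dominated_convergence[OF lm qm m]) (use ql qb in auto)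
    moreover have "(\<integral>x. q i x \<partial>M) = ((\<integral>x. F (X i) x \<partial>M) - (\<integral>x. F t x \<partial>M)) /\<^sub>R (X i - t)" for i
    proof -
      have "integrable M (F (X i))" "integrable M (F t)" using X(1) t by (auto intro!: int)
      then show ?thesis by (simp add: q_def)
    qed
    ultimately show "((\<lambda>s. ((\<integral>x. F s x \<partial>M) - (\<integral>x. F t x \<partial>M)) /\<^sub>R (s - t)) \<circ> X) \<longlonglongrightarrow> (\<integral>x. F' t x \<partial>M)"
      by (simp add: comp_def)
  qed
  then show ?thesis
    using has_vector_derivative_of_quotient_limit U by fastforce
qed

lemma continuous_on_integral_dominated:
  fixes h :: "'p::metric_space \<Rightarrow> real \<Rightarrow> 'v::{banach,second_countable_topology}" and \<psi> :: "real \<Rightarrow> real"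
  assumes c: "\<And>z. continuous_on S (\<lambda>p. h p z)" and b: "\<And>p z. norm (h p z) \<le> G"
    and ms: "\<And>p. h p \<in> borel_measurable borel" and i: "integrable lborel \<psi>"
  shows "continuous_on S (\<lambda>p. \<integral>z. \<psi> z *\<^sub>R h p z \<partial>lborel)"
proof (rule continuous_on_sequentiallyI)
  fix u a assume u: "\<forall>n. u n \<in> S" "a \<in> S" "u \<longlonglongrightarrow> a"
  show "(\<lambda>n. \<integral>z. \<psi> z *\<^sub>R h (u n) z \<partial>lborel) \<longlonglongrightarrow> (\<integral>z. \<psi> z *\<^sub>R h a z \<partial>lborel)"
  proof (rule integral_dominated_convergence[where w = "\<lambda>z. \<bar>\<psi> z\<bar> * G"])
    have [measurable]: "\<psi> \<in> borel_measurable borel" using i by auto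
    have M: "(\<lambda>z. \<psi> z *\<^sub>R h p z) \<in> borel_measurable lborel" for p using ms[of p] by measurable
    show "(\<lambda>z. \<psi> z *\<^sub>R h a z) \<in> borel_measurable lborel" by (rule M)
    show "(\<lambda>z. \<psi> z *\<^sub>R h (u n) z) \<in> borel_measurable lborel" for n by (rule M)
    show "integrable lborel (\<lambda>z. \<bar>\<psi> z\<bar> * G)" using i by auto
    show "AE z in lborel. norm (\<psi> z *\<^sub>R h (u n) z) \<le> \<bar>\<psi> z\<bar> * G" for n
      using b by (simp add: mult_left_mono)
    have "(\<lambda>n. h (u n) z) \<longlonglongrightarrow> h a z" for z
      using c[of z] u unfolding continuous_on_sequentially comp_def by blast
    then show "AE z in lborel. (\<lambda>n. \<psi> z *\<^sub>R h (u n) z) \<longlonglongrightarrow> \<psi> z *\<^sub>R h a z"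
      by (intro AE_I2 tendsto_scaleR tendsto_const)
  qed
qed

text \<open>The factor 1 + z^2 makes the kernel integrable; the extra 1 + |z| keeps its first moment
  integrable, which later absorbs the growth |z|^a of a Hoelder increment.\<close>

definition rapid :: "(real \<Rightarrow> real) \<Rightarrow> bool" where
  "rapid \<psi> \<longleftrightarrow> continuous_on UNIV \<psi> \<and> (\<exists>C. \<forall>z. \<bar>\<psi> z\<bar> * (1 + \<bar>z\<bar>) * (1 + z\<^sup>2) \<le> C)"

lemma integrable_inverse_square: "integrable lborel (\<lambda>x::real. inverse (1 + x\<^sup>2))"
  using integrable_inverse_1_plus_square by (simp add: set_integrable_def einterval_def)

lemma rapid_bound:
  assumes "rapid \<psi>"
  obtains C where "0 \<le> C" "\<And>z. \<bar>\<psi> z\<bar> * (1 + \<bar>z\<bar>) \<le> C * inverse (1 + z\<^sup>2)" "\<And>z. \<bar>\<psi> z\<bar> \<le> C * inverse (1 + z\<^sup>2)"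
proof -
  obtain C where C: "\<And>z. \<bar>\<psi> z\<bar> * (1 + \<bar>z\<bar>) * (1 + z\<^sup>2) \<le> C"
    using assms by (auto simp: rapid_def)
  have p: "0 < 1 + z\<^sup>2" for z :: real by (simp add: add_pos_nonneg)
  have 1: "\<bar>\<psi> z\<bar> * (1 + \<bar>z\<bar>) \<le> C * inverse (1 + z\<^sup>2)" for z
    using C[of z] p[of z] by (simp add: field_simps)
  have 2: "\<bar>\<psi> z\<bar> \<le> \<bar>\<psi> z\<bar> * (1 + \<bar>z\<bar>)" for z by (simp add: mult_le_cancel_left1)
  have "0 \<le> \<bar>\<psi> 0\<bar> * (1 + \<bar>0\<bar>) * (1 + 0\<^sup>2)" by simp
  then have "0 \<le> C" using C[of 0] by linarith
  then show thesis using that 1 2 order_trans by metis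
qed

lemma rapid_integrable:
  assumes "rapid \<psi>"
  shows "integrable lborel \<psi>" "integrable lborel (\<lambda>z. \<bar>\<psi> z\<bar> * (1 + \<bar>z\<bar>))"
proof -
  obtain C where C: "0 \<le> C" "\<And>z. \<bar>\<psi> z\<bar> * (1 + \<bar>z\<bar>) \<le> C * inverse (1 + z\<^sup>2)" "\<And>z. \<bar>\<psi> z\<bar> \<le> C * inverse (1 + z\<^sup>2)"
    using rapid_bound[OF assms] by metis
  have [measurable]: "\<psi> \<in> borel_measurable borel"
    using assms by (auto simp: rapid_def intro: borel_measurable_continuous_onI)
  have i: "integrable lborel (\<lambda>x::real. C * inverse (1 + x\<^sup>2))"
    using integrable_inverse_square by (rule integrable_mult_right)
  have n: "C * inverse (1 + x\<^sup>2) \<ge> 0" for x :: real using C(1) by (intro mult_nonneg_nonneg) (auto simp: add_nonneg_nonneg)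
  show "integrable lborel \<psi>"
    by (rule Bochner_Integration.integrable_bound[OF i]) (use C(3) n in \<open>auto simp del: inverse_eq_divide\<close>)
  show "integrable lborel (\<lambda>z. \<bar>\<psi> z\<bar> * (1 + \<bar>z\<bar>))"
  proof (rule Bochner_Integration.integrable_bound[OF i])
    show "(\<lambda>z. \<bar>\<psi> z\<bar> * (1 + \<bar>z\<bar>)) \<in> borel_measurable lborel" by measurable
    show "AE x in lborel. norm (\<bar>\<psi> x\<bar> * (1 + \<bar>x\<bar>)) \<le> norm (C * inverse (1 + x\<^sup>2))"
    proof (rule AE_I2)
      fix x
      have "norm (\<bar>\<psi> x\<bar> * (1 + \<bar>x\<bar>)) = \<bar>\<psi> x\<bar> * (1 + \<bar>x\<bar>)" by (simp add: abs_mult)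
      then show "norm (\<bar>\<psi> x\<bar> * (1 + \<bar>x\<bar>)) \<le> norm (C * inverse (1 + x\<^sup>2))"
        using C(2)[of x] n[of x] by simp
    qed
  qed
qed

text \<open>The value is 2 sqrt pi; the sequel rests on its positivity alone.\<close>

definition gauss_mass :: real where
  "gauss_mass = (\<integral>z. exp (- z\<^sup>2 / 4) \<partial>lborel)"

text \<open>The kernel heat_ker j is (-1)^j times the j-th derivative of the normalised Gaussian exp (- z^2 / 4); the signs make
  heat_op (Suc j) the spatial derivative of heat_op j.\<close>

definition heat_poly :: "nat \<Rightarrow> real \<Rightarrow> real" where
  "heat_poly j z = (if j = 0 then 1 else if j = 1 then z / 2 else if j = 2 then z\<^sup>2 / 4 - 1 / 2 else z ^ 3 / 8 - 3 * z / 4)"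

definition heat_ker :: "nat \<Rightarrow> real \<Rightarrow> real" where
  "heat_ker j z = heat_poly j z * exp (- z\<^sup>2 / 4) / gauss_mass"

text \<open>Four powers are required: the polynomials \<open>heat_poly\<close> grow at most like (1
  + z^2)^2, and the two weights in \<open>rapid\<close> cost one power each.\<close>

lemma gauss_decay: "(1 + z\<^sup>2) ^ 4 * exp (- z\<^sup>2 / 4) \<le> 16 ^ 4 * exp (1/4)" for z :: real
proof -
  \<comment> \<open>The scale 16 makes 4 w equal to (1 + z^2) / 4, so that w \<le> exp w, raised to
    the fourth power, becomes a Gaussian bound.\<close>
  define w where "w = (1 + z\<^sup>2) / 16"
  have w: "0 \<le> w" by (simp add: w_def add_nonneg_nonneg)
  have "w ^ 4 \<le> exp w ^ 4"
    using w exp_ge_add_one_self[of w] by (intro power_mono) linarith+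
  also have "exp w ^ 4 = exp (4 * w)" by (simp add: exp_of_nat_mult[symmetric])
  finally have "w ^ 4 * exp (- 4 * w) \<le> 1" by (simp add: exp_minus field_simps)
  then have "(16 * w) ^ 4 * (exp (1/4) * exp (- 4 * w)) \<le> 16 ^ 4 * exp (1/4)" by (simp add: power_mult_distrib)
  moreover have "exp (1/4) * exp (- 4 * w) = exp (- z\<^sup>2 / 4)" by (simp add: w_def mult_exp_exp field_simps)
  moreover have "16 * w = 1 + z\<^sup>2" by (simp add: w_def)
  ultimately show ?thesis by (simp only:)
qed

lemma heat_poly_bound: "\<bar>heat_poly j z\<bar> \<le> 2 * (1 + z\<^sup>2)\<^sup>2"
proof -
  have a: "\<bar>z\<bar> \<le> 1 + z\<^sup>2"
    using zero_le_power2[of "\<bar>z\<bar> - 1/2"] by (simp add: power2_diff power_divide)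
  have b: "1 + z\<^sup>2 \<le> (1 + z\<^sup>2)\<^sup>2" by (rule self_le_power) auto
  have "\<bar>z ^ 3\<bar> = \<bar>z\<bar> * z\<^sup>2" by (simp add: power3_eq_cube power2_eq_square abs_mult)
  also have "\<dots> \<le> (1 + z\<^sup>2) * (1 + z\<^sup>2)" using a by (intro mult_mono) auto
  finally have c: "\<bar>z ^ 3\<bar> \<le> (1 + z\<^sup>2)\<^sup>2" by (simp add: power2_eq_square)
  have d: "0 \<le> z\<^sup>2" by simp
  have e: "1 \<le> 2 * (1 + z\<^sup>2)\<^sup>2" "1 / 2 - z\<^sup>2 / 4 \<le> 2 * (1 + z\<^sup>2)\<^sup>2" using b d by linarith+
  show ?thesis unfolding heat_poly_def using a b c d e by (auto simp: abs_le_iff)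
qed

lemma rapid_heat_poly: "rapid (\<lambda>z. heat_poly j z * exp (- z\<^sup>2 / 4) * c)"
  unfolding rapid_def
proof
  show "continuous_on UNIV (\<lambda>z. heat_poly j z * exp (- z\<^sup>2 / 4) * c)"
    unfolding heat_poly_def by (cases "j = 0"; cases "j = 1"; cases "j = 2") (auto intro!: continuous_intros)
  have "\<bar>heat_poly j z * exp (- z\<^sup>2 / 4) * c\<bar> * (1 + \<bar>z\<bar>) * (1 + z\<^sup>2) \<le> 4 * (16 ^ 4 * exp (1/4)) * \<bar>c\<bar>" for z
  proof -
    have a: "1 + \<bar>z\<bar> \<le> 2 * (1 + z\<^sup>2)"
      using zero_le_power2[of "\<bar>z\<bar> - 1/2"] zero_le_power2[of z] by (simp add: power2_diff power_divide)
    have "\<bar>heat_poly j z * exp (- z\<^sup>2 / 4) * c\<bar> * (1 + \<bar>z\<bar>) * (1 + z\<^sup>2)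
       = (\<bar>heat_poly j z\<bar> * (1 + \<bar>z\<bar>)) * ((1 + z\<^sup>2) * (exp (- z\<^sup>2 / 4) * \<bar>c\<bar>))"
      by (simp add: abs_mult algebra_simps)
    also have "\<dots> \<le> ((2 * (1 + z\<^sup>2)\<^sup>2) * (2 * (1 + z\<^sup>2))) * ((1 + z\<^sup>2) * (exp (- z\<^sup>2 / 4) * \<bar>c\<bar>))"
      using a heat_poly_bound[of j z] by (intro mult_right_mono mult_mono) auto
    also have "\<dots> = 4 * ((1 + z\<^sup>2) ^ 4 * exp (- z\<^sup>2 / 4)) * \<bar>c\<bar>" by algebra
    also have "\<dots> \<le> 4 * (16 ^ 4 * exp (1/4)) * \<bar>c\<bar>"
      by (intro mult_right_mono mult_left_mono gauss_decay) auto
    finally show ?thesis .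
  qed
  then show "\<exists>C. \<forall>z. \<bar>heat_poly j z * exp (- z\<^sup>2 / 4) * c\<bar> * (1 + \<bar>z\<bar>) * (1 + z\<^sup>2) \<le> C" by blast
qed

lemma rapid_heat_ker: "rapid (heat_ker j)"
  using rapid_heat_poly[of j "1 / gauss_mass"] by (simp add: heat_ker_def[abs_def])

lemma gauss_mass_pos: "0 < gauss_mass"
proof -
  have i: "integrable lborel (\<lambda>z::real. exp (- z\<^sup>2 / 4))"
    using rapid_integrable(1)[OF rapid_heat_poly[of 0 1]] by (simp add: heat_poly_def)
  have "0 \<le> gauss_mass" unfolding gauss_mass_def by (intro integral_nonneg_AE) auto
  moreover have "gauss_mass \<noteq> 0"
  proof
    assume "gauss_mass = 0"
    then have "AE z in lborel. exp (- z\<^sup>2 / 4) = (0::real)"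
      unfolding gauss_mass_def using integral_nonneg_eq_0_iff_AE[OF i] by auto
    then have "AE z in (lborel::real measure). False" by simp
    then have "ae_filter (lborel::real measure) = bot" by (simp add: eventually_False)
    then have "emeasure lborel (UNIV::real set) = 0" by (simp add: ae_filter_eq_bot_iff)
    then show False by simp
  qed
  ultimately show ?thesis by simp
qed

lemma integral_heat_ker_0: "(\<integral>z. heat_ker 0 z \<partial>lborel) = 1"
proof -
  have "(\<integral>z. heat_ker 0 z \<partial>lborel) = (\<integral>z. exp (- z\<^sup>2 / 4) \<partial>lborel) / gauss_mass"
    unfolding heat_ker_def heat_poly_def by simp
  then show ?thesis using gauss_mass_pos by (simp only: gauss_mass_def[symmetric]) simp
qed

lemma heat_ker_derivative:
  assumes "j < 3" shows "(heat_ker j has_real_derivative - heat_ker (Suc j) z) (at z)"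
proof -
  have "j = 0 \<or> j = 1 \<or> j = 2" using assms by auto
  then show ?thesis
    unfolding heat_ker_def[abs_def] heat_poly_def using gauss_mass_pos
    by (elim disjE; simp) (auto intro!: derivative_eq_intros simp: field_simps power2_eq_square power3_eq_cube)
qed

text \<open>With G the Gaussian this is (z G)' = -2 G'', the profile equation of the self-similar
  heat kernel. It turns a derivative in the scale into a second derivative in space.\<close>

lemma heat_ker_scaling: "heat_ker 0 z + z * (- heat_ker 1 z) = - 2 * heat_ker 2 z"
  using gauss_mass_pos by (simp add: heat_ker_def heat_poly_def field_simps power2_eq_square)

section \<open>Heat operators\<close>

text \<open>With l = sqrt t, heat_op j l g is the j-th spatial derivative of the heat flow of g at time t.\<close>

definition heat_op :: "nat \<Rightarrow> real \<Rightarrow> (real \<Rightarrow> 'v::euclidean_space) \<Rightarrow> real \<Rightarrow> 'v" where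
  "heat_op j l g y = (1 / l ^ j) *\<^sub>R (\<integral>z. heat_ker j z *\<^sub>R g (y + l * z) \<partial>lborel)"

text \<open>A function that is not integrable has integral 0 by convention, and the right side is
  nonnegative; hence no measurability of \<open>f\<close> is assumed.\<close>

lemma norm_lebesgue_integral_le:
  fixes f :: "'m \<Rightarrow> 'v::{banach,second_countable_topology}"
  assumes "integrable M w" "\<And>x. x \<in> space M \<Longrightarrow> norm (f x) \<le> w x"
  shows "norm (\<integral>x. f x \<partial>M) \<le> (\<integral>x. w x \<partial>M)"
proof (cases "integrable M f")
  case True
  have "norm (\<integral>x. f x \<partial>M) \<le> (\<integral>x. norm (f x) \<partial>M)" by (rule integral_norm_bound)
  also have "\<dots> \<le> (\<integral>x. w x \<partial>M)"
    using True assms by (intro integral_mono) auto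
  finally show ?thesis .
next
  case False
  have "0 \<le> (\<integral>x. w x \<partial>M)"
    using assms(2) norm_ge_zero order_trans by (intro integral_nonneg_AE AE_I2) blast
  then show ?thesis using False by (simp add: not_integrable_integral_eq)
qed

text \<open>Moves the parameters \<open>y\<close> and \<open>l\<close> from \<open>g\<close>, which
  is only continuous, to the smooth kernel, where they can be differentiated.\<close>

lemma conv_rescale:
  fixes g :: "real \<Rightarrow> 'v::euclidean_space"
  assumes "0 < l"
  shows "(\<integral>z. \<psi> z *\<^sub>R g (y + l * z) \<partial>lborel) = (\<integral>x. (\<psi> ((x - y) / l) / l) *\<^sub>R g x \<partial>lborel)"
proof -
  have "(\<integral>x. (\<psi> ((x - y) / l) / l) *\<^sub>R g x \<partial>lborel) = \<bar>l\<bar> *\<^sub>R (\<integral>x. (\<psi> ((y + l * x - y) / l) / l) *\<^sub>R g (y + l * x) \<partial>lborel)"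
    using assms by (intro lborel_integral_real_affine) simp
  also have "\<dots> = (\<integral>x. l *\<^sub>R ((\<psi> x / l) *\<^sub>R g (y + l * x)) \<partial>lborel)"
    unfolding Bochner_Integration.integral_scaleR_right using assms by simp
  also have "\<dots> = (\<integral>z. \<psi> z *\<^sub>R g (y + l * z) \<partial>lborel)"
    by (rule Bochner_Integration.integral_cong) (use assms in auto)
  finally show ?thesis ..
qed

lemma rapid_conv_integrable:
  fixes g :: "real \<Rightarrow> 'v::euclidean_space"
  assumes "rapid \<psi>" "continuous_on UNIV g" "\<And>x. norm (g x) \<le> G"
  shows "integrable lborel (\<lambda>z. \<psi> z *\<^sub>R g (y + l * z))"
proof (rule Bochner_Integration.integrable_bound)
  show "integrable lborel (\<lambda>z. \<psi> z * G)" using rapid_integrable(1)[OF assms(1)] by auto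
  have [measurable]: "\<psi> \<in> borel_measurable borel" "g \<in> borel_measurable borel"
    using assms by (auto simp: rapid_def intro: borel_measurable_continuous_onI)
  show "(\<lambda>z. \<psi> z *\<^sub>R g (y + l * z)) \<in> borel_measurable lborel" by measurable
  show "AE z in lborel. norm (\<psi> z *\<^sub>R g (y + l * z)) \<le> norm (\<psi> z * G)"
  proof (rule AE_I2)
    fix z
    have "norm (g (y + l * z)) \<le> \<bar>G\<bar>" using assms(3)[of "y + l * z"] by linarith
    then show "norm (\<psi> z *\<^sub>R g (y + l * z)) \<le> norm (\<psi> z * G)"
      by (simp add: abs_mult mult_left_mono)
  qed
qed

lemma rapid_conv_rescaled_integrable:
  fixes g :: "real \<Rightarrow> 'v::euclidean_space"
  assumes "rapid \<psi>" "continuous_on UNIV g" "\<And>x. norm (g x) \<le> G" "0 < l"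
  shows "integrable lborel (\<lambda>x. (\<psi> ((x - y) / l) / l) *\<^sub>R g x)"
proof -
  have "integrable lborel (\<lambda>z. (1 / l) *\<^sub>R (\<psi> z *\<^sub>R g (y + l * z)))"
    using rapid_conv_integrable[OF assms(1-3)] by (intro integrable_scaleR_right)
  then have "integrable lborel (\<lambda>x. (1 / l) *\<^sub>R (\<psi> (- y / l + (1 / l) * x) *\<^sub>R g (y + l * (- y / l + (1 / l) * x))))"
    using assms(4) lborel_integrable_real_affine[of "\<lambda>z. (1 / l) *\<^sub>R (\<psi> z *\<^sub>R g (y + l * z))" "1 / l" "- y / l"] by simp
  moreover have "- y / l + (1 / l) * x = (x - y) / l" "y + l * ((x - y) / l) = x" for x
    using assms(4) by (auto simp: field_simps)
  ultimately show ?thesis by simp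
qed

lemma integrable_inverse_square_affine:
  assumes "l \<noteq> 0"
  shows "integrable lborel (\<lambda>x. K * inverse (1 + ((x - y) / l)\<^sup>2) :: real)"
proof -
  have "integrable lborel (\<lambda>x. inverse (1 + (- y / l + (1 / l) * x)\<^sup>2) :: real)"
    using lborel_integrable_real_affine[OF integrable_inverse_square, of "1 / l" "- y / l"] assms by simp
  moreover have "- y / l + (1 / l) * x = (x - y) / l" for x
    using assms by (auto simp: field_simps)
  ultimately show ?thesis by (intro integrable_mult_right) simp
qed

text \<open>Supplies one integrable majorant for all kernels whose centres vary in a bounded range,
  as differentiation under the integral demands.\<close>

lemma inverse_square_shift:
  fixes u v d :: real
  assumes "\<bar>u - v\<bar> \<le> d"
  shows "inverse (1 + u\<^sup>2) \<le> (2 + 2 * d\<^sup>2) * inverse (1 + v\<^sup>2)"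
proof -
  have p: "0 < 1 + u\<^sup>2" "0 < 1 + v\<^sup>2" by (auto simp: add_pos_nonneg)
  have "(u - v)\<^sup>2 \<le> d\<^sup>2" using power_mono[OF assms abs_ge_zero, of 2] by simp
  moreover have "v\<^sup>2 \<le> 2 * u\<^sup>2 + 2 * (u - v)\<^sup>2"
    using zero_le_power2[of "2 * u - v"] by (simp add: power2_diff power2_eq_square algebra_simps)
  ultimately have "1 + v\<^sup>2 \<le> 2 + 2 * u\<^sup>2 + 2 * d\<^sup>2" by linarith
  also have "\<dots> \<le> (2 + 2 * d\<^sup>2) * (1 + u\<^sup>2)" by (simp add: algebra_simps)
  finally show ?thesis using p by (simp add: field_simps)
qed

lemma heat_op_derivative:
  fixes g :: "real \<Rightarrow> 'v::euclidean_space"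
  assumes j: "j < 3" and l: "0 < l" and c: "continuous_on UNIV g" and G: "\<And>x. norm (g x) \<le> G"
  shows "(heat_op j l g has_vector_derivative heat_op (Suc j) l g y) (at y)"
proof -
  define \<psi> where "\<psi> = heat_ker (Suc j)"
  obtain C where C: "0 \<le> C" "\<And>z. \<bar>\<psi> z\<bar> \<le> C * inverse (1 + z\<^sup>2)"
    using rapid_bound[OF rapid_heat_ker[of "Suc j"]] unfolding \<psi>_def by metis
  have G0: "0 \<le> G" using G[of 0] norm_ge_zero order_trans by blast
  \<comment> \<open>\<open>C\<close> is the decay constant of the kernel; moving its centre by less
    than 1 shifts the scaled variable by at most \<open>1 / l\<close>.\<close>
  define K where "K = C * (2 + 2 * (1 / l)\<^sup>2) / l\<^sup>2 * G"
  have "((\<lambda>s. \<integral>x. (heat_ker j ((x - s) / l) / l) *\<^sub>R g x \<partial>lborel) has_vector_derivative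
      (\<integral>x. (\<psi> ((x - y) / l) / l\<^sup>2) *\<^sub>R g x \<partial>lborel)) (at y)"
  proof (rule has_vector_derivative_integral_dominated[where a = "y - 1" and b = "y + 1" and m = "\<lambda>x. K * inverse (1 + ((x - y) / l)\<^sup>2)"])
    show "integrable lborel (\<lambda>x. (heat_ker j ((x - s) / l) / l) *\<^sub>R g x)" for s
      using rapid_conv_rescaled_integrable[OF rapid_heat_ker c G l] .
    show "((\<lambda>s. (heat_ker j ((x - s) / l) / l) *\<^sub>R g x) has_vector_derivative (\<psi> ((x - s) / l) / l\<^sup>2) *\<^sub>R g x) (at s)" for s x
    proof -
      have "((\<lambda>s. (x - s) / l) has_real_derivative (- 1 / l)) (at s)"
        using l by (auto intro!: derivative_eq_intros)
      from DERIV_chain2[OF heat_ker_derivative[OF j] this]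
      have "((\<lambda>s. heat_ker j ((x - s) / l) / l) has_real_derivative (- heat_ker (Suc j) ((x - s) / l) * (- 1 / l) / l)) (at s)"
        by (rule DERIV_cdivide)
      moreover have "- heat_ker (Suc j) ((x - s) / l) * (- 1 / l) / l = \<psi> ((x - s) / l) / l\<^sup>2"
        by (simp add: \<psi>_def power2_eq_square)
      ultimately have "((\<lambda>s. heat_ker j ((x - s) / l) / l) has_real_derivative \<psi> ((x - s) / l) / l\<^sup>2) (at s)" by simp
      from has_vector_derivative_scaleR[OF this has_vector_derivative_const[of "g x"]] show ?thesis by simp
    qed
    show "norm ((\<psi> ((x - s) / l) / l\<^sup>2) *\<^sub>R g x) \<le> K * inverse (1 + ((x - y) / l)\<^sup>2)" if "y - 1 < s" "s < y + 1" for s x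
    proof -
      have "\<bar>(x - s) / l - (x - y) / l\<bar> \<le> 1 / l"
        using that l by (simp add: diff_divide_distrib[symmetric] abs_le_iff divide_right_mono)
      then have "\<bar>\<psi> ((x - s) / l)\<bar> \<le> C * ((2 + 2 * (1 / l)\<^sup>2) * inverse (1 + ((x - y) / l)\<^sup>2))"
        by (intro order_trans[OF C(2)] mult_left_mono inverse_square_shift C(1))
      then have "\<bar>\<psi> ((x - s) / l)\<bar> / l\<^sup>2 * norm (g x) \<le> C * ((2 + 2 * (1 / l)\<^sup>2) * inverse (1 + ((x - y) / l)\<^sup>2)) / l\<^sup>2 * G"
        using l G[of x] by (intro mult_mono divide_right_mono) auto
      also have "\<dots> = K * inverse (1 + ((x - y) / l)\<^sup>2)" by (simp add: K_def)
      finally show ?thesis by simp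
    qed
    show "integrable lborel (\<lambda>x. K * inverse (1 + ((x - y) / l)\<^sup>2))"
      using l by (intro integrable_inverse_square_affine) simp
  qed auto
  from has_vector_derivative_scaleR[OF DERIV_const[of "1 / l ^ j"] this]
  have "((\<lambda>s. (1 / l ^ j) *\<^sub>R (\<integral>x. (heat_ker j ((x - s) / l) / l) *\<^sub>R g x \<partial>lborel)) has_vector_derivative
      (1 / l ^ j) *\<^sub>R (\<integral>x. (\<psi> ((x - y) / l) / l\<^sup>2) *\<^sub>R g x \<partial>lborel)) (at y)" by simp
  moreover have "(\<integral>x. (\<psi> ((x - y) / l) / l\<^sup>2) *\<^sub>R g x \<partial>lborel) = (1 / l) *\<^sub>R (\<integral>x. (\<psi> ((x - y) / l) / l) *\<^sub>R g x \<partial>lborel)"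
    by (subst integral_scaleR_right[symmetric]) (simp add: power2_eq_square)
  moreover have "heat_op j l g = (\<lambda>s. (1 / l ^ j) *\<^sub>R (\<integral>x. (heat_ker j ((x - s) / l) / l) *\<^sub>R g x \<partial>lborel))"
    by (rule ext) (simp add: heat_op_def conv_rescale[OF l])
  ultimately show ?thesis
    unfolding heat_op_def[of "Suc j"] conv_rescale[OF l] by (simp add: \<psi>_def mult.commute[of l])
qed

lemma heat_op_derivative_scale:
  fixes g :: "real \<Rightarrow> 'v::euclidean_space"
  assumes l: "0 < l" and c: "continuous_on UNIV g" and G: "\<And>x. norm (g x) \<le> G"
  shows "((\<lambda>l. heat_op 0 l g y) has_vector_derivative (2 * l) *\<^sub>R heat_op 2 l g y) (at l)"
proof -
  obtain C where C: "0 \<le> C" "\<And>z. \<bar>heat_ker 2 z\<bar> \<le> C * inverse (1 + z\<^sup>2)"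
    using rapid_bound[OF rapid_heat_ker[of 2]] by metis
  have G0: "0 \<le> G" using G[of 0] norm_ge_zero order_trans by blast
  \<comment> \<open>For scales \<open>s\<close> between l/2 and 2 l, the factor 1/s^2 is at most
    4/l^2 and the decay at scale \<open>s\<close> is dominated by that at scale 2 l; with the 2 in
    front of the kernel this gives 8.\<close>
  define K where "K = 8 * C / l\<^sup>2 * G"
  have "((\<lambda>s. \<integral>x. (heat_ker 0 ((x - y) / s) / s) *\<^sub>R g x \<partial>lborel) has_vector_derivative
      (\<integral>x. (2 * heat_ker 2 ((x - y) / l) / l\<^sup>2) *\<^sub>R g x \<partial>lborel)) (at l)"
  proof (rule has_vector_derivative_integral_dominated[where a = "l / 2" and b = "2 * l" and m = "\<lambda>x. K * inverse (1 + ((x - y) / (2 * l))\<^sup>2)"])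
    show "integrable lborel (\<lambda>x. (heat_ker 0 ((x - y) / s) / s) *\<^sub>R g x)" if "l / 2 < s" for s
      using rapid_conv_rescaled_integrable[OF rapid_heat_ker c G, of s] l that by simp
    show "((\<lambda>s. (heat_ker 0 ((x - y) / s) / s) *\<^sub>R g x) has_vector_derivative (2 * heat_ker 2 ((x - y) / s) / s\<^sup>2) *\<^sub>R g x) (at s)"
      if "l / 2 < s" for s x
    proof -
      have s: "s > 0" using that l by simp
      define u where "u = (x - y) / s"
      have "((\<lambda>s. (x - y) / s) has_real_derivative (- u / s)) (at s)"
        using s by (auto intro!: derivative_eq_intros simp: u_def field_simps)
      from DERIV_chain2[OF heat_ker_derivative[of 0] this]
      have "((\<lambda>s. heat_ker 0 ((x - y) / s)) has_real_derivative (- heat_ker 1 u * (- u / s))) (at s)"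
        by (simp add: u_def)
      from DERIV_divide[OF this DERIV_ident]
      have "((\<lambda>s. heat_ker 0 ((x - y) / s) / s) has_real_derivative ((- heat_ker 1 u * (- u / s) * s - heat_ker 0 u * 1) / (s * s))) (at s)"
        using s by (simp add: u_def)
      moreover have "(- heat_ker 1 u * (- u / s) * s - heat_ker 0 u * 1) / (s * s) = 2 * heat_ker 2 u / s\<^sup>2"
      proof -
        have "- heat_ker 1 u * (- u / s) * s - heat_ker 0 u * 1 = 2 * heat_ker 2 u"
          using heat_ker_scaling[of u] s by (simp add: algebra_simps)
        then show ?thesis by (simp add: power2_eq_square)
      qed
      ultimately have "((\<lambda>s. heat_ker 0 ((x - y) / s) / s) has_real_derivative 2 * heat_ker 2 u / s\<^sup>2) (at s)" by simp
      from has_vector_derivative_scaleR[OF this has_vector_derivative_const[of "g x"]] show ?thesis by (simp add: u_def)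
    qed
    show "norm ((2 * heat_ker 2 ((x - y) / s) / s\<^sup>2) *\<^sub>R g x) \<le> K * inverse (1 + ((x - y) / (2 * l))\<^sup>2)" if s: "l / 2 < s" "s < 2 * l" for s x
    proof -
      have sp: "s > 0" using s l by simp
      have "((x - y) / (2 * l))\<^sup>2 \<le> ((x - y) / s)\<^sup>2"
        unfolding power_divide using s sp l by (intro frac_le[OF _ order_refl] power_mono) auto
      then have "inverse (1 + ((x - y) / s)\<^sup>2) \<le> inverse (1 + ((x - y) / (2 * l))\<^sup>2)"
        by (intro le_imp_inverse_le) (auto simp: add_pos_nonneg)
      then have 1: "\<bar>heat_ker 2 ((x - y) / s)\<bar> \<le> C * inverse (1 + ((x - y) / (2 * l))\<^sup>2)"
        by (intro order_trans[OF C(2)] mult_left_mono C(1))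
      have "(l / 2)\<^sup>2 \<le> s\<^sup>2" using s l by (intro power_mono) auto
      then have 2: "1 / s\<^sup>2 \<le> 4 / l\<^sup>2" using l sp by (simp add: power_divide field_simps)
      have "norm ((2 * heat_ker 2 ((x - y) / s) / s\<^sup>2) *\<^sub>R g x) = 2 * \<bar>heat_ker 2 ((x - y) / s)\<bar> * (1 / s\<^sup>2) * norm (g x)"
        using sp by (simp add: abs_mult)
      also have "\<dots> \<le> 2 * (C * inverse (1 + ((x - y) / (2 * l))\<^sup>2)) * (4 / l\<^sup>2) * G"
        using 1 2 G[of x] C G0 by (intro mult_mono mult_left_mono) (auto simp: add_nonneg_nonneg)
      also have "\<dots> = K * inverse (1 + ((x - y) / (2 * l))\<^sup>2)" by (simp add: K_def)
      finally show ?thesis .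
    qed
    show "integrable lborel (\<lambda>x. K * inverse (1 + ((x - y) / (2 * l))\<^sup>2))"
      using l by (intro integrable_inverse_square_affine) simp
  qed (use l in auto)
  then have "((\<lambda>s. heat_op 0 s g y) has_vector_derivative (\<integral>x. (2 * heat_ker 2 ((x - y) / l) / l\<^sup>2) *\<^sub>R g x \<partial>lborel)) (at l)"
  proof (rule has_vector_derivative_transform_within_open[where S = "{0<..}"])
    show "(\<integral>x. (heat_ker 0 ((x - y) / s) / s) *\<^sub>R g x \<partial>lborel) = heat_op 0 s g y" if "s \<in> {0<..}" for s
      using that by (simp add: heat_op_def conv_rescale)
  qed (use l in auto)
  moreover have "(\<integral>x. (2 * heat_ker 2 ((x - y) / l) / l\<^sup>2) *\<^sub>R g x \<partial>lborel) = (2 / l) *\<^sub>R (\<integral>x. (heat_ker 2 ((x - y) / l) / l) *\<^sub>R g x \<partial>lborel)"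
    by (subst integral_scaleR_right[symmetric]) (simp add: power2_eq_square)
  moreover have "(2 / l) *\<^sub>R (\<integral>x. (heat_ker 2 ((x - y) / l) / l) *\<^sub>R g x \<partial>lborel) = (2 * l) *\<^sub>R heat_op 2 l g y"
    using l by (simp add: heat_op_def conv_rescale[OF l] power2_eq_square)
  ultimately show ?thesis by simp
qed

lemma heat_op_derivative_time:
  fixes g :: "real \<Rightarrow> 'v::euclidean_space"
  assumes r: "0 < r" and c: "continuous_on UNIV g" and G: "\<And>x. norm (g x) \<le> G"
  shows "((\<lambda>r. heat_op 0 (sqrt r) g y) has_vector_derivative heat_op 2 (sqrt r) g y) (at r)"
proof -
  have "(sqrt has_vector_derivative inverse (sqrt r) / 2) (at r)"
    using DERIV_real_sqrt[OF r] by (simp add: has_real_derivative_iff_has_vector_derivative)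
  from vector_diff_chain_at[OF this heat_op_derivative_scale[OF _ c G, of "sqrt r" y]]
  have "((\<lambda>r. heat_op 0 (sqrt r) g y) has_vector_derivative (inverse (sqrt r) / 2) *\<^sub>R (2 * sqrt r) *\<^sub>R heat_op 2 (sqrt r) g y) (at r)"
    using r by (simp add: comp_def)
  then show ?thesis using r by simp
qed

text \<open>The operators applied to the constant 1 do not depend on \<open>y\<close>. Each kernel
  gives the derivative of what the previous one gives, so its mass is zero.\<close>

lemma integral_heat_ker_pos:
  assumes "1 \<le> j" "j \<le> 3" shows "(\<integral>z. heat_ker j z \<partial>lborel) = 0"
proof -
  obtain i where i: "j = Suc i" "i < 3" using assms by (cases j) auto
  have "(heat_op i 1 (\<lambda>_. 1::real) has_vector_derivative heat_op j 1 (\<lambda>_. 1::real) 0) (at 0)"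
    unfolding i(1) by (rule heat_op_derivative[where G = 1]) (use i in auto)
  moreover have "heat_op i 1 (\<lambda>_. 1::real) = (\<lambda>y. heat_op i 1 (\<lambda>_. 1::real) 0)"
    by (rule ext) (simp add: heat_op_def)
  then have "(heat_op i 1 (\<lambda>_. 1::real) has_vector_derivative 0) (at 0)"
    using has_vector_derivative_const by metis
  ultimately have "heat_op j 1 (\<lambda>_. 1::real) 0 = 0" using vector_derivative_unique_at by blast
  then show ?thesis by (simp add: heat_op_def)
qed

text \<open>The weight 1 + |z| dominates |z|^a for every \<open>a\<close> in (0,1], so one constant
  serves all exponents.\<close>

definition heat_const :: real where
  "heat_const = (\<Sum>j\<le>3. \<integral>z. \<bar>heat_ker j z\<bar> * (1 + \<bar>z\<bar>) \<partial>lborel)"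

lemma heat_const_ge: "j \<le> 3 \<Longrightarrow> (\<integral>z. \<bar>heat_ker j z\<bar> * (1 + \<bar>z\<bar>) \<partial>lborel) \<le> heat_const"
  unfolding heat_const_def
  by (rule member_le_sum[of j "{..3}" "\<lambda>j. \<integral>z. \<bar>heat_ker j z\<bar> * (1 + \<bar>z\<bar>) \<partial>lborel"])
     (auto intro!: integral_nonneg_AE AE_I2)

lemma heat_const_nonneg: "0 \<le> heat_const"
  unfolding heat_const_def by (intro sum_nonneg integral_nonneg_AE AE_I2) auto

lemma powr_le_one_plus: "0 \<le> x \<Longrightarrow> 0 < a \<Longrightarrow> a \<le> 1 \<Longrightarrow> x powr a \<le> 1 + (x::real)"
  using powr_mono[of a 1 x] powr_mono2[of a x 1] by (cases "x \<le> 1") auto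

lemma norm_heat_op_0:
  fixes g :: "real \<Rightarrow> 'v::euclidean_space"
  assumes "continuous_on UNIV g" "\<And>x. norm (g x) \<le> M"
  shows "norm (heat_op 0 l g y) \<le> heat_const * M"
proof -
  have M: "0 \<le> M" using assms(2)[of 0] norm_ge_zero order_trans by blast
  have "norm (\<integral>z. heat_ker 0 z *\<^sub>R g (y + l * z) \<partial>lborel) \<le> (\<integral>z. M * (\<bar>heat_ker 0 z\<bar> * (1 + \<bar>z\<bar>)) \<partial>lborel)"
  proof (rule norm_lebesgue_integral_le)
    show "integrable lborel (\<lambda>z. M * (\<bar>heat_ker 0 z\<bar> * (1 + \<bar>z\<bar>)))"
      using rapid_integrable(2)[OF rapid_heat_ker] by (rule integrable_mult_right)
    fix z
    have "\<bar>heat_ker 0 z\<bar> * norm (g (y + l * z)) \<le> (\<bar>heat_ker 0 z\<bar> * (1 + \<bar>z\<bar>)) * M"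
      using assms(2)[of "y + l * z"] by (intro mult_mono) (auto simp: mult_le_cancel_left1)
    then show "norm (heat_ker 0 z *\<^sub>R g (y + l * z)) \<le> M * (\<bar>heat_ker 0 z\<bar> * (1 + \<bar>z\<bar>))" by (simp add: mult.commute)
  qed
  also have "\<dots> \<le> M * heat_const" using heat_const_ge[of 0] M by (simp add: mult_left_mono)
  finally show ?thesis by (simp add: heat_op_def mult.commute)
qed

text \<open>Kernels of positive order have mass zero, so \<open>g y\<close> can be subtracted under
  the integral. The increment is of order (l |z|)^a, which improves l^(-j) to l^(a-j).\<close>

lemma norm_heat_op:
  fixes g :: "real \<Rightarrow> 'v::euclidean_space"
  assumes g: "holder a M g" and a: "0 < a" "a \<le> 1" and l: "0 < l" and j: "1 \<le> j" "j \<le> 3"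
  shows "norm (heat_op j l g y) \<le> heat_const * M * l powr (a - j)"
proof -
  have c: "continuous_on UNIV g" using holder_continuous[OF a(1) g] .
  have M: "0 \<le> M" using holder_nonneg[OF g] .
  note i1 = rapid_conv_integrable[OF rapid_heat_ker c holderD1[OF g], of j y l]
  note i0 = rapid_integrable(1)[OF rapid_heat_ker[of j]]
  have i2: "integrable lborel (\<lambda>z. heat_ker j z *\<^sub>R g y)" using i0 by (rule integrable_scaleR_left)
  have "(\<integral>z. heat_ker j z *\<^sub>R g (y + l * z) \<partial>lborel) = (\<integral>z. heat_ker j z *\<^sub>R g (y + l * z) \<partial>lborel) - (\<integral>z. heat_ker j z *\<^sub>R g y \<partial>lborel)"
    using i0 integral_heat_ker_pos[OF j] by simp
  also have "\<dots> = (\<integral>z. heat_ker j z *\<^sub>R g (y + l * z) - heat_ker j z *\<^sub>R g y \<partial>lborel)"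
    using i1 i2 by (rule Bochner_Integration.integral_diff[symmetric])
  finally have e: "(\<integral>z. heat_ker j z *\<^sub>R g (y + l * z) \<partial>lborel) = \<dots>" .
  have "norm (\<integral>z. heat_ker j z *\<^sub>R g (y + l * z) - heat_ker j z *\<^sub>R g y \<partial>lborel) \<le> (\<integral>z. (M * l powr a) * (\<bar>heat_ker j z\<bar> * (1 + \<bar>z\<bar>)) \<partial>lborel)"
  proof (rule norm_lebesgue_integral_le)
    show "integrable lborel (\<lambda>z. (M * l powr a) * (\<bar>heat_ker j z\<bar> * (1 + \<bar>z\<bar>)))"
      using rapid_integrable(2)[OF rapid_heat_ker] by (rule integrable_mult_right)
    fix z
    have "norm (g (y + l * z) - g y) \<le> M * \<bar>y + l * z - y\<bar> powr a" by (rule holderD2[OF g])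
    also have "\<bar>y + l * z - y\<bar> = l * \<bar>z\<bar>" using l by (simp add: abs_mult)
    also have "M * (l * \<bar>z\<bar>) powr a \<le> M * (l powr a * (1 + \<bar>z\<bar>))"
      using l M a by (simp add: powr_mult mult_left_mono powr_le_one_plus)
    finally have "\<bar>heat_ker j z\<bar> * norm (g (y + l * z) - g y) \<le> \<bar>heat_ker j z\<bar> * (M * (l powr a * (1 + \<bar>z\<bar>)))"
      by (intro mult_left_mono) auto
    then show "norm (heat_ker j z *\<^sub>R g (y + l * z) - heat_ker j z *\<^sub>R g y) \<le> (M * l powr a) * (\<bar>heat_ker j z\<bar> * (1 + \<bar>z\<bar>))"
      by (simp add: mult_ac flip: scaleR_right_diff_distrib)
  qed
  also have "\<dots> \<le> (M * l powr a) * heat_const" using heat_const_ge[OF j(2)] M by (simp add: mult_left_mono)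
  finally have "norm (heat_op j l g y) \<le> (1 / l ^ j) * ((M * l powr a) * heat_const)"
    unfolding heat_op_def e using l by (simp add: divide_right_mono)
  also have "\<dots> = heat_const * M * l powr (a - j)"
    using l by (simp add: powr_diff powr_realpow)
  finally show ?thesis .
qed

lemma norm_heat_op_diff:
  fixes g :: "real \<Rightarrow> 'v::euclidean_space"
  assumes g: "holder a M g" and a: "0 < a" "a \<le> 1" and l: "0 < l"
  shows "norm (heat_op 2 l g y - heat_op 2 l g y') \<le> heat_const * M * l powr (a - 3) * \<bar>y - y'\<bar>"
proof (rule lipschitz_vector_derivative)
  show "(heat_op 2 l g has_vector_derivative heat_op 3 l g x) (at x)" for x
    using heat_op_derivative[of 2 l g M x] l holder_continuous[OF a(1) g] holderD1[OF g] by (simp add: numeral_3_eq_3 numeral_2_eq_2)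
  show "norm (heat_op 3 l g x) \<le> heat_const * M * l powr (a - 3)" for x
    using norm_heat_op[OF g a l, of 3 x] by simp
qed

section \<open>Duhamel's formula\<close>

definition unif_holder :: "real \<Rightarrow> real \<Rightarrow> (real \<Rightarrow> real \<Rightarrow> 'v::euclidean_space) \<Rightarrow> bool" where
  "unif_holder a M f \<longleftrightarrow> continuous_on UNIV (\<lambda>p. f (fst p) (snd p)) \<and> (\<forall>t. holder a M (f t))"

text \<open>The variable \<open>r\<close> is elapsed time, so the singularity of the kernel always
  sits at 0.\<close>

definition duhamel :: "nat \<Rightarrow> (real \<Rightarrow> real \<Rightarrow> 'v::euclidean_space) \<Rightarrow> real \<Rightarrow> real \<Rightarrow> 'v" where
  "duhamel j f t y = (\<integral>r. indicator {0<..<t} r *\<^sub>R heat_op j (sqrt r) (f (t - r)) y \<partial>lborel)"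

lemma unif_holder_holder: "unif_holder a M f \<Longrightarrow> holder a M (f t)"
  by (simp add: unif_holder_def)

lemma unif_holder_compose_continuous:
  assumes "unif_holder a M f" "continuous_on S u" "continuous_on S v"
  shows "continuous_on S (\<lambda>p. f (u p) (v p))"
  using continuous_on_compose2[of UNIV "\<lambda>p. f (fst p) (snd p)" S "\<lambda>p. (u p, v p)"] assms
  by (auto simp: unif_holder_def intro: continuous_intros)

lemma unif_holder_continuous: "unif_holder a M f \<Longrightarrow> continuous_on S (f t)"
  using unif_holder_compose_continuous[of a M f S "\<lambda>_. t" "\<lambda>x. x"] by (simp add: continuous_intros)

text \<open>The prefactor \<open>1 / l ^ j\<close> is left out, so that scale 0 is included; for j =
  0 the integral there is the function itself, the initial value of the heat flow.\<close>

lemma heat_op_joint_continuous: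
  fixes f :: "real \<Rightarrow> real \<Rightarrow> 'v::euclidean_space"
  assumes "unif_holder a M f"
  shows "continuous_on UNIV (\<lambda>p::real \<times> real. \<integral>z. heat_ker j z *\<^sub>R f (fst p) (y + snd p * z) \<partial>lborel)"
proof (rule continuous_on_integral_dominated[where G = M])
  show "continuous_on UNIV (\<lambda>p::real \<times> real. f (fst p) (y + snd p * z))" for z
    by (intro unif_holder_compose_continuous[OF assms] continuous_intros)
  show "norm (f (fst p) (y + snd p * z)) \<le> M" for p :: "real \<times> real" and z
    using unif_holder_holder[OF assms] holderD1 by blast
  show "(\<lambda>z. f (fst p) (y + snd p * z)) \<in> borel_measurable borel" for p :: "real \<times> real"
    by (intro borel_measurable_continuous_onI unif_holder_compose_continuous[OF assms] continuous_intros)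
  show "integrable lborel (heat_ker j)" by (rule rapid_integrable(1)[OF rapid_heat_ker])
qed

lemma heat_op_compose_continuous:
  fixes f :: "real \<Rightarrow> real \<Rightarrow> 'v::euclidean_space" and u l :: "'p::topological_space \<Rightarrow> real"
  assumes "unif_holder a M f" "continuous_on S u" "continuous_on S l" "\<And>p. p \<in> S \<Longrightarrow> l p > 0"
  shows "continuous_on S (\<lambda>p. heat_op j (l p) (f (u p)) y)"
proof -
  have "continuous_on S (\<lambda>p. \<integral>z. heat_ker j z *\<^sub>R f (u p) (y + l p * z) \<partial>lborel)"
    using continuous_on_compose2[OF heat_op_joint_continuous[OF assms(1), of j y], of S "\<lambda>p. (u p, l p)"] assms
    by (auto intro: continuous_intros)
  then show ?thesis unfolding heat_op_def using assms(3,4)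
    by (intro continuous_intros) fastforce+
qed

lemma lborel_of_has_integral:
  fixes f :: "real \<Rightarrow> real"
  assumes "f \<in> borel_measurable borel" "S \<in> sets borel" "\<And>x. x \<in> S \<Longrightarrow> 0 \<le> f x" "(f has_integral I) S"
  shows "has_bochner_integral lborel (\<lambda>x. indicator S x *\<^sub>R f x) I"
proof -
  have [measurable]: "f \<in> borel_measurable borel" "S \<in> sets borel" using assms by auto
  have n: "0 \<le> indicator S x *\<^sub>R f x" for x using assms(3) by (auto simp: indicator_def)
  have "((\<lambda>x. if x \<in> S then f x else 0) has_integral I) UNIV"
    using assms(4) by (simp add: has_integral_restrict_UNIV)
  moreover have "(\<lambda>x. if x \<in> S then f x else 0) = (\<lambda>x. indicator S x *\<^sub>R f x)" by (auto simp: fun_eq_iff)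
  ultimately have "((\<lambda>x. indicator S x *\<^sub>R f x) has_integral I) UNIV" by simp
  then have "(\<integral>\<^sup>+x. ennreal (indicator S x *\<^sub>R f x) \<partial>lborel) = ennreal I"
    by (intro nn_integral_has_integral_lborel n) measurable
  moreover have "0 \<le> I" using assms has_integral_nonneg by blast
  ultimately show ?thesis
    by (intro has_bochner_integral_nn_integral AE_I2 n) auto
qed

lemma lborel_powr_integral:
  fixes e c :: real
  assumes "-1 < e" "0 \<le> c"
  shows "has_bochner_integral lborel (\<lambda>x. indicator {0<..<c} x *\<^sub>R x powr e) (c powr (e + 1) / (e + 1))"
  by (rule lborel_of_has_integral)
     (use has_integral_powr_from_0[OF assms] in \<open>auto simp: has_integral_Icc_iff_Ioo\<close>)

text \<open>Since (a - j)/2 is at least a/2 - 1 and r \<le> 1, one majorant, integrable at 0, covers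
  all j up to 2. Without the Hoelder gain the case j = 2 would behave like 1/r.\<close>

lemma norm_heat_op_time:
  fixes g :: "real \<Rightarrow> 'v::euclidean_space"
  assumes g: "holder a M g" and a: "0 < a" "a < 1" and r: "0 < r" "r \<le> 1" and j: "j \<le> 2"
  shows "norm (heat_op j (sqrt r) g y) \<le> heat_const * M * r powr (a / 2 - 1)"
proof (cases "j = 0")
  case True
  have "r powr 0 \<le> r powr (a / 2 - 1)" using r a by (intro powr_mono') auto
  then have "heat_const * M * 1 \<le> heat_const * M * r powr (a / 2 - 1)"
    using heat_const_nonneg holder_nonneg[OF g] r by (intro mult_left_mono) auto
  then show ?thesis
    using norm_heat_op_0[OF holder_continuous[OF a(1) g] holderD1[OF g], of "sqrt r" y] True by simp
next
  case False
  have "norm (heat_op j (sqrt r) g y) \<le> heat_const * M * sqrt r powr (a - j)"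
    using False j a r by (intro norm_heat_op[OF g]) auto
  also have "sqrt r powr (a - j) = r powr ((a - j) / 2)"
    using r by (simp add: powr_half_sqrt[symmetric] powr_powr)
  also have "heat_const * M * r powr ((a - j) / 2) \<le> heat_const * M * r powr (a / 2 - 1)"
    using heat_const_nonneg holder_nonneg[OF g] r j by (intro mult_left_mono powr_mono') (auto simp: field_simps)
  finally show ?thesis .
qed

context
  fixes a M :: real and f :: "real \<Rightarrow> real \<Rightarrow> 'v::euclidean_space"
  assumes a: "0 < a" "a < 1" and f: "unif_holder a M f"
begin

lemma unif_holder_nonneg: "0 \<le> M" using holder_nonneg[OF unif_holder_holder[OF f]] .

lemma unif_holder_bound: "norm (f t x) \<le> M" using holderD1[OF unif_holder_holder[OF f]] .

lemma duhamel_integrand_measurable: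
  "(\<lambda>r. indicator {0<..<t} r *\<^sub>R heat_op j (sqrt r) (f (t - r)) y) \<in> borel_measurable borel"
  by (intro borel_measurable_continuous_on_indicator heat_op_compose_continuous[OF f] continuous_intros) auto

lemma duhamel_majorant:
  assumes "0 \<le> t"
  shows "integrable lborel (\<lambda>r. (heat_const * M) * (indicator {0<..<t} r *\<^sub>R r powr (a / 2 - 1)))"
    "(\<integral>r. (heat_const * M) * (indicator {0<..<t} r *\<^sub>R r powr (a / 2 - 1)) \<partial>lborel) = heat_const * M * (t powr (a / 2) / (a / 2))"
proof -
  have "has_bochner_integral lborel (\<lambda>r. indicator {0<..<t} r *\<^sub>R r powr (a / 2 - 1)) (t powr (a / 2) / (a / 2))"
    using lborel_powr_integral[of "a / 2 - 1" t] a assms by simp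
  from has_bochner_integral_mult_right[OF this, of "heat_const * M"]
  show "integrable lborel (\<lambda>r. (heat_const * M) * (indicator {0<..<t} r *\<^sub>R r powr (a / 2 - 1)))"
    "(\<integral>r. (heat_const * M) * (indicator {0<..<t} r *\<^sub>R r powr (a / 2 - 1)) \<partial>lborel) = heat_const * M * (t powr (a / 2) / (a / 2))"
    unfolding has_bochner_integral_iff by auto
qed

lemma duhamel_integrand_bound:
  assumes "t \<le> 1" "j \<le> 2"
  shows "norm (indicator {0<..<t} r *\<^sub>R heat_op j (sqrt r) (f s) y) \<le> (heat_const * M) * (indicator {0<..<t} r *\<^sub>R r powr (a / 2 - 1))"
  using norm_heat_op_time[OF unif_holder_holder[OF f, of s] a, of r j y] assms by (auto simp: indicator_def)

lemma duhamel_integrable: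
  assumes "0 \<le> t" "t \<le> 1" "j \<le> 2"
  shows "integrable lborel (\<lambda>r. indicator {0<..<t} r *\<^sub>R heat_op j (sqrt r) (f (t - r)) y)"
proof (rule Bochner_Integration.integrable_bound[OF duhamel_majorant(1)[OF assms(1)]])
  show "(\<lambda>r. indicator {0<..<t} r *\<^sub>R heat_op j (sqrt r) (f (t - r)) y) \<in> borel_measurable lborel"
    using duhamel_integrand_measurable by simp
  show "AE r in lborel. norm (indicator {0<..<t} r *\<^sub>R heat_op j (sqrt r) (f (t - r)) y)
      \<le> norm ((heat_const * M) * (indicator {0<..<t} r *\<^sub>R r powr (a / 2 - 1)))"
  proof (rule AE_I2)
    fix r
    have "norm (indicator {0<..<t} r *\<^sub>R heat_op j (sqrt r) (f (t - r)) y) \<le> (heat_const * M) * (indicator {0<..<t} r *\<^sub>R r powr (a / 2 - 1))"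
      by (rule duhamel_integrand_bound[OF assms(2,3)])
    also have "\<dots> \<le> norm \<dots>" by simp
    finally show "norm (indicator {0<..<t} r *\<^sub>R heat_op j (sqrt r) (f (t - r)) y)
      \<le> norm ((heat_const * M) * (indicator {0<..<t} r *\<^sub>R r powr (a / 2 - 1)))" .
  qed
qed

lemma norm_duhamel:
  assumes "0 \<le> t" "t \<le> 1" "j \<le> 2"
  shows "norm (duhamel j f t y) \<le> heat_const * M * (t powr (a / 2) / (a / 2))"
proof -
  have "norm (duhamel j f t y) \<le> (\<integral>r. (heat_const * M) * (indicator {0<..<t} r *\<^sub>R r powr (a / 2 - 1)) \<partial>lborel)"
    unfolding duhamel_def
    by (rule norm_lebesgue_integral_le[OF duhamel_majorant(1)[OF assms(1)] duhamel_integrand_bound[OF assms(2,3)]])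
  then show ?thesis by (simp only: duhamel_majorant(2)[OF assms(1)])
qed

text \<open>The majorant does not depend on the space variable, so two derivatives may be taken
  under the integral.\<close>

lemma duhamel_derivative:
  assumes "0 \<le> t" "t \<le> 1" "j < 2"
  shows "(duhamel j f t has_vector_derivative duhamel (Suc j) f t y) (at y)"
  unfolding duhamel_def[abs_def]
proof (rule has_vector_derivative_integral_dominated[where a = "y - 1" and b = "y + 1"])
  show "integrable lborel (\<lambda>r. (heat_const * M) * (indicator {0<..<t} r *\<^sub>R r powr (a / 2 - 1)))"
    by (rule duhamel_majorant(1)[OF assms(1)])
  show "integrable lborel (\<lambda>r. indicator {0<..<t} r *\<^sub>R heat_op j (sqrt r) (f (t - r)) s)" for s
    using assms by (intro duhamel_integrable) auto
  show "norm (indicator {0<..<t} r *\<^sub>R heat_op (Suc j) (sqrt r) (f (t - r)) s) \<le> (heat_const * M) * (indicator {0<..<t} r *\<^sub>R r powr (a / 2 - 1))" for s r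
    using assms by (intro duhamel_integrand_bound) auto
  show "((\<lambda>s. indicator {0<..<t} r *\<^sub>R heat_op j (sqrt r) (f (t - r)) s) has_vector_derivative
     indicator {0<..<t} r *\<^sub>R heat_op (Suc j) (sqrt r) (f (t - r)) s) (at s)" for s r
  proof (cases "r \<in> {0<..<t}")
    case True
    then show ?thesis
      using heat_op_derivative[of j "sqrt r" "f (t - r)" M s] assms unif_holder_continuous[OF f] unif_holder_bound by simp
  qed simp
qed auto

text \<open>The integrand is bounded by r^(a/2-1) for r below |y - y'|^2 and by |y - y'| r^((a-3)/2) above.\<close>

lemma norm_duhamel_diff:
  assumes t: "0 \<le> t" "t \<le> 1"
  shows "norm (duhamel 2 f t y - duhamel 2 f t y') \<le> heat_const * M * (4 / a + 2 / (1 - a)) * \<bar>y - y'\<bar> powr a"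
proof -
  define d where "d = \<bar>y - y'\<bar>"
  have K: "0 \<le> heat_const * M" using heat_const_nonneg unif_holder_nonneg by simp
  have a1: "2 / (1 - a) \<ge> 0" using a by simp
  have "0 \<le> d" by (simp add: d_def)
  then consider "d = 0" | "d \<ge> 1" | "0 < d" "d < 1" by linarith
  then show ?thesis
  proof cases
    case 1
    then show ?thesis by (simp add: d_def)
  next
    case 2
    have "norm (duhamel 2 f t y - duhamel 2 f t y') \<le> norm (duhamel 2 f t y) + norm (duhamel 2 f t y')" by (rule norm_triangle_ineq4)
    also have "\<dots> \<le> 2 * (heat_const * M * (t powr (a / 2) / (a / 2)))"
      unfolding mult_2 by (intro add_mono norm_duhamel[OF t order_refl])
    also have "\<dots> \<le> 2 * (heat_const * M * (1 / (a / 2)))"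
      using K t a by (intro mult_left_mono divide_right_mono) (auto intro: powr_le1)
    also have "\<dots> = heat_const * M * (4 / a) * 1" by simp
    also have "\<dots> \<le> heat_const * M * (4 / a + 2 / (1 - a)) * d powr a"
      using K a 2 a1 by (intro mult_mono mult_left_mono) (auto intro: ge_one_powr_ge_zero)
    finally show ?thesis by (simp add: d_def)
  next
    case 3
    define e where "e = d\<^sup>2"
    have e: "0 < e" "e < 1" using 3 power_strict_mono[of d 1 2] by (auto simp: e_def)
    have ep: "e powr x = d powr (2 * x)" for x
    proof -
      have "e = d powr 2" using 3 by (simp add: e_def powr_numeral)
      then show ?thesis by (simp add: powr_powr)
    qed
    have i1: "has_bochner_integral lborel (\<lambda>r. indicator {0<..<e} r *\<^sub>R r powr (a / 2 - 1)) (d powr a / (a / 2))"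
      using lborel_powr_integral[of "a / 2 - 1" e] a e ep[of "a / 2"] by simp
    have "((\<lambda>r. r powr ((a - 3) / 2)) has_integral (1 powr ((a - 1) / 2) / ((a - 1) / 2) - e powr ((a - 1) / 2) / ((a - 1) / 2))) {e..1}"
    proof (rule fundamental_theorem_of_calculus)
      fix r assume "r \<in> {e..1}"
      then have "((\<lambda>r. r powr ((a - 1) / 2) / ((a - 1) / 2)) has_real_derivative (((a - 1) / 2) * r powr ((a - 1) / 2 - 1) / ((a - 1) / 2))) (at r within {e..1})"
        using e by (intro DERIV_cdivide has_field_derivative_at_within[OF has_real_derivative_powr]) auto
      moreover have "((a - 1) / 2) * r powr ((a - 1) / 2 - 1) / ((a - 1) / 2) = r powr ((a - 3) / 2)"
        using a by (simp add: field_simps)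
      ultimately show "((\<lambda>r. r powr ((a - 1) / 2) / ((a - 1) / 2)) has_vector_derivative r powr ((a - 3) / 2)) (at r within {e..1})"
        by (simp add: has_real_derivative_iff_has_vector_derivative)
    qed (use e in auto)
    moreover have "1 powr ((a - 1) / 2) / ((a - 1) / 2) - e powr ((a - 1) / 2) / ((a - 1) / 2) = (d powr (a - 1) - 1) * (2 / (1 - a))"
    proof -
      have "2 * ((a - 1) / 2) = a - 1" by (rule nonzero_mult_div_cancel_left[of 2 "a - 1", unfolded times_divide_eq_right[symmetric]]) simp
      then have X: "e powr ((a - 1) / 2) = d powr (a - 1)" unfolding ep by (rule arg_cong)
      have c: "1 / ((a - 1) / 2) = - (2 / (1 - a))" using a by (simp add: divide_simps)
      have "1 powr ((a - 1) / 2) / ((a - 1) / 2) - e powr ((a - 1) / 2) / ((a - 1) / 2) = (1 - d powr (a - 1)) * (1 / ((a - 1) / 2))"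
        unfolding X by (simp add: diff_divide_distrib)
      also have "\<dots> = (d powr (a - 1) - 1) * (2 / (1 - a))" unfolding c by algebra
      finally show ?thesis .
    qed
    ultimately have i2: "has_bochner_integral lborel (\<lambda>r. indicator {e..1} r *\<^sub>R r powr ((a - 3) / 2)) ((d powr (a - 1) - 1) * (2 / (1 - a)))"
      using e by (intro lborel_of_has_integral) auto
    define w where "w r = (heat_const * M) * (2 * (indicator {0<..<e} r *\<^sub>R r powr (a / 2 - 1)) + d * (indicator {e..1} r *\<^sub>R r powr ((a - 3) / 2)))" for r
    have w: "has_bochner_integral lborel w ((heat_const * M) * (2 * (d powr a / (a / 2)) + d * ((d powr (a - 1) - 1) * (2 / (1 - a)))))"
      unfolding w_def by (intro has_bochner_integral_mult_right has_bochner_integral_add i1 i2)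
    have "duhamel 2 f t y - duhamel 2 f t y' = (\<integral>r. indicator {0<..<t} r *\<^sub>R heat_op 2 (sqrt r) (f (t - r)) y - indicator {0<..<t} r *\<^sub>R heat_op 2 (sqrt r) (f (t - r)) y' \<partial>lborel)"
      unfolding duhamel_def by (rule Bochner_Integration.integral_diff[symmetric]; rule duhamel_integrable[OF t]) auto
    also have "norm \<dots> \<le> (\<integral>r. w r \<partial>lborel)"
    proof (rule norm_lebesgue_integral_le)
      show "integrable lborel w" using w by (simp add: has_bochner_integral_iff)
      fix r
      consider "r \<notin> {0<..<t}" | "r \<in> {0<..<t}" "r < e" | "r \<in> {0<..<t}" "e \<le> r" by fastforce
      then show "norm (indicator {0<..<t} r *\<^sub>R heat_op 2 (sqrt r) (f (t - r)) y - indicator {0<..<t} r *\<^sub>R heat_op 2 (sqrt r) (f (t - r)) y') \<le> w r"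
      proof cases
        case 1
        have "0 \<le> w r" unfolding w_def using \<open>0 < d\<close> by (intro mult_nonneg_nonneg[OF K] add_nonneg_nonneg mult_nonneg_nonneg) (auto simp: indicator_def)
        then show ?thesis using 1 by simp
      next
        case 2
        then have r: "0 < r" "r \<le> 1" using t by auto
        have "norm (heat_op 2 (sqrt r) (f (t - r)) y - heat_op 2 (sqrt r) (f (t - r)) y') \<le>
          norm (heat_op 2 (sqrt r) (f (t - r)) y) + norm (heat_op 2 (sqrt r) (f (t - r)) y')" by (rule norm_triangle_ineq4)
        also have "\<dots> \<le> heat_const * M * (2 * r powr (a / 2 - 1))"
          using norm_heat_op_time[OF unif_holder_holder[OF f, of "t - r"] a r, of 2 y] norm_heat_op_time[OF unif_holder_holder[OF f, of "t - r"] a r, of 2 y'] by simp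
        finally show ?thesis using 2 by (simp add: w_def)
      next
        case 3
        then have r: "0 < r" "r \<le> 1" using t by auto
        have "norm (heat_op 2 (sqrt r) (f (t - r)) y - heat_op 2 (sqrt r) (f (t - r)) y') \<le> heat_const * M * sqrt r powr (a - 3) * \<bar>y - y'\<bar>"
          using norm_heat_op_diff[OF unif_holder_holder[OF f, of "t - r"], of "sqrt r" y y'] a r by simp
        also have "sqrt r powr (a - 3) = r powr ((a - 3) / 2)"
          using r by (simp add: powr_half_sqrt[symmetric] powr_powr)
        finally show ?thesis using 3 r by (simp add: w_def d_def mult_ac)
      qed
    qed
    also have "\<dots> = (heat_const * M) * (2 * (d powr a / (a / 2)) + d * ((d powr (a - 1) - 1) * (2 / (1 - a))))"
      using w by (simp add: has_bochner_integral_iff)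
    also have "\<dots> \<le> (heat_const * M) * ((4 / a + 2 / (1 - a)) * d powr a)"
    proof (intro mult_left_mono K)
      have "d * d powr (a - 1) = d powr a" using 3 by (simp add: powr_diff)
      then have "d * ((d powr (a - 1) - 1) * (2 / (1 - a))) = d powr a * (2 / (1 - a)) - d * (2 / (1 - a))"
        by (simp only: left_diff_distrib right_diff_distrib mult.assoc[symmetric] mult_1_right)
      moreover have "0 \<le> d * (2 / (1 - a))" using 3 a by simp
      moreover have "k * P + (P * q - d * q) \<le> (k + q) * P" if "0 \<le> d * q" for P q k :: real
        using that by (simp add: algebra_simps)
      moreover have "2 * (d powr a / (a / 2)) = 4 / a * d powr a" by simp
      ultimately show "2 * (d powr a / (a / 2)) + d * ((d powr (a - 1) - 1) * (2 / (1 - a))) \<le> (4 / a + 2 / (1 - a)) * d powr a"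
        by metis
    qed
    finally show ?thesis by (simp add: d_def)
  qed
qed

text \<open>The second space derivative of the heat flow is its time derivative, so the integral
  telescopes. The derivative is used in the open interval only, because it is singular at 0, while
  the flow itself is continuous down to time 0.\<close>

lemma integral_heat_op_2:
  assumes t: "0 \<le> t" "t \<le> 1"
  shows "(\<integral>r. indicator {0<..<t} r *\<^sub>R heat_op 2 (sqrt r) (f s) y \<partial>lborel) = heat_op 0 (sqrt t) (f s) y - f s y"
proof -
  have m: "(\<lambda>r. indicator {0<..<t} r *\<^sub>R heat_op 2 (sqrt r) (f s) y) \<in> borel_measurable borel"
    by (intro borel_measurable_continuous_on_indicator heat_op_compose_continuous[OF f] continuous_intros) auto
  have i: "set_integrable lborel {0<..<t} (\<lambda>r. heat_op 2 (sqrt r) (f s) y)"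
    unfolding set_integrable_def
  proof (rule Bochner_Integration.integrable_bound[OF duhamel_majorant(1)[OF t(1)]])
    show "AE r in lborel. norm (indicator {0<..<t} r *\<^sub>R heat_op 2 (sqrt r) (f s) y)
      \<le> norm ((heat_const * M) * (indicator {0<..<t} r *\<^sub>R r powr (a / 2 - 1)))"
      using duhamel_integrand_bound[OF t(2), of 2] by (auto intro!: AE_I2 intro: order_trans[OF _ abs_ge_self])
  qed (use m in simp)
  have "((\<lambda>r. heat_op 2 (sqrt r) (f s) y) has_integral (heat_op 0 (sqrt t) (f s) y - heat_op 0 (sqrt 0) (f s) y)) {0..t}"
  proof (rule fundamental_theorem_of_calculus_interior[OF t(1)])
    have "continuous_on {0..t} (\<lambda>p. (s, sqrt p))" by (intro continuous_intros)
    then have "continuous_on {0..t} (\<lambda>p. \<integral>z. heat_ker 0 z *\<^sub>R f s (y + sqrt p * z) \<partial>lborel)"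
      using continuous_on_compose2[OF heat_op_joint_continuous[OF f, of 0 y], of "{0..t}" "\<lambda>p. (s, sqrt p)"]
      by simp
    then show "continuous_on {0..t} (\<lambda>r. heat_op 0 (sqrt r) (f s) y)" by (simp add: heat_op_def)
    show "((\<lambda>r. heat_op 0 (sqrt r) (f s) y) has_vector_derivative heat_op 2 (sqrt r) (f s) y) (at r)" if "r \<in> {0<..<t}" for r
      using that by (intro heat_op_derivative_time[OF _ unif_holder_continuous[OF f] unif_holder_bound]) auto
  qed
  then have "((\<lambda>r. heat_op 2 (sqrt r) (f s) y) has_integral (heat_op 0 (sqrt t) (f s) y - heat_op 0 (sqrt 0) (f s) y)) {0<..<t}"
    by (simp add: has_integral_Icc_iff_Ioo)
  moreover have "heat_op 0 (sqrt 0) (f s) y = f s y"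
    using rapid_integrable(1)[OF rapid_heat_ker[of 0]] integral_heat_ker_0 by (simp add: heat_op_def)
  ultimately show ?thesis
    using set_borel_integral_eq_integral(2)[OF i] by (simp add: set_lebesgue_integral_def integral_unique)
qed

text \<open>Here the source time is the integration variable, the form in which integrals over a
  triangle can be exchanged.\<close>

lemma duhamel_reflect: "duhamel j f t y = (\<integral>r. indicator {0<..<t} r *\<^sub>R heat_op j (sqrt (t - r)) (f r) y \<partial>lborel)"
proof -
  have "duhamel j f t y = (\<integral>r. indicator {0<..<t} (t + (-1) * r) *\<^sub>R heat_op j (sqrt (t + (-1) * r)) (f (t - (t + (-1) * r))) y \<partial>lborel)"
    unfolding duhamel_def
    by (subst lborel_integral_real_affine[where c = "-1" and t = t]) auto
  also have "\<dots> = (\<integral>r. indicator {0<..<t} r *\<^sub>R heat_op j (sqrt (t - r)) (f r) y \<partial>lborel)"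
    by (rule Bochner_Integration.integral_cong) (auto simp: indicator_def)
  finally show ?thesis .
qed

definition triangle :: "real \<Rightarrow> (real \<times> real) set" where
  "triangle t = {p. 0 < snd p \<and> snd p < fst p \<and> fst p < t}"

lemma unif_holder_measurable: "(\<lambda>r. f r y) \<in> borel_measurable borel"
  by (intro borel_measurable_continuous_onI unif_holder_compose_continuous[OF f] continuous_intros)

text \<open>The forcing has no time derivative, so Duhamel's integral is not differentiated in
  \<open>t\<close> directly. Instead the second derivatives are integrated over the triangle 0 < r <
  \<tau> < t in the other order, where the inner integral in \<tau> is known from
  \<open>integral_heat_op_2\<close>.\<close>

lemma duhamel_time_integral:
  assumes t: "0 \<le> t" "t \<le> 1"
  shows "integrable lborel (\<lambda>\<tau>. indicator {0<..<t} \<tau> *\<^sub>R (duhamel 2 f \<tau> y + f \<tau> y))"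
    "duhamel 0 f t y = (\<integral>\<tau>. indicator {0<..<t} \<tau> *\<^sub>R (duhamel 2 f \<tau> y + f \<tau> y) \<partial>lborel)"
proof -
  define Q where "Q p = indicator (triangle t) p *\<^sub>R heat_op 2 (sqrt (fst p - snd p)) (f (snd p)) y" for p
  have op: "open (triangle t)" unfolding triangle_def
    by (intro open_Collect_conj open_Collect_less continuous_intros)
  have Qm: "Q \<in> borel_measurable borel"
    unfolding Q_def[abs_def] using op
    by (intro borel_measurable_continuous_on_indicator heat_op_compose_continuous[OF f] continuous_intros)
       (auto simp: triangle_def)
  have Qm2: "Q \<in> borel_measurable (lborel \<Otimes>\<^sub>M lborel)" using Qm by (simp add: lborel_prod)
  have Q1: "Q (\<tau>, r) = indicator {0<..<t} \<tau> *\<^sub>R (indicator {0<..<\<tau>} r *\<^sub>R heat_op 2 (sqrt (\<tau> - r)) (f r) y)" for \<tau> r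
    by (auto simp: Q_def triangle_def indicator_def)
  have Q2: "Q (\<tau>, r) = indicator {0<..<t} r *\<^sub>R (indicator {0<..<t - r} (\<tau> - r) *\<^sub>R heat_op 2 (sqrt (\<tau> - r)) (f r) y)" for \<tau> r
    by (auto simp: Q_def triangle_def indicator_def)
  have inner: "(\<integral>r. Q (\<tau>, r) \<partial>lborel) = indicator {0<..<t} \<tau> *\<^sub>R duhamel 2 f \<tau> y" for \<tau>
    unfolding Q1 duhamel_reflect by (rule Bochner_Integration.integral_scaleR_right)
  have rfl: "indicator {0<..<\<tau>} (\<tau> + (-1) * r) *\<^sub>R heat_op 2 (sqrt (\<tau> - (\<tau> + (-1) * r))) (f (\<tau> + (-1) * r)) y
     = indicator {0<..<\<tau>} r *\<^sub>R heat_op 2 (sqrt r) (f (\<tau> - r)) y" for \<tau> r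
    by (auto simp: indicator_def)
  have int1: "integrable lborel (\<lambda>r. Q (\<tau>, r))" for \<tau>
  proof (cases "\<tau> \<in> {0<..<t}")
    case True
    then have "integrable lborel (\<lambda>r. indicator {0<..<\<tau>} (\<tau> + (-1) * r) *\<^sub>R heat_op 2 (sqrt (\<tau> - (\<tau> + (-1) * r))) (f (\<tau> + (-1) * r)) y)"
      unfolding rfl using t by (intro duhamel_integrable) auto
    then have "integrable lborel (\<lambda>r. indicator {0<..<\<tau>} r *\<^sub>R heat_op 2 (sqrt (\<tau> - r)) (f r) y)"
      by (subst (asm) lborel_integrable_real_affine_iff) auto
    then show ?thesis unfolding Q1 by (rule integrable_scaleR_right)
  qed (simp add: Q1)
  \<comment> \<open>The hypothesis of Fubini: the inner norm integrals are bounded uniformly in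
    \<tau> by the integral of the majorant.\<close>
  have normint: "(\<integral>r. norm (Q (\<tau>, r)) \<partial>lborel) \<le> indicator {0<..<t} \<tau> * (heat_const * M * (t powr (a / 2) / (a / 2)))" for \<tau>
  proof (cases "\<tau> \<in> {0<..<t}")
    case True
    have "(\<integral>r. norm (Q (\<tau>, r)) \<partial>lborel) = (\<integral>r. norm (indicator {0<..<\<tau>} r *\<^sub>R heat_op 2 (sqrt (\<tau> - r)) (f r) y) \<partial>lborel)"
      unfolding Q1 using True by simp
    also have "\<dots> = (\<integral>r. norm (indicator {0<..<\<tau>} r *\<^sub>R heat_op 2 (sqrt r) (f (\<tau> - r)) y) \<partial>lborel)"
      by (subst lborel_integral_real_affine[where c = "-1" and t = \<tau>]) (simp_all only: rfl, simp_all)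
    also have "\<dots> \<le> (\<integral>r. (heat_const * M) * (indicator {0<..<\<tau>} r *\<^sub>R r powr (a / 2 - 1)) \<partial>lborel)"
      using True t by (intro integral_mono integrable_norm duhamel_integrable duhamel_majorant(1) duhamel_integrand_bound) auto
    also have "\<dots> = heat_const * M * (\<tau> powr (a / 2) / (a / 2))" using True by (intro duhamel_majorant(2)) auto
    also have "\<dots> \<le> heat_const * M * (t powr (a / 2) / (a / 2))"
      using True a heat_const_nonneg unif_holder_nonneg by (intro mult_left_mono divide_right_mono powr_mono2) auto
    finally show ?thesis using True by simp
  qed (simp add: Q1)
  have Qi: "integrable (lborel \<Otimes>\<^sub>M lborel) Q"
  proof (rule lborel_pair.Fubini_integrable[OF Qm2])
    have i: "integrable lborel (\<lambda>\<tau>. indicator {0<..<t} \<tau> * (heat_const * M * (t powr (a / 2) / (a / 2))))"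
      using t by (intro integrable_mult_left integrable_real_indicator) auto
    show "integrable lborel (\<lambda>\<tau>. \<integral>r. norm (Q (\<tau>, r)) \<partial>lborel)"
    proof (rule Bochner_Integration.integrable_bound[OF i])
      show "(\<lambda>\<tau>. \<integral>r. norm (Q (\<tau>, r)) \<partial>lborel) \<in> borel_measurable lborel"
        using Qm2 by measurable
      show "AE \<tau> in lborel. norm (\<integral>r. norm (Q (\<tau>, r)) \<partial>lborel) \<le> norm (indicator {0<..<t} \<tau> * (heat_const * M * (t powr (a / 2) / (a / 2))))"
      proof (rule AE_I2)
        fix \<tau>
        have "norm (\<integral>r. norm (Q (\<tau>, r)) \<partial>lborel) = (\<integral>r. norm (Q (\<tau>, r)) \<partial>lborel)" by simp
        also note normint
        also have "indicator {0<..<t} \<tau> * (heat_const * M * (t powr (a / 2) / (a / 2))) \<le> norm (indicator {0<..<t} \<tau> * (heat_const * M * (t powr (a / 2) / (a / 2))))"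
          unfolding real_norm_def by (rule abs_ge_self)
        finally show "norm (\<integral>r. norm (Q (\<tau>, r)) \<partial>lborel) \<le> norm (indicator {0<..<t} \<tau> * (heat_const * M * (t powr (a / 2) / (a / 2))))" .
      qed
    qed
    show "AE \<tau> in lborel. integrable lborel (\<lambda>r. Q (\<tau>, r))" using int1 by simp
  qed
  have Qi': "integrable (lborel \<Otimes>\<^sub>M lborel) (case_prod (\<lambda>\<tau> r. Q (\<tau>, r)))" using Qi by simp
  have iV: "integrable lborel (\<lambda>\<tau>. indicator {0<..<t} \<tau> *\<^sub>R duhamel 2 f \<tau> y)"
    using lborel_pair.integrable_fst[OF Qi'] by (simp only: inner)
  have bnd: "integrable lborel (\<lambda>\<tau>. indicator {0<..<t} \<tau> *\<^sub>R u \<tau>)" if "u \<in> borel_measurable borel" "\<And>\<tau>. norm (u \<tau>) \<le> B" for u :: "real \<Rightarrow> 'v" and B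
  proof (rule Bochner_Integration.integrable_bound[where f = "\<lambda>\<tau>. indicator {0<..<t} \<tau> * B"])
    show "integrable lborel (\<lambda>\<tau>. indicator {0<..<t} \<tau> * B)" using t by (intro integrable_mult_left integrable_real_indicator) auto
    show "(\<lambda>\<tau>. indicator {0<..<t} \<tau> *\<^sub>R u \<tau>) \<in> borel_measurable lborel" using that(1) by measurable
    show "AE \<tau> in lborel. norm (indicator {0<..<t} \<tau> *\<^sub>R u \<tau>) \<le> norm (indicator {0<..<t} \<tau> * B)"
      using that(2) by (intro AE_I2) (auto simp: indicator_def intro: order_trans[OF _ abs_ge_self])
  qed
  have iF: "integrable lborel (\<lambda>\<tau>. indicator {0<..<t} \<tau> *\<^sub>R f \<tau> y)"
    by (rule bnd[OF unif_holder_measurable unif_holder_bound])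
  show "integrable lborel (\<lambda>\<tau>. indicator {0<..<t} \<tau> *\<^sub>R (duhamel 2 f \<tau> y + f \<tau> y))"
    unfolding scaleR_add_right using iV iF by (rule Bochner_Integration.integrable_add)
  have swap: "(\<integral>\<tau>. (\<integral>r. Q (\<tau>, r) \<partial>lborel) \<partial>lborel) = (\<integral>r. (\<integral>\<tau>. Q (\<tau>, r) \<partial>lborel) \<partial>lborel)"
    using lborel_pair.Fubini_integral[OF Qi'] by simp
  have inner2: "(\<integral>\<tau>. Q (\<tau>, r) \<partial>lborel) = indicator {0<..<t} r *\<^sub>R (heat_op 0 (sqrt (t - r)) (f r) y - f r y)" for r
  proof (cases "r \<in> {0<..<t}")
    case True
    have "(\<integral>\<tau>. Q (\<tau>, r) \<partial>lborel) = (\<integral>\<tau>. indicator {0<..<t - r} (\<tau> - r) *\<^sub>R heat_op 2 (sqrt (\<tau> - r)) (f r) y \<partial>lborel)"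
      unfolding Q2 using True by simp
    also have "\<dots> = (\<integral>\<tau>. indicator {0<..<t - r} \<tau> *\<^sub>R heat_op 2 (sqrt \<tau>) (f r) y \<partial>lborel)"
      by (subst lborel_integral_real_affine[where c = 1 and t = r]) auto
    also have "\<dots> = heat_op 0 (sqrt (t - r)) (f r) y - f r y"
      using True t by (intro integral_heat_op_2) auto
    finally show ?thesis using True by simp
  qed (simp add: Q2)
  have i0: "integrable lborel (\<lambda>r. indicator {0<..<t} r *\<^sub>R heat_op 0 (sqrt (t - r)) (f r) y)"
  proof -
    have "integrable lborel (\<lambda>r. indicator {0<..<t} (t + (-1) * r) *\<^sub>R heat_op 0 (sqrt (t - (t + (-1) * r))) (f (t + (-1) * r)) y)"
    proof (rule iffD1[OF Bochner_Integration.integrable_cong[OF refl] duhamel_integrable[OF t, of 0 y]])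
      show "indicator {0<..<t} r *\<^sub>R heat_op 0 (sqrt r) (f (t - r)) y =
        indicator {0<..<t} (t + (-1) * r) *\<^sub>R heat_op 0 (sqrt (t - (t + (-1) * r))) (f (t + (-1) * r)) y" for r
        by (auto simp: indicator_def)
    qed auto
    then show ?thesis by (subst (asm) lborel_integrable_real_affine_iff) auto
  qed
  have "(\<integral>\<tau>. indicator {0<..<t} \<tau> *\<^sub>R duhamel 2 f \<tau> y \<partial>lborel) = (\<integral>r. indicator {0<..<t} r *\<^sub>R (heat_op 0 (sqrt (t - r)) (f r) y - f r y) \<partial>lborel)"
    using swap unfolding inner inner2 .
  also have "\<dots> = duhamel 0 f t y - (\<integral>r. indicator {0<..<t} r *\<^sub>R f r y \<partial>lborel)"
    unfolding scaleR_diff_right duhamel_reflect using i0 iF by (rule Bochner_Integration.integral_diff)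
  finally show "duhamel 0 f t y = (\<integral>\<tau>. indicator {0<..<t} \<tau> *\<^sub>R (duhamel 2 f \<tau> y + f \<tau> y) \<partial>lborel)"
    unfolding scaleR_add_right using Bochner_Integration.integral_add[OF iV iF] by simp
qed

end

lemma duhamel_diff:
  assumes a: "0 < a" "a < 1" and f: "unif_holder a M f" "unif_holder a M f'" and t: "0 \<le> t" "t \<le> 1" "j \<le> 2"
  shows "duhamel j (\<lambda>t x. f t x - f' t x) t y = duhamel j f t y - duhamel j f' t y"
proof -
  have h: "heat_op j l (\<lambda>x. f s x - f' s x) y = heat_op j l (f s) y - heat_op j l (f' s) y" for l s
  proof -
    have i: "integrable lborel (\<lambda>z. heat_ker j z *\<^sub>R f s (y + l * z))" "integrable lborel (\<lambda>z. heat_ker j z *\<^sub>R f' s (y + l * z))"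
      by (rule rapid_conv_integrable[OF rapid_heat_ker unif_holder_continuous unif_holder_bound[OF a]]; rule f)+
    show ?thesis
      by (simp only: heat_op_def Bochner_Integration.integral_diff[OF i] scaleR_diff_right)
  qed
  show ?thesis
    unfolding duhamel_def h scaleR_diff_right
    by (intro Bochner_Integration.integral_diff duhamel_integrable[OF a f(1) t] duhamel_integrable[OF a f(2) t])
qed

lemma duhamel_shift:
  assumes "\<And>t y. f t (y + L) = f t y"
  shows "duhamel j f t (y + L) = duhamel j f t y"
proof -
  have "f s (y + L + l * z) = f s (y + l * z)" for s l z
    using assms[of s "y + l * z"] by (simp add: add_ac)
  then have "heat_op j l (f s) (y + L) = heat_op j l (f s) y" for l s by (simp add: heat_op_def)
  then show ?thesis by (simp add: duhamel_def)
qed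

lemma duhamel_zero_time: "duhamel j f 0 y = 0"
  by (simp add: duhamel_def)

section \<open>Time regularity by interpolation\<close>

lemma norm_diff_le_segment:
  fixes f :: "real \<Rightarrow> 'v::real_normed_vector"
  assumes d: "\<And>x. (f has_vector_derivative f' x) (at x)" and b: "\<And>x. \<bar>x\<bar> \<le> e \<Longrightarrow> norm (f' x) \<le> B" and u: "\<bar>u\<bar> \<le> e"
  shows "norm (f u - f 0) \<le> B * \<bar>u\<bar>"
proof -
  have "norm (f u - f 0) \<le> B * norm (u - 0)"
  proof (rule differentiable_bound[where S = "{-e..e}" and f' = "\<lambda>x h. h *\<^sub>R f' x"])
    show "(f has_derivative (\<lambda>h. h *\<^sub>R f' x)) (at x within {-e..e})" for x
      using d[of x] by (auto simp: has_vector_derivative_def intro: has_derivative_at_withinI)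
    show "onorm (\<lambda>h. h *\<^sub>R f' x) \<le> B" if "x \<in> {-e..e}" for x
    proof (rule onorm_bound)
      have *: "norm (f' x) \<le> B" using that by (intro b) auto
      then show "0 \<le> B" using norm_ge_zero order_trans by blast
      show "norm (h *\<^sub>R f' x) \<le> B * norm h" for h
        using mult_right_mono[OF *, of "norm h"] by (simp add: mult.commute)
    qed
  qed (use u in auto)
  then show ?thesis by simp
qed

text \<open>The symmetric second difference at step \<open>e\<close> consists of two increments of
  \<open>h\<close> and equals e^2 times the second derivative up to Taylor remainders, which the
  modulus of \<open>h2\<close> bounds. The step \<open>e\<close> is left free to be
  optimised.\<close>

lemma interpolation_second_derivative:
  fixes h :: "real \<Rightarrow> 'v::real_normed_vector"
  assumes d1: "\<And>x. (h has_vector_derivative h1 x) (at x)" and d2: "\<And>x. (h1 has_vector_derivative h2 x) (at x)"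
    and b: "\<And>x y. norm (h x - h y) \<le> E * \<bar>x - y\<bar> powr a" "\<And>x y. norm (h2 x - h2 y) \<le> K * \<bar>x - y\<bar> powr a"
    and e: "0 < e" and K: "0 \<le> K" and a: "0 < a"
  shows "norm (h2 x) \<le> 2 * K * e powr a + 2 * E * e powr (a - 2)"
proof -
  have sh: "((\<lambda>u. g (x + u)) has_vector_derivative g' (x + u)) (at u)"
    if "\<And>x. (g has_vector_derivative g' x) (at x)" for g g' :: "real \<Rightarrow> 'v" and u
  proof -
    have "((\<lambda>u. x + u) has_vector_derivative 1) (at u)" by (auto intro!: derivative_eq_intros)
    from vector_diff_chain_at[OF this that] show ?thesis by (simp add: comp_def)
  qed
  define r where "r u = h1 (x + u) - h1 x - u *\<^sub>R h2 x" for u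
  define R where "R u = h (x + u) - h x - u *\<^sub>R h1 x - (u\<^sup>2 / 2) *\<^sub>R h2 x" for u
  have dr: "(r has_vector_derivative (h2 (x + u) - h2 x)) (at u)" for u
    unfolding r_def by (auto intro!: derivative_eq_intros sh[OF d2])
  have dR: "(R has_vector_derivative r u) (at u)" for u
  proof -
    have "((\<lambda>u. (u\<^sup>2 / 2) *\<^sub>R h2 x) has_vector_derivative u *\<^sub>R h2 x) (at u)"
    proof -
      have "((\<lambda>u. u\<^sup>2 / 2) has_real_derivative u) (at u)" by (auto intro!: derivative_eq_intros)
      from has_vector_derivative_scaleR[OF this has_vector_derivative_const[of "h2 x"]] show ?thesis by simp
    qed
    then show ?thesis unfolding R_def r_def
      by (auto intro!: derivative_eq_intros sh[OF d1])
  qed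
  have br: "norm (r u) \<le> K * e powr a * e" if "\<bar>u\<bar> \<le> e" for u
  proof -
    have "norm (r u - r 0) \<le> (K * e powr a) * \<bar>u\<bar>"
    proof (rule norm_diff_le_segment[OF dr _ that])
      fix u :: real assume "\<bar>u\<bar> \<le> e"
      then have "K * \<bar>x + u - x\<bar> powr a \<le> K * e powr a" using K a by (intro mult_left_mono powr_mono2) auto
      then show "norm (h2 (x + u) - h2 x) \<le> K * e powr a" using b(2)[of "x + u" x] by linarith
    qed
    also have "\<dots> \<le> (K * e powr a) * e" using that K by (intro mult_left_mono) auto
    finally show ?thesis by (simp add: r_def)
  qed
  have bR: "norm (R u) \<le> K * e powr a * e * e" if "\<bar>u\<bar> = e" for u
  proof -
    have "norm (R u - R 0) \<le> (K * e powr a * e) * \<bar>u\<bar>"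
      using that by (intro norm_diff_le_segment[OF dR br]) auto
    then show ?thesis using that by (simp add: R_def)
  qed
  \<comment> \<open>Adding the remainders at e and -e cancels the first derivative.\<close>
  have "e\<^sup>2 *\<^sub>R h2 x = (h (x + e) - h x) - (h x - h (x + - e)) - (R e + R (- e))"
  proof -
    have "(e\<^sup>2 / 2) *\<^sub>R h2 x + (e\<^sup>2 / 2) *\<^sub>R h2 x = e\<^sup>2 *\<^sub>R h2 x" by (simp flip: scaleR_left_distrib)
    then show ?thesis unfolding R_def by (simp add: algebra_simps)
  qed
  then have "e\<^sup>2 * norm (h2 x) = norm ((h (x + e) - h x) - (h x - h (x + - e)) - (R e + R (- e)))"
    by (metis norm_scaleR abs_power2)
  also have "\<dots> \<le> (norm (h (x + e) - h x) + norm (h x - h (x + - e))) + (norm (R e) + norm (R (- e)))"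
    by (intro order_trans[OF norm_triangle_ineq4] add_mono norm_triangle_ineq4 norm_triangle_ineq)
  also have "\<dots> \<le> (E * e powr a + E * e powr a) + (K * e powr a * e * e + K * e powr a * e * e)"
    using b(1)[of "x + e" x] b(1)[of x "x + - e"] e by (intro add_mono bR) auto
  also have "\<dots> = e\<^sup>2 * (2 * K * e powr a + 2 * E * e powr (a - 2))"
    using e by (simp add: powr_diff powr_numeral power2_eq_square field_simps)
  finally show ?thesis using e by simp
qed

text \<open>A one-sided Taylor expansion at step \<open>e\<close> balances the size of
  \<open>h\<close> against that of its second derivative.\<close>

lemma interpolation_first_derivative:
  fixes h :: "real \<Rightarrow> 'v::real_normed_vector"
  assumes d1: "\<And>x. (h has_vector_derivative h1 x) (at x)" and d2: "\<And>x. (h1 has_vector_derivative h2 x) (at x)"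
    and b: "\<And>x. norm (h x) \<le> E" "\<And>x. norm (h2 x) \<le> K" and e: "0 < e"
  shows "norm (h1 x) \<le> 2 * E / e + K * e"
proof -
  have sh: "((\<lambda>u. h (x + u)) has_vector_derivative h1 (x + u)) (at u)" for u
  proof -
    have "((\<lambda>u. x + u) has_vector_derivative 1) (at u)" by (auto intro!: derivative_eq_intros)
    from vector_diff_chain_at[OF this d1] show ?thesis by (simp add: comp_def)
  qed
  define R where "R u = h (x + u) - h x - u *\<^sub>R h1 x" for u
  have dR: "(R has_vector_derivative (h1 (x + u) - h1 x)) (at u)" for u
    unfolding R_def by (auto intro!: derivative_eq_intros sh)
  have K: "0 \<le> K" using b(2)[of x] norm_ge_zero order_trans by blast
  have "norm (R e - R 0) \<le> (K * e) * \<bar>e\<bar>"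
  proof (rule norm_diff_le_segment[OF dR])
    fix u :: real assume u: "\<bar>u\<bar> \<le> e"
    have "norm (h1 (x + u) - h1 x) \<le> K * \<bar>x + u - x\<bar>"
      using lipschitz_vector_derivative[OF d2 b(2)] .
    also have "\<dots> \<le> K * e" using u K by (intro mult_left_mono) auto
    finally show "norm (h1 (x + u) - h1 x) \<le> K * e" .
  qed (use e in auto)
  then have 1: "norm (R e) \<le> K * e * e" using e by (simp add: R_def)
  have "e * norm (h1 x) = norm (h (x + e) - h x - R e)" using e by (simp add: R_def)
  also have "\<dots> \<le> (norm (h (x + e)) + norm (h x)) + norm (R e)"
    by (intro order_trans[OF norm_triangle_ineq4] add_mono norm_triangle_ineq4) simp
  also have "\<dots> \<le> (E + E) + K * e * e" using 1 b(1) by (intro add_mono) auto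
  also have "\<dots> = e * (2 * E / e + K * e)" using e by (simp add: field_simps)
  finally show ?thesis using e by simp
qed

lemma continuous_on_of_holder:
  fixes u :: "real \<Rightarrow> 'w::real_normed_vector"
  assumes "\<And>t t'. t \<in> S \<Longrightarrow> t' \<in> S \<Longrightarrow> norm (u t - u t') \<le> K * \<bar>t - t'\<bar> powr b" "0 < b"
  shows "continuous_on S u"
  unfolding continuous_on_def
proof
  fix x assume x: "x \<in> S"
  have "((\<lambda>y. K * \<bar>y - x\<bar> powr b) \<longlongrightarrow> K * \<bar>x - x\<bar> powr b) (at x within S)"
    using assms(2) by (intro tendsto_intros) auto
  then have "((\<lambda>y. K * \<bar>y - x\<bar> powr b) \<longlongrightarrow> 0) (at x within S)" using assms(2) by simp
  then have "((\<lambda>y. u y - u x) \<longlongrightarrow> 0) (at x within S)"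
    by (rule Lim_null_comparison[rotated]) (use assms(1) x in \<open>auto simp: eventually_at_filter\<close>)
  then show "(u \<longlongrightarrow> u x) (at x within S)" by (simp add: LIM_zero_cancel)
qed

text \<open>The parenthesis is the constant of the spatial Hoelder bound; the added 1 leaves room
  for the forcing itself in the rate \<open>duhamel 2 f + f\<close>.\<close>

definition duhamel_const :: "real \<Rightarrow> real" where
  "duhamel_const a = heat_const * (4 / a + 2 / (1 - a)) + 1"

lemma duhamel_const_ge_1: "0 < a \<Longrightarrow> a < 1 \<Longrightarrow> 1 \<le> duhamel_const a"
  using heat_const_nonneg by (simp add: duhamel_const_def)

context
  fixes a M :: real and f :: "real \<Rightarrow> real \<Rightarrow> 'v::euclidean_space"
  assumes a: "0 < a" "a < 1" and f: "unif_holder a M f"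
begin

lemma M_nonneg: "0 \<le> M" using unif_holder_nonneg[OF a f] .

lemma duhamel_bound_plus:
  assumes "0 \<le> t" "t \<le> 1" "j \<le> 2"
  shows "norm (duhamel j f t y) + M * t powr (a / 2) \<le> duhamel_const a * M * t powr (a / 2)"
proof -
  have "heat_const * M * (t powr (a / 2) / (a / 2)) = (heat_const * (2 / a)) * (M * t powr (a / 2))" by simp
  also have "\<dots> \<le> (heat_const * (4 / a + 2 / (1 - a))) * (M * t powr (a / 2))"
  proof (intro mult_right_mono mult_left_mono heat_const_nonneg)
    have "2 / a \<le> 4 / a" using a by (simp add: divide_right_mono)
    moreover have "0 \<le> 2 / (1 - a)" using a by simp
    ultimately show "2 / a \<le> 4 / a + 2 / (1 - a)" by linarith
  qed (use M_nonneg in auto)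
  finally show ?thesis
    using norm_duhamel[OF a f assms, of y] by (simp add: duhamel_const_def distrib_right mult.assoc)
qed

lemma duhamel_bound:
  assumes "0 \<le> t" "t \<le> 1" "j \<le> 2"
  shows "norm (duhamel j f t y) \<le> duhamel_const a * M * t powr (a / 2)"
proof -
  have "0 \<le> M * t powr (a / 2)" using M_nonneg by simp
  then show ?thesis using duhamel_bound_plus[OF assms, of y] by linarith
qed

lemma duhamel_holder_plus:
  assumes "0 \<le> t" "t \<le> 1"
  shows "norm (duhamel 2 f t y - duhamel 2 f t y') + M * \<bar>y - y'\<bar> powr a \<le> duhamel_const a * M * \<bar>y - y'\<bar> powr a"
  using norm_duhamel_diff[OF a f assms, of y y'] by (simp add: duhamel_const_def algebra_simps)

lemma duhamel_holder:
  assumes "0 \<le> t" "t \<le> 1"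
  shows "norm (duhamel 2 f t y - duhamel 2 f t y') \<le> duhamel_const a * M * \<bar>y - y'\<bar> powr a"
proof -
  have "0 \<le> M * \<bar>y - y'\<bar> powr a" using M_nonneg by simp
  then show ?thesis using duhamel_holder_plus[OF assms, of y y'] by linarith
qed

lemma indicator_time_bound:
  fixes q :: "real \<Rightarrow> 'v"
  assumes t: "0 \<le> t'" "t' \<le> t" and q: "\<And>\<tau>. 0 < \<tau> \<Longrightarrow> \<tau> < t \<Longrightarrow> norm (q \<tau>) \<le> B" and B: "0 \<le> B"
  shows "norm (\<integral>\<tau>. indicator {0<..<t} \<tau> *\<^sub>R q \<tau> - indicator {0<..<t'} \<tau> *\<^sub>R q \<tau> \<partial>lborel) \<le> B * (t - t')"
proof -
  have "norm (\<integral>\<tau>. indicator {0<..<t} \<tau> *\<^sub>R q \<tau> - indicator {0<..<t'} \<tau> *\<^sub>R q \<tau> \<partial>lborel) \<le> (\<integral>\<tau>. B * indicator {t'..t} \<tau> \<partial>lborel)"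
  proof (rule norm_lebesgue_integral_le)
    show "integrable lborel (\<lambda>\<tau>. B * indicator {t'..t} \<tau>)"
      using t by (intro integrable_mult_right integrable_real_indicator) auto
    show "norm (indicator {0<..<t} \<tau> *\<^sub>R q \<tau> - indicator {0<..<t'} \<tau> *\<^sub>R q \<tau>) \<le> B * indicator {t'..t} \<tau>" for \<tau>
      using t q[of \<tau>] B by (auto simp: indicator_def)
  qed
  also have "\<dots> = B * (t - t')" using t by simp
  finally show ?thesis .
qed

text \<open>Thanks to the room kept in \<open>duhamel_const\<close>, the rate is bounded in C^a
  uniformly in time; integrating it over the elapsed time gives both estimates.\<close>

lemma duhamel_time_difference:
  assumes t: "0 \<le> t'" "t' \<le> t" "t \<le> 1"
  shows "norm (duhamel 0 f t y - duhamel 0 f t' y) \<le> duhamel_const a * M * (t - t')"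
    and "norm ((duhamel 0 f t y - duhamel 0 f t' y) - (duhamel 0 f t y' - duhamel 0 f t' y')) \<le> duhamel_const a * M * (t - t') * \<bar>y - y'\<bar> powr a"
proof -
  define q where "q y \<tau> = duhamel 2 f \<tau> y + f \<tau> y" for y \<tau>
  have t1: "0 \<le> t" "t' \<le> 1" using t by auto
  note i = duhamel_time_integral(1)[OF a f t1(1) t(3), folded q_def] duhamel_time_integral(1)[OF a f t(1) t1(2), folded q_def]
  have d: "duhamel 0 f t y - duhamel 0 f t' y = (\<integral>\<tau>. indicator {0<..<t} \<tau> *\<^sub>R q y \<tau> - indicator {0<..<t'} \<tau> *\<^sub>R q y \<tau> \<partial>lborel)" for y
    unfolding duhamel_time_integral(2)[OF a f t1(1) t(3), folded q_def] duhamel_time_integral(2)[OF a f t(1) t1(2), folded q_def]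
    by (rule Bochner_Integration.integral_diff[symmetric]; rule i)
  have D0: "0 \<le> duhamel_const a * M" using duhamel_const_ge_1[OF a] M_nonneg by simp
  have "norm (q y \<tau>) \<le> duhamel_const a * M" if "0 < \<tau>" "\<tau> < t" for \<tau>
  proof -
    have \<tau>: "0 \<le> \<tau>" "\<tau> \<le> 1" "\<tau> powr (a / 2) \<le> 1" using that t a by (auto intro: powr_le1)
    have "norm (q y \<tau>) \<le> norm (duhamel 2 f \<tau> y) + M" unfolding q_def
      by (rule order_trans[OF norm_triangle_ineq]) (simp add: unif_holder_bound[OF a f])
    also have "\<dots> \<le> duhamel_const a * M"
    proof -
      have "norm (duhamel 2 f \<tau> y) \<le> (duhamel_const a * M - M) * \<tau> powr (a / 2)"
        using duhamel_bound_plus[OF \<tau>(1,2), of 2 y] by (simp add: algebra_simps)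
      also have "\<dots> \<le> (duhamel_const a * M - M) * 1"
        using \<tau>(3) mult_right_mono[OF duhamel_const_ge_1[OF a] M_nonneg] by (intro mult_left_mono) auto
      finally show ?thesis by simp
    qed
    finally show ?thesis .
  qed
  from indicator_time_bound[OF t(1,2) this D0] show "norm (duhamel 0 f t y - duhamel 0 f t' y) \<le> duhamel_const a * M * (t - t')"
    unfolding d .
  have "(duhamel 0 f t y - duhamel 0 f t' y) - (duhamel 0 f t y' - duhamel 0 f t' y') =
     (\<integral>\<tau>. indicator {0<..<t} \<tau> *\<^sub>R (q y \<tau> - q y' \<tau>) - indicator {0<..<t'} \<tau> *\<^sub>R (q y \<tau> - q y' \<tau>) \<partial>lborel)"
    unfolding d by (subst Bochner_Integration.integral_diff[symmetric])
      (auto intro!: Bochner_Integration.integrable_diff i Bochner_Integration.integral_cong simp: algebra_simps)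
  also have "norm \<dots> \<le> (duhamel_const a * M * \<bar>y - y'\<bar> powr a) * (t - t')"
  proof (rule indicator_time_bound[OF t(1,2)])
    fix \<tau> assume "0 < \<tau>" "\<tau> < t"
    then have \<tau>: "0 \<le> \<tau>" "\<tau> \<le> 1" using t by auto
    have "norm (q y \<tau> - q y' \<tau>) \<le> norm (duhamel 2 f \<tau> y - duhamel 2 f \<tau> y') + norm (f \<tau> y - f \<tau> y')"
      unfolding q_def by (rule norm_diff_triangle_ineq)
    also have "\<dots> \<le> duhamel_const a * M * \<bar>y - y'\<bar> powr a"
      using duhamel_holder_plus[OF \<tau>, of y y'] holderD2[OF unif_holder_holder[OF f], of \<tau> y y'] by linarith
    finally show "norm (q y \<tau> - q y' \<tau>) \<le> duhamel_const a * M * \<bar>y - y'\<bar> powr a" .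
  qed (use D0 in simp)
  finally show "norm ((duhamel 0 f t y - duhamel 0 f t' y) - (duhamel 0 f t y' - duhamel 0 f t' y')) \<le> duhamel_const a * M * (t - t') * \<bar>y - y'\<bar> powr a"
    by (simp add: mult_ac)
qed

text \<open>The increment is of order t - t' in C^a and bounded in C^(2+a); interpolate at the scale sqrt (t - t').\<close>

lemma duhamel_time_holder_ordered:
  assumes t: "0 \<le> t'" "t' < t" "t \<le> 1"
  shows "norm (duhamel 1 f t y - duhamel 1 f t' y) \<le> 6 * duhamel_const a * M * (t - t') powr (a / 2)"
    and "norm (duhamel 2 f t y - duhamel 2 f t' y) \<le> 6 * duhamel_const a * M * (t - t') powr (a / 2)"
proof -
  have t1: "0 \<le> t" "t' \<le> t" "t' \<le> 1" using t by auto
  define e where "e = (t - t') powr (1 / 2)"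
  have e: "0 < e" using t by (simp add: e_def)
  have e1: "e \<le> 1" unfolding e_def using t by (intro powr_le1) auto
  have ee: "e powr x = (t - t') powr (x / 2)" for x by (simp add: e_def powr_powr)
  have e2: "e powr (a - 2) * (t - t') = (t - t') powr (a / 2)"
  proof -
    have "e powr (a - 2) = (t - t') powr (a / 2 - 1)" unfolding ee by (simp add: diff_divide_distrib)
    then show ?thesis using t by (simp add: powr_diff)
  qed
  have e3: "(t - t') / e = e" using t unfolding e_def
    by (simp add: powr_half_sqrt real_div_sqrt)
  define h where "h j y = duhamel j f t y - duhamel j f t' y" for j y
  have dh: "(h j has_vector_derivative h (Suc j) y) (at y)" if "j < 2" for j y
    unfolding h_def[abs_def] using that t t1 by (intro has_vector_derivative_diff duhamel_derivative[OF a f]) auto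
  have dh': "(h 0 has_vector_derivative h 1 y) (at y)" "(h 1 has_vector_derivative h 2 y) (at y)" for y
    using dh[of 0] dh[of 1] by (auto simp: numeral_2_eq_2)
  have D: "0 \<le> duhamel_const a * M" using duhamel_const_ge_1[OF a] M_nonneg by simp
  have h2: "norm (h 2 x - h 2 y) \<le> (2 * duhamel_const a * M) * \<bar>x - y\<bar> powr a" for x y
  proof -
    have "norm (h 2 x - h 2 y) = norm ((duhamel 2 f t x - duhamel 2 f t y) - (duhamel 2 f t' x - duhamel 2 f t' y))"
      by (simp add: h_def algebra_simps)
    also have "\<dots> \<le> duhamel_const a * M * \<bar>x - y\<bar> powr a + duhamel_const a * M * \<bar>x - y\<bar> powr a"
      using t t1 by (intro order_trans[OF norm_triangle_ineq4] add_mono duhamel_holder) auto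
    finally show ?thesis by (simp add: mult_ac)
  qed
  have h0: "norm (h 0 x - h 0 y) \<le> (duhamel_const a * M * (t - t')) * \<bar>x - y\<bar> powr a" for x y
    unfolding h_def using duhamel_time_difference(2)[OF t(1) t1(2) t(3)] .
  have "norm (h 2 y) \<le> 2 * (2 * duhamel_const a * M) * e powr a + 2 * (duhamel_const a * M * (t - t')) * e powr (a - 2)"
    by (intro interpolation_second_derivative[OF dh' h0 h2 e]) (use a D in \<open>auto simp: mult.assoc\<close>)
  also have "\<dots> = 4 * duhamel_const a * M * (t - t') powr (a / 2) + 2 * duhamel_const a * M * (e powr (a - 2) * (t - t'))"
    unfolding ee[of a] by (simp add: algebra_simps)
  also have "\<dots> = 6 * duhamel_const a * M * (t - t') powr (a / 2)" unfolding e2 by (simp add: algebra_simps)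
  finally show "norm (duhamel 2 f t y - duhamel 2 f t' y) \<le> 6 * duhamel_const a * M * (t - t') powr (a / 2)" by (simp add: h_def)
  have b2: "norm (h 2 x) \<le> 2 * duhamel_const a * M" for x
  proof -
    have "norm (duhamel 2 f s x) \<le> duhamel_const a * M" if "0 \<le> s" "s \<le> 1" for s
    proof -
      have "duhamel_const a * M * s powr (a / 2) \<le> duhamel_const a * M * 1" using that a by (intro mult_left_mono D powr_le1) auto
      then show ?thesis using duhamel_bound[OF that order_refl, of x] by linarith
    qed
    from this[of t] this[of t'] show ?thesis
      using norm_triangle_ineq4[of "duhamel 2 f t x" "duhamel 2 f t' x"] t t1 by (simp add: h_def)
  qed
  have b0: "norm (h 0 x) \<le> duhamel_const a * M * (t - t')" for x
    unfolding h_def using duhamel_time_difference(1)[OF t(1) t1(2) t(3)] .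
  have "norm (h 1 y) \<le> 2 * (duhamel_const a * M * (t - t')) / e + 2 * duhamel_const a * M * e"
    by (rule interpolation_first_derivative[OF dh' b0 b2 e])
  also have "\<dots> = 2 * duhamel_const a * M * ((t - t') / e) + 2 * duhamel_const a * M * e" by simp
  also have "\<dots> = 4 * (duhamel_const a * M) * e" unfolding e3 by simp
  also have "\<dots> \<le> 6 * (duhamel_const a * M) * e powr a"
    proof (rule mult_mono)
      show "4 * (duhamel_const a * M) \<le> 6 * (duhamel_const a * M)" using D by linarith
    qed (use e e1 D a powr_mono'[of a 1 e] in auto)
  finally show "norm (duhamel 1 f t y - duhamel 1 f t' y) \<le> 6 * duhamel_const a * M * (t - t') powr (a / 2)"
    by (simp add: h_def ee)
qed

lemma duhamel_time_holder:
  assumes t: "t \<in> {0..1}" "t' \<in> {0..1}" and j: "j \<le> 2"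
  shows "norm (duhamel j f t y - duhamel j f t' y) \<le> 6 * duhamel_const a * M * \<bar>t - t'\<bar> powr (a / 2)"
proof -
  have D: "0 \<le> duhamel_const a * M" using duhamel_const_ge_1[OF a] M_nonneg by simp
  have *: "norm (duhamel j f t y - duhamel j f t' y) \<le> 6 * duhamel_const a * M * (t - t') powr (a / 2)" if "t' < t" "0 \<le> t'" "t \<le> 1" for t t'
  proof -
    consider "j = 0" | "j = 1" | "j = 2" using j by linarith
    then show ?thesis
    proof cases
      case 1
      have "norm (duhamel 0 f t y - duhamel 0 f t' y) \<le> duhamel_const a * M * (t - t')" using that by (intro duhamel_time_difference) auto
      also have "\<dots> \<le> (6 * (duhamel_const a * M)) * (t - t') powr (a / 2)"
      proof (rule mult_mono)
        show "duhamel_const a * M \<le> 6 * (duhamel_const a * M)" using D by linarith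
      qed (use that D a powr_mono'[of "a / 2" 1 "t - t'"] in auto)
      finally show ?thesis using 1 by (simp add: mult.assoc)
    qed (use duhamel_time_holder_ordered that in auto)
  qed
  show ?thesis
    using *[of t' t] *[of t t'] t by (cases t t' rule: linorder_cases) (auto simp: norm_minus_commute)
qed

text \<open>Hoelder continuity in time of the second derivative makes the integrand of the time
  integral continuous, so the integral identity can be differentiated.\<close>

lemma duhamel_time_derivative:
  assumes t: "t \<in> {0..1}"
  shows "((\<lambda>t. duhamel 0 f t y) has_vector_derivative (duhamel 2 f t y + f t y)) (at t within {0..1})"
proof -
  define q where "q \<tau> = duhamel 2 f \<tau> y + f \<tau> y" for \<tau>
  have "continuous_on {0..1} (\<lambda>t. duhamel 2 f t y)"
    by (rule continuous_on_of_holder[where b = "a / 2"]) (use duhamel_time_holder[of _ _ 2] a in auto)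
  then have c: "continuous_on {0..1} q"
    unfolding q_def by (intro continuous_intros unif_holder_compose_continuous[OF f])
  have e: "duhamel 0 f t y = integral {0..t} q" if "t \<in> {0..1}" for t
  proof -
    have t: "0 \<le> t" "t \<le> 1" using that by auto
    have "duhamel 0 f t y = integral {0<..<t} q"
      using set_borel_integral_eq_integral(2)[of "{0<..<t}" q] duhamel_time_integral[OF a f t, of y]
      by (simp add: set_integrable_def set_lebesgue_integral_def q_def)
    also have "\<dots> = integral {0..t} q" by (rule integral_open_interval_real[symmetric])
    finally show ?thesis .
  qed
  have "((\<lambda>t. integral {0..t} q) has_vector_derivative q t) (at t within {0..1})"
    by (rule integral_has_vector_derivative[OF c t])
  then have "((\<lambda>t. duhamel 0 f t y) has_vector_derivative q t) (at t within {0..1})"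
    by (rule has_vector_derivative_transform[OF t, rotated]) (use e in auto)
  then show ?thesis by (simp add: q_def)
qed

end

section \<open>Variable coefficients\<close>

definition coeff :: "real \<Rightarrow> (real \<Rightarrow> real) \<Rightarrow> (real \<Rightarrow> real) \<Rightarrow> (real \<Rightarrow> real) \<Rightarrow> bool" where
  "coeff B c c1 c2 \<longleftrightarrow> 1 \<le> B \<and> periodic1 c \<and> (\<forall>s. (c has_vector_derivative c1 s) (at s)) \<and> (\<forall>s. (c1 has_vector_derivative c2 s) (at s))
    \<and> (\<forall>s. 1 / B \<le> c s \<and> c s \<le> B \<and> \<bar>c1 s\<bar> \<le> B \<and> \<bar>c2 s\<bar> \<le> B)"

text \<open>In the coordinate chart c the operator c d^2/ds^2 + (c'/2) d/ds becomes the second derivative.\<close>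

definition chart :: "(real \<Rightarrow> real) \<Rightarrow> real \<Rightarrow> real" where
  "chart c = (SOME Y. \<forall>s. (Y has_vector_derivative 1 / sqrt (c s)) (at s))"

definition pull :: "(real \<Rightarrow> real) \<Rightarrow> (real \<Rightarrow> real \<Rightarrow> 'v) \<Rightarrow> real \<Rightarrow> real \<Rightarrow> 'v" where
  "pull c f t y = f t (inv (chart c) y)"

definition lin_sol0 :: "(real \<Rightarrow> real) \<Rightarrow> (real \<Rightarrow> real \<Rightarrow> 'v::euclidean_space) \<Rightarrow> real \<Rightarrow> real \<Rightarrow> 'v" where
  "lin_sol0 c f t s = duhamel 0 (pull c f) t (chart c s)"

definition lin_sol1 :: "(real \<Rightarrow> real) \<Rightarrow> (real \<Rightarrow> real \<Rightarrow> 'v::euclidean_space) \<Rightarrow> real \<Rightarrow> real \<Rightarrow> 'v" where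
  "lin_sol1 c f t s = (1 / sqrt (c s)) *\<^sub>R duhamel 1 (pull c f) t (chart c s)"

text \<open>Chain rule through the chart; the second coefficient is the derivative of
  \<open>1 / sqrt c\<close>.\<close>

definition lin_sol2 :: "(real \<Rightarrow> real) \<Rightarrow> (real \<Rightarrow> real) \<Rightarrow> (real \<Rightarrow> real \<Rightarrow> 'v::euclidean_space) \<Rightarrow> real \<Rightarrow> real \<Rightarrow> 'v" where
  "lin_sol2 c c1 f t s = (1 / c s) *\<^sub>R duhamel 2 (pull c f) t (chart c s) + (- c1 s / (2 * c s * sqrt (c s))) *\<^sub>R duhamel 1 (pull c f) t (chart c s)"

text \<open>The largest contribution is \<open>4 * B ^ 5 + 16 * B ^ 7\<close> from the Hoelder bound
  of \<open>lin_sol2\<close>; the sup and time estimates produce \<open>12 * B ^ 4\<close>.\<close>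

definition lin_sol_const :: "real \<Rightarrow> real \<Rightarrow> real" where
  "lin_sol_const a B = 20 * B ^ 7 * duhamel_const a"

context
  fixes a B :: real and c c1 c2 :: "real \<Rightarrow> real"
  assumes a: "0 < a" "a < 1" and co: "coeff B c c1 c2"
begin

lemma coeffD: "1 \<le> B" "periodic1 c" "(c has_vector_derivative c1 s) (at s)" "(c1 has_vector_derivative c2 s) (at s)"
  "1 / B \<le> c s" "c s \<le> B" "\<bar>c1 s\<bar> \<le> B" "\<bar>c2 s\<bar> \<le> B"
  using co by (auto simp: coeff_def)

lemma coeff_pos: "0 < c s"
  using coeffD(1) coeffD(5)[of s] by (meson less_le_trans zero_less_divide_1_iff zero_less_one)

lemma coeff_inverse_le: "1 / c s \<le> B"
  using coeffD(1) coeffD(5)[of s] coeff_pos[of s] by (simp add: field_simps)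

lemma coeff_inverse_sqrt: "1 / B \<le> 1 / sqrt (c s)" "1 / sqrt (c s) \<le> B" "0 < sqrt (c s)"
proof -
  show p: "0 < sqrt (c s)" using coeff_pos by simp
  have "sqrt (c s) \<le> sqrt (B\<^sup>2)" using coeffD(1) coeffD(6)[of s] self_le_power[of B 2] by (intro real_sqrt_le_mono) linarith
  then have "sqrt (c s) \<le> B" using coeffD(1) by simp
  then show "1 / B \<le> 1 / sqrt (c s)" using p by (intro divide_left_mono) (auto intro: mult_pos_pos less_le_trans[OF p])
  have "1 / B = sqrt ((1 / B)\<^sup>2)" using coeffD(1) by simp
  also have "\<dots> \<le> sqrt (1 / B)"
    using coeffD(1) by (intro real_sqrt_le_mono) (simp add: power2_eq_square divide_le_eq)
  also have "\<dots> \<le> sqrt (c s)" using coeffD(5) by (intro real_sqrt_le_mono)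
  finally show "1 / sqrt (c s) \<le> B" using p coeffD(1) by (simp add: field_simps)
qed

lemma chart_derivative: "(chart c has_vector_derivative 1 / sqrt (c s)) (at s)"
proof -
  have "continuous_on UNIV (\<lambda>s. 1 / sqrt (c s))"
    using coeff_inverse_sqrt(3) by (intro continuous_intros continuous_on_of_vector_derivative[OF coeffD(3)]) (metis less_irrefl)
  then have "\<exists>Y. \<forall>s. (Y has_vector_derivative 1 / sqrt (c s)) (at s)" by (rule has_antiderivative)
  then have "\<forall>s. (chart c has_vector_derivative 1 / sqrt (c s)) (at s)"
    unfolding chart_def by (rule someI_ex)
  then show ?thesis by blast
qed

lemma chart_DERIV: "(chart c has_real_derivative 1 / sqrt (c s)) (at s)"
  using chart_derivative by (simp add: has_real_derivative_iff_has_vector_derivative)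

lemma chart_lipschitz: "\<bar>chart c s - chart c s'\<bar> \<le> B * \<bar>s - s'\<bar>"
  using lipschitz_vector_derivative[OF chart_derivative, of B s s'] coeff_inverse_sqrt(2) coeff_inverse_sqrt(3)
  by (simp add: less_imp_le)

lemma chart_growth: "s' \<le> s \<Longrightarrow> (s - s') / B \<le> chart c s - chart c s'"
proof (cases "s' = s")
  case False
  assume "s' \<le> s"
  then obtain z where "chart c s - chart c s' = (s - s') * (1 / sqrt (c z))"
    using MVT2[of s' s "chart c" "\<lambda>z. 1 / sqrt (c z)"] chart_DERIV False by auto
  moreover have "(s - s') * (1 / B) \<le> (s - s') * (1 / sqrt (c z))"
    using \<open>s' \<le> s\<close> by (intro mult_left_mono coeff_inverse_sqrt) auto
  ultimately show ?thesis by simp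
qed simp

lemma chart_bilipschitz: "\<bar>s - s'\<bar> \<le> B * \<bar>chart c s - chart c s'\<bar>"
proof (cases "s \<le> s'")
  case True
  have "s' - s = B * ((s' - s) / B)" using coeffD(1) by simp
  also have "\<dots> \<le> B * (chart c s' - chart c s)" using chart_growth[OF True] coeffD(1) by (intro mult_left_mono) auto
  also have "\<dots> \<le> B * \<bar>chart c s - chart c s'\<bar>" using coeffD(1) by (intro mult_left_mono) auto
  finally show ?thesis using True by simp
next
  case False
  then have le: "s' \<le> s" by simp
  have "s - s' = B * ((s - s') / B)" using coeffD(1) by simp
  also have "\<dots> \<le> B * (chart c s - chart c s')" using chart_growth[OF le] coeffD(1) by (intro mult_left_mono) auto
  also have "\<dots> \<le> B * \<bar>chart c s - chart c s'\<bar>" using coeffD(1) by (intro mult_left_mono) auto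
  finally show ?thesis using le by simp
qed

lemma chart_bij: "bij (chart c)"
proof (rule bijI)
  show "inj (chart c)"
  proof (rule injI)
    fix x y assume "chart c x = chart c y"
    then show "x = y" using chart_bilipschitz[of x y] by simp
  qed
  show "surj (chart c)"
    unfolding surj_def
  proof
    fix y
    \<comment> \<open>By the growth bound, the chart has moved by at least
      \<open>\<bar>y - chart c 0\<bar>\<close> after the distance \<open>n\<close> on either side of
      0.\<close>
    define n where "n = B * \<bar>y - chart c 0\<bar>"
    have n: "0 \<le> n" "n / B = \<bar>y - chart c 0\<bar>" using coeffD(1) by (auto simp: n_def)
    have 1: "y \<le> chart c n" using chart_growth[of 0 n] n by simp
    have 2: "chart c (- n) \<le> y" using chart_growth[of "- n" 0] n by simp
    have "\<exists>x. - n \<le> x \<and> x \<le> n \<and> chart c x = y"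
      using n by (intro IVT' 1 2 continuous_on_of_vector_derivative[OF chart_derivative]) auto
    then show "\<exists>x. y = chart c x" by blast
  qed
qed

lemma inv_chart [simp]: "inv (chart c) (chart c s) = s" "chart c (inv (chart c) y) = y"
  using chart_bij by (auto simp: bij_def surj_f_inv_f)

lemma pull_chart [simp]: "pull c f t (chart c s) = f t s"
  by (simp add: pull_def)

lemma inv_chart_lipschitz: "\<bar>inv (chart c) y - inv (chart c) y'\<bar> \<le> B * \<bar>y - y'\<bar>"
  using chart_bilipschitz[of "inv (chart c) y" "inv (chart c) y'"] by simp

lemma powr_B_le: "(B * \<bar>x\<bar>) powr a \<le> B * \<bar>x\<bar> powr a"
proof -
  have "B powr a \<le> B powr 1" using coeffD(1) a by (intro powr_mono) auto
  then show ?thesis using coeffD(1) by (simp add: powr_mult mult_right_mono)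
qed

lemma unif_holder_pull:
  assumes "unif_holder a M f" shows "unif_holder a (B * M) (pull c f)"
proof -
  have M: "0 \<le> M" using unif_holder_nonneg[OF a assms] .
  have "continuous_on UNIV (inv (chart c))"
    unfolding continuous_on_iff
  proof (intro ballI allI impI)
    fix x e :: real assume e: "0 < e"
    show "\<exists>d>0. \<forall>x'\<in>UNIV. dist x' x < d \<longrightarrow> dist (inv (chart c) x') (inv (chart c) x) < e"
    proof (intro exI[of _ "e / B"] conjI ballI impI)
      fix x' assume "dist x' x < e / B"
      then have "B * \<bar>x' - x\<bar> < e" using coeffD(1) by (simp add: dist_real_def field_simps)
      then show "dist (inv (chart c) x') (inv (chart c) x) < e"
        using inv_chart_lipschitz[of x' x] by (simp add: dist_real_def)
    qed (use e coeffD(1) in auto)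
  qed
  then have "continuous_on UNIV (\<lambda>p::real \<times> real. inv (chart c) (snd p))"
    by (rule continuous_on_compose2) (auto intro: continuous_intros)
  then have "continuous_on UNIV (\<lambda>p. pull c f (fst p) (snd p))"
    unfolding pull_def by (intro unif_holder_compose_continuous[OF assms] continuous_intros)
  moreover have "holder a (B * M) (pull c f t)" for t
  proof (rule holderI)
    have "M \<le> B * M" using coeffD(1) M by (simp add: mult_le_cancel_right1)
    then show "norm (pull c f t x) \<le> B * M" for x
      using unif_holder_bound[OF a assms, of t "inv (chart c) x"] by (simp add: pull_def)
    fix x y
    have "norm (pull c f t x - pull c f t y) \<le> M * \<bar>inv (chart c) x - inv (chart c) y\<bar> powr a"
      unfolding pull_def by (rule holderD2[OF unif_holder_holder[OF assms]])
    also have "\<dots> \<le> M * (B * \<bar>x - y\<bar>) powr a"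
      using a by (intro mult_left_mono M powr_mono2 inv_chart_lipschitz) auto
    also have "\<dots> \<le> M * (B * \<bar>x - y\<bar> powr a)" by (intro mult_left_mono M powr_B_le)
    finally show "norm (pull c f t x - pull c f t y) \<le> B * M * \<bar>x - y\<bar> powr a" by (simp add: mult_ac)
  qed
  ultimately show ?thesis by (simp add: unif_holder_def)
qed

text \<open>The increment of the chart over one period has derivative zero because \<open>c\<close>
  is periodic. Its value \<open>L\<close> is the length of the circle in the new coordinate, so data
  of period 1 become data of period \<open>L\<close> for the heat equation on the line.\<close>

lemma chart_periodic: obtains L where "\<And>s. chart c (s + 1) = chart c s + L" "\<And>y. inv (chart c) (y + L) = inv (chart c) y + 1"
proof -
  have "((\<lambda>s. chart c (s + 1) - chart c s) has_real_derivative (1 / sqrt (c (s + 1)) - 1 / sqrt (c s))) (at s)" for s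
    using DERIV_shift[of "chart c" "1 / sqrt (c (s+1))" s 1] chart_DERIV[of "s + 1"]
    by (intro derivative_intros chart_DERIV) simp
  then have "\<forall>s. ((\<lambda>s. chart c (s + 1) - chart c s) has_real_derivative 0) (at s)"
    using coeffD(2) by (simp add: periodic1_def)
  from DERIV_isconst_all[OF this] have *: "chart c (s + 1) - chart c s = chart c (0 + 1) - chart c 0" for s by blast
  define L where "L = chart c (0 + 1) - chart c 0"
  have 1: "chart c (s + 1) = chart c s + L" for s using *[of s] by (simp add: L_def)
  have "inv (chart c) (y + L) = inv (chart c) y + 1" for y
    using 1[of "inv (chart c) y"] inv_chart by metis
  with 1 show thesis using that by blast
qed

lemma duhamel_pull_periodic:
  assumes "\<And>t. periodic1 (f t)"
  shows "duhamel j (pull c f) t (chart c (s + 1)) = duhamel j (pull c f) t (chart c s)"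
proof -
  obtain L where L: "\<And>s. chart c (s + 1) = chart c s + L" "\<And>y. inv (chart c) (y + L) = inv (chart c) y + 1"
    using chart_periodic by blast
  have "pull c f t (y + L) = pull c f t y" for t y
    using assms by (simp add: pull_def L(2) periodic1_def)
  then show ?thesis using duhamel_shift[of "pull c f" L] by (simp add: L(1))
qed

lemma lin_sol0_periodic: "(\<And>t. periodic1 (f t)) \<Longrightarrow> periodic1 (lin_sol0 c f t)"
  using duhamel_pull_periodic[of f 0 t] by (simp add: periodic1_def lin_sol0_def)

lemma sqrt_inverse_derivative:
  "((\<lambda>s. 1 / sqrt (c s)) has_real_derivative (- c1 s / (2 * c s * sqrt (c s)))) (at s)"
proof -
  have D: "(c has_real_derivative c1 s) (at s)" using coeffD(3) by (simp add: has_real_derivative_iff_has_vector_derivative)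
  have p: "0 < c s" "sqrt (c s) * sqrt (c s) = c s" using coeff_pos[of s] by auto
  have "((\<lambda>s. sqrt (c s)) has_real_derivative (inverse (sqrt (c s)) / 2 * c1 s)) (at s)"
    using DERIV_chain2[OF DERIV_real_sqrt[OF p(1)] D] .
  from DERIV_divide[OF DERIV_const[of 1] this]
  have "((\<lambda>s. 1 / sqrt (c s)) has_real_derivative ((0 * sqrt (c s) - 1 * (inverse (sqrt (c s)) / 2 * c1 s)) / (sqrt (c s) * sqrt (c s)))) (at s)"
    using p by simp
  moreover have "(0 * sqrt (c s) - 1 * (inverse (sqrt (c s)) / 2 * c1 s)) / (sqrt (c s) * sqrt (c s)) = - c1 s / (2 * c s * sqrt (c s))"
    unfolding p(2) by (simp add: field_simps)
  ultimately show ?thesis by simp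
qed

lemma duhamel_chart_derivative:
  assumes f: "unif_holder a M f" and t: "0 \<le> t" "t \<le> 1" and j: "j < 2"
  shows "((\<lambda>s. duhamel j (pull c f) t (chart c s)) has_vector_derivative (1 / sqrt (c s)) *\<^sub>R duhamel (Suc j) (pull c f) t (chart c s)) (at s)"
  using vector_diff_chain_at[OF chart_derivative duhamel_derivative[OF a unif_holder_pull[OF f] t j]]
  by (simp add: comp_def)

lemma par_derivatives:
  assumes f: "unif_holder a M f" and t: "0 \<le> t" "t \<le> 1"
  shows "(lin_sol0 c f t has_vector_derivative lin_sol1 c f t s) (at s)"
    and "(lin_sol1 c f t has_vector_derivative lin_sol2 c c1 f t s) (at s)"
proof -
  show "(lin_sol0 c f t has_vector_derivative lin_sol1 c f t s) (at s)"
    using duhamel_chart_derivative[OF f t, of 0 s] by (simp add: lin_sol0_def[abs_def] lin_sol1_def)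
  have "(lin_sol1 c f t has_vector_derivative ((1 / sqrt (c s)) *\<^sub>R (1 / sqrt (c s)) *\<^sub>R duhamel 2 (pull c f) t (chart c s)
     + (- c1 s / (2 * c s * sqrt (c s))) *\<^sub>R duhamel 1 (pull c f) t (chart c s))) (at s)"
    using has_vector_derivative_scaleR[OF sqrt_inverse_derivative duhamel_chart_derivative[OF f t, of 1 s]]
    by (simp add: lin_sol1_def[abs_def] numeral_2_eq_2)
  moreover have "1 / sqrt (c s) * (1 / sqrt (c s)) = 1 / c s" using coeff_pos[of s] by simp
  ultimately show "(lin_sol1 c f t has_vector_derivative lin_sol2 c c1 f t s) (at s)"
    by (simp add: lin_sol2_def)
qed

lemma coefficient_bounds:
  "\<bar>1 / sqrt (c s)\<bar> \<le> B" "\<bar>1 / c s\<bar> \<le> B" "\<bar>- c1 s / (2 * c s * sqrt (c s))\<bar> \<le> B ^ 3"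
proof -
  show "\<bar>1 / sqrt (c s)\<bar> \<le> B" using coeff_inverse_sqrt(2,3)[of s] by simp
  show "\<bar>1 / c s\<bar> \<le> B" using coeff_inverse_le[of s] coeff_pos[of s] by simp
  have "\<bar>- c1 s / (2 * c s * sqrt (c s))\<bar> = (1 / 2) * (\<bar>c1 s\<bar> * (1 / c s) * (1 / sqrt (c s)))"
    using coeff_pos[of s] by (simp add: abs_mult)
  also have "\<dots> \<le> (1 / 2) * (B * B * B)"
    using coeffD(1,7) coeff_inverse_le coeff_inverse_sqrt less_imp_le[OF coeff_pos[of s]] by (intro mult_mono mult_nonneg_nonneg) auto
  also have "\<dots> \<le> B ^ 3" using coeffD(1) by (simp add: power3_eq_cube)
  finally show "\<bar>- c1 s / (2 * c s * sqrt (c s))\<bar> \<le> B ^ 3" .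
qed

lemma holder_inverse_c: "holder a (2 * B ^ 3) (\<lambda>s. 1 / c s)"
proof (rule holder_C1)
  show "norm (1 / c x) \<le> B ^ 3" for x
    using coefficient_bounds(2)[of x] self_le_power[OF coeffD(1), of 3] by simp
  show "((\<lambda>s. 1 / c s) has_vector_derivative (- c1 x * (1 / c x) * (1 / c x))) (at x)" for x
  proof -
    have D: "(c has_real_derivative c1 x) (at x)" using coeffD(3) by (simp add: has_real_derivative_iff_has_vector_derivative)
    have "((\<lambda>s. 1 / c s) has_real_derivative ((0 * c x - 1 * c1 x) / (c x * c x))) (at x)"
      using coeff_pos[of x] by (intro DERIV_divide DERIV_const D) simp
    then show ?thesis by (simp add: has_real_derivative_iff_has_vector_derivative)
  qed
  show "norm (- c1 x * (1 / c x) * (1 / c x)) \<le> B ^ 3" for x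
  proof -
    have "norm (- c1 x * (1 / c x) * (1 / c x)) = \<bar>c1 x\<bar> * \<bar>1 / c x\<bar> * \<bar>1 / c x\<bar>" by (simp add: abs_mult)
    also have "\<dots> \<le> B * B * B"
      using coeffD(1,7) coefficient_bounds(2) by (intro mult_mono mult_nonneg_nonneg) auto
    finally show ?thesis by (simp add: power3_eq_cube)
  qed
qed (use a in auto)

lemma holder_c_sqrt: "holder a (4 * B ^ 5) (\<lambda>s. - c1 s / (2 * c s * sqrt (c s)))"
proof -
  define w1 where "w1 s = - c1 s / (2 * c s * sqrt (c s))" for s
  have "holder a (2 * (2 * B ^ 5)) w1"
  proof (rule holder_C1)
    have B35: "B ^ 3 \<le> B ^ 5" using coeffD(1) by (intro power_increasing) auto
    show "norm (w1 x) \<le> 2 * B ^ 5" for x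
      using coefficient_bounds(3)[of x] B35 coeffD(1) zero_le_power[of B 5] unfolding w1_def real_norm_def by linarith
    have w: "w1 s = (- 1 / 2) * (c1 s * (1 / c s) * (1 / sqrt (c s)))" for s by (simp add: w1_def)
    define w2 where "w2 x = (- 1 / 2) * ((c2 x * (1 / c x) + (- c1 x * (1 / c x) * (1 / c x)) * c1 x) * (1 / sqrt (c x)) + w1 x * (c1 x * (1 / c x)))" for x
    show "(w1 has_vector_derivative w2 x) (at x)" for x
    proof -
      have D: "(c has_real_derivative c1 x) (at x)" "(c1 has_real_derivative c2 x) (at x)"
        using coeffD(3,4) by (auto simp: has_real_derivative_iff_has_vector_derivative)
      have D2: "((\<lambda>s. 1 / c s) has_real_derivative (- c1 x * (1 / c x) * (1 / c x))) (at x)"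
      proof -
        have "((\<lambda>s. 1 / c s) has_real_derivative ((0 * c x - 1 * c1 x) / (c x * c x))) (at x)"
          using coeff_pos[of x] by (intro DERIV_divide DERIV_const D) simp
        then show ?thesis by simp
      qed
      have "((\<lambda>s. (- 1 / 2) * (c1 s * (1 / c s) * (1 / sqrt (c s)))) has_real_derivative w2 x) (at x)"
        unfolding w2_def using DERIV_cmult[OF DERIV_mult[OF DERIV_mult[OF D(2) D2] sqrt_inverse_derivative], of "- 1 / 2"]
        by (simp add: w1_def)
      then show ?thesis unfolding w[abs_def] by (simp add: has_real_derivative_iff_has_vector_derivative)
    qed
    show "norm (w2 x) \<le> 2 * B ^ 5" for x
    proof -
      have B: "0 \<le> B" using coeffD(1) by simp
      have "\<bar>c2 x * (1 / c x) + (- c1 x * (1 / c x) * (1 / c x)) * c1 x\<bar> \<le> \<bar>c2 x\<bar> * \<bar>1 / c x\<bar> + \<bar>c1 x\<bar> * \<bar>1 / c x\<bar> * \<bar>1 / c x\<bar> * \<bar>c1 x\<bar>"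
        by (rule order_trans[OF abs_triangle_ineq]) (simp add: abs_mult)
      also have "\<dots> \<le> B * B + B * B * B * B"
        using B coeffD(7,8) coefficient_bounds(2) by (intro add_mono mult_mono mult_nonneg_nonneg) auto
      finally have 1: "\<bar>(c2 x * (1 / c x) + (- c1 x * (1 / c x) * (1 / c x)) * c1 x) * (1 / sqrt (c x))\<bar> \<le> (B * B + B * B * B * B) * B"
        using coefficient_bounds(1)[of x] B unfolding abs_mult by (intro mult_mono add_nonneg_nonneg mult_nonneg_nonneg) auto
      have 2: "\<bar>w1 x * (c1 x * (1 / c x))\<bar> \<le> B ^ 3 * (B * B)"
        unfolding abs_mult using B coeffD(7) coefficient_bounds(2,3) by (intro mult_mono mult_nonneg_nonneg) (auto simp: w1_def)
      have "norm (w2 x) \<le> (1 / 2) * ((B * B + B * B * B * B) * B + B ^ 3 * (B * B))"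
      proof -
        have h: "norm ((- 1 / 2) * (X + Y)) \<le> (1 / 2) * (P + Q)" if "\<bar>X\<bar> \<le> P" "\<bar>Y\<bar> \<le> Q" for X Y P Q :: real
          using that by (simp add: abs_le_iff)
        show ?thesis unfolding w2_def by (rule h[OF 1 2])
      qed
      also have "\<dots> = (1 / 2) * (B ^ 3 + 2 * B ^ 5)" by algebra
      also have "\<dots> \<le> 2 * B ^ 5"
      proof -
        have h: "(1 / 2) * (x + 2 * y) \<le> 2 * y" if "x \<le> y" "0 \<le> y" for x y :: real using that by simp
        show ?thesis by (rule h[OF B35]) (use B in simp)
      qed
      finally show ?thesis .
    qed
  qed (use a in auto)
  then show ?thesis by (simp add: w1_def[abs_def])
qed

lemma lin_sol_const_ge: "1 \<le> lin_sol_const a B" "D \<ge> 0 \<Longrightarrow> k \<le> 7 \<Longrightarrow> m \<le> 20 \<Longrightarrow> 0 \<le> m \<Longrightarrow> m * B ^ k * (duhamel_const a * D) \<le> lin_sol_const a B * D"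
proof -
  have b: "1 \<le> B ^ 7" using coeffD(1) by simp
  then have "1 \<le> 20 * B ^ 7" by linarith
  then have "1 * 1 \<le> (20 * B ^ 7) * duhamel_const a" using duhamel_const_ge_1[OF a] coeffD(1) by (intro mult_mono) auto
  then show "1 \<le> lin_sol_const a B" by (simp add: lin_sol_const_def)
  assume D: "D \<ge> 0" and k: "k \<le> 7" and m: "m \<le> 20" "0 \<le> m"
  have "m * B ^ k \<le> 20 * B ^ 7" using coeffD(1) k m by (intro mult_mono power_increasing) auto
  then have "m * B ^ k * (duhamel_const a * D) \<le> 20 * B ^ 7 * (duhamel_const a * D)"
    using D duhamel_const_ge_1[OF a] by (intro mult_right_mono mult_nonneg_nonneg) auto
  then show "m * B ^ k * (duhamel_const a * D) \<le> lin_sol_const a B * D" by (simp add: lin_sol_const_def mult.assoc)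
qed

context
  fixes M :: real and f :: "real \<Rightarrow> real \<Rightarrow> 'v::euclidean_space"
  assumes f: "unif_holder a M f"
begin

text \<open>The 6 in the conclusions comes from the time modulus of \<open>duhamel\<close>: for time
  differences the lemma is applied to increments divided by 6.\<close>

lemma par_combination_bounds:
  assumes d: "norm (d0 :: 'v) \<le> duhamel_const a * (B * M) * q" "norm (d1 :: 'v) \<le> duhamel_const a * (B * M) * q" "norm (d2 :: 'v) \<le> duhamel_const a * (B * M) * q"
    and q: "0 \<le> q"
  shows "6 * norm d0 \<le> lin_sol_const a B * M * q" "6 * norm ((1 / sqrt (c s)) *\<^sub>R d1) \<le> lin_sol_const a B * M * q"
    "6 * norm ((1 / c s) *\<^sub>R d2 + (- c1 s / (2 * c s * sqrt (c s))) *\<^sub>R d1) \<le> lin_sol_const a B * M * q"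
proof -
  have M: "0 \<le> M" using unif_holder_nonneg[OF a f] .
  have B: "0 \<le> B" using coeffD(1) by simp
  have MQ: "0 \<le> M * q" using M q by simp
  have B13: "B \<le> B ^ 3" using coeffD(1) by (intro self_le_power) auto
  have B0: "1 \<le> B ^ 3" using coeffD(1) by simp
  define D where "D = duhamel_const a * (B * M) * q"
  have D: "0 \<le> D" using duhamel_const_ge_1[OF a] B M q by (simp add: D_def)
  have key: "6 * (2 * B ^ 3 * D) \<le> lin_sol_const a B * M * q"
    using lin_sol_const_ge(2)[OF MQ, of 4 12] by (simp add: D_def mult_ac power_numeral_reduce)
  have le: "D \<le> 2 * B ^ 3 * D" "B * D \<le> 2 * B ^ 3 * D"
    using D B0 B13 mult_right_mono[OF B0 D] mult_right_mono[OF B13 D] by auto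
  show "6 * norm d0 \<le> lin_sol_const a B * M * q" using d(1)[folded D_def] le key by linarith
  have "norm ((1 / sqrt (c s)) *\<^sub>R d1) \<le> B * D"
    unfolding norm_scaleR using coefficient_bounds(1)[of s] d(2)[folded D_def] B by (intro mult_mono) auto
  then show "6 * norm ((1 / sqrt (c s)) *\<^sub>R d1) \<le> lin_sol_const a B * M * q" using le key by linarith
  have "norm ((1 / c s) *\<^sub>R d2 + (- c1 s / (2 * c s * sqrt (c s))) *\<^sub>R d1) \<le> B * D + B ^ 3 * D"
    using coefficient_bounds(2,3)[of s] d(2,3)[folded D_def] B
    by (intro order_trans[OF norm_triangle_ineq] add_mono) (auto simp del: abs_divide intro!: mult_mono)
  also have "\<dots> \<le> 2 * B ^ 3 * D" using mult_right_mono[OF B13 D] by (simp add: mult.commute)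
  finally show "6 * norm ((1 / c s) *\<^sub>R d2 + (- c1 s / (2 * c s * sqrt (c s))) *\<^sub>R d1) \<le> lin_sol_const a B * M * q"
    using key by linarith
qed

lemma par_bounds:
  assumes t: "0 \<le> t" "t \<le> 1"
  shows "norm (lin_sol0 c f t s) \<le> lin_sol_const a B * M * t powr (a / 2)" "norm (lin_sol1 c f t s) \<le> lin_sol_const a B * M * t powr (a / 2)"
    "norm (lin_sol2 c c1 f t s) \<le> lin_sol_const a B * M * t powr (a / 2)"
proof -
  note d = duhamel_bound[OF a unif_holder_pull[OF f] t, of _ "chart c s"]
  have d': "norm (duhamel 0 (pull c f) t (chart c s)) \<le> duhamel_const a * (B * M) * t powr (a / 2)"
    "norm (duhamel 1 (pull c f) t (chart c s)) \<le> duhamel_const a * (B * M) * t powr (a / 2)"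
    "norm (duhamel 2 (pull c f) t (chart c s)) \<le> duhamel_const a * (B * M) * t powr (a / 2)"
    by (rule d; simp)+
  note p = par_combination_bounds[OF d' powr_ge_zero]
  have 6: "x \<le> y" if "6 * x \<le> y" "0 \<le> x" for x y :: real using that by linarith
  show "norm (lin_sol0 c f t s) \<le> lin_sol_const a B * M * t powr (a / 2)"
    unfolding lin_sol0_def by (rule 6[OF p(1)]) simp
  show "norm (lin_sol1 c f t s) \<le> lin_sol_const a B * M * t powr (a / 2)"
    unfolding lin_sol1_def by (rule 6[OF p(2)]) simp
  show "norm (lin_sol2 c c1 f t s) \<le> lin_sol_const a B * M * t powr (a / 2)"
    unfolding lin_sol2_def by (rule 6[OF p(3)]) simp
qed

lemma par_time_holder:
  assumes t: "t \<in> {0..1}" "t' \<in> {0..1}"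
  shows "norm (lin_sol0 c f t s - lin_sol0 c f t' s) \<le> lin_sol_const a B * M * \<bar>t - t'\<bar> powr (a / 2)"
    "norm (lin_sol1 c f t s - lin_sol1 c f t' s) \<le> lin_sol_const a B * M * \<bar>t - t'\<bar> powr (a / 2)"
    "norm (lin_sol2 c c1 f t s - lin_sol2 c c1 f t' s) \<le> lin_sol_const a B * M * \<bar>t - t'\<bar> powr (a / 2)"
proof -
  define h where "h j = (1/6) *\<^sub>R (duhamel j (pull c f) t (chart c s) - duhamel j (pull c f) t' (chart c s))" for j
  have d: "norm (h j) \<le> duhamel_const a * (B * M) * \<bar>t - t'\<bar> powr (a / 2)" if "j \<le> 2" for j
    using duhamel_time_holder[OF a unif_holder_pull[OF f] t that, of "chart c s"] by (simp add: h_def)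
  have d': "norm (h 0) \<le> duhamel_const a * (B * M) * \<bar>t - t'\<bar> powr (a / 2)"
    "norm (h 1) \<le> duhamel_const a * (B * M) * \<bar>t - t'\<bar> powr (a / 2)"
    "norm (h 2) \<le> duhamel_const a * (B * M) * \<bar>t - t'\<bar> powr (a / 2)"
    by (rule d; simp)+
  note p = par_combination_bounds[OF d' powr_ge_zero]
  have e0: "lin_sol0 c f t s - lin_sol0 c f t' s = 6 *\<^sub>R h 0" by (simp add: h_def lin_sol0_def)
  have e1: "lin_sol1 c f t s - lin_sol1 c f t' s = 6 *\<^sub>R ((1 / sqrt (c s)) *\<^sub>R h 1)"
    by (simp add: h_def lin_sol1_def scaleR_diff_right)
  have e2: "lin_sol2 c c1 f t s - lin_sol2 c c1 f t' s = 6 *\<^sub>R ((1 / c s) *\<^sub>R h 2 + (- c1 s / (2 * c s * sqrt (c s))) *\<^sub>R h 1)"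
    by (simp add: h_def lin_sol2_def scaleR_diff_right scaleR_add_right mult.assoc)
  show "norm (lin_sol0 c f t s - lin_sol0 c f t' s) \<le> lin_sol_const a B * M * \<bar>t - t'\<bar> powr (a / 2)"
    unfolding e0 using p(1) by simp
  show "norm (lin_sol1 c f t s - lin_sol1 c f t' s) \<le> lin_sol_const a B * M * \<bar>t - t'\<bar> powr (a / 2)"
    unfolding e1 using p(2) by simp
  show "norm (lin_sol2 c c1 f t s - lin_sol2 c c1 f t' s) \<le> lin_sol_const a B * M * \<bar>t - t'\<bar> powr (a / 2)"
    unfolding e2 norm_scaleR[of 6] using p(3) by simp
qed

lemma lin_sol2_holder:
  assumes t: "0 \<le> t" "t \<le> 1"
  shows "holder a (lin_sol_const a B * M) (lin_sol2 c c1 f t)"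
proof -
  have M: "0 \<le> M" using unif_holder_nonneg[OF a f] .
  have B: "0 \<le> B" using coeffD(1) by simp
  define D where "D = duhamel_const a * (B * M)"
  have D: "0 \<le> D" using duhamel_const_ge_1[OF a] B M by (simp add: D_def)
  have BD: "D \<le> B * D" using mult_right_mono[OF coeffD(1) D] by simp
  have tp: "t powr (a / 2) \<le> 1" using t a by (intro powr_le1) auto
  have bd: "norm (duhamel j (pull c f) t y) \<le> D" if "j \<le> 2" for j y
  proof -
    have "norm (duhamel j (pull c f) t y) \<le> D * t powr (a / 2)"
      using duhamel_bound[OF a unif_holder_pull[OF f] t that] by (simp add: D_def)
    also have "\<dots> \<le> D * 1" by (intro mult_left_mono tp D)
    finally show ?thesis by simp
  qed
  have h2: "holder a (B * D) (\<lambda>s. duhamel 2 (pull c f) t (chart c s))"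
  proof (rule holderI)
    show "norm (duhamel 2 (pull c f) t (chart c x)) \<le> B * D" for x using bd[OF order_refl] BD order_trans by blast
    fix x y
    have "norm (duhamel 2 (pull c f) t (chart c x) - duhamel 2 (pull c f) t (chart c y)) \<le> D * \<bar>chart c x - chart c y\<bar> powr a"
      unfolding D_def by (rule duhamel_holder[OF a unif_holder_pull[OF f] t])
    also have "\<dots> \<le> D * (B * \<bar>x - y\<bar>) powr a"
      using a by (intro mult_left_mono D powr_mono2 chart_lipschitz) auto
    also have "\<dots> \<le> D * (B * \<bar>x - y\<bar> powr a)" by (intro mult_left_mono D powr_B_le)
    finally show "norm (duhamel 2 (pull c f) t (chart c x) - duhamel 2 (pull c f) t (chart c y)) \<le> B * D * \<bar>x - y\<bar> powr a"
      by (simp add: mult_ac)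
  qed
  have h1: "holder a (2 * (B * D)) (\<lambda>s. duhamel 1 (pull c f) t (chart c s))"
  proof (rule holder_C1)
    show "norm (duhamel 1 (pull c f) t (chart c x)) \<le> B * D" for x using bd[of 1] BD order_trans by fastforce
    show "((\<lambda>s. duhamel 1 (pull c f) t (chart c s)) has_vector_derivative (1 / sqrt (c x)) *\<^sub>R duhamel 2 (pull c f) t (chart c x)) (at x)" for x
      using duhamel_chart_derivative[OF f t, of 1 x] by (simp add: numeral_2_eq_2)
    show "norm ((1 / sqrt (c x)) *\<^sub>R duhamel 2 (pull c f) t (chart c x)) \<le> B * D" for x
      unfolding norm_scaleR using coefficient_bounds(1)[of x] bd[OF order_refl, of "chart c x"] B by (intro mult_mono) auto
  qed (use a in auto)
  have "holder a (2 * (2 * B ^ 3) * (B * D) + 2 * (4 * B ^ 5) * (2 * (B * D))) (lin_sol2 c c1 f t)"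
    unfolding lin_sol2_def[abs_def] by (intro holder_add holder_scaleR holder_inverse_c holder_c_sqrt h1 h2)
  moreover have "2 * (2 * B ^ 3) * (B * D) + 2 * (4 * B ^ 5) * (2 * (B * D)) \<le> lin_sol_const a B * M"
  proof -
    have "2 * (2 * B ^ 3) * (B * D) + 2 * (4 * B ^ 5) * (2 * (B * D)) = 4 * B ^ 5 * (duhamel_const a * M) + 16 * B ^ 7 * (duhamel_const a * M)"
      unfolding D_def by algebra
    moreover have "4 * B ^ 5 * (duhamel_const a * M) \<le> 4 * B ^ 7 * (duhamel_const a * M)"
      using coeffD(1) M duhamel_const_ge_1[OF a] by (intro mult_right_mono mult_left_mono power_increasing) auto
    ultimately show ?thesis by (simp add: lin_sol_const_def mult_ac)
  qed
  ultimately show ?thesis by (rule holder_mono)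
qed

lemma par_time_derivative:
  assumes t: "t \<in> {0..1}"
  shows "((\<lambda>t. lin_sol0 c f t s) has_vector_derivative (c s *\<^sub>R lin_sol2 c c1 f t s + (c1 s / 2) *\<^sub>R lin_sol1 c f t s + f t s)) (at t within {0..1})"
proof -
  have "c s *\<^sub>R lin_sol2 c c1 f t s + (c1 s / 2) *\<^sub>R lin_sol1 c f t s = duhamel 2 (pull c f) t (chart c s)"
    using coeff_pos[of s] unfolding lin_sol1_def lin_sol2_def by (simp add: scaleR_add_right scaleR_diff_right)
  then show ?thesis
    using duhamel_time_derivative[OF a unif_holder_pull[OF f] t, of "chart c s"] by (simp add: lin_sol0_def)
qed

end

lemma par_diff:
  assumes f: "unif_holder a M f" "unif_holder a M f'" and t: "0 \<le> t" "t \<le> 1"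
  shows "lin_sol0 c (\<lambda>t x. f t x - f' t x) t s = lin_sol0 c f t s - lin_sol0 c f' t s"
    "lin_sol1 c (\<lambda>t x. f t x - f' t x) t s = lin_sol1 c f t s - lin_sol1 c f' t s"
    "lin_sol2 c c1 (\<lambda>t x. f t x - f' t x) t s = lin_sol2 c c1 f t s - lin_sol2 c c1 f' t s"
proof -
  have p: "pull c (\<lambda>t x. f t x - f' t x) = (\<lambda>t x. pull c f t x - pull c f' t x)"
    by (auto simp: pull_def fun_eq_iff)
  note d = duhamel_diff[OF a unif_holder_pull[OF f(1)] unif_holder_pull[OF f(2)] t]
  show "lin_sol0 c (\<lambda>t x. f t x - f' t x) t s = lin_sol0 c f t s - lin_sol0 c f' t s"
    "lin_sol1 c (\<lambda>t x. f t x - f' t x) t s = lin_sol1 c f t s - lin_sol1 c f' t s"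
    "lin_sol2 c c1 (\<lambda>t x. f t x - f' t x) t s = lin_sol2 c c1 f t s - lin_sol2 c c1 f' t s"
    unfolding lin_sol0_def lin_sol1_def lin_sol2_def p by (simp_all add: d scaleR_diff_right)
qed

lemma par_zero_time: "lin_sol0 c f 0 s = 0"
  by (simp add: lin_sol0_def duhamel_zero_time)

end

section \<open>Fixed points and the tension\<close>

lemma holder_limit:
  fixes F :: "nat \<Rightarrow> real \<Rightarrow> 'v::real_normed_vector"
  assumes "\<And>s. (\<lambda>n. F n s) \<longlonglongrightarrow> G s" "\<And>n. holder a K (F n)"
  shows "holder a K G"
proof (rule holderI)
  show "norm (G x) \<le> K" for x
    using tendsto_norm[OF assms(1)[of x]] by (rule LIMSEQ_le_const2) (use holderD1[OF assms(2)] in auto)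
  show "norm (G x - G y) \<le> K * \<bar>x - y\<bar> powr a" for x y
    using tendsto_norm[OF tendsto_diff[OF assms(1)[of x] assms(1)[of y]]]
    by (rule LIMSEQ_le_const2) (use holderD2[OF assms(2)] in auto)
qed

definition unif_holder_per :: "real \<Rightarrow> real \<Rightarrow> (real \<Rightarrow> real \<Rightarrow> 'v::euclidean_space) \<Rightarrow> bool" where
  "unif_holder_per a M f \<longleftrightarrow> unif_holder a M f \<and> (\<forall>t. periodic1 (f t))"

text \<open>Banach's iteration carried out by hand, as closeness is expressed by
  \<open>holder\<close> uniformly in time. The iterates from 0 have geometric tails; these give
  uniform convergence, which preserves joint continuity and permits passing to the limit in the
  map.\<close>

lemma contraction_fixed_point:
  fixes \<Psi> :: "(real \<Rightarrow> real \<Rightarrow> 'v::euclidean_space) \<Rightarrow> real \<Rightarrow> real \<Rightarrow> 'v"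
  assumes M: "0 \<le> M" and self: "\<And>f. unif_holder_per a M f \<Longrightarrow> unif_holder_per a M (\<Psi> f)"
    and con: "\<And>f g D t. unif_holder_per a M f \<Longrightarrow> unif_holder_per a M g \<Longrightarrow> (\<And>t. holder a D (\<lambda>s. f t s - g t s)) \<Longrightarrow> holder a (D / 2) (\<lambda>s. \<Psi> f t s - \<Psi> g t s)"
  obtains f where "unif_holder_per a M f" "\<Psi> f = f"
proof -
  define F where "F n = (\<Psi> ^^ n) (\<lambda>t s. 0)" for n
  have F0: "F 0 = (\<lambda>t s. 0)" and FS: "F (Suc n) = \<Psi> (F n)" for n by (auto simp: F_def)
  have g: "unif_holder_per a M (F n)" for n
  proof (induction n)
    case 0
    then show ?case unfolding F0 by (auto simp: unif_holder_per_def unif_holder_def periodic1_def holder_zero[OF M])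
  next
    case (Suc n)
    then show ?case unfolding FS by (rule self)
  qed
  have st: "holder a (M / 2 ^ n) (\<lambda>s. F (Suc n) t s - F n t s)" for n t
  proof (induction n arbitrary: t)
    case 0
    then show ?case using g[of 1] by (simp add: F0 unif_holder_per_def unif_holder_def)
  next
    case (Suc n)
    have "holder a (M / 2 ^ n / 2) (\<lambda>s. \<Psi> (F (Suc n)) t s - \<Psi> (F n) t s)"
      by (rule con[OF g g Suc.IH])
    then show ?case unfolding FS[of "Suc n"] FS[of n, symmetric] by (simp add: mult.commute)
  qed
  \<comment> \<open>Partial sums of the geometric series of ratio 1/2, kept exact so that the
    induction closes.\<close>
  have mult: "holder a (2 * M / 2 ^ n * (1 - 1 / 2 ^ k)) (\<lambda>s. F (n + k) t s - F n t s)" for n k t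
  proof (induction k)
    case 0
    then show ?case by (simp add: holder_zero)
  next
    case (Suc k)
    have "holder a (2 * M / 2 ^ n * (1 - 1 / 2 ^ k) + M / 2 ^ (n + k)) (\<lambda>s. (F (n + k) t s - F n t s) + (F (Suc (n + k)) t s - F (n + k) t s))"
      by (rule holder_add[OF Suc.IH st])
    moreover have "2 * M / 2 ^ n * (1 - 1 / 2 ^ k) + M / 2 ^ (n + k) = 2 * M / 2 ^ n * (1 - 1 / 2 ^ Suc k)"
      by (simp add: power_add field_simps)
    ultimately show ?case by simp
  qed
  have tail: "holder a (2 * M / 2 ^ n) (\<lambda>s. F (n + k) t s - F n t s)" for n k t
    using mult by (rule holder_mono) (use M in \<open>simp add: mult_left_le field_simps\<close>)
  have lim0: "(\<lambda>n. K / 2 ^ n) \<longlonglongrightarrow> 0" for K :: real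
    using tendsto_mult[OF tendsto_const[of K] LIMSEQ_inverse_realpow_zero[of 2]] by (simp add: divide_inverse)
  have "Cauchy (\<lambda>n. F n t s)" for t s
  proof (rule metric_CauchyI)
    fix e :: real assume e: "0 < e"
    have "\<forall>\<^sub>F n in sequentially. 4 * M / 2 ^ n < e" using lim0[of "4 * M"] e by (rule order_tendstoD)
    then obtain N where N: "4 * M / 2 ^ N < e" by (auto simp: eventually_sequentially)
    show "\<exists>N. \<forall>m\<ge>N. \<forall>n\<ge>N. dist (F m t s) (F n t s) < e"
    proof (intro exI allI impI)
      fix m n assume mn: "N \<le> m" "N \<le> n"
      have d: "dist (F k t s) (F N t s) \<le> 2 * M / 2 ^ N" if "N \<le> k" for k
        using holderD1[OF tail[of N "k - N" t], of s] that by (simp add: dist_norm)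
      have "dist (F m t s) (F n t s) \<le> dist (F m t s) (F N t s) + dist (F n t s) (F N t s)"
        by (rule dist_triangle2)
      also have "\<dots> \<le> 2 * M / 2 ^ N + 2 * M / 2 ^ N" by (intro add_mono d mn)
      also have "\<dots> < e" using N by simp
      finally show "dist (F m t s) (F n t s) < e" .
    qed
  qed
  then have "\<exists>l. (\<lambda>n. F n t s) \<longlonglongrightarrow> l" for t s using Cauchy_convergent convergent_def by blast
  then obtain f where f: "\<And>t s. (\<lambda>n. F n t s) \<longlonglongrightarrow> f t s" by metis
  have ft: "holder a (2 * M / 2 ^ n) (\<lambda>s. f t s - F n t s)" for n t
  proof (rule holder_limit[OF _ tail])
    show "(\<lambda>k. F (n + k) t s - F n t s) \<longlonglongrightarrow> f t s - F n t s" for s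
      using LIMSEQ_ignore_initial_segment[OF f[of t s], of n] by (intro tendsto_diff tendsto_const) (simp add: add.commute)
  qed
  have "continuous_on UNIV (\<lambda>p. f (fst p) (snd p))"
  proof (rule uniform_limit_theorem[where F = sequentially and f = "\<lambda>n p. F n (fst p) (snd p)"])
    show "\<forall>\<^sub>F n in sequentially. continuous_on UNIV (\<lambda>p. F n (fst p) (snd p))"
      using g by (intro always_eventually) (simp add: unif_holder_per_def unif_holder_def)
    show "uniform_limit UNIV (\<lambda>n p. F n (fst p) (snd p)) (\<lambda>p. f (fst p) (snd p)) sequentially"
    proof (rule uniform_limitI)
      fix e :: real assume e: "0 < e"
      have "\<forall>\<^sub>F n in sequentially. 2 * M / 2 ^ n < e" using lim0[of "2 * M"] e by (rule order_tendstoD)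
      then show "\<forall>\<^sub>F n in sequentially. \<forall>p\<in>UNIV. dist (F n (fst p) (snd p)) (f (fst p) (snd p)) < e"
      proof (rule eventually_mono)
        fix n assume n: "2 * M / 2 ^ n < e"
        show "\<forall>p\<in>UNIV. dist (F n (fst p) (snd p)) (f (fst p) (snd p)) < e"
          using holderD1[OF ft[of n]] n by (fastforce simp: dist_norm norm_minus_commute intro: le_less_trans)
      qed
    qed
  qed simp
  moreover have "holder a M (f t)" for t
    using f by (rule holder_limit) (use g in \<open>simp add: unif_holder_per_def unif_holder_def\<close>)
  moreover have "periodic1 (f t)" for t
    unfolding periodic1_def
  proof
    fix s
    have "F n t (s + 1) = F n t s" for n using g by (simp add: unif_holder_per_def periodic1_def)
    then show "f t (s + 1) = f t s" using f[of t "s + 1"] f[of t s] LIMSEQ_unique by simp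
  qed
  ultimately have gf: "unif_holder_per a M f" by (simp add: unif_holder_per_def unif_holder_def)
  have "\<Psi> f t s = f t s" for t s
  proof -
    have "norm (\<Psi> f t s - f t s) \<le> 3 * M / 2 ^ n" for n
    proof -
      have "holder a (2 * M / 2 ^ n / 2) (\<lambda>s. \<Psi> f t s - \<Psi> (F n) t s)" by (rule con[OF gf g ft])
      then have 1: "norm (\<Psi> f t s - F (Suc n) t s) \<le> M / 2 ^ n"
        unfolding FS using holderD1[of a _ _ s] by fastforce
      have 2: "norm (f t s - F (Suc n) t s) \<le> M / 2 ^ n"
        using holderD1[OF ft[of "Suc n" t], of s] by simp
      have "norm (\<Psi> f t s - f t s) \<le> norm (\<Psi> f t s - F (Suc n) t s) + norm (f t s - F (Suc n) t s)"
        using norm_triangle_ineq4[of "\<Psi> f t s - F (Suc n) t s" "f t s - F (Suc n) t s"] by simp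
      also have "\<dots> \<le> M / 2 ^ n + M / 2 ^ n" by (intro add_mono 1 2)
      also have "\<dots> \<le> 3 * M / 2 ^ n" using M by (simp add: field_simps)
      finally show ?thesis .
    qed
    then have "norm (\<Psi> f t s - f t s) \<le> 0" using LIMSEQ_le_const[OF lim0[of "3 * M"]] by blast
    then show ?thesis by simp
  qed
  then show thesis using that gf by blast
qed

section \<open>The tension and its dependence on the squared curvature\<close>

definition solves_ell :: "(real \<Rightarrow> real) \<Rightarrow> (real \<Rightarrow> real) \<Rightarrow> (real \<Rightarrow> real) \<Rightarrow> bool" where
  "solves_ell p \<sigma> \<sigma>1 \<longleftrightarrow> periodic1 \<sigma> \<and> (\<forall>s. (\<sigma> has_vector_derivative \<sigma>1 s) (at s)) \<and> (\<forall>s. (\<sigma>1 has_vector_derivative (p s * \<sigma> s - 1)) (at s))"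

text \<open>The 1/2 is half of the lower bound 1 valid for closed unit-speed curves; the other half
  is spent on the perturbation during the lifespan.\<close>

definition pot :: "real \<Rightarrow> (real \<Rightarrow> real) \<Rightarrow> bool" where
  "pot P p \<longleftrightarrow> continuous_on UNIV p \<and> periodic1 p \<and> (\<forall>s. 0 \<le> p s \<and> p s \<le> P) \<and> 1 / 2 \<le> integral {0..1} p"

definition ell :: "(real \<Rightarrow> real) \<Rightarrow> (real \<Rightarrow> real) \<times> (real \<Rightarrow> real)" where
  "ell p = (SOME q. solves_ell p (fst q) (snd q))"

lemma solves_ell: assumes "pot P p" shows "solves_ell p (fst (ell p)) (snd (ell p))"
proof -
  have "0 < integral {0..1} p" using assms by (simp add: pot_def)
  then obtain \<sigma> \<sigma>1 where "periodic1 \<sigma>" "\<And>s. (\<sigma> has_vector_derivative \<sigma>1 s) (at s)"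
    "\<And>s. (\<sigma>1 has_vector_derivative (p s * \<sigma> s - 1)) (at s)"
    using elliptic_exists[of p] assms by (auto simp: pot_def)
  then have "solves_ell p (fst (\<sigma>, \<sigma>1)) (snd (\<sigma>, \<sigma>1))" by (simp add: solves_ell_def)
  then show ?thesis unfolding ell_def by (rule someI)
qed

lemma solves_ell_bounds:
  assumes s: "solves_ell p \<sigma> \<sigma>1" and p: "pot P p"
  shows "1 / P \<le> \<sigma> s" "\<bar>\<sigma> s\<bar> \<le> 8" "\<bar>p s * \<sigma> s - 1\<bar> \<le> 8 * P + 1" "\<bar>\<sigma>1 s\<bar> \<le> 8 * P + 1"
proof -
  note s' = s[unfolded solves_ell_def] note p' = p[unfolded pot_def]
  show "1 / P \<le> \<sigma> s" by (rule elliptic_lower_bound[of \<sigma> \<sigma>1 p P]) (use s' p' in auto)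
  \<comment> \<open>The a priori bound 4 G / m with G = 1 and m = 1/2.\<close>
  have b: "\<bar>\<sigma> s\<bar> \<le> 8" for s
    using elliptic_apriori[of \<sigma> \<sigma>1 p "\<lambda>_. 1" "1/2" 1 s] s' p' by simp
  then show "\<bar>\<sigma> s\<bar> \<le> 8" .
  have d: "\<bar>p s * \<sigma> s - 1\<bar> \<le> 8 * P + 1" for s
  proof -
    have "\<bar>p s * \<sigma> s\<bar> \<le> P * 8" unfolding abs_mult using p' b[of s] by (intro mult_mono) auto
    then show ?thesis by (simp add: abs_le_iff)
  qed
  then show "\<bar>p s * \<sigma> s - 1\<bar> \<le> 8 * P + 1" .
  show "\<bar>\<sigma>1 s\<bar> \<le> 8 * P + 1"
    by (rule periodic1_derivative_bound[of \<sigma> \<sigma>1 "\<lambda>s. p s * \<sigma> s - 1"]) (use s' d in auto)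
qed

text \<open>The difference \<delta> solves the tension equation for \<open>p\<close> with source g =
  -(p - q) \<tau>, bounded by 8 \<eta>. The a priori bound with m = 1/2 gives 64 \<eta> for
  \<delta>; in the second derivative p \<delta> - g the source adds 8 \<eta>, whence 72 P \<eta>.
  Thus a sup-norm change of the potential moves the tension in C^2.\<close>

lemma solves_ell_diff:
  assumes s: "solves_ell p \<sigma> \<sigma>1" "solves_ell q \<tau> \<tau>1" and p: "pot P p" "pot P q" and P: "1 \<le> P"
    and d: "\<And>s. \<bar>p s - q s\<bar> \<le> \<eta>"
  shows "\<bar>\<sigma> s - \<tau> s\<bar> \<le> 72 * P * \<eta>" "\<bar>\<sigma>1 s - \<tau>1 s\<bar> \<le> 72 * P * \<eta>"
    "\<bar>(p s * \<sigma> s - 1) - (q s * \<tau> s - 1)\<bar> \<le> 72 * P * \<eta>"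
proof -
  note s' = s[unfolded solves_ell_def] note p' = p[unfolded pot_def]
  define g where "g s = - (p s - q s) * \<tau> s" for s
  define \<delta> where "\<delta> s = \<sigma> s - \<tau> s" for s
  define \<delta>1 where "\<delta>1 s = \<sigma>1 s - \<tau>1 s" for s
  have e0: "0 \<le> \<eta>" using d[of 0] by linarith
  have pe: "\<eta> \<le> P * \<eta>" using mult_right_mono[OF P e0] by simp
  have per: "periodic1 \<delta>" using s' by (simp add: \<delta>_def periodic1_def)
  have d1: "(\<delta> has_vector_derivative \<delta>1 s) (at s)" for s
    unfolding \<delta>_def[abs_def] \<delta>1_def using s' by (intro has_vector_derivative_diff) auto
  have d2: "(\<delta>1 has_vector_derivative (p s * \<delta> s - g s)) (at s)" for s
  proof -
    have "(\<delta>1 has_vector_derivative ((p s * \<sigma> s - 1) - (q s * \<tau> s - 1))) (at s)"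
      unfolding \<delta>1_def[abs_def] using s' by (intro has_vector_derivative_diff) auto
    moreover have "(p s * \<sigma> s - 1) - (q s * \<tau> s - 1) = p s * \<delta> s - g s"
      by (simp add: \<delta>_def g_def algebra_simps)
    ultimately show ?thesis by simp
  qed
  have gb: "\<bar>g s\<bar> \<le> 8 * \<eta>" for s
  proof -
    have "\<bar>g s\<bar> = \<bar>p s - q s\<bar> * \<bar>\<tau> s\<bar>" by (simp add: g_def abs_mult abs_minus_commute)
    also have "\<dots> \<le> \<eta> * 8" using d solves_ell_bounds(2)[OF s(2) p(2)] e0 by (intro mult_mono) auto
    finally show ?thesis by simp
  qed
  have "continuous_on UNIV \<tau>" using s' continuous_on_of_vector_derivative by blast
  then have "continuous_on UNIV g" unfolding g_def using p' by (intro continuous_intros) auto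
  then have 1: "\<bar>\<delta> s\<bar> \<le> 64 * \<eta>" for s
    using elliptic_apriori[OF per d1 d2, of "1/2" "8 * \<eta>" s] p' gb by simp
  have 2: "\<bar>p s * \<delta> s - g s\<bar> \<le> 72 * P * \<eta>" for s
  proof -
    have "\<bar>p s * \<delta> s\<bar> \<le> P * (64 * \<eta>)" unfolding abs_mult using p' 1[of s] P by (intro mult_mono) auto
    then show ?thesis using gb[of s] pe by (simp add: abs_le_iff)
  qed
  have "\<bar>\<delta> s\<bar> \<le> 72 * P * \<eta>" using 1[of s] pe e0 by linarith
  then show "\<bar>\<sigma> s - \<tau> s\<bar> \<le> 72 * P * \<eta>" by (simp add: \<delta>_def)
  show "\<bar>\<sigma>1 s - \<tau>1 s\<bar> \<le> 72 * P * \<eta>"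
    using periodic1_derivative_bound[OF per d1 d2 2] by (simp add: \<delta>1_def)
  show "\<bar>(p s * \<sigma> s - 1) - (q s * \<tau> s - 1)\<bar> \<le> 72 * P * \<eta>"
    using 2[of s] by (simp add: \<delta>_def g_def algebra_simps)
qed

lemma solves_ell_holder:
  assumes a: "0 < a" "a < 1" and s: "solves_ell p \<sigma> \<sigma>1" and p: "pot P p" and P: "1 \<le> P"
  shows "holder a (18 * P) \<sigma>" "holder a (18 * P) \<sigma>1"
proof -
  note b = solves_ell_bounds[OF s p] note s' = s[unfolded solves_ell_def]
  have "holder a (2 * (8 * P + 1)) \<sigma>"
    by (rule holder_C1[where g' = \<sigma>1]) (use a b s' P in \<open>auto intro: order_trans[OF b(2)]\<close>)
  then show "holder a (18 * P) \<sigma>" by (rule holder_mono) (use P in simp)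
  have "holder a (2 * (8 * P + 1)) \<sigma>1"
    by (rule holder_C1[where g' = "\<lambda>s. p s * \<sigma> s - 1"]) (use a b s' in auto)
  then show "holder a (18 * P) \<sigma>1" by (rule holder_mono) (use P in simp)
qed

lemma solves_ell_diff_holder:
  assumes a: "0 < a" "a < 1" and s: "solves_ell p \<sigma> \<sigma>1" "solves_ell q \<tau> \<tau>1" and p: "pot P p" "pot P q" and P: "1 \<le> P"
    and d: "\<And>s. \<bar>p s - q s\<bar> \<le> \<eta>"
  shows "holder a (144 * P * \<eta>) (\<lambda>s. \<sigma> s - \<tau> s)" "holder a (144 * P * \<eta>) (\<lambda>s. \<sigma>1 s - \<tau>1 s)"
proof -
  note b = solves_ell_diff[OF s p P d] note s' = s[unfolded solves_ell_def]
  have "holder a (2 * (72 * P * \<eta>)) (\<lambda>s. \<sigma> s - \<tau> s)"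
    by (rule holder_C1[where g' = "\<lambda>s. \<sigma>1 s - \<tau>1 s"]) (use a b s' in \<open>auto intro!: has_vector_derivative_diff\<close>)
  then show "holder a (144 * P * \<eta>) (\<lambda>s. \<sigma> s - \<tau> s)" by (simp add: mult.assoc)
  have "holder a (2 * (72 * P * \<eta>)) (\<lambda>s. \<sigma>1 s - \<tau>1 s)"
  proof (rule holder_C1)
    show "((\<lambda>s. \<sigma>1 s - \<tau>1 s) has_vector_derivative ((p s * \<sigma> s - 1) - (q s * \<tau> s - 1))) (at s)" for s
      using s' by (intro has_vector_derivative_diff) auto
  qed (use a b in auto)
  then show "holder a (144 * P * \<eta>) (\<lambda>s. \<sigma>1 s - \<tau>1 s)" by (simp add: mult.assoc)
qed

section \<open>The nonlinearity\<close>

lemma norm_square_diff_le: "\<bar>(norm x)\<^sup>2 - (norm y)\<^sup>2\<bar> \<le> norm (x - y) * (norm x + norm y)"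
proof -
  have "\<bar>(norm x)\<^sup>2 - (norm y)\<^sup>2\<bar> = \<bar>norm x - norm y\<bar> * (norm x + norm y)"
    by (simp add: power2_eq_square square_diff_square_factored abs_mult)
  also have "\<dots> \<le> norm (x - y) * (norm x + norm y)" by (intro mult_right_mono norm_triangle_ineq3) simp
  finally show ?thesis .
qed

text \<open>By Rolle some tangent is orthogonal to the initial one, so the tangent moves by at least 1.\<close>

lemma closed_curve_bending:
  fixes u0 :: "real \<Rightarrow> 'v::euclidean_space"
  assumes per: "periodic1 u0" and d: "\<And>s. (u0 has_vector_derivative u1 s) (at s)" "\<And>s. (u1 has_vector_derivative u2 s) (at s)"
    and n: "\<And>s. norm (u1 s) = 1" and c: "continuous_on UNIV u2"
  shows "1 \<le> integral {0..1} (\<lambda>s. (norm (u2 s))\<^sup>2)"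
proof -
  define e where "e = u1 0"
  define \<phi> where "\<phi> s = u0 s \<bullet> e" for s
  have D: "(\<phi> has_derivative (\<lambda>h. h * (u1 s \<bullet> e))) (at s)" for s
  proof -
    have "(u0 has_derivative (\<lambda>h. h *\<^sub>R u1 s)) (at s)" using d(1) by (simp add: has_vector_derivative_def)
    from has_derivative_inner_left[OF this, of e] show ?thesis by (simp add: \<phi>_def[abs_def])
  qed
  have "u0 1 = u0 0" using per unfolding periodic1_def by (metis add_0)
  then have "\<phi> 0 = \<phi> 1" by (simp add: \<phi>_def)
  moreover have "continuous_on {0..1} \<phi>" using D by (meson continuous_at_imp_continuous_on has_derivative_continuous)
  ultimately obtain z where z: "0 < z" "z < 1" "(\<lambda>h. h * (u1 z \<bullet> e)) = (\<lambda>h. 0)"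
    using Rolle_deriv[of 0 1 \<phi> "\<lambda>s h. h * (u1 s \<bullet> e)"] D by auto
  have "u1 z \<bullet> e = 0" using fun_cong[OF z(3), of 1] by simp
  then have "(norm (u1 z - e))\<^sup>2 = 2"
    using n[of z] n[of 0] by (simp add: power2_norm_eq_inner inner_diff inner_commute e_def norm_eq_1)
  then have "1\<^sup>2 \<le> (norm (u1 z - e))\<^sup>2" by simp
  then have 1: "1 \<le> norm (u1 z - e)" by (rule power2_le_imp_le) simp
  also have "norm (u1 z - e) \<le> integral {0..1} (\<lambda>s. norm (u2 s))"
    unfolding e_def using z by (intro norm_diff_le_integral[OF d(2) c]) auto
  finally have "1\<^sup>2 \<le> (integral {0..1} (\<lambda>s. norm (u2 s)))\<^sup>2" by (intro power_mono) auto
  also have "\<dots> \<le> integral {0..1} (\<lambda>s. (norm (u2 s))\<^sup>2)"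
    by (rule integral_norm_square_le[OF continuous_on_subset[OF c]]) simp
  finally show ?thesis by simp
qed

definition init :: "real \<Rightarrow> real \<Rightarrow> (real \<Rightarrow> 'v::euclidean_space) \<Rightarrow> (real \<Rightarrow> 'v) \<Rightarrow> (real \<Rightarrow> 'v) \<Rightarrow> bool" where
  "init a R u0 u1 u2 \<longleftrightarrow> 1 \<le> R \<and> periodic1 u0 \<and> (\<forall>s. (u0 has_vector_derivative u1 s) (at s)) \<and> (\<forall>s. (u1 has_vector_derivative u2 s) (at s))
    \<and> (\<forall>s. norm (u0 s) \<le> R \<and> norm (u1 s) = 1) \<and> holder a R u2"

text \<open>Two constants, because for the linear solutions the sup bound \<kappa> tends to 0 with
  time while the Hoelder constant \<open>K\<close> of the second derivative is only bounded.\<close>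

definition jet :: "real \<Rightarrow> real \<Rightarrow> real \<Rightarrow> (real \<Rightarrow> 'v::euclidean_space) \<Rightarrow> (real \<Rightarrow> 'v) \<Rightarrow> (real \<Rightarrow> 'v) \<Rightarrow> bool" where
  "jet a \<kappa> K v0 v1 v2 \<longleftrightarrow> periodic1 v0 \<and> (\<forall>s. (v0 has_vector_derivative v1 s) (at s)) \<and> (\<forall>s. (v1 has_vector_derivative v2 s) (at s))
    \<and> (\<forall>s. norm (v0 s) \<le> \<kappa> \<and> norm (v1 s) \<le> \<kappa> \<and> norm (v2 s) \<le> \<kappa>) \<and> holder a K v2"

lemma jet_zero: "0 \<le> \<kappa> \<Longrightarrow> 0 \<le> K \<Longrightarrow> jet a \<kappa> K (\<lambda>_. 0) (\<lambda>_. 0) (\<lambda>_. 0)"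
  by (auto simp: jet_def periodic1_def holder_zero)

definition pt :: "(real \<Rightarrow> 'v::euclidean_space) \<Rightarrow> (real \<Rightarrow> 'v) \<Rightarrow> real \<Rightarrow> real" where
  "pt u2 v2 s = (norm (u2 s + v2 s))\<^sup>2"

definition flux :: "(real \<Rightarrow> real) \<Rightarrow> (real \<Rightarrow> real) \<Rightarrow> (real \<Rightarrow> 'v::euclidean_space) \<Rightarrow> (real \<Rightarrow> 'v) \<Rightarrow> (real \<Rightarrow> 'v) \<Rightarrow> real \<Rightarrow> 'v" where
  "flux \<sigma> \<sigma>1 x0 x1 x2 s = \<sigma> s *\<^sub>R x2 s + \<sigma>1 s *\<^sub>R x1 s + x0 s"

text \<open>The nonlinearity minus the linear operator frozen at the initial tension c; its fixed points solve the problem.\<close>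

definition rhs :: "(real \<Rightarrow> real) \<Rightarrow> (real \<Rightarrow> real) \<Rightarrow> (real \<Rightarrow> real) \<Rightarrow> (real \<Rightarrow> real) \<Rightarrow>
   (real \<Rightarrow> 'v::euclidean_space) \<Rightarrow> (real \<Rightarrow> 'v) \<Rightarrow> (real \<Rightarrow> 'v) \<Rightarrow> (real \<Rightarrow> 'v) \<Rightarrow> (real \<Rightarrow> 'v) \<Rightarrow> (real \<Rightarrow> 'v) \<Rightarrow> real \<Rightarrow> 'v" where
  "rhs c c1 \<sigma> \<sigma>1 u0 u1 u2 v0 v1 v2 s =
     flux \<sigma> \<sigma>1 (\<lambda>s. u0 s + v0 s) (\<lambda>s. u1 s + v1 s) (\<lambda>s. u2 s + v2 s) s - c s *\<^sub>R v2 s - (c1 s / 2) *\<^sub>R v1 s"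

definition pot_max :: "real \<Rightarrow> real" where "pot_max R = (R + 1)\<^sup>2"

text \<open>The constants come from termwise product estimates of the difference of two right-hand
  sides. The Hoelder constant \<open>H\<close> of the second-order difference enters only multiplied
  by the small \<kappa>.\<close>

definition hdiff_con :: "real \<Rightarrow> real \<Rightarrow> real \<Rightarrow> real \<Rightarrow> real \<Rightarrow> real" where
  "hdiff_con R \<kappa> K \<eta> H = 864 * pot_max R * R * \<kappa> * H + 1152 * pot_max R * R * \<eta> * (R + K) + 144 * pot_max R * \<eta>
     + 2304 * pot_max R * R * (R + 1) * \<eta> + 2 * \<eta>"

definition sdiff_con :: "real \<Rightarrow> real" where
  "sdiff_con R = 16 + 576 * pot_max R * R * (R + 1) + 18 * pot_max R + 1"

lemma pot_max_ge: "1 \<le> R \<Longrightarrow> 1 \<le> pot_max R"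
  unfolding pot_max_def by (rule one_le_power) simp

context
  fixes a R \<kappa> K :: real and u0 u1 u2 :: "real \<Rightarrow> 'v::euclidean_space" and c c1 :: "real \<Rightarrow> real"
  assumes a: "0 < a" "a < 1" and i: "init a R u0 u1 u2" and \<kappa>: "6 * R * \<kappa> \<le> 1"
begin

lemma initD: "1 \<le> R" "periodic1 u0" "(u0 has_vector_derivative u1 s) (at s)" "(u1 has_vector_derivative u2 s) (at s)"
  "norm (u0 s) \<le> R" "norm (u1 s) = 1" "holder a R u2" "norm (u2 s) \<le> R"
  using i holderD1[of a R u2] by (auto simp: init_def)

lemma jet_small: "jet a \<kappa> K v0 v1 v2 \<Longrightarrow> norm (v0 s) \<le> \<kappa> \<and> norm (v1 s) \<le> \<kappa> \<and> norm (v2 s) \<le> \<kappa> \<and> \<kappa> \<le> 1 \<and> 0 \<le> \<kappa>"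
proof -
  assume j: "jet a \<kappa> K v0 v1 v2"
  then have n: "norm (v0 s) \<le> \<kappa>" "norm (v1 s) \<le> \<kappa>" "norm (v2 s) \<le> \<kappa>" by (auto simp: jet_def)
  then have k0: "0 \<le> \<kappa>" using norm_ge_zero order_trans by blast
  have "1 * \<kappa> \<le> (6 * R) * \<kappa>" using initD(1) k0 by (intro mult_right_mono) auto
  then show ?thesis using n k0 \<kappa> by simp
qed

text \<open>The difference of squares factors. Both vectors are bounded by R + \<kappa> \<le> 2 R,
  and for the zero jet one of them by R, which gives 4 R and 3 R.\<close>

lemma pt_diff:
  assumes j: "jet a \<kappa> K v0 v1 v2" "jet a \<kappa> K w0 w1 w2" and h: "norm (v2 s - w2 s) \<le> \<eta>"
  shows "\<bar>pt u2 v2 s - pt u2 w2 s\<bar> \<le> 4 * R * \<eta>" "w2 = (\<lambda>_. 0) \<Longrightarrow> \<bar>pt u2 v2 s - pt u2 w2 s\<bar> \<le> 3 * R * \<kappa>"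
proof -
  note s = jet_small[OF j(1), of s] jet_small[OF j(2), of s]
  have e: "0 \<le> \<eta>" using h norm_ge_zero order_trans by blast
  have b: "norm (u2 s + v2 s) \<le> R + \<kappa>" "norm (u2 s + w2 s) \<le> R + \<kappa>"
    using norm_triangle_ineq[of "u2 s" "v2 s"] norm_triangle_ineq[of "u2 s" "w2 s"] initD(8)[of s] s by linarith+
  have "\<bar>pt u2 v2 s - pt u2 w2 s\<bar> \<le> norm ((u2 s + v2 s) - (u2 s + w2 s)) * (norm (u2 s + v2 s) + norm (u2 s + w2 s))"
    unfolding pt_def by (rule norm_square_diff_le)
  also have "\<dots> \<le> \<eta> * (4 * R)"
    using h b e s initD(1) by (intro mult_mono) auto
  finally show "\<bar>pt u2 v2 s - pt u2 w2 s\<bar> \<le> 4 * R * \<eta>" by (simp add: mult_ac)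
  assume w: "w2 = (\<lambda>_. 0)"
  have "\<bar>pt u2 v2 s - pt u2 w2 s\<bar> \<le> norm ((u2 s + v2 s) - (u2 s + w2 s)) * (norm (u2 s + v2 s) + norm (u2 s + w2 s))"
    unfolding pt_def by (rule norm_square_diff_le)
  also have "\<dots> \<le> \<kappa> * (3 * R)"
    using b s initD(1) initD(8)[of s] by (intro mult_mono) (auto simp: w)
  finally show "\<bar>pt u2 v2 s - pt u2 w2 s\<bar> \<le> 3 * R * \<kappa>" by (simp add: mult_ac)
qed

text \<open>The initial squared curvature has mean at least 1, and the perturbation changes it by at
  most 3 R \<kappa> \<le> 1/2; this is what the smallness of \<kappa> is for.\<close>

lemma pt_pot:
  assumes j: "jet a \<kappa> K v0 v1 v2"
  shows "pot (pot_max R) (pt u2 v2)"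
proof -
  have K0: "0 \<le> K" using j holder_nonneg by (auto simp: jet_def)
  have c2: "continuous_on S u2" "continuous_on S v2" for S
    using holder_continuous[OF a(1) initD(7)] j holder_continuous[OF a(1), of K v2] continuous_on_subset by (auto simp: jet_def)
  have cc: "continuous_on S (pt u2 v2)" "continuous_on S (pt u2 (\<lambda>_. 0))" for S
    unfolding pt_def by (intro continuous_intros c2)+
  have j': "periodic1 v0" "(v0 has_vector_derivative v1 s) (at s)" "(v1 has_vector_derivative v2 s) (at s)" for s
    using j by (auto simp: jet_def)
  have p2: "periodic1 u2"
    by (rule periodic1_has_vector_derivative[OF periodic1_has_vector_derivative[OF initD(2,3)] initD(4)])
  have p2': "periodic1 v2"
    by (rule periodic1_has_vector_derivative[OF periodic1_has_vector_derivative[OF j'(1,2)] j'(3)])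
  have z: "jet a \<kappa> K (\<lambda>_. 0) (\<lambda>_. 0) (\<lambda>_. 0::'v)" using jet_small[OF j] K0 by (intro jet_zero) auto
  have "1 / 2 \<le> 1 - 3 * R * \<kappa>" using \<kappa> by simp
  also have "\<dots> \<le> integral {0..1} (pt u2 (\<lambda>_. 0)) - 3 * R * \<kappa>"
    using closed_curve_bending[OF initD(2,3,4,6) c2(1)] by (simp add: pt_def[abs_def])
  also have "\<dots> = integral {0..1} (\<lambda>s. pt u2 (\<lambda>_. 0) s - 3 * R * \<kappa>)"
  proof -
    have "((\<lambda>s. pt u2 (\<lambda>_. 0) s - 3 * R * \<kappa>) has_integral (integral {0..1} (pt u2 (\<lambda>_. 0)) - 3 * R * \<kappa>)) {0..1}"
      using has_integral_const_real[of "3 * R * \<kappa>" 0 1]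
      by (intro has_integral_diff integrable_integral integrable_continuous_interval cc) simp
    then show ?thesis by (simp add: integral_unique)
  qed
  also have "\<dots> \<le> integral {0..1} (pt u2 v2)"
  proof (rule integral_le)
    show "(\<lambda>s. pt u2 (\<lambda>_. 0) s - 3 * R * \<kappa>) integrable_on {0..1}" "pt u2 v2 integrable_on {0..1}"
      by (intro integrable_continuous_interval continuous_intros cc)+
    show "pt u2 (\<lambda>_. 0) s - 3 * R * \<kappa> \<le> pt u2 v2 s" for s
      using pt_diff(2)[OF j z order_refl refl, of s] by (simp add: abs_le_iff)
  qed
  finally have "1 / 2 \<le> integral {0..1} (pt u2 v2)" .
  moreover have "pt u2 v2 s \<le> pot_max R" for s
  proof -
    have "norm (u2 s + v2 s) \<le> R + 1"
      using norm_triangle_ineq[of "u2 s" "v2 s"] initD(8)[of s] jet_small[OF j, of s] by linarith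
    then show ?thesis unfolding pt_def pot_max_def by (intro power_mono) auto
  qed
  moreover have "periodic1 (pt u2 v2)" using p2 p2' by (simp add: periodic1_def pt_def)
  moreover have "0 \<le> pt u2 v2 s" for s by (simp add: pt_def)
  ultimately show ?thesis unfolding pot_def using cc(1)[of UNIV] by blast
qed

text \<open>The decomposition behind the contraction: the difference of second derivatives is
  multiplied only by \<sigma> - c, which is small near the initial time; all other terms contain
  tension differences or lower-order differences.\<close>

lemma rhs_diff:
  "rhs c c1 \<sigma> \<sigma>1 u0 u1 u2 v0 v1 v2 s - rhs c c1 \<tau> \<tau>1 u0 u1 u2 w0 w1 w2 s =
    (\<sigma> s - c s) *\<^sub>R (v2 s - w2 s) + (\<sigma> s - \<tau> s) *\<^sub>R (u2 s + w2 s) + (\<sigma>1 s - c1 s / 2) *\<^sub>R (v1 s - w1 s)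
    + (\<sigma>1 s - \<tau>1 s) *\<^sub>R (u1 s + w1 s) + (v0 s - w0 s)"
  by (simp add: rhs_def flux_def algebra_simps)

context
  fixes v0 v1 v2 w0 w1 w2 :: "real \<Rightarrow> 'v" and \<sigma> \<sigma>1 \<tau> \<tau>1 :: "real \<Rightarrow> real" and \<eta> :: real
  assumes c: "solves_ell (pt u2 (\<lambda>_. 0)) c c1"
    and j: "jet a \<kappa> K v0 v1 v2" "jet a \<kappa> K w0 w1 w2"
    and s: "solves_ell (pt u2 v2) \<sigma> \<sigma>1" "solves_ell (pt u2 w2) \<tau> \<tau>1"
    and h: "\<And>s. norm (v0 s - w0 s) \<le> \<eta>" "\<And>s. norm (v1 s - w1 s) \<le> \<eta>" "\<And>s. norm (v2 s - w2 s) \<le> \<eta>"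
begin

lemma jet_zero_K: "jet a \<kappa> K (\<lambda>_. 0) (\<lambda>_. 0) (\<lambda>_. 0::'v)"
  using jet_small[OF j(1)] j(1) holder_nonneg by (intro jet_zero) (auto simp: jet_def)

lemma rhs_holder_diff:
  assumes H: "holder a H (\<lambda>s. v2 s - w2 s)"
  shows "holder a (hdiff_con R \<kappa> K \<eta> H) (\<lambda>s. rhs c c1 \<sigma> \<sigma>1 u0 u1 u2 v0 v1 v2 s - rhs c c1 \<tau> \<tau>1 u0 u1 u2 w0 w1 w2 s)"
proof -
  note P = pot_max_ge[OF initD(1)]
  note pv = pt_pot[OF j(1)] and pw = pt_pot[OF j(2)] and pz = pt_pot[OF jet_zero_K]
  have j': "(v0 has_vector_derivative v1 s) (at s)" "(v1 has_vector_derivative v2 s) (at s)"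
      "(w0 has_vector_derivative w1 s) (at s)" "(w1 has_vector_derivative w2 s) (at s)" "holder a K v2" "holder a K w2" for s
    using j by (auto simp: jet_def)
  have 1: "holder a (144 * pot_max R * (3 * R * \<kappa>)) (\<lambda>s. \<sigma> s - c s)"
    by (rule solves_ell_diff_holder(1)[OF a s(1) c pv pz P pt_diff(2)[OF j(1) jet_zero_K order_refl refl]])
  have 2: "holder a (144 * pot_max R * (4 * R * \<eta>)) (\<lambda>s. \<sigma> s - \<tau> s)" "holder a (144 * pot_max R * (4 * R * \<eta>)) (\<lambda>s. \<sigma>1 s - \<tau>1 s)"
    by (rule solves_ell_diff_holder[OF a s pv pw P pt_diff(1)[OF j h(3)]])+
  have 3: "holder a (R + K) (\<lambda>s. u2 s + w2 s)" by (rule holder_add[OF initD(7) j'(6)])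
  have c1h: "holder a (18 * pot_max R) (\<lambda>s. c1 s / 2)"
  proof -
    have x: "holder a (18 * pot_max R) c1" by (rule solves_ell_holder(2)[OF a c pz P])
    show ?thesis
    proof (rule holderI)
      show "norm (c1 x / 2) \<le> 18 * pot_max R" for x using holderD1[OF x, of x] by simp
      show "norm (c1 x / 2 - c1 y / 2) \<le> 18 * pot_max R * \<bar>x - y\<bar> powr a" for x y
        using holderD2[OF x, of x y] by (simp flip: diff_divide_distrib)
    qed
  qed
  have 4: "holder a (18 * pot_max R + 18 * pot_max R) (\<lambda>s. \<sigma>1 s - c1 s / 2)"
    by (rule holder_diff[OF solves_ell_holder(2)[OF a s(1) pv P] c1h])
  have 5: "holder a (2 * \<eta>) (\<lambda>s. v1 s - w1 s)"
    by (rule holder_C1[where g' = "\<lambda>s. v2 s - w2 s"]) (use a j' h in \<open>auto intro!: has_vector_derivative_diff\<close>)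
  have 6: "holder a (2 * \<eta>) (\<lambda>s. v0 s - w0 s)"
    by (rule holder_C1[where g' = "\<lambda>s. v1 s - w1 s"]) (use a j' h in \<open>auto intro!: has_vector_derivative_diff\<close>)
  have 7: "holder a (2 * (R + 1)) (\<lambda>s. u1 s + w1 s)"
  proof (rule holder_C1[where g' = "\<lambda>s. u2 s + w2 s"])
    show "norm (u1 x + w1 x) \<le> R + 1" for x
      using norm_triangle_ineq[of "u1 x" "w1 x"] initD(6)[of x] initD(1) jet_small[OF j(2), of x] by linarith
    show "norm (u2 x + w2 x) \<le> R + 1" for x
      using norm_triangle_ineq[of "u2 x" "w2 x"] initD(8)[of x] jet_small[OF j(2), of x] by linarith
  qed (use a j' initD in \<open>auto intro!: has_vector_derivative_add\<close>)
  have "holder a (2 * (144 * pot_max R * (3 * R * \<kappa>)) * H + 2 * (144 * pot_max R * (4 * R * \<eta>)) * (R + K)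
     + 2 * (18 * pot_max R + 18 * pot_max R) * (2 * \<eta>) + 2 * (144 * pot_max R * (4 * R * \<eta>)) * (2 * (R + 1)) + 2 * \<eta>)
     (\<lambda>s. rhs c c1 \<sigma> \<sigma>1 u0 u1 u2 v0 v1 v2 s - rhs c c1 \<tau> \<tau>1 u0 u1 u2 w0 w1 w2 s)"
    unfolding rhs_diff by (intro holder_add holder_scaleR 1 2 3 4 5 6 7 H)
  moreover have "2 * (144 * pot_max R * (3 * R * \<kappa>)) * H + 2 * (144 * pot_max R * (4 * R * \<eta>)) * (R + K)
     + 2 * (18 * pot_max R + 18 * pot_max R) * (2 * \<eta>) + 2 * (144 * pot_max R * (4 * R * \<eta>)) * (2 * (R + 1)) + 2 * \<eta> = hdiff_con R \<kappa> K \<eta> H"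
    unfolding hdiff_con_def by algebra
  ultimately show ?thesis by simp
qed

text \<open>The sup-norm counterpart; applied to one forcing at two times, it yields the modulus in
  time of the Picard image.\<close>

lemma rhs_sup_diff:
  "norm (rhs c c1 \<sigma> \<sigma>1 u0 u1 u2 v0 v1 v2 s - rhs c c1 \<tau> \<tau>1 u0 u1 u2 w0 w1 w2 s) \<le> sdiff_con R * \<eta>"
proof -
  note P = pot_max_ge[OF initD(1)]
  note pv = pt_pot[OF j(1)] and pw = pt_pot[OF j(2)] and pz = pt_pot[OF jet_zero_K]
  have e: "0 \<le> \<eta>" using h(1)[of 0] norm_ge_zero order_trans by blast
  have 1: "\<bar>\<sigma> s - c s\<bar> \<le> 16"
    using solves_ell_bounds(2)[OF s(1) pv, of s] solves_ell_bounds(2)[OF c pz, of s] by linarith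
  have 2: "\<bar>\<sigma> s - \<tau> s\<bar> \<le> 72 * pot_max R * (4 * R * \<eta>)" "\<bar>\<sigma>1 s - \<tau>1 s\<bar> \<le> 72 * pot_max R * (4 * R * \<eta>)"
    by (rule solves_ell_diff[OF s pv pw P pt_diff(1)[OF j h(3)]])+
  have 3: "\<bar>\<sigma>1 s - c1 s / 2\<bar> \<le> 18 * pot_max R"
    using solves_ell_bounds(4)[OF s(1) pv, of s] solves_ell_bounds(4)[OF c pz, of s] P by linarith
  have 4: "norm (u1 s + w1 s) \<le> R + 1" "norm (u2 s + w2 s) \<le> R + 1"
    using norm_triangle_ineq[of "u1 s" "w1 s"] initD(6)[of s] initD(1) jet_small[OF j(2), of s]
      norm_triangle_ineq[of "u2 s" "w2 s"] initD(8)[of s] by linarith+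
  have "norm ((\<sigma> s - c s) *\<^sub>R (v2 s - w2 s) + (\<sigma> s - \<tau> s) *\<^sub>R (u2 s + w2 s) + (\<sigma>1 s - c1 s / 2) *\<^sub>R (v1 s - w1 s)
    + (\<sigma>1 s - \<tau>1 s) *\<^sub>R (u1 s + w1 s) + (v0 s - w0 s)) \<le> 16 * \<eta> + 72 * pot_max R * (4 * R * \<eta>) * (R + 1) + 18 * pot_max R * \<eta>
    + 72 * pot_max R * (4 * R * \<eta>) * (R + 1) + \<eta>"
    using e 1 2 3 4 h initD(1) P by (intro norm_triangle_mono) (auto intro!: mult_mono)
  also have "\<dots> = sdiff_con R * \<eta>" unfolding sdiff_con_def by algebra
  finally show ?thesis unfolding rhs_diff .
qed

end

text \<open>The size of the image of the zero forcing, which fixes the radius of the ball.\<close>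

lemma flux_zero_holder:
  assumes c: "solves_ell (pt u2 (\<lambda>_. 0)) c c1" and p: "pot (pot_max R) (pt u2 (\<lambda>_. 0))"
  shows "holder a (108 * pot_max R * R + 2 * R) (rhs c c1 c c1 u0 u1 u2 (\<lambda>_. 0) (\<lambda>_. 0) (\<lambda>_. 0))"
proof -
  note P = pot_max_ge[OF initD(1)]
  have 1: "holder a (2 * R) u0" by (rule holder_C1[where g' = u1]) (use a initD in auto)
  have 2: "holder a (2 * R) u1" by (rule holder_C1[where g' = u2]) (use a initD in auto)
  have "holder a (2 * (18 * pot_max R) * R + 2 * (18 * pot_max R) * (2 * R) + 2 * R) (\<lambda>s. c s *\<^sub>R u2 s + c1 s *\<^sub>R u1 s + u0 s)"
    by (intro holder_add holder_scaleR solves_ell_holder[OF a c p P] 1 2 initD(7))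
  moreover have "2 * (18 * pot_max R) * R + 2 * (18 * pot_max R) * (2 * R) + 2 * R = 108 * pot_max R * R + 2 * R" by algebra
  ultimately have "holder a (108 * pot_max R * R + 2 * R) (\<lambda>s. c s *\<^sub>R u2 s + c1 s *\<^sub>R u1 s + u0 s)" by (simp only:)
  then show ?thesis unfolding rhs_def[abs_def] flux_def by simp
qed

end

section \<open>Local existence\<close>

text \<open>Increments in space are controlled uniformly in time, so only continuity in time at the
  limiting space point remains.\<close>

lemma continuous_on_joint:
  fixes F :: "real \<Rightarrow> real \<Rightarrow> 'v::real_normed_vector"
  assumes a: "0 < a" and h: "\<And>t. holder a M (F t)" and c: "\<And>s. continuous_on UNIV (\<lambda>t. F t s)"
  shows "continuous_on UNIV (\<lambda>p. F (fst p) (snd p))"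
proof (rule continuous_on_sequentiallyI)
  fix u :: "nat \<Rightarrow> real \<times> real" and q assume u: "u \<longlonglongrightarrow> q"
  have u1: "(\<lambda>n. fst (u n)) \<longlonglongrightarrow> fst q" and u2: "(\<lambda>n. snd (u n)) \<longlonglongrightarrow> snd q"
    using u by (auto intro: tendsto_fst tendsto_snd)
  have "(\<lambda>n. M * \<bar>snd (u n) - snd q\<bar> powr a + norm (F (fst (u n)) (snd q) - F (fst q) (snd q))) \<longlonglongrightarrow>
     M * \<bar>snd q - snd q\<bar> powr a + norm (F (fst q) (snd q) - F (fst q) (snd q))"
  proof (intro tendsto_intros u2)
    show "(\<lambda>n. F (fst (u n)) (snd q)) \<longlonglongrightarrow> F (fst q) (snd q)"
      using c[of "snd q"] u1 unfolding continuous_on_sequentially comp_def by blast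
  qed (use a u in auto)
  then have "(\<lambda>n. M * \<bar>snd (u n) - snd q\<bar> powr a + norm (F (fst (u n)) (snd q) - F (fst q) (snd q))) \<longlonglongrightarrow> 0"
    by simp
  then have "(\<lambda>n. F (fst (u n)) (snd (u n)) - F (fst q) (snd q)) \<longlonglongrightarrow> 0"
  proof (rule Lim_null_comparison[rotated])
    show "\<forall>\<^sub>F n in sequentially. norm (F (fst (u n)) (snd (u n)) - F (fst q) (snd q)) \<le>
      M * \<bar>snd (u n) - snd q\<bar> powr a + norm (F (fst (u n)) (snd q) - F (fst q) (snd q))"
    proof (intro always_eventually allI)
      fix n
      have "norm (F (fst (u n)) (snd (u n)) - F (fst q) (snd q)) \<le>
        norm (F (fst (u n)) (snd (u n)) - F (fst (u n)) (snd q)) + norm (F (fst (u n)) (snd q) - F (fst q) (snd q))"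
        using norm_triangle_ineq[of "F (fst (u n)) (snd (u n)) - F (fst (u n)) (snd q)" "F (fst (u n)) (snd q) - F (fst q) (snd q)"] by simp
      then show "norm (F (fst (u n)) (snd (u n)) - F (fst q) (snd q)) \<le>
        M * \<bar>snd (u n) - snd q\<bar> powr a + norm (F (fst (u n)) (snd q) - F (fst q) (snd q))"
        using holderD2[OF h, of "fst (u n)" "snd (u n)" "snd q"] by linarith
    qed
  qed
  then show "(\<lambda>n. F (fst (u n)) (snd (u n))) \<longlonglongrightarrow> F (fst q) (snd q)" by (rule LIM_zero_cancel)
qed

text \<open>Derivatives appear as explicit functions and all bounds share one \<open>K\<close>; this
  separates the analysis from the derivative operators and suprema in
  \<open>is_solution\<close>.\<close>

definition classical :: "real \<Rightarrow> real \<Rightarrow> real \<Rightarrow> (real \<Rightarrow> real \<Rightarrow> 'v::euclidean_space) \<Rightarrow> (real \<Rightarrow> real \<Rightarrow> 'v) \<Rightarrow> (real \<Rightarrow> real \<Rightarrow> 'v)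
    \<Rightarrow> (real \<Rightarrow> real \<Rightarrow> 'v) \<Rightarrow> (real \<Rightarrow> real \<Rightarrow> real) \<Rightarrow> (real \<Rightarrow> real \<Rightarrow> real) \<Rightarrow> bool" where
  "classical a T K x0 x1 x2 xt \<sigma> \<sigma>1 \<longleftrightarrow>
    (\<forall>t\<in>{0..T}. jet a K K (x0 t) (x1 t) (x2 t) \<and> holder a K (xt t) \<and> periodic1 (xt t)
      \<and> solves_ell (\<lambda>s. (norm (x2 t s))\<^sup>2) (\<sigma> t) (\<sigma>1 t)
      \<and> (\<forall>s. xt t s = flux (\<sigma> t) (\<sigma>1 t) (x0 t) (x1 t) (x2 t) s)
      \<and> (\<forall>s. ((\<lambda>t. x0 t s) has_vector_derivative xt t s) (at t within {0..T})))
    \<and> (\<forall>t\<in>{0..T}. \<forall>t'\<in>{0..T}. \<forall>s. norm (x0 t s - x0 t' s) \<le> K * \<bar>t - t'\<bar> powr (a / 2)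
      \<and> norm (x1 t s - x1 t' s) \<le> K * \<bar>t - t'\<bar> powr (a / 2) \<and> norm (x2 t s - x2 t' s) \<le> K * \<bar>t - t'\<bar> powr (a / 2)
      \<and> norm (xt t s - xt t' s) \<le> K * \<bar>t - t'\<bar> powr (a / 2))"

section \<open>Constants and the lifespan, depending on the exponent and the initial norm\<close>

context
  fixes a R :: real
  assumes a: "0 < a" "a < 1" and R: "1 \<le> R"
begin

text \<open>With P = \<open>pot_max R\<close>, the initial tension is bounded by 8, its inverse by P
  and its derivatives by 8 P + 1; 9 P exceeds all of these.\<close>

definition "coeff_bound = 9 * pot_max R"
definition "lin_const = lin_sol_const a coeff_bound"
text \<open>Twice the bound for the image of the zero forcing: a map contracting by 1/2 preserves
  the ball of this radius.\<close>

definition "radius = 2 * (108 * pot_max R * R + 2 * R)"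
text \<open>What remains of \<open>hdiff_con\<close> after the substitutions of
  \<open>hdiff_con_scale\<close>, where every term is proportional to the time factor.\<close>

definition "contr_const = lin_const * (864 * pot_max R * R * lin_const * radius + 1152 * pot_max R * R * (R + lin_const * radius) + 144 * pot_max R + 2304 * pot_max R * R * (R + 1) + 2)"
text \<open>The first summand of the denominator makes the map a contraction, the second keeps the
  mean squared curvature above 1/2; the exponent 2/a inverts t^(a/2).\<close>

definition "lifespan = (1 / (2 * contr_const + 6 * R * lin_const * radius)) powr (2 / a)"

lemma pot_max_ge_1: "1 \<le> pot_max R" using pot_max_ge[OF R] .

lemma coeff_bound_ge: "1 \<le> coeff_bound" using pot_max_ge_1 by (simp add: coeff_bound_def)

lemma lin_const_ge: "1 \<le> lin_const"
proof -
  have "coeff coeff_bound (\<lambda>_. 1) (\<lambda>_. 0) (\<lambda>_. 0)" using coeff_bound_ge by (auto simp: coeff_def periodic1_def)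
  from lin_sol_const_ge(1)[OF a this] show ?thesis by (simp add: lin_const_def)
qed

lemma radius_nonneg: "0 \<le> radius" using pot_max_ge_1 R by (simp add: radius_def)

lemma contr_const_ge: "2 \<le> contr_const"
proof -
  have 1: "2 \<le> 864 * pot_max R * R * lin_const * radius + 1152 * pot_max R * R * (R + lin_const * radius) + 144 * pot_max R + 2304 * pot_max R * R * (R + 1) + 2"
    using pot_max_ge_1 R lin_const_ge radius_nonneg by (simp add: add_nonneg_nonneg)
  have "1 * 2 \<le> contr_const" unfolding contr_const_def using lin_const_ge 1 by (intro mult_mono) auto
  then show ?thesis by simp
qed

lemma lifespan: "0 < lifespan" "lifespan \<le> 1"
  "0 \<le> t \<Longrightarrow> t \<le> lifespan \<Longrightarrow> contr_const * t powr (a / 2) \<le> 1 / 2"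
  "0 \<le> t \<Longrightarrow> t \<le> lifespan \<Longrightarrow> 6 * R * (lin_const * radius * t powr (a / 2)) \<le> 1"
proof -
  define q where "q = 6 * R * lin_const * radius"
  have q: "0 \<le> q" using R lin_const_ge radius_nonneg by (simp add: q_def)
  define D where "D = 2 * contr_const + q"
  have D: "4 \<le> D" using q contr_const_ge by (simp add: D_def)
  have T: "lifespan = (1 / D) powr (2 / a)" by (simp add: lifespan_def D_def q_def)
  show "0 < lifespan" "lifespan \<le> 1" unfolding T using D a by (auto intro!: powr_le1)
  assume t: "0 \<le> t" "t \<le> lifespan"
  have "t powr (a / 2) \<le> lifespan powr (a / 2)" using t a by (intro powr_mono2) auto
  also have "\<dots> = 1 / D" unfolding T using D a by (simp add: powr_powr)
  finally have tp: "D * t powr (a / 2) \<le> 1" using D by (simp add: field_simps)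
  have t0: "0 \<le> t powr (a / 2)" by simp
  have "2 * (contr_const * t powr (a / 2)) + q * t powr (a / 2) \<le> 1" using tp by (simp add: D_def algebra_simps)
  moreover have "0 \<le> q * t powr (a / 2)" "0 \<le> contr_const * t powr (a / 2)" using q contr_const_ge t0 by auto
  ultimately show "contr_const * t powr (a / 2) \<le> 1 / 2" "6 * R * (lin_const * radius * t powr (a / 2)) \<le> 1"
    by (simp_all add: q_def mult_ac)
qed

text \<open>A sum of nonnegative bounds for, in turn, the sup norms, the modulus of the second
  derivative, the norm of the rate in space and its modulus in time.\<close>

definition "sol_bound = (R + 1) + (R + lin_const * radius) + (36 * pot_max R * (R + lin_const * radius) + 72 * pot_max R * (R + 1) + 2 * (R + 1))
   + (sdiff_con R + 8 + 9 * pot_max R) * (lin_const * radius)"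

lemma lin_radius_nonneg: "0 \<le> lin_const * radius" using lin_const_ge radius_nonneg by simp

lemma sup_const_ge_1: "1 \<le> sdiff_con R"
  using pot_max_ge_1 R by (simp add: sdiff_con_def add_nonneg_nonneg)

lemma sol_bound_ge: "R + 1 \<le> sol_bound" "R + lin_const * radius \<le> sol_bound" "36 * pot_max R * (R + lin_const * radius) + 72 * pot_max R * (R + 1) + 2 * (R + 1) \<le> sol_bound"
  "(sdiff_con R + 8 + 9 * pot_max R) * (lin_const * radius) \<le> sol_bound" "lin_const * radius \<le> sol_bound"
proof -
  have "0 \<le> R + 1" "0 \<le> R + lin_const * radius" "0 \<le> (sdiff_con R + 8 + 9 * pot_max R) * (lin_const * radius)"
    "0 \<le> 36 * pot_max R * (R + lin_const * radius) + 72 * pot_max R * (R + 1) + 2 * (R + 1)"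
    using lin_radius_nonneg R pot_max_ge_1 sup_const_ge_1 by (auto intro!: add_nonneg_nonneg mult_nonneg_nonneg)
  then show "R + 1 \<le> sol_bound" "R + lin_const * radius \<le> sol_bound" "36 * pot_max R * (R + lin_const * radius) + 72 * pot_max R * (R + 1) + 2 * (R + 1) \<le> sol_bound"
    "(sdiff_con R + 8 + 9 * pot_max R) * (lin_const * radius) \<le> sol_bound" "lin_const * radius \<le> sol_bound"
    unfolding sol_bound_def using R by linarith+
qed

section \<open>The Picard map on forcings and its fixed point\<close>

context
  fixes u0 u1 u2 :: "real \<Rightarrow> 'v::euclidean_space"
  assumes i: "init a R u0 u1 u2"
begin

definition "tension0 = fst (ell (pt u2 (\<lambda>_. 0)))"
definition "tension0' = snd (ell (pt u2 (\<lambda>_. 0)))"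

lemma pot_initial: "pot (pot_max R) (pt u2 (\<lambda>_. 0))"
  by (rule pt_pot[OF a i, of 0 0 "\<lambda>_. 0" "\<lambda>_. 0"]) (auto intro: jet_zero)

lemma ell_initial: "solves_ell (pt u2 (\<lambda>_. 0)) tension0 tension0'"
  unfolding tension0_def tension0'_def by (rule solves_ell[OF pot_initial])

lemma tension0_bounds: "\<bar>tension0 s\<bar> \<le> 8" "\<bar>tension0' s\<bar> \<le> 8 * pot_max R + 1"
  using solves_ell_bounds[OF ell_initial pot_initial] by auto

lemma coeff_tension0: "coeff coeff_bound tension0 tension0' (\<lambda>s. pt u2 (\<lambda>_. 0) s * tension0 s - 1)"
proof -
  note b = solves_ell_bounds[OF ell_initial pot_initial]
  have "1 / coeff_bound \<le> 1 / pot_max R" using pot_max_ge_1 by (intro divide_left_mono) (auto simp: coeff_bound_def)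
  then have "1 / coeff_bound \<le> tension0 s" for s using b(1)[of s] by linarith
  moreover have "tension0 s \<le> coeff_bound" for s using b(2)[of s] pot_max_ge_1 by (simp add: coeff_bound_def)
  moreover have "\<bar>tension0' s\<bar> \<le> coeff_bound" "\<bar>pt u2 (\<lambda>_. 0) s * tension0 s - 1\<bar> \<le> coeff_bound" for s
    using b(3,4)[of s] pot_max_ge_1 by (auto simp: coeff_bound_def)
  ultimately show ?thesis using ell_initial coeff_bound_ge by (simp add: coeff_def solves_ell_def)
qed

lemma jet_lin_sol:
  assumes f: "unif_holder_per a radius f" and t: "0 \<le> t" "t \<le> lifespan"
  shows "jet a (lin_const * radius * t powr (a / 2)) (lin_const * radius) (lin_sol0 tension0 f t) (lin_sol1 tension0 f t) (lin_sol2 tension0 tension0' f t)"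
    "jet a (lin_const * radius * lifespan powr (a / 2)) (lin_const * radius) (lin_sol0 tension0 f t) (lin_sol1 tension0 f t) (lin_sol2 tension0 tension0' f t)"
proof -
  have t1: "t \<le> 1" using t lifespan by linarith
  have g: "unif_holder a radius f" "\<And>t. periodic1 (f t)" using f by (auto simp: unif_holder_per_def)
  show 1: "jet a (lin_const * radius * t powr (a / 2)) (lin_const * radius) (lin_sol0 tension0 f t) (lin_sol1 tension0 f t) (lin_sol2 tension0 tension0' f t)"
    unfolding jet_def lin_const_def
    using lin_sol0_periodic[OF a coeff_tension0, of f t, OF g(2)] par_derivatives[OF a coeff_tension0 g(1) t(1) t1]
      par_bounds[OF a coeff_tension0 g(1) t(1) t1] lin_sol2_holder[OF a coeff_tension0 g(1) t(1) t1] by blast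
  have "lin_const * radius * t powr (a / 2) \<le> lin_const * radius * lifespan powr (a / 2)"
    using lin_radius_nonneg t a by (intro mult_left_mono powr_mono2) auto
  then show "jet a (lin_const * radius * lifespan powr (a / 2)) (lin_const * radius) (lin_sol0 tension0 f t) (lin_sol1 tension0 f t) (lin_sol2 tension0 tension0' f t)"
    using 1 unfolding jet_def by (meson order_trans)
qed

lemma radius_small: "6 * R * (lin_const * radius * lifespan powr (a / 2)) \<le> 1"
  using lifespan(1) by (intro lifespan(4)) auto

text \<open>Freezes time outside the lifespan, so that the Picard map acts on forcings defined for
  all real times without losing continuity.\<close>

definition "clip t = max 0 (min t lifespan)"

lemma clip: "0 \<le> clip t" "clip t \<le> lifespan" "clip t \<le> 1" "0 \<le> t \<Longrightarrow> t \<le> lifespan \<Longrightarrow> clip t = t"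
  using lifespan(1,2) by (auto simp: clip_def)

definition "tension f t = ell (pt u2 (lin_sol2 tension0 tension0' f (clip t)))"
text \<open>A fixed point is a forcing equal to the remainder of the nonlinearity evaluated at its
  own linear solution.\<close>

definition "picard f t = rhs tension0 tension0' (fst (tension f t)) (snd (tension f t)) u0 u1 u2 (lin_sol0 tension0 f (clip t)) (lin_sol1 tension0 f (clip t)) (lin_sol2 tension0 tension0' f (clip t))"

lemma tension: "unif_holder_per a radius f \<Longrightarrow> pot (pot_max R) (pt u2 (lin_sol2 tension0 tension0' f (clip t)))"
  "unif_holder_per a radius f \<Longrightarrow> solves_ell (pt u2 (lin_sol2 tension0 tension0' f (clip t))) (fst (tension f t)) (snd (tension f t))"
proof -
  assume f: "unif_holder_per a radius f"
  show "pot (pot_max R) (pt u2 (lin_sol2 tension0 tension0' f (clip t)))"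
    by (rule pt_pot[OF a i radius_small jet_lin_sol(2)[OF f clip(1,2)]])
  then show "solves_ell (pt u2 (lin_sol2 tension0 tension0' f (clip t))) (fst (tension f t)) (snd (tension f t))"
    unfolding tension_def by (rule solves_ell)
qed

text \<open>Sup-norm quantities carry the factor \<open>q\<close>, the power t^(a/2), while Hoelder
  constants do not; yet each term of \<open>hdiff_con\<close> contains a sup-norm quantity, so
  \<open>q\<close> factors out.\<close>

lemma hdiff_con_scale:
  "hdiff_con R (lin_const * radius * q) (lin_const * radius) (lin_const * D * q) (lin_const * D) = D * (contr_const * q)"
  unfolding hdiff_con_def contr_const_def by algebra

text \<open>By linearity the two linear solutions differ by the solution for \<open>f - g\<close>,
  so the estimates hold with \<open>D\<close> in place of the radius; homogeneity in
  \<open>D\<close> and the choice of the lifespan give the factor 1/2.\<close>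

lemma picard_contraction:
  assumes f: "unif_holder_per a radius f" and g: "unif_holder_per a radius g" and D: "\<And>t. holder a D (\<lambda>s. f t s - g t s)"
  shows "holder a (D / 2) (\<lambda>s. picard f t s - picard g t s)"
proof -
  have D0: "0 \<le> D" using holder_nonneg[OF D] .
  have gf: "unif_holder a radius f" "unif_holder a radius g" using f g by (auto simp: unif_holder_per_def)
  have gd: "unif_holder a D (\<lambda>t s. f t s - g t s)"
    using gf D by (auto simp: unif_holder_def intro: continuous_intros)
  define q where "q = lifespan powr (a / 2)"
  have tq: "D' * clip t powr (a / 2) \<le> D' * q" if "0 \<le> D'" for D'
    using that clip[of t] a unfolding q_def by (intro mult_left_mono powr_mono2) auto
  have CD: "0 \<le> lin_const * D" using lin_const_ge D0 by simp
  note pd = par_diff[OF a coeff_tension0 gf clip(1,3), of t]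
  note pb = par_bounds[OF a coeff_tension0 gd clip(1,3), of t, unfolded pd, folded lin_const_def]
  have h: "norm (lin_sol0 tension0 f (clip t) s - lin_sol0 tension0 g (clip t) s) \<le> lin_const * D * q"
    "norm (lin_sol1 tension0 f (clip t) s - lin_sol1 tension0 g (clip t) s) \<le> lin_const * D * q"
    "norm (lin_sol2 tension0 tension0' f (clip t) s - lin_sol2 tension0 tension0' g (clip t) s) \<le> lin_const * D * q" for s
    using order_trans[OF pb(1) tq[OF CD]] order_trans[OF pb(2) tq[OF CD]] order_trans[OF pb(3) tq[OF CD]] by auto
  have H: "holder a (lin_const * D) (\<lambda>s. lin_sol2 tension0 tension0' f (clip t) s - lin_sol2 tension0 tension0' g (clip t) s)"
    using lin_sol2_holder[OF a coeff_tension0 gd clip(1,3), of t] unfolding lin_const_def pd(3)[symmetric] .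
  have "holder a (hdiff_con R (lin_const * radius * q) (lin_const * radius) (lin_const * D * q) (lin_const * D)) (\<lambda>s. picard f t s - picard g t s)"
    unfolding picard_def q_def
    by (rule rhs_holder_diff[OF a i radius_small ell_initial jet_lin_sol(2)[OF f clip(1,2)] jet_lin_sol(2)[OF g clip(1,2)] tension(2)[OF f] tension(2)[OF g] h[unfolded q_def] H])
  moreover have "hdiff_con R (lin_const * radius * q) (lin_const * radius) (lin_const * D * q) (lin_const * D) \<le> D / 2"
    unfolding hdiff_con_scale using mult_left_mono[OF lifespan(3)[of lifespan] D0] lifespan(1) by (simp add: q_def)
  ultimately show ?thesis by (rule holder_mono)
qed

lemma picard_time:
  assumes f: "unif_holder_per a radius f"
  shows "norm (picard f t s - picard f t' s) \<le> sdiff_con R * (lin_const * radius * \<bar>clip t - clip t'\<bar> powr (a / 2))"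
proof -
  have gf: "unif_holder a radius f" using f by (auto simp: unif_holder_per_def)
  have m: "clip t \<in> {0..1}" "clip t' \<in> {0..1}" using clip by auto
  note h = par_time_holder[OF a coeff_tension0 gf m, folded lin_const_def]
  show ?thesis unfolding picard_def
    by (rule rhs_sup_diff[OF a i radius_small ell_initial jet_lin_sol(2)[OF f clip(1,2)] jet_lin_sol(2)[OF f clip(1,2)] tension(2)[OF f] tension(2)[OF f] h])
qed

text \<open>The contraction estimate against the zero jet puts the image within radius/2 of the
  image of zero, which itself has norm at most radius/2. Joint continuity holds because the linear
  solution, hence the image, is Hoelder in time even if the forcing is merely continuous.\<close>

lemma picard_self:
  assumes f: "unif_holder_per a radius f" shows "unif_holder_per a radius (picard f)"
proof -
  have h: "holder a radius (picard f t)" for t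
  proof -
    define q where "q = lifespan powr (a / 2)"
    define r0 where "r0 = rhs tension0 tension0' tension0 tension0' u0 u1 u2 (\<lambda>_. 0) (\<lambda>_. 0) (\<lambda>_. 0)"
    have K0: "0 \<le> lin_const * radius * q" using lin_radius_nonneg by (simp add: q_def)
    note j = jet_lin_sol(2)[OF f clip(1,2), of t, folded q_def]
    have n: "norm (lin_sol0 tension0 f (clip t) s - 0) \<le> lin_const * radius * q" "norm (lin_sol1 tension0 f (clip t) s - 0) \<le> lin_const * radius * q"
      "norm (lin_sol2 tension0 tension0' f (clip t) s - 0) \<le> lin_const * radius * q" for s
      using j by (auto simp: jet_def)
    have H: "holder a (lin_const * radius) (\<lambda>s. lin_sol2 tension0 tension0' f (clip t) s - 0)" using j by (simp add: jet_def)
    have "holder a (hdiff_con R (lin_const * radius * q) (lin_const * radius) (lin_const * radius * q) (lin_const * radius)) (\<lambda>s. picard f t s - r0 s)"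
      unfolding picard_def r0_def
      by (rule rhs_holder_diff[OF a i radius_small[folded q_def] ell_initial j jet_zero[OF K0 lin_radius_nonneg] tension(2)[OF f] ell_initial n H])
    moreover have "hdiff_con R (lin_const * radius * q) (lin_const * radius) (lin_const * radius * q) (lin_const * radius) \<le> radius / 2"
      unfolding hdiff_con_scale using mult_left_mono[OF lifespan(3)[of lifespan] radius_nonneg] lifespan(1) by (simp add: q_def)
    ultimately have 1: "holder a (radius / 2) (\<lambda>s. picard f t s - r0 s)" by (rule holder_mono)
    have 2: "holder a (radius / 2) r0"
    proof -
      have "radius / 2 = 108 * pot_max R * R + 2 * R" by (simp add: radius_def)
      then show ?thesis using flux_zero_holder[OF a i _ ell_initial pot_initial, of 0] by (simp only: r0_def mult_zero_right zero_le_one)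
    qed
    show ?thesis using holder_add[OF 1 2] by simp
  qed
  have clc: "\<bar>clip t - clip t'\<bar> \<le> \<bar>t - t'\<bar>" for t t' unfolding clip_def by linarith
  have "norm (picard f t s - picard f t' s) \<le> (sdiff_con R * (lin_const * radius)) * \<bar>t - t'\<bar> powr (a / 2)" for t t' s
  proof -
    have "norm (picard f t s - picard f t' s) \<le> (sdiff_con R * (lin_const * radius)) * \<bar>clip t - clip t'\<bar> powr (a / 2)"
      using picard_time[OF f, of t s t'] by (simp add: mult.assoc)
    also have "\<dots> \<le> (sdiff_con R * (lin_const * radius)) * \<bar>t - t'\<bar> powr (a / 2)"
      using a clc lin_radius_nonneg sup_const_ge_1 by (intro mult_left_mono powr_mono2) auto
    finally show ?thesis .
  qed
  then have "continuous_on UNIV (\<lambda>t. picard f t s)" for s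
    using a by (intro continuous_on_of_holder[where b = "a / 2"]) auto
  then have "continuous_on UNIV (\<lambda>p. picard f (fst p) (snd p))"
    by (rule continuous_on_joint[OF a(1) h])
  moreover have "periodic1 (picard f t)" for t
  proof -
    have per: "periodic1 u0" "periodic1 u1" "periodic1 u2"
    proof -
      show 0: "periodic1 u0" using i by (simp add: init_def)
      show 1: "periodic1 u1" by (rule periodic1_has_vector_derivative[OF 0]) (use i in \<open>simp add: init_def\<close>)
      show "periodic1 u2" by (rule periodic1_has_vector_derivative[OF 1]) (use i in \<open>simp add: init_def\<close>)
    qed
    have jp: "periodic1 v0 \<and> periodic1 v1 \<and> periodic1 v2" if "jet a k K v0 v1 v2" for k K and v0 v1 v2 :: "real \<Rightarrow> 'v"
    proof -
      have 0: "periodic1 v0" using that by (simp add: jet_def)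
      have 1: "periodic1 v1" by (rule periodic1_has_vector_derivative[OF 0]) (use that in \<open>simp add: jet_def\<close>)
      have "periodic1 v2" by (rule periodic1_has_vector_derivative[OF 1]) (use that in \<open>simp add: jet_def\<close>)
      with 0 1 show ?thesis by simp
    qed
    have ep: "periodic1 s0 \<and> periodic1 s1" if "solves_ell p s0 s1" for p s0 s1
    proof -
      have 0: "periodic1 s0" using that by (simp add: solves_ell_def)
      have "periodic1 s1" by (rule periodic1_has_vector_derivative[OF 0]) (use that in \<open>simp add: solves_ell_def\<close>)
      with 0 show ?thesis by simp
    qed
    show ?thesis
      using per jp[OF jet_lin_sol(2)[OF f clip(1,2), of t]] ep[OF tension(2)[OF f, of t]] ep[OF ell_initial]
      unfolding picard_def periodic1_def rhs_def flux_def by simp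
  qed
  ultimately show ?thesis using h by (simp add: unif_holder_per_def unif_holder_def)
qed

lemma existence_core:
  "\<exists>x0 x1 x2 xt \<sigma> \<sigma>1. classical a lifespan sol_bound x0 x1 x2 xt \<sigma> \<sigma>1 \<and> x0 0 = u0"
proof -
  obtain f where f: "unif_holder_per a radius f" "picard f = f"
    using contraction_fixed_point[where \<Psi> = picard, OF radius_nonneg picard_self picard_contraction] by blast
  have gf: "unif_holder a radius f" using f by (auto simp: unif_holder_per_def)
  define x0 where "x0 t s = u0 s + lin_sol0 tension0 f t s" for t s
  define x1 where "x1 t s = u1 s + lin_sol1 tension0 f t s" for t s
  define x2 where "x2 t s = u2 s + lin_sol2 tension0 tension0' f t s" for t s
  define \<sigma> where "\<sigma> t = fst (tension f t)" for t
  define \<sigma>1 where "\<sigma>1 t = snd (tension f t)" for t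
  define xt where "xt t = flux (\<sigma> t) (\<sigma>1 t) (x0 t) (x1 t) (x2 t)" for t
  have i': "periodic1 u0" "(u0 has_vector_derivative u1 s) (at s)" "(u1 has_vector_derivative u2 s) (at s)"
    "norm (u0 s) \<le> R" "norm (u1 s) = 1" "holder a R u2" "norm (u2 s) \<le> R" for s
    using i holderD1[of a R u2] by (auto simp: init_def)
  have xtf: "xt t s = tension0 s *\<^sub>R lin_sol2 tension0 tension0' f t s + (tension0' s / 2) *\<^sub>R lin_sol1 tension0 f t s + f t s" if t: "t \<in> {0..lifespan}" for t s
  proof -
    have "f t s = picard f t s" using f(2) by simp
    then show ?thesis using t clip(4)[of t]
      by (simp add: picard_def rhs_def xt_def \<sigma>_def \<sigma>1_def x0_def[abs_def] x1_def[abs_def] x2_def[abs_def])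
  qed
  have main: "jet a sol_bound sol_bound (x0 t) (x1 t) (x2 t) \<and> holder a sol_bound (xt t) \<and> periodic1 (xt t)
      \<and> solves_ell (\<lambda>s. (norm (x2 t s))\<^sup>2) (\<sigma> t) (\<sigma>1 t)
      \<and> (\<forall>s. xt t s = flux (\<sigma> t) (\<sigma>1 t) (x0 t) (x1 t) (x2 t) s)
      \<and> (\<forall>s. ((\<lambda>t. x0 t s) has_vector_derivative xt t s) (at t within {0..lifespan}))" if t: "t \<in> {0..lifespan}" for t
  proof (intro conjI allI)
    have t': "0 \<le> t" "t \<le> lifespan" "t \<le> 1" using t lifespan by auto
    note j = jet_lin_sol(2)[OF f(1) t'(1,2)]
    note js = jet_small[OF a i radius_small j]
    have jd: "(lin_sol0 tension0 f t has_vector_derivative lin_sol1 tension0 f t s) (at s)" "(lin_sol1 tension0 f t has_vector_derivative lin_sol2 tension0 tension0' f t s) (at s)"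
      "holder a (lin_const * radius) (lin_sol2 tension0 tension0' f t)" for s using j by (auto simp: jet_def)
    have d: "(x0 t has_vector_derivative x1 t s) (at s)" "(x1 t has_vector_derivative x2 t s) (at s)" for s
      unfolding x0_def[abs_def] x1_def[abs_def] x2_def by (intro has_vector_derivative_add i' jd)+
    have b: "norm (x0 t s) \<le> R + 1" "norm (x1 t s) \<le> R + 1" "norm (x2 t s) \<le> R + 1" for s
      unfolding x0_def x1_def x2_def using js[of s] i'(4,5,7)[of s] R
      by (auto intro!: order_trans[OF norm_triangle_ineq] add_mono)
    have h2: "holder a (R + lin_const * radius) (x2 t)" unfolding x2_def[abs_def] by (rule holder_add[OF i'(6) jd(3)])
    show "jet a sol_bound sol_bound (x0 t) (x1 t) (x2 t)"
    proof -
      have "periodic1 (x0 t)" using i'(1) j by (simp add: periodic1_def x0_def jet_def)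
      then show ?thesis unfolding jet_def using d order_trans[OF b(1) sol_bound_ge(1)] order_trans[OF b(2) sol_bound_ge(1)]
          order_trans[OF b(3) sol_bound_ge(1)] holder_mono[OF h2 sol_bound_ge(2)] by blast
    qed
    have pe: "pt u2 (lin_sol2 tension0 tension0' f (clip t)) = (\<lambda>s. (norm (x2 t s))\<^sup>2)"
      unfolding clip(4)[OF t'(1,2)] by (auto simp: pt_def x2_def fun_eq_iff)
    note s = tension[OF f(1), of t, unfolded pe, folded \<sigma>_def \<sigma>1_def]
    show "solves_ell (\<lambda>s. (norm (x2 t s))\<^sup>2) (\<sigma> t) (\<sigma>1 t)" by (rule s(2))
    have h0: "holder a (2 * (R + 1)) (x0 t)" by (rule holder_C1[where g' = "x1 t"]) (use a b d in auto)
    have h1: "holder a (2 * (R + 1)) (x1 t)" by (rule holder_C1[where g' = "x2 t"]) (use a b d in auto)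
    have "holder a (2 * (18 * pot_max R) * (R + lin_const * radius) + 2 * (18 * pot_max R) * (2 * (R + 1)) + 2 * (R + 1)) (xt t)"
      unfolding xt_def flux_def[abs_def] by (intro holder_add holder_scaleR solves_ell_holder[OF a s(2,1) pot_max_ge_1] h0 h1 h2)
    then show "holder a sol_bound (xt t)" by (rule holder_mono) (use sol_bound_ge(3) in \<open>simp add: algebra_simps\<close>)
    have "periodic1 (f t)" using f(1) by (simp add: unif_holder_per_def)
    have p0: "periodic1 (x0 t)" using i'(1) j by (simp add: periodic1_def x0_def jet_def)
    have p1: "periodic1 (x1 t)" by (rule periodic1_has_vector_derivative[OF p0 d(1)])
    have p2: "periodic1 (x2 t)" by (rule periodic1_has_vector_derivative[OF p1 d(2)])
    have q0: "periodic1 (\<sigma> t)" using s(2) by (simp add: solves_ell_def)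
    have q1: "periodic1 (\<sigma>1 t)" by (rule periodic1_has_vector_derivative[OF q0]) (use s(2) in \<open>simp add: solves_ell_def\<close>)
    show "periodic1 (xt t)" using p0 p1 p2 q0 q1 by (simp add: periodic1_def xt_def flux_def)
    show "xt t s = flux (\<sigma> t) (\<sigma>1 t) (x0 t) (x1 t) (x2 t) s" for s by (simp add: xt_def)
    fix s
    have "((\<lambda>t. lin_sol0 tension0 f t s) has_vector_derivative xt t s) (at t within {0..1})"
      unfolding xtf[OF t] using t' by (intro par_time_derivative[OF a coeff_tension0 gf]) auto
    then have "((\<lambda>t. lin_sol0 tension0 f t s) has_vector_derivative xt t s) (at t within {0..lifespan})"
      by (rule has_vector_derivative_within_subset) (use lifespan(2) in auto)
    then show "((\<lambda>t. x0 t s) has_vector_derivative xt t s) (at t within {0..lifespan})"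
      unfolding x0_def using has_vector_derivative_add[OF has_vector_derivative_const] by fastforce
  qed
  have hol: "norm (x0 t s - x0 t' s) \<le> sol_bound * \<bar>t - t'\<bar> powr (a / 2)
      \<and> norm (x1 t s - x1 t' s) \<le> sol_bound * \<bar>t - t'\<bar> powr (a / 2) \<and> norm (x2 t s - x2 t' s) \<le> sol_bound * \<bar>t - t'\<bar> powr (a / 2)
      \<and> norm (xt t s - xt t' s) \<le> sol_bound * \<bar>t - t'\<bar> powr (a / 2)" if t: "t \<in> {0..lifespan}" "t' \<in> {0..lifespan}" for t t' s
  proof -
    have m: "t \<in> {0..1}" "t' \<in> {0..1}" using t lifespan(2) by auto
    define q where "q = \<bar>t - t'\<bar> powr (a / 2)"
    have q: "0 \<le> q" by (simp add: q_def)
    note h = par_time_holder[OF a coeff_tension0 gf m, folded lin_const_def q_def]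
    have k: "lin_const * radius * q \<le> sol_bound * q" by (intro mult_right_mono sol_bound_ge q)
    have f1: "norm (f t s - f t' s) \<le> sdiff_con R * (lin_const * radius * q)"
      using picard_time[OF f(1), of t s t'] t clip(4)[of t] clip(4)[of t'] by (simp add: f(2) q_def)
    have "norm (xt t s - xt t' s) = norm (tension0 s *\<^sub>R (lin_sol2 tension0 tension0' f t s - lin_sol2 tension0 tension0' f t' s)
        + (tension0' s / 2) *\<^sub>R (lin_sol1 tension0 f t s - lin_sol1 tension0 f t' s) + (f t s - f t' s))"
      unfolding xtf[OF t(1)] xtf[OF t(2)] by (simp add: algebra_simps)
    also have "\<dots> \<le> 8 * (lin_const * radius * q) + (9 * pot_max R) * (lin_const * radius * q) + sdiff_con R * (lin_const * radius * q)"
    proof (intro norm_triangle_mono f1)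
      show "norm (tension0 s *\<^sub>R (lin_sol2 tension0 tension0' f t s - lin_sol2 tension0 tension0' f t' s)) \<le> 8 * (lin_const * radius * q)"
        unfolding norm_scaleR using tension0_bounds(1)[of s] h(3)[of s] by (intro mult_mono) auto
      have "\<bar>tension0' s / 2\<bar> \<le> 9 * pot_max R" using tension0_bounds(2)[of s] pot_max_ge_1 by simp
      then show "norm ((tension0' s / 2) *\<^sub>R (lin_sol1 tension0 f t s - lin_sol1 tension0 f t' s)) \<le> (9 * pot_max R) * (lin_const * radius * q)"
        unfolding norm_scaleR using h(2)[of s] pot_max_ge_1 by (intro mult_mono) auto
    qed
    also have "\<dots> = ((sdiff_con R + 8 + 9 * pot_max R) * (lin_const * radius)) * q" by (simp add: algebra_simps)
    also have "\<dots> \<le> sol_bound * q" by (intro mult_right_mono sol_bound_ge q)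
    finally have x: "norm (xt t s - xt t' s) \<le> sol_bound * q" .
    show ?thesis
      using order_trans[OF h(1)[of s] k] order_trans[OF h(2)[of s] k] order_trans[OF h(3)[of s] k] x
      by (simp add: x0_def x1_def x2_def q_def)
  qed
  have "x0 0 = u0" by (rule ext) (simp add: x0_def par_zero_time[OF a coeff_tension0])
  moreover have "classical a lifespan sol_bound x0 x1 x2 xt \<sigma> \<sigma>1" unfolding classical_def using main hol by blast
  ultimately show ?thesis by blast
qed

end

end

section \<open>Energy estimates\<close>

lemma young: "0 < \<theta> \<Longrightarrow> x * y \<le> \<theta> * x\<^sup>2 + y\<^sup>2 / (4 * \<theta>)" for x y \<theta> :: real
proof -
  assume t: "0 < \<theta>"
  have "0 \<le> (2 * \<theta> * x - y)\<^sup>2" by simp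
  then have "4 * \<theta> * (x * y) \<le> 4 * \<theta> * (\<theta> * x\<^sup>2) + y\<^sup>2"
    by (simp add: power2_eq_square algebra_simps)
  then show ?thesis using t by (simp add: field_simps)
qed

text \<open>Averaging over [s, s + e] makes a Hoelder function continuously differentiable, at the
  price 1/e in the derivative and with an error e^a. It replaces differentiation of the coefficient
  in an integration by parts.\<close>

lemma moving_average:
  fixes r :: "real \<Rightarrow> 'v::euclidean_space"
  assumes a: "0 < a" and r: "holder a \<rho> r" and per: "periodic1 r" and e: "0 < e"
  obtains R R' where "\<And>s. (R has_vector_derivative R' s) (at s)" "continuous_on UNIV R'" "R 1 = R 0"
    "\<And>s. norm (R s) \<le> \<rho>" "\<And>s. norm (R' s) \<le> 2 * \<rho> / e" "\<And>s. norm (r s - R s) \<le> \<rho> * e powr a"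
proof -
  have c: "continuous_on UNIV r" by (rule holder_continuous[OF a r])
  obtain J where J: "\<And>x. (J has_vector_derivative r x) (at x)"
    using has_antiderivative[OF c] by blast
  have sh: "((\<lambda>u. J (u + y)) has_vector_derivative r (u + y)) (at u)" for u y
  proof -
    have "((\<lambda>u. u + y) has_vector_derivative 1) (at u)" by (auto intro!: derivative_eq_intros)
    from vector_diff_chain_at[OF this J] show ?thesis by (simp add: comp_def)
  qed
  have rho: "0 \<le> \<rho>" by (rule holder_nonneg[OF r])
  define R where "R s = (1 / e) *\<^sub>R (J (s + e) - J s)" for s
  define R' where "R' s = (1 / e) *\<^sub>R (r (s + e) - r s)" for s
  show thesis
  proof (rule that[of R R'])
    show "(R has_vector_derivative R' s) (at s)" for s
      unfolding R_def[abs_def] R'_def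
      using has_vector_derivative_scaleR[OF DERIV_const has_vector_derivative_diff[OF sh J], of "1 / e"] by simp
    have "continuous_on UNIV (\<lambda>s. r (s + e))"
      by (rule continuous_on_compose2[OF c]) (auto intro: continuous_intros)
    then show "continuous_on UNIV R'" unfolding R'_def by (intro continuous_intros c)
    \<comment> \<open>The antiderivative gains the same amount over every unit interval; this makes
      the average periodic although \<open>J\<close> need not be.\<close>
    have "((\<lambda>s. J (s + 1) - J s) has_vector_derivative 0) (at s)" for s
      using has_vector_derivative_diff[OF sh[of 1 s] J[of s]] per by (simp add: periodic1_def)
    then obtain k where k: "\<And>s. J (s + 1) - J s = k"
      using has_vector_derivative_zero_constant[of UNIV "\<lambda>s. J (s + 1) - J s"] by auto
    have "J (1 + e) - J 1 = J e - J 0" using k[of e] k[of 0] by (simp add: algebra_simps)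
    then show "R 1 = R 0" by (simp add: R_def)
    show "norm (R s) \<le> \<rho>" for s
    proof -
      have "norm (R s) = norm (J (s + e) - J s) / e" using e by (simp add: R_def)
      then show ?thesis using lipschitz_vector_derivative[OF J holderD1[OF r], of "s + e" s] e by (simp add: divide_le_eq)
    qed
    show "norm (R' s) \<le> 2 * \<rho> / e" for s
    proof -
      have "norm (r (s + e) - r s) \<le> 2 * \<rho>"
        using norm_triangle_ineq4[of "r (s + e)" "r s"] holderD1[OF r, of "s + e"] holderD1[OF r, of s] by linarith
      then show ?thesis using e by (simp add: R'_def divide_right_mono)
    qed
    show "norm (r s - R s) \<le> \<rho> * e powr a" for s
    proof -
      define q where "q u = J (u + s) - u *\<^sub>R r s" for u
      have "norm (q e - q 0) \<le> (\<rho> * e powr a) * \<bar>e\<bar>"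
      proof (rule norm_diff_le_segment[where f' = "\<lambda>u. r (u + s) - r s"])
        show "(q has_vector_derivative r (u + s) - r s) (at u)" for u
          unfolding q_def[abs_def] by (auto intro!: derivative_eq_intros sh)
        fix u :: real assume u: "\<bar>u\<bar> \<le> e"
        have "norm (r (u + s) - r s) \<le> \<rho> * \<bar>u + s - s\<bar> powr a" by (rule holderD2[OF r])
        also have "\<dots> \<le> \<rho> * e powr a" using u a rho by (intro mult_left_mono powr_mono2) auto
        finally show "norm (r (u + s) - r s) \<le> \<rho> * e powr a" .
      qed (use e in auto)
      moreover have "r s - R s = (- 1 / e) *\<^sub>R (q e - q 0)"
        using e by (simp add: q_def R_def add.commute algebra_simps)
      moreover from this have "norm (r s - R s) = norm (q e - q 0) / e" using e by simp
      ultimately show ?thesis using e by (simp add: divide_le_eq)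
    qed
  qed
qed

text \<open>The right-hand side of the equation for the difference of two tensions contains second derivatives of the difference of
  the curves. Averaging its Hoelder coefficient over length e and integrating by parts trades all but a small
  multiple of them for first derivatives.\<close>

lemma elliptic_difference_energy:
  fixes x2 y2 w1 w2 :: "real \<Rightarrow> 'v::euclidean_space"
  assumes a: "0 < a" "a < 1" and s: "solves_ell (\<lambda>s. (norm (x2 s))\<^sup>2) \<sigma> \<sigma>1" "solves_ell (\<lambda>s. (norm (y2 s))\<^sup>2) \<tau> \<tau>1"
    and x: "holder a K x2" "holder a K y2" "periodic1 x2" "periodic1 y2"
    and w: "\<And>s. w2 s = x2 s - y2 s" "\<And>s. (w1 has_vector_derivative w2 s) (at s)" "w1 1 = w1 0"
    and m: "0 < m" "m \<le> 1" "m \<le> integral {0..1} (\<lambda>s. (norm (x2 s))\<^sup>2)"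
    and S: "\<And>s. \<bar>\<tau> s\<bar> \<le> S" "\<And>s. \<bar>\<tau>1 s\<bar> \<le> S" and e: "0 < e" and rho: "\<rho> = 8 * S * K"
  defines "E \<equiv> integral {0..1} (\<lambda>s. (\<sigma>1 s - \<tau>1 s)\<^sup>2 + (norm (x2 s))\<^sup>2 * (\<sigma> s - \<tau> s)\<^sup>2)"
  shows "m / 4 * (\<sigma> s - \<tau> s)\<^sup>2 \<le> E" "integral {0..1} (\<lambda>s. (\<sigma>1 s - \<tau>1 s)\<^sup>2) \<le> E"
    "E \<le> 16 / m * \<rho>\<^sup>2 * (e powr a)\<^sup>2 * integral {0..1} (\<lambda>s. (norm (w2 s))\<^sup>2)
       + 2 * (\<rho>\<^sup>2 + 32 * \<rho>\<^sup>2 / (m * e\<^sup>2)) * integral {0..1} (\<lambda>s. (norm (w1 s))\<^sup>2)"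
proof -
  note s' = s[unfolded solves_ell_def]
  define p where "p s = (norm (x2 s))\<^sup>2" for s
  define \<delta> where "\<delta> s = \<sigma> s - \<tau> s" for s
  define \<delta>1 where "\<delta>1 s = \<sigma>1 s - \<tau>1 s" for s
  \<comment> \<open>Since |x2|^2 - |y2|^2 = (x2 + y2) \<bullet> w2, the difference of the two
    tension equations has the source -r \<bullet> w2.\<close>
  define r where "r s = \<tau> s *\<^sub>R (x2 s + y2 s)" for s
  define g where "g s = - (r s \<bullet> w2 s)" for s
  have cx: "continuous_on A x2" "continuous_on A y2" for A
    using holder_continuous[OF a(1) x(1)] holder_continuous[OF a(1) x(2)] continuous_on_subset by blast+
  have cw: "continuous_on A w1" "continuous_on A w2" for A
    using continuous_on_of_vector_derivative[OF w(2)] cx unfolding w(1) by (auto intro!: continuous_intros)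
  have ct: "continuous_on A \<tau>" for A using s' continuous_on_of_vector_derivative by blast
  have cr: "continuous_on A r" "continuous_on A g" "continuous_on A p" for A
    unfolding g_def r_def p_def by (intro continuous_intros ct cx cw)+
  have per: "periodic1 \<delta>" using s' by (simp add: periodic1_def \<delta>_def)
  have d1: "(\<delta> has_vector_derivative \<delta>1 s) (at s)" for s
    unfolding \<delta>_def[abs_def] \<delta>1_def using s' by (intro has_vector_derivative_diff) auto
  have d2: "(\<delta>1 has_vector_derivative (p s * \<delta> s - g s)) (at s)" for s
  proof -
    have "(\<delta>1 has_vector_derivative (((norm (x2 s))\<^sup>2 * \<sigma> s - 1) - ((norm (y2 s))\<^sup>2 * \<tau> s - 1))) (at s)"
      unfolding \<delta>1_def[abs_def] using s' by (intro has_vector_derivative_diff) auto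
    moreover have "((norm (x2 s))\<^sup>2 * \<sigma> s - 1) - ((norm (y2 s))\<^sup>2 * \<tau> s - 1) = p s * \<delta> s - g s"
      by (simp add: p_def \<delta>_def g_def r_def w(1) power2_norm_eq_inner inner_commute algebra_simps)
    ultimately show ?thesis by simp
  qed
  have cd: "continuous_on A \<delta>" "continuous_on A \<delta>1" for A
    using continuous_on_of_vector_derivative[OF d1] continuous_on_of_vector_derivative[OF d2] by auto
  have E: "E = integral {0..1} (\<lambda>s. (\<delta>1 s)\<^sup>2 + p s * (\<delta> s)\<^sup>2)" by (simp add: E_def p_def \<delta>_def \<delta>1_def)
  have co: "m / 4 * (\<delta> s)\<^sup>2 \<le> E" for s
    unfolding E using m by (intro elliptic_coercive[OF per d1 cd(2) cr(3)]) (auto simp: p_def[abs_def])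
  then show "m / 4 * (\<sigma> s - \<tau> s)\<^sup>2 \<le> E" by (simp add: \<delta>_def)
  have d1E: "integral {0..1} (\<lambda>s. (\<delta>1 s)\<^sup>2) \<le> E"
    unfolding E by (intro integral_le integrable_continuous_interval continuous_intros cd cr) (simp add: p_def)
  then show "integral {0..1} (\<lambda>s. (\<sigma>1 s - \<tau>1 s)\<^sup>2) \<le> E" by (simp add: \<delta>1_def)
  have K0: "0 \<le> K" using holder_nonneg[OF x(1)] .
  have S0: "0 \<le> S" using S(1)[of 0] by linarith
  \<comment> \<open>The product estimate gives 2 (2 S) (2 K) = 8 S K, the value prescribed for
    \<rho>.\<close>
  have "holder a (2 * S) \<tau>" by (rule holder_C1[where g' = \<tau>1]) (use a S s' in auto)
  then have "holder a (2 * (2 * S) * (K + K)) r" unfolding r_def[abs_def] by (intro holder_scaleR holder_add x)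
  then have rh: "holder a \<rho> r" by (simp add: rho mult.assoc)
  have r0: "0 \<le> \<rho>" by (rule holder_nonneg[OF rh])
  have rp: "periodic1 r" using s' x by (simp add: periodic1_def r_def)
  obtain R R' where R: "\<And>s. (R has_vector_derivative R' s) (at s)" "continuous_on UNIV R'" "R 1 = R 0"
    "\<And>s. norm (R s) \<le> \<rho>" "\<And>s. norm (R' s) \<le> 2 * \<rho> / e" "\<And>s. norm (r s - R s) \<le> \<rho> * e powr a"
    using moving_average[OF a(1) rh rp e] by metis
  have cR: "continuous_on A R" "continuous_on A R'" for A
    using continuous_on_of_vector_derivative[OF R(1)] R(2) continuous_on_subset by blast+
  have "\<delta> 1 = \<delta> 0" using per unfolding periodic1_def by (metis add_0)
  then have parts: "integral {0..1} (\<lambda>s. w2 s \<bullet> (\<delta> s *\<^sub>R R s)) = - integral {0..1} (\<lambda>s. w1 s \<bullet> (\<delta> s *\<^sub>R R' s + \<delta>1 s *\<^sub>R R s))"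
    using d1 R(1,3) w(3)
    by (intro integral_by_parts_periodic w(2) cw has_vector_derivative_scaleR continuous_intros cd cR)
       (auto simp: has_real_derivative_iff_has_vector_derivative)
  \<comment> \<open>The constants left by Young's inequality with weight m/32: by coercivity each of
    the two terms with \<delta> then costs at most E/8 and the term with \<delta>1 a quarter of E,
    so that half of E can be absorbed on the left.\<close>
  define c1 where "c1 = 8 / m * \<rho>\<^sup>2 * (e powr a)\<^sup>2"
  define c2 where "c2 = \<rho>\<^sup>2 + 32 * \<rho>\<^sup>2 / (m * e\<^sup>2)"
  have "E = integral {0..1} (\<lambda>s. g s * \<delta> s)"
    unfolding E by (rule elliptic_energy[OF per d1 d2 cr(3,2)])
  also have "\<dots> = integral {0..1} (\<lambda>s. - \<delta> s * ((r s - R s) \<bullet> w2 s) - w2 s \<bullet> (\<delta> s *\<^sub>R R s))"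
    by (intro integral_cong) (simp add: g_def inner_commute algebra_simps)
  also have "\<dots> = integral {0..1} (\<lambda>s. - \<delta> s * ((r s - R s) \<bullet> w2 s)) + integral {0..1} (\<lambda>s. w1 s \<bullet> (\<delta> s *\<^sub>R R' s + \<delta>1 s *\<^sub>R R s))"
  proof -
    have "integral {0..1} (\<lambda>s. - \<delta> s * ((r s - R s) \<bullet> w2 s) - w2 s \<bullet> (\<delta> s *\<^sub>R R s)) =
      integral {0..1} (\<lambda>s. - \<delta> s * ((r s - R s) \<bullet> w2 s)) - integral {0..1} (\<lambda>s. w2 s \<bullet> (\<delta> s *\<^sub>R R s))"
      by (rule Henstock_Kurzweil_Integration.integral_diff)
         (intro integrable_continuous_interval continuous_intros cd cR cr cw)+
    then show ?thesis unfolding parts by simp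
  qed
  also have "\<dots> = integral {0..1} (\<lambda>s. - \<delta> s * ((r s - R s) \<bullet> w2 s) + w1 s \<bullet> (\<delta> s *\<^sub>R R' s + \<delta>1 s *\<^sub>R R s))"
    by (rule Henstock_Kurzweil_Integration.integral_add[symmetric])
       (auto intro!: integrable_continuous_interval continuous_intros cd cR cr cw)
  also have "\<dots> \<le> integral {0..1} (\<lambda>s. E / 4 + (1 / 4) * (\<delta>1 s)\<^sup>2 + c1 * (norm (w2 s))\<^sup>2 + c2 * (norm (w1 s))\<^sup>2)"
  proof (rule integral_le)
    show "(\<lambda>s. - \<delta> s * ((r s - R s) \<bullet> w2 s) + w1 s \<bullet> (\<delta> s *\<^sub>R R' s + \<delta>1 s *\<^sub>R R s)) integrable_on {0..1}"
      "(\<lambda>s. E / 4 + (1 / 4) * (\<delta>1 s)\<^sup>2 + c1 * (norm (w2 s))\<^sup>2 + c2 * (norm (w1 s))\<^sup>2) integrable_on {0..1}"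
      by (intro integrable_continuous_interval continuous_intros cd cR cr cw)+
    fix s
    define D where "D = \<bar>\<delta> s\<bar>"
    have D: "m / 32 * D\<^sup>2 \<le> E / 8" using co[of s] by (simp add: D_def)
    have "- \<delta> s * ((r s - R s) \<bullet> w2 s) \<le> D * \<bar>(r s - R s) \<bullet> w2 s\<bar>"
      using abs_ge_self[of "- \<delta> s * ((r s - R s) \<bullet> w2 s)"] by (simp add: D_def abs_mult)
    also have "\<dots> \<le> D * ((\<rho> * e powr a) * norm (w2 s))"
      using Cauchy_Schwarz_ineq2[of "r s - R s" "w2 s"] R(6)[of s]
      by (intro mult_left_mono order_trans[OF Cauchy_Schwarz_ineq2] mult_right_mono) (auto simp: D_def)
    also have "\<dots> \<le> m / 32 * D\<^sup>2 + ((\<rho> * e powr a) * norm (w2 s))\<^sup>2 / (4 * (m / 32))"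
      by (rule young) (use m in simp)
    also have "\<dots> = m / 32 * D\<^sup>2 + c1 * (norm (w2 s))\<^sup>2"
      by (simp add: c1_def power_mult_distrib)
    finally have 1: "- \<delta> s * ((r s - R s) \<bullet> w2 s) \<le> E / 8 + c1 * (norm (w2 s))\<^sup>2" using D by linarith
    have "w1 s \<bullet> (\<delta> s *\<^sub>R R' s) \<le> norm (w1 s) * (D * norm (R' s))"
      using norm_cauchy_schwarz[of "w1 s" "\<delta> s *\<^sub>R R' s"] by (simp add: D_def)
    also have "\<dots> \<le> norm (w1 s) * (D * (2 * \<rho> / e))" by (intro mult_left_mono R) (auto simp: D_def)
    also have "\<dots> = D * ((2 * \<rho> / e) * norm (w1 s))" by simp
    also have "\<dots> \<le> m / 32 * D\<^sup>2 + ((2 * \<rho> / e) * norm (w1 s))\<^sup>2 / (4 * (m / 32))"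
      by (rule young) (use m in simp)
    also have "\<dots> = m / 32 * D\<^sup>2 + 32 * \<rho>\<^sup>2 / (m * e\<^sup>2) * (norm (w1 s))\<^sup>2"
      by (simp add: power_mult_distrib power_divide mult_ac)
    finally have 2: "w1 s \<bullet> (\<delta> s *\<^sub>R R' s) \<le> E / 8 + 32 * \<rho>\<^sup>2 / (m * e\<^sup>2) * (norm (w1 s))\<^sup>2" using D by linarith
    have "w1 s \<bullet> (\<delta>1 s *\<^sub>R R s) \<le> norm (w1 s) * (\<bar>\<delta>1 s\<bar> * norm (R s))"
      using norm_cauchy_schwarz[of "w1 s" "\<delta>1 s *\<^sub>R R s"] by simp
    also have "\<dots> \<le> norm (w1 s) * (\<bar>\<delta>1 s\<bar> * \<rho>)" by (intro mult_left_mono R) auto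
    also have "\<dots> = \<bar>\<delta>1 s\<bar> * (\<rho> * norm (w1 s))" by simp
    also have "\<dots> \<le> 1 / 4 * \<bar>\<delta>1 s\<bar>\<^sup>2 + (\<rho> * norm (w1 s))\<^sup>2 / (4 * (1 / 4))" by (rule young) simp
    finally have 3: "w1 s \<bullet> (\<delta>1 s *\<^sub>R R s) \<le> 1 / 4 * (\<delta>1 s)\<^sup>2 + \<rho>\<^sup>2 * (norm (w1 s))\<^sup>2" by (simp add: power_mult_distrib)
    show "- \<delta> s * ((r s - R s) \<bullet> w2 s) + w1 s \<bullet> (\<delta> s *\<^sub>R R' s + \<delta>1 s *\<^sub>R R s)
      \<le> E / 4 + (1 / 4) * (\<delta>1 s)\<^sup>2 + c1 * (norm (w2 s))\<^sup>2 + c2 * (norm (w1 s))\<^sup>2"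
      using 1 2 3 unfolding c2_def inner_add_right distrib_right by linarith
  qed
  also have "\<dots> = E / 4 + (1 / 4) * integral {0..1} (\<lambda>s. (\<delta>1 s)\<^sup>2) + c1 * integral {0..1} (\<lambda>s. (norm (w2 s))\<^sup>2) + c2 * integral {0..1} (\<lambda>s. (norm (w1 s))\<^sup>2)"
  proof (rule integral_unique)
    have "((\<lambda>s::real. E / 4) has_integral E / 4) {0..1}" using has_integral_const_real[of "E / 4" 0 1] by simp
    then show "((\<lambda>s. E / 4 + (1 / 4) * (\<delta>1 s)\<^sup>2 + c1 * (norm (w2 s))\<^sup>2 + c2 * (norm (w1 s))\<^sup>2) has_integral
       E / 4 + (1 / 4) * integral {0..1} (\<lambda>s. (\<delta>1 s)\<^sup>2) + c1 * integral {0..1} (\<lambda>s. (norm (w2 s))\<^sup>2) + c2 * integral {0..1} (\<lambda>s. (norm (w1 s))\<^sup>2)) {0..1}"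
      by (intro has_integral_add has_integral_mult_right integrable_integral integrable_continuous_interval continuous_intros cd cw)
  qed
  finally have fin: "E \<le> E / 2 + (c1 * integral {0..1} (\<lambda>s. (norm (w2 s))\<^sup>2) + c2 * integral {0..1} (\<lambda>s. (norm (w1 s))\<^sup>2))"
    using d1E by linarith
  define A where "A = integral {0..1} (\<lambda>s. (norm (w2 s))\<^sup>2)"
  define Bq where "Bq = integral {0..1} (\<lambda>s. (norm (w1 s))\<^sup>2)"
  have "E \<le> 2 * (c1 * A) + 2 * (c2 * Bq)" using fin by (simp add: A_def Bq_def)
  also have "\<dots> = 16 / m * \<rho>\<^sup>2 * (e powr a)\<^sup>2 * A + 2 * (\<rho>\<^sup>2 + 32 * \<rho>\<^sup>2 / (m * e\<^sup>2)) * Bq"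
    by (simp add: c1_def c2_def algebra_simps)
  finally show "E \<le> 16 / m * \<rho>\<^sup>2 * (e powr a)\<^sup>2 * integral {0..1} (\<lambda>s. (norm (w2 s))\<^sup>2)
       + 2 * (\<rho>\<^sup>2 + 32 * \<rho>\<^sup>2 / (m * e\<^sup>2)) * integral {0..1} (\<lambda>s. (norm (w1 s))\<^sup>2)"
    by (simp add: A_def Bq_def)
qed

lemma gronwall_zero:
  fixes F :: "real \<Rightarrow> real"
  assumes T: "0 < T" and d: "\<And>t. t \<in> {0..T} \<Longrightarrow> (F has_vector_derivative F' t) (at t within {0..T})"
    and b: "\<And>t. t \<in> {0..T} \<Longrightarrow> F' t \<le> L * F t" and z: "F 0 = 0" and t: "t \<in> {0..T}"
  shows "F t \<le> 0"
proof (cases "t = 0")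
  case False
  then have t': "0 < t" "t \<le> T" using t by auto
  define G where "G t = exp (- L * t) * F t" for t
  have "(G has_derivative (*) (exp (- L * x) * (F' x - L * F x))) (at x within {0..t})" if "0 \<le> x" "x \<le> t" for x
  proof -
    have "(F has_real_derivative F' x) (at x within {0..t})"
      using has_vector_derivative_within_subset[OF d, of x "{0..t}"] that t' by (auto simp: has_real_derivative_iff_has_vector_derivative)
    then have "(G has_real_derivative (exp (- L * x) * (- L) * F x + exp (- L * x) * F' x)) (at x within {0..t})"
      unfolding G_def[abs_def] by (auto intro!: derivative_eq_intros)
    moreover have "exp (- L * x) * (- L) * F x + exp (- L * x) * F' x = exp (- L * x) * (F' x - L * F x)"
      by (simp add: algebra_simps)
    ultimately show ?thesis by (simp add: has_field_derivative_def)
  qed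
  from mvt_simple[OF t'(1) this]
  obtain x where x: "x \<in> {0<..<t}" "G t - G 0 = exp (- L * x) * (F' x - L * F x) * (t - 0)" by blast
  have "F' x - L * F x \<le> 0" using b[of x] x(1) t' by auto
  then have "G t - G 0 \<le> 0" unfolding x(2) using t'(1) by (intro mult_nonpos_nonneg mult_nonneg_nonpos) auto
  then have "exp (- L * t) * F t \<le> 0" by (simp add: G_def z)
  then show ?thesis by (simp add: mult_le_0_iff)
qed (use z in simp)

section \<open>Nondegeneracy of the tension equation along a solution\<close>

lemma classicalD:
  assumes "classical a T K x0 x1 x2 xt \<sigma> \<sigma>1" "t \<in> {0..T}"
  shows "periodic1 (x0 t)" "\<And>s. (x0 t has_vector_derivative x1 t s) (at s)" "\<And>s. (x1 t has_vector_derivative x2 t s) (at s)"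
    "\<And>s. norm (x0 t s) \<le> K" "\<And>s. norm (x1 t s) \<le> K" "\<And>s. norm (x2 t s) \<le> K" "holder a K (x2 t)" "holder a K (xt t)"
    "solves_ell (\<lambda>s. (norm (x2 t s))\<^sup>2) (\<sigma> t) (\<sigma>1 t)"
    "\<And>s. xt t s = flux (\<sigma> t) (\<sigma>1 t) (x0 t) (x1 t) (x2 t) s"
    "\<And>s. ((\<lambda>t. x0 t s) has_vector_derivative xt t s) (at t within {0..T})"
    "periodic1 (x1 t)" "periodic1 (x2 t)"
    "\<And>t' s. t' \<in> {0..T} \<Longrightarrow> norm (x0 t s - x0 t' s) \<le> K * \<bar>t - t'\<bar> powr (a / 2)"
    "\<And>t' s. t' \<in> {0..T} \<Longrightarrow> norm (x2 t s - x2 t' s) \<le> K * \<bar>t - t'\<bar> powr (a / 2)"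
    "\<And>t' s. t' \<in> {0..T} \<Longrightarrow> norm (xt t s - xt t' s) \<le> K * \<bar>t - t'\<bar> powr (a / 2)"
proof -
  show *: "periodic1 (x0 t)" "\<And>s. (x0 t has_vector_derivative x1 t s) (at s)" "\<And>s. (x1 t has_vector_derivative x2 t s) (at s)"
    "\<And>s. norm (x0 t s) \<le> K" "\<And>s. norm (x1 t s) \<le> K" "\<And>s. norm (x2 t s) \<le> K" "holder a K (x2 t)" "holder a K (xt t)"
    "solves_ell (\<lambda>s. (norm (x2 t s))\<^sup>2) (\<sigma> t) (\<sigma>1 t)"
    "\<And>s. xt t s = flux (\<sigma> t) (\<sigma>1 t) (x0 t) (x1 t) (x2 t) s"
    "\<And>s. ((\<lambda>t. x0 t s) has_vector_derivative xt t s) (at t within {0..T})"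
    "\<And>t' s. t' \<in> {0..T} \<Longrightarrow> norm (x0 t s - x0 t' s) \<le> K * \<bar>t - t'\<bar> powr (a / 2)"
    "\<And>t' s. t' \<in> {0..T} \<Longrightarrow> norm (x2 t s - x2 t' s) \<le> K * \<bar>t - t'\<bar> powr (a / 2)"
    "\<And>t' s. t' \<in> {0..T} \<Longrightarrow> norm (xt t s - xt t' s) \<le> K * \<bar>t - t'\<bar> powr (a / 2)"
    using assms unfolding classical_def jet_def by blast+
  show "periodic1 (x1 t)" by (rule periodic1_has_vector_derivative[OF *(1,2)])
  then show "periodic1 (x2 t)" by (rule periodic1_has_vector_derivative) (rule *(3))
qed

text \<open>If the squared curvature vanished, the tension equation would read \<sigma>'' = -1,
  which has no periodic solution. At positive times unit speed is not part of the notion of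
  solution, so this replaces the bending argument.\<close>

lemma integral_pos_of_elliptic:
  fixes x2 :: "real \<Rightarrow> 'v::euclidean_space"
  assumes s: "solves_ell (\<lambda>s. (norm (x2 s))\<^sup>2) \<sigma> \<sigma>1" and c: "continuous_on UNIV x2" and p: "periodic1 x2"
  shows "0 < integral {0..1} (\<lambda>s. (norm (x2 s))\<^sup>2)"
proof -
  have c': "continuous_on {0..1} (\<lambda>s. (norm (x2 s))\<^sup>2)"
    by (intro continuous_intros continuous_on_subset[OF c]) auto
  have "0 \<le> integral {0..1} (\<lambda>s. (norm (x2 s))\<^sup>2)"
    by (intro integral_nonneg integrable_continuous_interval c') auto
  moreover have "integral {0..1} (\<lambda>s. (norm (x2 s))\<^sup>2) \<noteq> 0"
  proof
    assume "integral {0..1} (\<lambda>s. (norm (x2 s))\<^sup>2) = 0"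
    then have z: "\<forall>s\<in>{0..1}. (norm (x2 s))\<^sup>2 = 0"
      using integral_eq_0_iff[OF c'] by auto
    then have "x2 s = 0" for s using periodic1_all[OF p, of "\<lambda>v. v = 0"] by simp
    then have d: "(\<sigma>1 has_vector_derivative (- 1)) (at s)" for s
      using s by (simp add: solves_ell_def)
    have "((\<lambda>s. - 1) has_integral (\<sigma>1 1 - \<sigma>1 0)) {0..1::real}"
      by (rule fundamental_theorem_of_calculus) (auto intro: has_vector_derivative_at_within[OF d])
    moreover have "((\<lambda>s. - 1) has_integral (- 1 :: real)) {0..1::real}"
      using has_integral_const_real[of "- 1 :: real" 0 1] by simp
    ultimately have "\<sigma>1 1 - \<sigma>1 0 = - 1" by (rule has_integral_unique)
    moreover have "periodic1 \<sigma>1"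
      by (rule periodic1_has_vector_derivative[of \<sigma>]) (use s in \<open>auto simp: solves_ell_def\<close>)
    then have "\<sigma>1 1 = \<sigma>1 0" unfolding periodic1_def by (metis add_0)
    ultimately show False by simp
  qed
  ultimately show ?thesis by simp
qed

text \<open>The mean squared curvature is continuous in time, by the modulus of the second
  derivatives, and positive at each time, so it attains a positive minimum on the compact
  interval.\<close>

lemma curvature_lower_bound:
  assumes a: "0 < a" "a < 1" and T: "0 < T" and x: "classical a T K x0 x1 x2 xt \<sigma> \<sigma>1"
  obtains m where "0 < m" "m \<le> 1" "\<And>t. t \<in> {0..T} \<Longrightarrow> m \<le> integral {0..1} (\<lambda>s. (norm (x2 t s))\<^sup>2)"
proof -
  note X = classicalD[OF x]
  have cx: "continuous_on S (x2 t)" if "t \<in> {0..T}" for S t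
    using holder_continuous[OF a(1) X(7)[OF that]] continuous_on_subset by blast
  define I where "I t = integral {0..1} (\<lambda>s. (norm (x2 t s))\<^sup>2)" for t
  have i: "(\<lambda>s. (norm (x2 t s))\<^sup>2) integrable_on {0..1}" if "t \<in> {0..T}" for t
    by (intro integrable_continuous_interval continuous_intros cx[OF that])
  have "norm (I t - I t') \<le> (2 * K * K) * \<bar>t - t'\<bar> powr (a / 2)" if t: "t \<in> {0..T}" "t' \<in> {0..T}" for t t'
  proof -
    have "I t - I t' = integral {0..1} (\<lambda>s. (norm (x2 t s))\<^sup>2 - (norm (x2 t' s))\<^sup>2)"
      unfolding I_def by (rule Henstock_Kurzweil_Integration.integral_diff[symmetric]; rule i; rule t)
    also have "norm \<dots> \<le> integral {0..1} (\<lambda>s::real. (2 * K * K) * \<bar>t - t'\<bar> powr (a / 2))"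
    proof (rule integral_norm_bound_integral)
      show "(\<lambda>s. (norm (x2 t s))\<^sup>2 - (norm (x2 t' s))\<^sup>2) integrable_on {0..1}"
        by (intro integrable_diff i t)
      fix s
      have "norm ((norm (x2 t s))\<^sup>2 - (norm (x2 t' s))\<^sup>2) \<le> norm (x2 t s - x2 t' s) * (norm (x2 t s) + norm (x2 t' s))"
        using norm_square_diff_le by simp
      also have "\<dots> \<le> (K * \<bar>t - t'\<bar> powr (a / 2)) * (K + K)"
        using X(15)[OF t, of s] X(6)[OF t(1), of s] X(6)[OF t(2), of s] holder_nonneg[OF X(7)[OF t(1)]]
        by (intro mult_mono add_mono) auto
      finally show "norm ((norm (x2 t s))\<^sup>2 - (norm (x2 t' s))\<^sup>2) \<le> (2 * K * K) * \<bar>t - t'\<bar> powr (a / 2)"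
        by (simp add: mult_ac)
    qed auto
    finally show ?thesis by simp
  qed
  then have "continuous_on {0..T} I" using a by (intro continuous_on_of_holder[where b = "a / 2"]) auto
  then obtain t0 where t0: "t0 \<in> {0..T}" "\<And>t. t \<in> {0..T} \<Longrightarrow> I t0 \<le> I t"
    using continuous_attains_inf[of "{0..T}" I] T by auto
  have "0 < I t0" unfolding I_def by (rule integral_pos_of_elliptic[OF X(9)[OF t0(1)] cx[OF t0(1)] X(13)[OF t0(1)]])
  then show thesis
    using that[of "min 1 (I t0)"] t0(2) by (auto simp: I_def min_le_iff_disj)
qed

lemma elliptic_bounds_from_mass:
  assumes s: "solves_ell p \<sigma> \<sigma>1" and c: "continuous_on UNIV p" and p: "\<And>s. 0 \<le> p s" "\<And>s. p s \<le> P" "m \<le> integral {0..1} p"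
    and m: "0 < m" "m \<le> 1" and P: "1 \<le> P"
  shows "1 / P \<le> \<sigma> s" "\<bar>\<sigma> s\<bar> \<le> P * (4 / m) + 1" "\<bar>\<sigma>1 s\<bar> \<le> P * (4 / m) + 1"
proof -
  note s' = s[unfolded solves_ell_def]
  show "1 / P \<le> \<sigma> s" by (rule elliptic_lower_bound[of \<sigma> \<sigma>1 p P]) (use s' p in auto)
  have b: "\<bar>\<sigma> s\<bar> \<le> 4 / m" for s
    using elliptic_apriori[of \<sigma> \<sigma>1 p "\<lambda>_. 1" m 1 s] s' p c m by simp
  have "1 * (4 / m) \<le> P * (4 / m)" using P m by (intro mult_right_mono) auto
  then show "\<bar>\<sigma> s\<bar> \<le> P * (4 / m) + 1" using b[of s] by linarith
  have d: "\<bar>p s * \<sigma> s - 1\<bar> \<le> P * (4 / m) + 1" for s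
  proof -
    have "\<bar>p s * \<sigma> s\<bar> \<le> P * (4 / m)" unfolding abs_mult using p b[of s] P by (intro mult_mono) auto
    then show ?thesis by linarith
  qed
  show "\<bar>\<sigma>1 s\<bar> \<le> P * (4 / m) + 1"
    by (rule periodic1_derivative_bound[of \<sigma> \<sigma>1 "\<lambda>s. p s * \<sigma> s - 1"]) (use s' d in auto)
qed

text \<open>Coercivity contributes -2 \<mu> times the square of \<open>w2\<close>. Young's
  inequality spends \<mu>/2 on the mixed term with \<open>w\<close> and \<mu> on the remainder
  \<open>z\<close>, so -\<mu>/2 survives. The 4 in \<open>Q\<close> comes from squaring a sum of
  four terms.\<close>

lemma energy_pointwise:
  fixes w w2 z :: "'v::euclidean_space"
  assumes l: "0 < \<mu>" "\<mu> \<le> \<sigma>" "\<sigma> \<le> S" and z: "norm z \<le> K * d + S * n1 + K * d1 + norm w"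
    and nn: "0 \<le> d" "0 \<le> n1" "0 \<le> d1" "0 \<le> K" "0 \<le> S"
  defines "Q \<equiv> 4 * (1 + 1 / \<mu>)"
  shows "2 * ((w - w2) \<bullet> (\<sigma> *\<^sub>R w2 + z)) \<le> - (\<mu> / 2) * (norm w2)\<^sup>2 + Q * K\<^sup>2 * d\<^sup>2 + Q * K\<^sup>2 * d1\<^sup>2
     + Q * S\<^sup>2 * n1\<^sup>2 + (Q + 2 * S\<^sup>2 / \<mu> + 1) * (norm w)\<^sup>2"
proof -
  define n0 where "n0 = norm w"
  define n2 where "n2 = norm w2"
  define \<zeta> where "\<zeta> = K * d + S * n1 + K * d1 + n0"
  have pos: "0 \<le> n0" "0 \<le> n2" by (auto simp: n0_def n2_def)
  have "2 * ((w - w2) \<bullet> (\<sigma> *\<^sub>R w2 + z)) = 2 * (w \<bullet> (\<sigma> *\<^sub>R w2)) + 2 * (w \<bullet> z) - 2 * (\<sigma> * n2\<^sup>2) - 2 * (w2 \<bullet> z)"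
    by (simp add: inner_diff_left inner_add_right n2_def power2_norm_eq_inner algebra_simps)
  also have "\<dots> \<le> 2 * (n0 * (S * n2)) + 2 * (n0 * \<zeta>) - 2 * (\<mu> * n2\<^sup>2) + 2 * (n2 * \<zeta>)"
  proof -
    have 1: "w \<bullet> (\<sigma> *\<^sub>R w2) \<le> n0 * (S * n2)"
      using l pos by (intro order_trans[OF norm_cauchy_schwarz]) (auto simp: n0_def n2_def intro!: mult_mono)
    have 2: "w \<bullet> z \<le> n0 * \<zeta>"
      using z by (intro order_trans[OF norm_cauchy_schwarz]) (auto simp: n0_def \<zeta>_def intro!: mult_mono)
    have 3: "- (w2 \<bullet> z) \<le> n2 * \<zeta>"
    proof -
      have "- (w2 \<bullet> z) \<le> \<bar>w2 \<bullet> z\<bar>" by simp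
      also have "\<dots> \<le> norm w2 * norm z" by (rule Cauchy_Schwarz_ineq2)
      also have "\<dots> \<le> n2 * \<zeta>" using z by (auto simp: n0_def n2_def \<zeta>_def intro!: mult_mono)
      finally show ?thesis .
    qed
    have 4: "\<mu> * n2\<^sup>2 \<le> \<sigma> * n2\<^sup>2" using l by (intro mult_right_mono) auto
    show ?thesis using 1 2 3 4 by linarith
  qed
  also have "\<dots> \<le> - (\<mu> / 2) * n2\<^sup>2 + (1 + 1 / \<mu>) * \<zeta>\<^sup>2 + (2 * S\<^sup>2 / \<mu> + 1) * n0\<^sup>2"
  proof -
    have 1: "n2 * (2 * S * n0) \<le> \<mu> / 2 * n2\<^sup>2 + (2 * S * n0)\<^sup>2 / (4 * (\<mu> / 2))" by (rule young) (use l in simp)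
    have 2: "n2 * (2 * \<zeta>) \<le> \<mu> * n2\<^sup>2 + (2 * \<zeta>)\<^sup>2 / (4 * \<mu>)" by (rule young) (use l in simp)
    have 3: "n0 * (2 * \<zeta>) \<le> 1 * n0\<^sup>2 + (2 * \<zeta>)\<^sup>2 / (4 * 1)" by (rule young) simp
    have e: "(2 * S * n0)\<^sup>2 / (4 * (\<mu> / 2)) = 2 * S\<^sup>2 / \<mu> * n0\<^sup>2" "(2 * \<zeta>)\<^sup>2 / (4 * \<mu>) = 1 / \<mu> * \<zeta>\<^sup>2" "(2 * \<zeta>)\<^sup>2 / (4 * 1) = \<zeta>\<^sup>2"
      by (auto simp: power_mult_distrib)
    have f: "2 * (n0 * (S * n2)) = n2 * (2 * S * n0)" "2 * (n0 * \<zeta>) = n0 * (2 * \<zeta>)" "2 * (n2 * \<zeta>) = n2 * (2 * \<zeta>)"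
      "(1 + 1 / \<mu>) * \<zeta>\<^sup>2 = \<zeta>\<^sup>2 + 1 / \<mu> * \<zeta>\<^sup>2" "(2 * S\<^sup>2 / \<mu> + 1) * n0\<^sup>2 = 2 * S\<^sup>2 / \<mu> * n0\<^sup>2 + n0\<^sup>2"
      by (auto simp: distrib_right)
    define u v p q where "u = 2 * S\<^sup>2 / \<mu> * n0\<^sup>2" and "v = 1 / \<mu> * \<zeta>\<^sup>2" and "p = \<mu> * n2\<^sup>2" and "q = \<mu> / 2 * n2\<^sup>2"
    have pq: "p = 2 * q" "- (\<mu> / 2) * n2\<^sup>2 = - q" by (auto simp: p_def q_def)
    show ?thesis using 1 2 3 unfolding e f pq u_def[symmetric] v_def[symmetric] p_def[symmetric] q_def[symmetric] by (simp add: pq)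
  qed
  also have "\<dots> \<le> - (\<mu> / 2) * n2\<^sup>2 + (1 + 1 / \<mu>) * (4 * (K\<^sup>2 * d\<^sup>2 + S\<^sup>2 * n1\<^sup>2 + K\<^sup>2 * d1\<^sup>2 + n0\<^sup>2)) + (2 * S\<^sup>2 / \<mu> + 1) * n0\<^sup>2"
  proof -
    have sq: "(x + y + u + v)\<^sup>2 \<le> 4 * (x\<^sup>2 + y\<^sup>2 + u\<^sup>2 + v\<^sup>2)" for x y u v :: real
    proof -
      have "0 \<le> (x - y)\<^sup>2 + (x - u)\<^sup>2 + (x - v)\<^sup>2 + (y - u)\<^sup>2 + (y - v)\<^sup>2 + (u - v)\<^sup>2" by (intro add_nonneg_nonneg) auto
      then show ?thesis by (simp add: power2_eq_square algebra_simps)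
    qed
    have "\<zeta>\<^sup>2 \<le> 4 * (K\<^sup>2 * d\<^sup>2 + S\<^sup>2 * n1\<^sup>2 + K\<^sup>2 * d1\<^sup>2 + n0\<^sup>2)"
      using sq[of "K * d" "S * n1" "K * d1" n0] by (simp add: \<zeta>_def power_mult_distrib)
    then have "(1 + 1 / \<mu>) * \<zeta>\<^sup>2 \<le> (1 + 1 / \<mu>) * (4 * (K\<^sup>2 * d\<^sup>2 + S\<^sup>2 * n1\<^sup>2 + K\<^sup>2 * d1\<^sup>2 + n0\<^sup>2))"
      using l by (intro mult_left_mono) auto
    then show ?thesis by simp
  qed
  also have "\<dots> = - (\<mu> / 2) * n2\<^sup>2 + Q * K\<^sup>2 * d\<^sup>2 + Q * K\<^sup>2 * d1\<^sup>2 + Q * S\<^sup>2 * n1\<^sup>2 + (Q + 2 * S\<^sup>2 / \<mu> + 1) * n0\<^sup>2"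
    unfolding Q_def by (simp add: algebra_simps)
  finally show ?thesis by (simp add: n0_def n2_def)
qed

section \<open>Uniqueness\<close>

lemma solves_ell_continuous:
  assumes "solves_ell p \<sigma> \<sigma>1"
  shows "continuous_on A \<sigma>" "continuous_on A \<sigma>1"
proof -
  show "continuous_on A \<sigma>"
    by (rule continuous_on_of_vector_derivative[of \<sigma> \<sigma>1]) (use assms in \<open>simp add: solves_ell_def\<close>)
  show "continuous_on A \<sigma>1"
    by (rule continuous_on_of_vector_derivative[of \<sigma>1 "\<lambda>s. p s * \<sigma> s - 1"]) (use assms in \<open>simp add: solves_ell_def\<close>)
qed

context
  fixes a T K :: real and x0 x1 x2 xt y0 y1 y2 yt :: "real \<Rightarrow> real \<Rightarrow> 'v::euclidean_space" and \<sigma> \<sigma>1 \<tau> \<tau>1 :: "real \<Rightarrow> real \<Rightarrow> real"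
  assumes a: "0 < a" "a < 1" and T: "0 < T" and K: "1 \<le> K"
    and x: "classical a T K x0 x1 x2 xt \<sigma> \<sigma>1" and y: "classical a T K y0 y1 y2 yt \<tau> \<tau>1"
    and eq0: "x0 0 = y0 0"
begin

definition "dif t s = x0 t s - y0 t s"
definition "dif1 t s = x1 t s - y1 t s"
definition "dif2 t s = x2 t s - y2 t s"
definition "dift t s = xt t s - yt t s"
definition "energy t = integral {0..1} (\<lambda>s. (norm (dif t s))\<^sup>2 + (norm (dif1 t s))\<^sup>2)"
text \<open>The formal time derivative of the H^1 energy, with the contribution of the first
  derivatives integrated by parts, because the rate \<open>dift\<close> has no derivative in
  space.\<close>

definition "energy_rate t = integral {0..1} (\<lambda>s. 2 * ((dif t s - dif2 t s) \<bullet> dift t s))"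

lemma dif_deriv:
  assumes t: "t \<in> {0..T}"
  shows "(dif t has_vector_derivative dif1 t s) (at s)" "(dif1 t has_vector_derivative dif2 t s) (at s)"
    "((\<lambda>t. dif t s) has_vector_derivative dift t s) (at t within {0..T})"
  unfolding dif_def[abs_def] dif1_def[abs_def] dif2_def dift_def
  using classicalD(2,3,11)[OF x t] classicalD(2,3,11)[OF y t] by (auto intro!: has_vector_derivative_diff)

lemma dif_periodic:
  assumes t: "t \<in> {0..T}"
  shows "periodic1 (dif t)" "dif t 1 = dif t 0" "dif1 t 1 = dif1 t 0"
proof -
  show 1: "periodic1 (dif t)" using classicalD(1)[OF x t] classicalD(1)[OF y t] by (simp add: periodic1_def dif_def)
  have 2: "periodic1 (dif1 t)" by (rule periodic1_has_vector_derivative[OF 1 dif_deriv(1)[OF t]])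
  show "dif t 1 = dif t 0" "dif1 t 1 = dif1 t 0" using 1 2 unfolding periodic1_def by (metis add_0)+
qed

lemma dif_continuous:
  assumes t: "t \<in> {0..T}"
  shows "continuous_on S (dif t)" "continuous_on S (dif1 t)" "continuous_on S (dif2 t)" "continuous_on S (dift t)"
proof -
  show "continuous_on S (dif t)" "continuous_on S (dif1 t)"
    using continuous_on_of_vector_derivative dif_deriv[OF t] by blast+
  have "continuous_on UNIV (x2 t)" "continuous_on UNIV (y2 t)" "continuous_on UNIV (xt t)" "continuous_on UNIV (yt t)"
    using holder_continuous[OF a(1)] classicalD(7,8)[OF x t] classicalD(7,8)[OF y t] by blast+
  then show "continuous_on S (dif2 t)" "continuous_on S (dift t)"
    unfolding dif2_def[abs_def] dift_def[abs_def] by (auto intro!: continuous_on_diff intro: continuous_on_subset)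
qed

lemma dif_bounds:
  assumes t: "t \<in> {0..T}" "t' \<in> {0..T}"
  shows "norm (dif t s) \<le> 2 * K" "norm (dif2 t s) \<le> 2 * K" "norm (dift t s) \<le> 2 * K"
    "norm (dif t s - dif t' s) \<le> 2 * K * \<bar>t - t'\<bar> powr (a / 2)"
    "norm (dif2 t s - dif2 t' s) \<le> 2 * K * \<bar>t - t'\<bar> powr (a / 2)"
    "norm (dift t s - dift t' s) \<le> 2 * K * \<bar>t - t'\<bar> powr (a / 2)"
proof -
  have 2: "norm (p - q) \<le> 2 * b" if "norm p \<le> b" "norm q \<le> b" for p q :: 'v and b
    using norm_triangle_ineq4[of p q] that by linarith
  show "norm (dif t s) \<le> 2 * K" unfolding dif_def by (intro 2 classicalD(4)[OF x t(1)] classicalD(4)[OF y t(1)])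
  show "norm (dif2 t s) \<le> 2 * K" unfolding dif2_def by (intro 2 classicalD(6)[OF x t(1)] classicalD(6)[OF y t(1)])
  show "norm (dift t s) \<le> 2 * K" unfolding dift_def by (intro 2 holderD1[OF classicalD(8)[OF x t(1)]] holderD1[OF classicalD(8)[OF y t(1)]])
  have 3: "norm ((p - q) - (p' - q')) \<le> 2 * K * \<bar>t - t'\<bar> powr (a / 2)"
    if "norm (p - p') \<le> K * \<bar>t - t'\<bar> powr (a / 2)" "norm (q - q') \<le> K * \<bar>t - t'\<bar> powr (a / 2)" for p q p' q' :: 'v
  proof -
    have e: "(p - q) - (p' - q') = (p - p') - (q - q')" by simp
    show ?thesis unfolding e mult.assoc by (rule 2[OF that])
  qed
  show "norm (dif t s - dif t' s) \<le> 2 * K * \<bar>t - t'\<bar> powr (a / 2)"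
    unfolding dif_def by (intro 3 classicalD(14)[OF x t] classicalD(14)[OF y t])
  show "norm (dif2 t s - dif2 t' s) \<le> 2 * K * \<bar>t - t'\<bar> powr (a / 2)"
    unfolding dif2_def by (intro 3 classicalD(15)[OF x t] classicalD(15)[OF y t])
  show "norm (dift t s - dift t' s) \<le> 2 * K * \<bar>t - t'\<bar> powr (a / 2)"
    unfolding dift_def by (intro 3 classicalD(16)[OF x t] classicalD(16)[OF y t])
qed

text \<open>\<open>dif1\<close> is not known to be differentiable in time. Hence the energy is
  differentiated through increments: differences of squares are factored and the space derivative is
  integrated by parts, which leaves increments of \<open>dif\<close> only.\<close>

lemma energy_increment:
  assumes t: "t \<in> {0..T}" "r \<in> {0..T}"
  shows "energy r - energy t = integral {0..1} (\<lambda>s. (dif r s - dif t s) \<bullet> ((dif r s + dif t s) - (dif2 r s + dif2 t s)))"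
proof -
  note c = dif_continuous[OF t(1)] dif_continuous[OF t(2)]
  have "energy r - energy t = integral {0..1} (\<lambda>s. ((norm (dif r s))\<^sup>2 + (norm (dif1 r s))\<^sup>2) - ((norm (dif t s))\<^sup>2 + (norm (dif1 t s))\<^sup>2))"
    unfolding energy_def
    by (rule Henstock_Kurzweil_Integration.integral_diff[symmetric]; intro integrable_continuous_interval continuous_intros c)
  also have "\<dots> = integral {0..1} (\<lambda>s. (dif r s - dif t s) \<bullet> (dif r s + dif t s) + (dif1 r s - dif1 t s) \<bullet> (dif1 r s + dif1 t s))"
    by (intro integral_cong) (simp add: power2_norm_eq_inner inner_commute algebra_simps)
  also have "\<dots> = integral {0..1} (\<lambda>s. (dif r s - dif t s) \<bullet> (dif r s + dif t s)) + integral {0..1} (\<lambda>s. (dif1 r s - dif1 t s) \<bullet> (dif1 r s + dif1 t s))"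
    by (rule Henstock_Kurzweil_Integration.integral_add; intro integrable_continuous_interval continuous_intros c)
  also have "integral {0..1} (\<lambda>s. (dif1 r s - dif1 t s) \<bullet> (dif1 r s + dif1 t s)) = - integral {0..1} (\<lambda>s. (dif r s - dif t s) \<bullet> (dif2 r s + dif2 t s))"
    using dif_periodic[OF t(1)] dif_periodic[OF t(2)]
    by (intro integral_by_parts_periodic has_vector_derivative_diff has_vector_derivative_add dif_deriv t continuous_intros c) auto
  also have "integral {0..1} (\<lambda>s. (dif r s - dif t s) \<bullet> (dif r s + dif t s)) + - integral {0..1} (\<lambda>s. (dif r s - dif t s) \<bullet> (dif2 r s + dif2 t s))
    = integral {0..1} (\<lambda>s. (dif r s - dif t s) \<bullet> (dif r s + dif t s)) - integral {0..1} (\<lambda>s. (dif r s - dif t s) \<bullet> (dif2 r s + dif2 t s))"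
    by simp
  also have "\<dots> = integral {0..1} (\<lambda>s. (dif r s - dif t s) \<bullet> (dif r s + dif t s) - (dif r s - dif t s) \<bullet> (dif2 r s + dif2 t s))"
    by (rule Henstock_Kurzweil_Integration.integral_diff[symmetric]; intro integrable_continuous_interval continuous_intros c)
  finally show ?thesis by (simp add: inner_diff_right)
qed

text \<open>\<open>dif\<close> is linearised at \<open>t\<close>, its rate being Hoelder in time;
  the other factor tends to twice \<open>dif - dif2\<close> with the same modulus, because second
  derivatives are Hoelder in time.\<close>

lemma energy_taylor:
  assumes t: "t \<in> {0..T}" "r \<in> {0..T}"
  shows "\<bar>energy r - energy t - (r - t) * energy_rate t\<bar> \<le> 24 * K\<^sup>2 * \<bar>r - t\<bar> * \<bar>r - t\<bar> powr (a / 2)"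
proof -
  note c = dif_continuous[OF t(1)] dif_continuous[OF t(2)]
  define q where "q = \<bar>r - t\<bar> powr (a / 2)"
  have q0: "0 \<le> q" by (simp add: q_def)
  have lin: "norm (dif r s - dif t s - (r - t) *\<^sub>R dift t s) \<le> \<bar>r - t\<bar> * (2 * K * q)" for s
  proof -
    define I where "I = closed_segment t r"
    have I: "I \<subseteq> {0..T}" unfolding I_def using t by (simp add: closed_segment_subset)
    have "norm (dif r s - dif t s - (r - t) *\<^sub>R dift t s) \<le> norm (r - t) * (2 * K * q)"
    proof (rule vector_differentiable_bound_linearization[where S = I and f = "\<lambda>t. dif t s" and f' = "\<lambda>t. dift t s"])
      show "((\<lambda>t. dif t s) has_vector_derivative dift u s) (at u within I)" if "u \<in> I" for u
        using that I by (intro has_vector_derivative_within_subset[OF dif_deriv(3)]) auto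
      show "norm (dift u s - dift t s) \<le> 2 * K * q" if "u \<in> I" for u
      proof -
        have "\<bar>u - t\<bar> \<le> \<bar>r - t\<bar>" using that by (auto simp: I_def closed_segment_eq_real_ivl split: if_splits)
        then have "2 * K * \<bar>u - t\<bar> powr (a / 2) \<le> 2 * K * q"
          unfolding q_def using a K by (intro mult_left_mono powr_mono2) auto
        moreover have "u \<in> {0..T}" using that I by blast
        ultimately show ?thesis using dif_bounds(6)[of u t s] t by linarith
      qed
    qed (auto simp: I_def)
    then show ?thesis by simp
  qed
  have 1: "energy r - energy t - (r - t) * energy_rate t = integral {0..1} (\<lambda>s. (dif r s - dif t s) \<bullet> ((dif r s + dif t s) - (dif2 r s + dif2 t s))
      - (r - t) * (2 * ((dif t s - dif2 t s) \<bullet> dift t s)))"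
    unfolding energy_increment[OF t] energy_rate_def integral_mult_right[symmetric]
    by (rule Henstock_Kurzweil_Integration.integral_diff[symmetric]; intro integrable_continuous_interval continuous_intros c)
  have 2: "norm (integral {0..1} (\<lambda>s. (dif r s - dif t s) \<bullet> ((dif r s + dif t s) - (dif2 r s + dif2 t s))
      - (r - t) * (2 * ((dif t s - dif2 t s) \<bullet> dift t s)))) \<le> integral {0..1} (\<lambda>s::real. 24 * K\<^sup>2 * \<bar>r - t\<bar> * q)"
  proof (rule integral_norm_bound_integral)
    show "(\<lambda>s. (dif r s - dif t s) \<bullet> ((dif r s + dif t s) - (dif2 r s + dif2 t s)) - (r - t) * (2 * ((dif t s - dif2 t s) \<bullet> dift t s))) integrable_on {0..1}"
      by (intro integrable_continuous_interval continuous_intros c)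
    fix s
    define Z where "Z = (dif r s + dif t s) - (dif2 r s + dif2 t s)"
    define Z0 where "Z0 = dif t s - dif2 t s"
    have Z: "norm Z \<le> 8 * K"
      using norm_triangle_ineq4[of "dif r s + dif t s" "dif2 r s + dif2 t s"] norm_triangle_ineq[of "dif r s" "dif t s"] norm_triangle_ineq[of "dif2 r s" "dif2 t s"]
        dif_bounds(1,2)[OF t, of s] dif_bounds(1,2)[OF t(2,1), of s] unfolding Z_def by linarith
    have "Z - 2 *\<^sub>R Z0 = (dif r s - dif t s) - (dif2 r s - dif2 t s)" by (simp add: Z_def Z0_def algebra_simps scaleR_2)
    then have ZZ: "norm (Z - 2 *\<^sub>R Z0) \<le> 4 * K * q"
      using norm_triangle_ineq4[of "dif r s - dif t s" "dif2 r s - dif2 t s"] dif_bounds(4,5)[OF t(2,1), of s] by (simp add: q_def)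
    have "(dif r s - dif t s) \<bullet> Z - (r - t) * (2 * (Z0 \<bullet> dift t s)) =
       (dif r s - dif t s - (r - t) *\<^sub>R dift t s) \<bullet> Z + ((r - t) *\<^sub>R dift t s) \<bullet> (Z - 2 *\<^sub>R Z0)"
      using inner_commute[of Z0 "dift t s"] by (simp add: inner_diff_left inner_diff_right)
    \<comment> \<open>The linearisation error 2 K q meets the bound 8 K, and the rate bound 2 K
      meets the increment 4 K q; together 24 K^2 q.\<close>
    also have "\<bar>\<dots>\<bar> \<le> (\<bar>r - t\<bar> * (2 * K * q)) * (8 * K) + (\<bar>r - t\<bar> * (2 * K)) * (4 * K * q)"
    proof (rule order_trans[OF abs_triangle_ineq], intro add_mono order_trans[OF Cauchy_Schwarz_ineq2] mult_mono lin Z ZZ)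
      show "norm ((r - t) *\<^sub>R dift t s) \<le> \<bar>r - t\<bar> * (2 * K)"
        using dif_bounds(3)[OF t, of s] by (simp add: mult_left_mono)
    qed (use K q0 in auto)
    also have "\<dots> = 24 * K\<^sup>2 * \<bar>r - t\<bar> * q" by (simp add: power2_eq_square)
    finally show "norm ((dif r s - dif t s) \<bullet> ((dif r s + dif t s) - (dif2 r s + dif2 t s)) - (r - t) * (2 * ((dif t s - dif2 t s) \<bullet> dift t s)))
      \<le> 24 * K\<^sup>2 * \<bar>r - t\<bar> * q" by (simp add: Z_def Z0_def)
  qed auto
  have "integral {0..1} (\<lambda>s::real. 24 * K\<^sup>2 * \<bar>r - t\<bar> * q) = 24 * K\<^sup>2 * \<bar>r - t\<bar> * q"
    by simp
  then show ?thesis using 2 unfolding 1[symmetric] q_def real_norm_def by simp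
qed

lemma energy_derivative:
  assumes t: "t \<in> {0..T}"
  shows "(energy has_vector_derivative energy_rate t) (at t within {0..T})"
proof (rule has_vector_derivative_of_quotient_limit)
  have "((\<lambda>r. 24 * K\<^sup>2 * \<bar>r - t\<bar> powr (a / 2)) \<longlongrightarrow> 24 * K\<^sup>2 * \<bar>t - t\<bar> powr (a / 2)) (at t within {0..T})"
    using a by (intro tendsto_intros) auto
  then have "((\<lambda>r. 24 * K\<^sup>2 * \<bar>r - t\<bar> powr (a / 2)) \<longlongrightarrow> 0) (at t within {0..T})" by simp
  then have "((\<lambda>r. (energy r - energy t) /\<^sub>R (r - t) - energy_rate t) \<longlongrightarrow> 0) (at t within {0..T})"
  proof (rule Lim_null_comparison[rotated])
    show "\<forall>\<^sub>F r in at t within {0..T}. norm ((energy r - energy t) /\<^sub>R (r - t) - energy_rate t) \<le> 24 * K\<^sup>2 * \<bar>r - t\<bar> powr (a / 2)"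
      unfolding eventually_at_filter
    proof (rule always_eventually, intro allI impI)
      fix r assume r: "r \<noteq> t" "r \<in> {0..T}"
      have "(energy r - energy t) /\<^sub>R (r - t) - energy_rate t = (energy r - energy t - (r - t) * energy_rate t) / (r - t)"
        using r(1) by (simp add: field_simps)
      then have "norm ((energy r - energy t) /\<^sub>R (r - t) - energy_rate t) = \<bar>energy r - energy t - (r - t) * energy_rate t\<bar> / \<bar>r - t\<bar>" by simp
      also have "\<dots> \<le> 24 * K\<^sup>2 * \<bar>r - t\<bar> powr (a / 2)"
        using energy_taylor[OF t r(2)] r(1) by (simp add: divide_le_eq mult_ac)
      finally show "norm ((energy r - energy t) /\<^sub>R (r - t) - energy_rate t) \<le> 24 * K\<^sup>2 * \<bar>r - t\<bar> powr (a / 2)" .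
    qed
  qed
  then show "((\<lambda>r. (energy r - energy t) /\<^sub>R (r - t)) \<longlongrightarrow> energy_rate t) (at t within {0..T})" by (rule LIM_zero_cancel)
qed

lemma energy_inequality: "\<exists>L. \<forall>t\<in>{0..T}. energy_rate t \<le> L * energy t"
proof -
  obtain mx where mx: "0 < mx" "mx \<le> 1" "\<And>t. t \<in> {0..T} \<Longrightarrow> mx \<le> integral {0..1} (\<lambda>s. (norm (x2 t s))\<^sup>2)"
    using curvature_lower_bound[OF a T x] by blast
  obtain my where my: "0 < my" "my \<le> 1" "\<And>t. t \<in> {0..T} \<Longrightarrow> my \<le> integral {0..1} (\<lambda>s. (norm (y2 t s))\<^sup>2)"
    using curvature_lower_bound[OF a T y] by blast
  define m where "m = min mx my"
  have m: "0 < m" "m \<le> 1" "\<And>t. t \<in> {0..T} \<Longrightarrow> m \<le> integral {0..1} (\<lambda>s. (norm (x2 t s))\<^sup>2)"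
    "\<And>t. t \<in> {0..T} \<Longrightarrow> m \<le> integral {0..1} (\<lambda>s. (norm (y2 t s))\<^sup>2)"
    using mx my by (auto simp: m_def min_le_iff_disj)
  define S where "S = K\<^sup>2 * (4 / m) + 1"
  \<comment> \<open>The lower bound of the tension, as the squared curvature is at most K^2.\<close>
  define \<mu> where "\<mu> = 1 / K\<^sup>2"
  have K2: "1 \<le> K\<^sup>2" using K by (rule one_le_power)
  have \<mu>: "0 < \<mu>" using K by (simp add: \<mu>_def)
  have S0: "0 \<le> S" using m K2 by (simp add: S_def)
  define \<rho> where "\<rho> = 8 * S * K"
  define Q where "Q = 4 * (1 + 1 / \<mu>)"
  have Q0: "0 \<le> Q" using \<mu> by (simp add: Q_def)
  \<comment> \<open>The 4/m belongs to the pointwise bound of the squared tension difference by its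
    energy, the 1 to the integral bound of its derivative.\<close>
  define G where "G = Q * K\<^sup>2 * (4 / m + 1)"
  have G0: "0 \<le> G" using Q0 m by (simp add: G_def)
  define Xc where "Xc = G * (16 / m * \<rho>\<^sup>2)"
  have X0: "0 \<le> Xc" using G0 m by (simp add: Xc_def)
  \<comment> \<open>Chosen so that the second derivatives hidden in the tension energy cost at most
    the dissipation \<mu>/2; the added 1 avoids a zero denominator. The averaging length
    \<open>e\<close> below solves e^(2 a) = \<eta>.\<close>
  define \<eta> where "\<eta> = (\<mu> / 2) / (Xc + 1)"
  have \<eta>: "0 < \<eta>" using \<mu> X0 by (simp add: \<eta>_def)
  define e where "e = \<eta> powr (1 / (2 * a))"
  have e: "0 < e" using \<eta> by (simp add: e_def)
  have ea: "(e powr a)\<^sup>2 = \<eta>"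
  proof -
    have "(e powr a)\<^sup>2 = e powr (a * 2)" using e by (simp add: powr_powr[symmetric] powr_numeral)
    also have "\<dots> = \<eta>" using a \<eta> by (simp add: e_def powr_powr)
    finally show ?thesis .
  qed
  have absorb: "G * (16 / m * \<rho>\<^sup>2 * (e powr a)\<^sup>2) \<le> \<mu> / 2"
  proof -
    have "G * (16 / m * \<rho>\<^sup>2 * (e powr a)\<^sup>2) = Xc * \<eta>" unfolding ea Xc_def by (simp only: mult.assoc)
    also have "\<dots> = (Xc / (Xc + 1)) * (\<mu> / 2)" unfolding \<eta>_def times_divide_eq_right times_divide_eq_left by simp
    also have "\<dots> \<le> 1 * (\<mu> / 2)" using X0 \<mu> by (intro mult_right_mono) auto
    finally show ?thesis by simp
  qed
  define Ce where "Ce = 2 * (\<rho>\<^sup>2 + 32 * \<rho>\<^sup>2 / (m * e\<^sup>2))"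
  have Ce0: "0 \<le> Ce" using m e by (auto simp: Ce_def intro!: add_nonneg_nonneg divide_nonneg_nonneg)
  define Zc where "Zc = Q + 2 * S\<^sup>2 / \<mu> + 1"
  have Z0: "0 \<le> Zc" using Q0 \<mu> by (simp add: Zc_def)
  define L where "L = (G * Ce + Q * S\<^sup>2) + Zc"
  have "energy_rate t \<le> L * energy t" if t: "t \<in> {0..T}" for t
  proof -
    note X = classicalD[OF x t] and Y = classicalD[OF y t]
    note c = dif_continuous[OF t]
    have cx: "continuous_on A (x2 t)" "continuous_on A (y2 t)" for A
      using holder_continuous[OF a(1) X(7)] holder_continuous[OF a(1) Y(7)] continuous_on_subset by blast+
    define \<delta> where "\<delta> s = \<sigma> t s - \<tau> t s" for s
    define \<delta>1 where "\<delta>1 s = \<sigma>1 t s - \<tau>1 t s" for s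
    have p: "(norm (x2 t s))\<^sup>2 \<le> K\<^sup>2" "(norm (y2 t s))\<^sup>2 \<le> K\<^sup>2" for s
      using X(6) Y(6) by (auto intro: power_mono)
    have bx: "1 / K\<^sup>2 \<le> \<sigma> t s" "\<bar>\<sigma> t s\<bar> \<le> S" "\<bar>\<sigma>1 t s\<bar> \<le> S" for s
      unfolding S_def using m(3)[OF t] p
      by (intro elliptic_bounds_from_mass[OF X(9) _ _ _ _ m(1,2) K2] continuous_intros cx; simp)+
    have by': "\<bar>\<tau> t s\<bar> \<le> S" "\<bar>\<tau>1 t s\<bar> \<le> S" for s
      unfolding S_def using m(4)[OF t] p
      by (intro elliptic_bounds_from_mass[OF Y(9) _ _ _ _ m(1,2) K2] continuous_intros cx; simp)+
    have cs: "continuous_on A \<delta>" "continuous_on A \<delta>1" for A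
      unfolding \<delta>_def \<delta>1_def by (intro continuous_intros solves_ell_continuous[OF X(9)] solves_ell_continuous[OF Y(9)])+
    define E where "E = integral {0..1} (\<lambda>s. (\<sigma>1 t s - \<tau>1 t s)\<^sup>2 + (norm (x2 t s))\<^sup>2 * (\<sigma> t s - \<tau> t s)\<^sup>2)"
    define A where "A = integral {0..1} (\<lambda>s. (norm (dif2 t s))\<^sup>2)"
    define B1 where "B1 = integral {0..1} (\<lambda>s. (norm (dif1 t s))\<^sup>2)"
    define B0 where "B0 = integral {0..1} (\<lambda>s. (norm (dif t s))\<^sup>2)"
    have dif2: "\<And>s. dif2 t s = x2 t s - y2 t s" by (simp add: dif2_def)
    note ede = elliptic_difference_energy[OF a X(9) Y(9) X(7) Y(7) X(13) Y(13) dif2 dif_deriv(2)[OF t] dif_periodic(3)[OF t]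
        m(1,2) m(3)[OF t] by' e \<rho>_def, folded E_def]
    have E1: "(\<delta> s)\<^sup>2 \<le> 4 / m * E" for s
      using ede(1)[of s] m(1) by (simp add: \<delta>_def field_simps)
    have E2: "integral {0..1} (\<lambda>s. (\<delta>1 s)\<^sup>2) \<le> E" using ede(2) by (simp add: \<delta>1_def)
    have E3: "E \<le> (16 / m * \<rho>\<^sup>2 * (e powr a)\<^sup>2) * A + Ce * B1" using ede(3) by (simp add: A_def B1_def Ce_def)
    have A0: "0 \<le> A" "0 \<le> B1" "0 \<le> B0" unfolding A_def B1_def B0_def
      by (intro integral_nonneg integrable_continuous_interval continuous_intros c; simp)+
    have pw: "2 * ((dif t s - dif2 t s) \<bullet> dift t s) \<le> - (\<mu> / 2) * (norm (dif2 t s))\<^sup>2 + Q * K\<^sup>2 * (4 / m * E) + Q * K\<^sup>2 * (\<delta>1 s)\<^sup>2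
     + Q * S\<^sup>2 * (norm (dif1 t s))\<^sup>2 + Zc * (norm (dif t s))\<^sup>2" for s
    proof -
      \<comment> \<open>All of the rate difference except \<sigma> times the second derivative of
        the difference. The splitting keeps the tension of the first solution in front of the
        top-order term and lets the tension differences multiply the bounded derivatives of the
        second curve.\<close>
      define z where "z = \<delta> s *\<^sub>R y2 t s + \<sigma>1 t s *\<^sub>R dif1 t s + \<delta>1 s *\<^sub>R y1 t s + dif t s"
      have wz: "dift t s = \<sigma> t s *\<^sub>R dif2 t s + z"
        unfolding dift_def X(10) Y(10) flux_def z_def dif_def dif1_def dif2_def \<delta>_def \<delta>1_def by (simp add: algebra_simps)
      have nz: "norm z \<le> K * \<bar>\<delta> s\<bar> + S * norm (dif1 t s) + K * \<bar>\<delta>1 s\<bar> + norm (dif t s)"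
        unfolding z_def
      proof (intro norm_triangle_mono)
        show "norm (\<delta> s *\<^sub>R y2 t s) \<le> K * \<bar>\<delta> s\<bar>" using mult_right_mono[OF Y(6)[of s], of "\<bar>\<delta> s\<bar>"] by (simp add: mult.commute)
        show "norm (\<sigma>1 t s *\<^sub>R dif1 t s) \<le> S * norm (dif1 t s)" using bx(3)[of s] by (simp add: mult_right_mono)
        show "norm (\<delta>1 s *\<^sub>R y1 t s) \<le> K * \<bar>\<delta>1 s\<bar>" using mult_right_mono[OF Y(5)[of s], of "\<bar>\<delta>1 s\<bar>"] by (simp add: mult.commute)
      qed simp
      have "2 * ((dif t s - dif2 t s) \<bullet> (\<sigma> t s *\<^sub>R dif2 t s + z)) \<le> - (\<mu> / 2) * (norm (dif2 t s))\<^sup>2 + Q * K\<^sup>2 * \<bar>\<delta> s\<bar>\<^sup>2 + Q * K\<^sup>2 * \<bar>\<delta>1 s\<bar>\<^sup>2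
       + Q * S\<^sup>2 * (norm (dif1 t s))\<^sup>2 + Zc * (norm (dif t s))\<^sup>2"
        unfolding Q_def Zc_def
        using bx(1,2)[of s] K S0 by (intro energy_pointwise[OF \<mu> _ _ nz]) (auto simp: \<mu>_def)
      moreover have "Q * K\<^sup>2 * \<bar>\<delta> s\<bar>\<^sup>2 \<le> Q * K\<^sup>2 * (4 / m * E)"
        using E1[of s] Q0 by (intro mult_left_mono) auto
      ultimately show ?thesis unfolding wz power2_abs by linarith
    qed
    have "energy_rate t \<le> integral {0..1} (\<lambda>s. - (\<mu> / 2) * (norm (dif2 t s))\<^sup>2 + Q * K\<^sup>2 * (4 / m * E) + Q * K\<^sup>2 * (\<delta>1 s)\<^sup>2
     + Q * S\<^sup>2 * (norm (dif1 t s))\<^sup>2 + Zc * (norm (dif t s))\<^sup>2)"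
      unfolding energy_rate_def by (intro integral_le pw integrable_continuous_interval continuous_intros c cs)
    also have "\<dots> = - (\<mu> / 2) * A + Q * K\<^sup>2 * (4 / m * E) + Q * K\<^sup>2 * integral {0..1} (\<lambda>s. (\<delta>1 s)\<^sup>2) + Q * S\<^sup>2 * B1 + Zc * B0"
    proof (rule integral_unique)
      have "((\<lambda>s::real. E) has_integral E) {0..1}"
        using has_integral_const_real[of E 0 1] by simp
      then show "((\<lambda>s. - (\<mu> / 2) * (norm (dif2 t s))\<^sup>2 + Q * K\<^sup>2 * (4 / m * E) + Q * K\<^sup>2 * (\<delta>1 s)\<^sup>2
     + Q * S\<^sup>2 * (norm (dif1 t s))\<^sup>2 + Zc * (norm (dif t s))\<^sup>2) has_integral
        - (\<mu> / 2) * A + Q * K\<^sup>2 * (4 / m * E) + Q * K\<^sup>2 * integral {0..1} (\<lambda>s. (\<delta>1 s)\<^sup>2) + Q * S\<^sup>2 * B1 + Zc * B0) {0..1}"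
        unfolding A_def B1_def B0_def
        by (intro has_integral_add has_integral_mult_right integrable_integral integrable_continuous_interval continuous_intros c cs)
    qed
    also have "\<dots> \<le> - (\<mu> / 2) * A + G * E + Q * S\<^sup>2 * B1 + Zc * B0"
    proof -
      have "Q * K\<^sup>2 * integral {0..1} (\<lambda>s. (\<delta>1 s)\<^sup>2) \<le> Q * K\<^sup>2 * E" using E2 Q0 by (intro mult_left_mono) auto
      moreover have "G * E = Q * K\<^sup>2 * (4 / m * E) + Q * K\<^sup>2 * E" by (simp add: G_def algebra_simps)
      ultimately show ?thesis by linarith
    qed
    also have "\<dots> \<le> (G * Ce + Q * S\<^sup>2) * B1 + Zc * B0"
    proof -
      have "G * E \<le> G * ((16 / m * \<rho>\<^sup>2 * (e powr a)\<^sup>2) * A + Ce * B1)" by (rule mult_left_mono[OF E3 G0])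
      also have "\<dots> = (G * (16 / m * \<rho>\<^sup>2 * (e powr a)\<^sup>2)) * A + G * Ce * B1" by (simp add: algebra_simps)
      also have "\<dots> \<le> (\<mu> / 2) * A + G * Ce * B1" using mult_right_mono[OF absorb A0(1)] by simp
      finally show ?thesis by (simp add: distrib_right)
    qed
    also have "\<dots> \<le> L * B1 + L * B0"
      using A0 G0 Ce0 Q0 Z0 by (intro add_mono mult_right_mono) (auto simp: L_def)
    also have "\<dots> = L * energy t"
    proof -
      have "energy t = B0 + B1" unfolding energy_def B0_def B1_def
        by (rule Henstock_Kurzweil_Integration.integral_add; intro integrable_continuous_interval continuous_intros c)
      then show ?thesis by (simp add: distrib_left)
    qed
    finally show ?thesis .
  qed
  then show ?thesis by blast
qed

lemma classical_unique:
  assumes t: "t \<in> {0..T}" shows "x0 t s = y0 t s"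
proof -
  obtain L where L: "\<And>t. t \<in> {0..T} \<Longrightarrow> energy_rate t \<le> L * energy t" using energy_inequality by blast
  have z: "0 \<in> {0..T}" using T by simp
  have "x1 0 s = y1 0 s" for s
    using classicalD(2)[OF x z, of s] classicalD(2)[OF y z, of s] unfolding eq0 by (rule vector_derivative_unique_at)
  then have "energy 0 = 0" by (simp add: energy_def dif_def dif1_def eq0)
  then have energy: "energy t \<le> 0" by (intro gronwall_zero[where F = energy, OF T energy_derivative L _ t]) auto
  note c = dif_continuous[OF t]
  have ci: "continuous_on {0..1} (\<lambda>s. (norm (dif t s))\<^sup>2 + (norm (dif1 t s))\<^sup>2)" by (intro continuous_intros c)
  have "0 \<le> energy t" unfolding energy_def by (intro integral_nonneg integrable_continuous_interval ci) auto
  then have "energy t = 0" using energy by simp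
  then have "\<forall>s\<in>{0..1}. (norm (dif t s))\<^sup>2 + (norm (dif1 t s))\<^sup>2 = 0"
    using integral_eq_0_iff[OF ci] by (simp add: energy_def)
  then have "dif t s = 0" if "s \<in> {0..1}" for s
    using that by (auto simp: sum_power2_eq_zero_iff)
  then have "dif t s = 0" using periodic1_all[OF dif_periodic(1)[OF t], of "\<lambda>v. v = 0"] by blast
  then show ?thesis by (simp add: dif_def)
qed

end

section \<open>The function spaces of the theorem\<close>

lemma circ_dist_le: "circ_dist x y \<le> \<bar>x - y\<bar>"
  using round_diff_minimal[of "x - y" 0] by (simp add: circ_dist_def)

lemma circ_dist_nonneg: "0 \<le> circ_dist x y"
  by (simp add: circ_dist_def)

text \<open>Translating \<open>x\<close> by the integer nearest to x - y realises the distance on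
  the circle, so Hoelder constants on the circle and on the line coincide.\<close>

lemma periodic1_diff_circ:
  assumes "periodic1 f"
  obtains x' where "f x = f x'" "\<bar>x' - y\<bar> = circ_dist x y"
proof
  show "f x = f (x + of_int (- round (x - y)))" using periodic1_int[OF assms] by metis
  show "\<bar>x + of_int (- round (x - y)) - y\<bar> = circ_dist x y" by (simp add: circ_dist_def algebra_simps)
qed

lemma holder_quot_S1_nonempty: "holder_quot_S1 a f \<noteq> {}"
proof -
  \<comment> \<open>Antipodal points: the rounded difference is 1, so their circle distance is 1/2.
    Nonemptiness matters because nothing can be said about \<open>Sup\<close> of the empty set of
    reals.\<close>
  have "round (1 / 2 :: real) = 1" by (simp add: round_def)
  then have "circ_dist (1 / 2) 0 \<noteq> 0" by (simp add: circ_dist_def)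
  then show ?thesis unfolding holder_quot_S1_def by blast
qed

lemma holder_quot_S1_nonneg: "q \<in> holder_quot_S1 a f \<Longrightarrow> 0 \<le> q"
  by (auto simp: holder_quot_S1_def)

lemma holder_quot_nonneg: "q \<in> holder_quot S a f \<Longrightarrow> 0 \<le> q"
  by (auto simp: holder_quot_def)

lemma Sup_nonneg_real:
  fixes A :: "real set"
  assumes "A \<noteq> {}" "bdd_above A" "\<And>q. q \<in> A \<Longrightarrow> 0 \<le> q"
  shows "0 \<le> Sup A"
  using assms cSup_upper by (meson all_not_in_conv order_trans)

lemma SUP_norm_nonneg:
  assumes "bdd_above ((\<lambda>s. norm (f s)) ` A)" "A \<noteq> {}"
  shows "0 \<le> (SUP s\<in>A. norm (f s))"
  using assms by (intro Sup_nonneg_real) auto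

lemma holder_quot_S1_le:
  fixes f :: "real \<Rightarrow> 'v::real_normed_vector"
  assumes "periodic1 f" "\<And>x y. norm (f x - f y) \<le> M * \<bar>x - y\<bar> powr a" "q \<in> holder_quot_S1 a f"
  shows "q \<le> M"
proof -
  obtain x y where q: "q = norm (f x - f y) / circ_dist x y powr a" "circ_dist x y \<noteq> 0"
    using assms(3) by (auto simp: holder_quot_S1_def)
  obtain x' where x': "f x = f x'" "\<bar>x' - y\<bar> = circ_dist x y" using periodic1_diff_circ[OF assms(1)] by blast
  have "norm (f x - f y) \<le> M * circ_dist x y powr a" using assms(2)[of x' y] x' by simp
  then show ?thesis using q circ_dist_nonneg[of x y] by (simp add: divide_le_eq)
qed

lemma holder_of_quot_S1:
  fixes f :: "real \<Rightarrow> 'v::real_normed_vector"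
  assumes per: "periodic1 f" and b: "bdd_above (holder_quot_S1 a f)" and a: "0 < a"
  shows "norm (f x - f y) \<le> Sup (holder_quot_S1 a f) * \<bar>x - y\<bar> powr a"
proof -
  define Q where "Q = Sup (holder_quot_S1 a f)"
  have Q: "0 \<le> Q" unfolding Q_def by (intro Sup_nonneg_real holder_quot_S1_nonempty b holder_quot_S1_nonneg)
  show ?thesis
  proof (cases "circ_dist x y = 0")
    case True
    obtain x' where x': "f x = f x'" "\<bar>x' - y\<bar> = circ_dist x y" using periodic1_diff_circ[OF per] by blast
    then have "f x = f y" using True by simp
    then show ?thesis using Q by (simp add: Q_def)
  next
    case False
    then have p: "0 < circ_dist x y" using circ_dist_nonneg[of x y] by simp
    have "norm (f x - f y) / circ_dist x y powr a \<in> holder_quot_S1 a f"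
      unfolding holder_quot_S1_def by (rule image_eqI[of _ _ "(x, y)"]) (use False in auto)
    then have "norm (f x - f y) / circ_dist x y powr a \<le> Q" unfolding Q_def using b by (rule cSup_upper)
    then have "norm (f x - f y) \<le> Q * circ_dist x y powr a" using p by (simp add: divide_le_eq)
    also have "\<dots> \<le> Q * \<bar>x - y\<bar> powr a"
      using circ_dist_le[of x y] p a by (intro mult_left_mono Q powr_mono2) auto
    finally show ?thesis by (simp add: Q_def)
  qed
qed

lemma C_S1_dpow:
  fixes f :: "real \<Rightarrow> 'v::real_normed_vector"
  assumes "C_S1 k a f" "j \<le> k"
  shows "periodic1 (dpow j f)" "continuous_on UNIV (dpow j f)" "bdd_above (range (\<lambda>s. norm (dpow j f s)))"
proof -
  have d: "i < k \<Longrightarrow> (dpow i f has_vector_derivative dpow (Suc i) f s) (at s)" for i s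
    using assms(1) unfolding C_S1_def by blast
  show p: "periodic1 (dpow j f)" using assms(2)
  proof (induction j)
    case 0
    then show ?case using assms(1) by (simp add: C_S1_def)
  next
    case (Suc j)
    then show ?case using periodic1_has_vector_derivative[of "dpow j f" "dpow (Suc j) f"] d by simp
  qed
  show c: "continuous_on UNIV (dpow j f)"
  proof (cases "j = k")
    case True then show ?thesis using assms(1) by (simp add: C_S1_def)
  next
    case False
    then show ?thesis using assms(2) d[of j] by (intro continuous_on_of_vector_derivative) auto
  qed
  obtain z where "\<And>x. norm (dpow j f x) \<le> norm (dpow j f z)" using periodic1_attains_sup_norm[OF p c] by blast
  then show "bdd_above (range (\<lambda>s. norm (dpow j f s)))" by (intro bdd_aboveI) auto
qed

lemma norm_S1_bounds:
  fixes f :: "real \<Rightarrow> 'v::real_normed_vector"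
  assumes c: "C_S1 k a f" and a: "0 < a"
  shows "j \<le> k \<Longrightarrow> norm (dpow j f s) \<le> norm_S1 k a f" "holder a (norm_S1 k a f) (dpow k f)"
proof -
  have s0: "0 \<le> (SUP s. norm (dpow i f s))" if "i \<le> k" for i
    using C_S1_dpow(3)[OF c that] by (intro SUP_norm_nonneg) auto
  have b: "bdd_above (holder_quot_S1 a (dpow k f))" using c by (simp add: C_S1_def)
  have h0: "0 \<le> Sup (holder_quot_S1 a (dpow k f))"
    by (intro Sup_nonneg_real holder_quot_S1_nonempty b holder_quot_S1_nonneg)
  have 1: "norm (dpow j f s) \<le> norm_S1 k a f" if "j \<le> k" for j s
  proof -
    have "norm (dpow j f s) \<le> (SUP s. norm (dpow j f s))" by (rule cSUP_upper[OF UNIV_I C_S1_dpow(3)[OF c that]])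
    also have "\<dots> \<le> (\<Sum>j\<le>k. (SUP s. norm (dpow j f s)))"
      using that s0 by (intro member_le_sum[of j "{..k}" "\<lambda>j. SUP s. norm (dpow j f s)"]) auto
    also have "\<dots> \<le> norm_S1 k a f" using h0 by (simp add: norm_S1_def)
    finally show ?thesis .
  qed
  then show "j \<le> k \<Longrightarrow> norm (dpow j f s) \<le> norm_S1 k a f" .
  have "Sup (holder_quot_S1 a (dpow k f)) \<le> norm_S1 k a f"
    unfolding norm_S1_def using sum_nonneg[of "{..k}" "\<lambda>j. SUP s. norm (dpow j f s)"] s0 by simp
  then have 2: "Sup (holder_quot_S1 a (dpow k f)) * \<bar>x - y\<bar> powr a \<le> norm_S1 k a f * \<bar>x - y\<bar> powr a" for x y
    by (intro mult_right_mono) auto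
  then show "holder a (norm_S1 k a f) (dpow k f)"
    by (intro holderI 1[OF order_refl] order_trans[OF holder_of_quot_S1[OF C_S1_dpow(1)[OF c order_refl] b a] 2])
qed

lemma C_S1_I:
  fixes f :: "real \<Rightarrow> 'v::real_normed_vector"
  assumes per: "periodic1 f" and d: "\<And>j s. j < k \<Longrightarrow> (dpow j f has_vector_derivative dpow (Suc j) f s) (at s)"
    and b: "\<And>j s. j \<le> k \<Longrightarrow> norm (dpow j f s) \<le> K" and h: "holder a K (dpow k f)" and pk: "periodic1 (dpow k f)" and a: "0 < a"
  shows "C_S1 k a f" "norm_S1 k a f \<le> (real k + 2) * K"
proof -
  have q: "\<And>q. q \<in> holder_quot_S1 a (dpow k f) \<Longrightarrow> q \<le> K"
    by (rule holder_quot_S1_le[OF pk holderD2[OF h]])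
  then have "bdd_above (holder_quot_S1 a (dpow k f))" by (rule bdd_aboveI)
  then show "C_S1 k a f" unfolding C_S1_def using per d holder_continuous[OF a h] by blast
  \<comment> \<open>There are k + 1 sup norms and one Hoelder quotient, each at most
    \<open>K\<close>.\<close>
  have "(\<Sum>j\<le>k. (SUP s. norm (dpow j f s))) \<le> of_nat (card {..k}) * K"
    using b by (intro sum_bounded_above cSUP_least) auto
  moreover have "Sup (holder_quot_S1 a (dpow k f)) \<le> K" using q by (intro cSup_least holder_quot_S1_nonempty) auto
  ultimately show "norm_S1 k a f \<le> (real k + 2) * K" by (simp add: norm_S1_def distrib_right)
qed

lemma dpow_eqs:
  assumes "\<And>s. (f has_vector_derivative f1 s) (at s)" "\<And>s. (f1 has_vector_derivative f2 s) (at s)"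
  shows "dpow 1 f = f1" "dpow 2 f = f2"
proof -
  have "dpow (Suc 0) f = f1" using assms(1) by (auto simp: fun_eq_iff vector_derivative_at)
  moreover from this have "dpow (Suc (Suc 0)) f = f2" using assms(2) by (simp add: fun_eq_iff vector_derivative_at)
  ultimately show "dpow 1 f = f1" "dpow 2 f = f2" by (simp_all add: numeral_2_eq_2)
qed

lemma holder_quot_nonempty: assumes "0 < T" shows "holder_quot {0..T} b f \<noteq> {}"
proof -
  have "norm (f 0 - f T) / \<bar>0 - T\<bar> powr b \<in> holder_quot {0..T} b f"
    unfolding holder_quot_def by (rule image_eqI[of _ _ "(0, T)"]) (use assms in auto)
  then show ?thesis by blast
qed

lemma C_int_I:
  fixes u :: "real \<Rightarrow> 'v::real_normed_vector"
  assumes T: "0 < T" and b: "0 < b" and n: "\<And>t. t \<in> {0..T} \<Longrightarrow> norm (u t) \<le> K"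
    and h: "\<And>t t'. t \<in> {0..T} \<Longrightarrow> t' \<in> {0..T} \<Longrightarrow> norm (u t - u t') \<le> K * \<bar>t - t'\<bar> powr b"
  shows "C_int T b u" "norm_int T b u \<le> 2 * K"
proof -
  have q: "q \<le> K" if "q \<in> holder_quot {0..T} b u" for q
  proof -
    obtain t t' where t: "q = norm (u t - u t') / \<bar>t - t'\<bar> powr b" "t \<in> {0..T}" "t' \<in> {0..T}" "t \<noteq> t'"
      using \<open>q \<in> _\<close> by (auto simp: holder_quot_def)
    then show ?thesis using h[OF t(2,3)] by (simp add: divide_le_eq)
  qed
  then have "bdd_above (holder_quot {0..T} b u)" by (rule bdd_aboveI)
  then show "C_int T b u" unfolding C_int_def using continuous_on_of_holder[of "{0..T}" u K b, OF h b] by blast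
  have "(SUP t\<in>{0..T}. norm (u t)) \<le> K" using n T by (intro cSUP_least) auto
  moreover have "Sup (holder_quot {0..T} b u) \<le> K" using q by (intro cSup_least holder_quot_nonempty[OF T]) auto
  ultimately show "norm_int T b u \<le> 2 * K" by (simp add: norm_int_def)
qed

lemma norm_int_bounds:
  fixes u :: "real \<Rightarrow> 'v::real_normed_vector"
  assumes T: "0 < T" and c: "C_int T b u"
  shows "0 \<le> norm_int T b u" "t \<in> {0..T} \<Longrightarrow> t' \<in> {0..T} \<Longrightarrow> norm (u t - u t') \<le> norm_int T b u * \<bar>t - t'\<bar> powr b"
proof -
  have "compact ((\<lambda>t. norm (u t)) ` {0..T})"
    using c by (intro compact_continuous_image continuous_intros) (auto simp: C_int_def)
  then have b1: "bdd_above ((\<lambda>t. norm (u t)) ` {0..T})" by (intro bounded_imp_bdd_above compact_imp_bounded)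
  have b2: "bdd_above (holder_quot {0..T} b u)" using c by (simp add: C_int_def)
  have 1: "0 \<le> (SUP t\<in>{0..T}. norm (u t))" using b1 T by (intro SUP_norm_nonneg) auto
  have 2: "0 \<le> Sup (holder_quot {0..T} b u)"
    by (intro Sup_nonneg_real holder_quot_nonempty T b2 holder_quot_nonneg)
  show 0: "0 \<le> norm_int T b u" using 1 2 by (simp add: norm_int_def)
  assume t: "t \<in> {0..T}" "t' \<in> {0..T}"
  show "norm (u t - u t') \<le> norm_int T b u * \<bar>t - t'\<bar> powr b"
  proof (cases "t = t'")
    case False
    have "norm (u t - u t') / \<bar>t - t'\<bar> powr b \<in> holder_quot {0..T} b u"
      unfolding holder_quot_def by (rule image_eqI[of _ _ "(t, t')"]) (use False t in auto)
    then have "norm (u t - u t') / \<bar>t - t'\<bar> powr b \<le> Sup (holder_quot {0..T} b u)" using b2 by (rule cSup_upper)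
    also have "\<dots> \<le> norm_int T b u" using 1 by (simp add: norm_int_def)
    finally show ?thesis using False by (simp add: divide_le_eq)
  qed simp
qed

lemma C_par_bounds:
  fixes xi :: "real \<Rightarrow> real \<Rightarrow> 'v::real_normed_vector"
  assumes T: "0 < T" and a: "0 < a" and c: "C_par k a b T xi"
  obtains K where "\<And>t j s. t \<in> {0..T} \<Longrightarrow> j \<le> k \<Longrightarrow> norm (dpow j (xi t) s) \<le> K"
    "\<And>t. t \<in> {0..T} \<Longrightarrow> holder a K (dpow k (xi t))"
    "\<And>t t' j s. t \<in> {0..T} \<Longrightarrow> t' \<in> {0..T} \<Longrightarrow> j \<le> k \<Longrightarrow> norm (dpow j (xi t) s - dpow j (xi t') s) \<le> K * \<bar>t - t'\<bar> powr b"
proof -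
  have cs: "\<And>t. t \<in> {0..T} \<Longrightarrow> C_S1 k a (xi t)" and ci: "\<And>s j. j \<le> k \<Longrightarrow> C_int T b (\<lambda>t. dpow j (xi t) s)"
    using c by (auto simp: C_par_def)
  obtain K1 where K1: "\<And>t. t \<in> {0..T} \<Longrightarrow> norm_S1 k a (xi t) \<le> K1"
    using c unfolding C_par_def bdd_above_def by blast
  obtain K2 where K2: "\<And>s. (\<Sum>j\<le>k. norm_int T b (\<lambda>t. dpow j (xi t) s)) \<le> K2"
    using c unfolding C_par_def bdd_above_def by blast
  show thesis
  proof (rule that[of "max K1 K2"])
    fix t assume t: "t \<in> {0..T}"
    show "norm (dpow j (xi t) s) \<le> max K1 K2" if "j \<le> k" for j s
      using norm_S1_bounds(1)[OF cs[OF t] a that, of s] K1[OF t] by linarith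
    show "holder a (max K1 K2) (dpow k (xi t))"
      using norm_S1_bounds(2)[OF cs[OF t] a] by (rule holder_mono) (use K1[OF t] in linarith)
    fix t' j s assume t': "t' \<in> {0..T}" and j: "j \<le> k"
    have "norm_int T b (\<lambda>t. dpow j (xi t) s) \<le> (\<Sum>j\<le>k. norm_int T b (\<lambda>t. dpow j (xi t) s))"
      using j norm_int_bounds(1)[OF T ci] by (intro member_le_sum[of j "{..k}" "\<lambda>j. norm_int T b (\<lambda>t. dpow j (xi t) s)"]) auto
    also have "\<dots> \<le> max K1 K2" using K2[of s] by linarith
    finally have "norm_int T b (\<lambda>t. dpow j (xi t) s) * \<bar>t - t'\<bar> powr b \<le> max K1 K2 * \<bar>t - t'\<bar> powr b"
      by (intro mult_right_mono) auto
    then show "norm (dpow j (xi t) s - dpow j (xi t') s) \<le> max K1 K2 * \<bar>t - t'\<bar> powr b"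
      using norm_int_bounds(2)[OF T ci[OF j] t t', of s] by linarith
  qed
qed

lemma C_par_I:
  fixes xi :: "real \<Rightarrow> real \<Rightarrow> 'v::real_normed_vector"
  assumes T: "0 < T" and a: "0 < a" and b: "0 < b"
    and per: "\<And>t. t \<in> {0..T} \<Longrightarrow> periodic1 (xi t)" and d: "\<And>t j s. t \<in> {0..T} \<Longrightarrow> j < k \<Longrightarrow> (dpow j (xi t) has_vector_derivative dpow (Suc j) (xi t) s) (at s)"
    and pk: "\<And>t. t \<in> {0..T} \<Longrightarrow> periodic1 (dpow k (xi t))"
    and n: "\<And>t j s. t \<in> {0..T} \<Longrightarrow> j \<le> k \<Longrightarrow> norm (dpow j (xi t) s) \<le> K"
    and h: "\<And>t. t \<in> {0..T} \<Longrightarrow> holder a K (dpow k (xi t))"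
    and ht: "\<And>t t' j s. t \<in> {0..T} \<Longrightarrow> t' \<in> {0..T} \<Longrightarrow> j \<le> k \<Longrightarrow> norm (dpow j (xi t) s - dpow j (xi t') s) \<le> K * \<bar>t - t'\<bar> powr b"
  shows "C_par k a b T xi"
proof -
  note S = C_S1_I[OF per d n h pk a]
  have I: "C_int T b (\<lambda>t. dpow j (xi t) s)" "norm_int T b (\<lambda>t. dpow j (xi t) s) \<le> 2 * K" if "j \<le> k" for j s
    by (rule C_int_I[where K = K, OF T b]; use n[OF _ that] ht[OF _ _ that] in blast)+
  have "(\<Sum>j\<le>k. norm_int T b (\<lambda>t. dpow j (xi t) s)) \<le> of_nat (card {..k}) * (2 * K)" for s
    using I(2) by (intro sum_bounded_above) auto
  then have "bdd_above ((\<lambda>s. \<Sum>j\<le>k. norm_int T b (\<lambda>t. dpow j (xi t) s)) ` UNIV)" by (intro bdd_aboveI) auto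
  moreover have "bdd_above ((\<lambda>t. norm_S1 k a (xi t)) ` {0..T})" using S(2) by (intro bdd_aboveI[of _ "(real k + 2) * K"]) auto
  ultimately show ?thesis unfolding C_par_def using S(1) I(1) by blast
qed

section \<open>Passage between \<open>classical\<close> and \<open>is_solution\<close>\<close>

lemma classical_is_solution:
  fixes x0 :: "real \<Rightarrow> real \<Rightarrow> 'v::euclidean_space"
  assumes a: "0 < a" "a < 1" and T: "0 < T" and x: "classical a T K x0 x1 x2 xt \<sigma> \<sigma>1" and i: "x0 0 = xi0"
  shows "is_solution a T xi0 x0"
proof -
  note X = classicalD[OF x]
  have d: "dpow 1 (x0 t) = x1 t" "dpow 2 (x0 t) = x2 t" if "t \<in> {0..T}" for t
    using dpow_eqs[OF X(2,3)] that by auto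
  have x1h: "norm (x1 t s - x1 t' s) \<le> K * \<bar>t - t'\<bar> powr (a / 2)" if "t \<in> {0..T}" "t' \<in> {0..T}" for t t' s
    using x that by (auto simp: classical_def)
  have j2: "j \<le> 2 \<longleftrightarrow> j = 0 \<or> j = 1 \<or> j = 2" "j < 2 \<longleftrightarrow> j = 0 \<or> j = 1" for j :: nat by auto
  have C2: "C_par 2 a (a / 2) T x0"
  proof (rule C_par_I[where K = K])
    show "(dpow j (x0 t) has_vector_derivative dpow (Suc j) (x0 t) s) (at s)" if "t \<in> {0..T}" "j < 2" for t j s
    proof -
      have "j = 0 \<or> j = 1" using that(2) by auto
      then show ?thesis
      proof
        assume j: "j = 0"
        show ?thesis unfolding j dpow.simps(1) One_nat_def[symmetric] d(1)[OF that(1)] by (rule X(2)[OF that(1)])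
      next
        assume j: "j = 1"
        have "Suc 1 = 2" by simp
        then show ?thesis unfolding j d(1)[OF that(1)] using d(2)[OF that(1)] X(3)[OF that(1)] by metis
      qed
    qed
    show "norm (dpow j (x0 t) s) \<le> K" if "t \<in> {0..T}" "j \<le> 2" for t j s
      using that(2) d[OF that(1)] X(4,5,6)[OF that(1), of s] unfolding j2 by auto
    show "norm (dpow j (x0 t) s - dpow j (x0 t') s) \<le> K * \<bar>t - t'\<bar> powr (a / 2)" if "t \<in> {0..T}" "t' \<in> {0..T}" "j \<le> 2" for t t' j s
      using that(3) d[OF that(1)] d[OF that(2)] X(14,15)[OF that(1,2), of s] x1h[OF that(1,2), of s] unfolding j2 by auto
  qed (use a T X d in auto)
  have dt: "dt T x0 t = xt t" if t: "t \<in> {0..T}" for t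
  proof
    fix s
    show "dt T x0 t s = xt t s"
      using vector_derivative_within_cbox[of 0 T t "\<lambda>t. x0 t s" "xt t s"] X(11)[OF t, of s] T t by (simp add: dt_def)
  qed
  have px: "periodic1 (xt t)" if "t \<in> {0..T}" for t using x that by (auto simp: classical_def)
  have C0: "C_par 0 a (a / 2) T (dt T x0)"
    by (rule C_par_I[where K = K]) (use a T X(8,16) holderD1[OF X(8)] dt px in auto)
  have sg: "periodic1 (\<sigma> t)" "(\<sigma> t has_vector_derivative dpow 1 (\<sigma> t) s) (at s)"
    "(dpow 1 (\<sigma> t) has_vector_derivative dpow 2 (\<sigma> t) s) (at s)"
    "dpow 2 (\<sigma> t) s - (norm (dpow 2 (x0 t) s))\<^sup>2 * \<sigma> t s = -1"
    "((\<lambda>r. \<sigma> t r *\<^sub>R dpow 1 (x0 t) r) has_vector_derivative (dt T x0 t s - x0 t s)) (at s)" if t: "t \<in> {0..T}" for t s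
  proof -
    have S: "periodic1 (\<sigma> t)" "\<And>s. (\<sigma> t has_vector_derivative \<sigma>1 t s) (at s)"
      "\<And>s. (\<sigma>1 t has_vector_derivative ((norm (x2 t s))\<^sup>2 * \<sigma> t s - 1)) (at s)"
      using X(9)[OF t] by (auto simp: solves_ell_def)
    note e = dpow_eqs[OF S(2,3)]
    show "periodic1 (\<sigma> t)" "(\<sigma> t has_vector_derivative dpow 1 (\<sigma> t) s) (at s)"
      "(dpow 1 (\<sigma> t) has_vector_derivative dpow 2 (\<sigma> t) s) (at s)"
      "dpow 2 (\<sigma> t) s - (norm (dpow 2 (x0 t) s))\<^sup>2 * \<sigma> t s = -1"
      using S unfolding e d[OF t] by auto
    have "((\<lambda>r. \<sigma> t r *\<^sub>R x1 t r) has_vector_derivative (\<sigma> t s *\<^sub>R x2 t s + \<sigma>1 t s *\<^sub>R x1 t s)) (at s)"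
      using S(2) X(3)[OF t] by (intro has_vector_derivative_scaleR) (simp add: has_real_derivative_iff_has_vector_derivative)
    moreover have "\<sigma> t s *\<^sub>R x2 t s + \<sigma>1 t s *\<^sub>R x1 t s = dt T x0 t s - x0 t s"
      unfolding dt[OF t] X(10)[OF t] flux_def by simp
    ultimately show "((\<lambda>r. \<sigma> t r *\<^sub>R dpow 1 (x0 t) r) has_vector_derivative (dt T x0 t s - x0 t s)) (at s)"
      unfolding d[OF t] by simp
  qed
  have df: "(\<lambda>\<tau>. x0 \<tau> s) differentiable (at t within {0..T})" if "t \<in> {0..T}" for t s
    using X(11)[OF that, of s] unfolding has_vector_derivative_def by (rule differentiableI)
  show ?thesis unfolding is_solution_def using C2 C0 sg df i by blast
qed

text \<open>Stated for all large \<open>N\<close>, because uniqueness compares two solutions with a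
  common constant.\<close>

lemma is_solution_classical:
  fixes xi :: "real \<Rightarrow> real \<Rightarrow> 'v::euclidean_space"
  assumes a: "0 < a" "a < 1" and T: "0 < T" and s: "is_solution a T xi0 xi"
  obtains K x1 x2 xt \<sigma> \<sigma>1 where "\<And>N. K \<le> N \<Longrightarrow> classical a T N xi x1 x2 xt \<sigma> \<sigma>1" "xi 0 = xi0"
proof -
  have c2: "C_par 2 a (a / 2) T xi" and c0: "C_par 0 a (a / 2) T (dt T xi)"
    and df: "\<And>t s. t \<in> {0..T} \<Longrightarrow> (\<lambda>\<tau>. xi \<tau> s) differentiable (at t within {0..T})" and i: "xi 0 = xi0"
    using s by (auto simp: is_solution_def)
  obtain \<sigma> :: "real \<Rightarrow> real \<Rightarrow> real" where sg: "\<And>t. t \<in> {0..T} \<Longrightarrow> periodic1 (\<sigma> t)"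
    "\<And>t s. t \<in> {0..T} \<Longrightarrow> (\<sigma> t has_vector_derivative dpow 1 (\<sigma> t) s) (at s)"
    "\<And>t s. t \<in> {0..T} \<Longrightarrow> (dpow 1 (\<sigma> t) has_vector_derivative dpow 2 (\<sigma> t) s) (at s)"
    "\<And>t s. t \<in> {0..T} \<Longrightarrow> dpow 2 (\<sigma> t) s - (norm (dpow 2 (xi t) s))\<^sup>2 * \<sigma> t s = -1"
    "\<And>t s. t \<in> {0..T} \<Longrightarrow> ((\<lambda>r. \<sigma> t r *\<^sub>R dpow 1 (xi t) r) has_vector_derivative (dt T xi t s - xi t s)) (at s)"
    using s unfolding is_solution_def by blast
  obtain K1 where K1: "\<And>t j s. t \<in> {0..T} \<Longrightarrow> j \<le> 2 \<Longrightarrow> norm (dpow j (xi t) s) \<le> K1"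
    "\<And>t. t \<in> {0..T} \<Longrightarrow> holder a K1 (dpow 2 (xi t))"
    "\<And>t t' j s. t \<in> {0..T} \<Longrightarrow> t' \<in> {0..T} \<Longrightarrow> j \<le> 2 \<Longrightarrow> norm (dpow j (xi t) s - dpow j (xi t') s) \<le> K1 * \<bar>t - t'\<bar> powr (a / 2)"
    using C_par_bounds[OF T a(1) c2] by metis
  obtain K2 where K2: "\<And>t. t \<in> {0..T} \<Longrightarrow> holder a K2 (dpow 0 (dt T xi t))"
    "\<And>t t' j s. t \<in> {0..T} \<Longrightarrow> t' \<in> {0..T} \<Longrightarrow> j \<le> 0 \<Longrightarrow> norm (dpow j (dt T xi t) s - dpow j (dt T xi t') s) \<le> K2 * \<bar>t - t'\<bar> powr (a / 2)"
    using C_par_bounds[OF T a(1) c0] by metis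
  have C2: "C_S1 2 a (xi t)" and C0: "C_S1 0 a (dt T xi t)" if "t \<in> {0..T}" for t
    using c2 c0 that by (auto simp: C_par_def)
  have d: "(xi t has_vector_derivative dpow 1 (xi t) s) (at s)" "(dpow 1 (xi t) has_vector_derivative dpow 2 (xi t) s) (at s)"
    if "t \<in> {0..T}" for t s
  proof -
    have "\<forall>j<2. \<forall>s. (dpow j (xi t) has_vector_derivative dpow (Suc j) (xi t) s) (at s)"
      using C2[OF that] by (simp add: C_S1_def)
    from this[rule_format, of 0] this[rule_format, of 1]
    show "(xi t has_vector_derivative dpow 1 (xi t) s) (at s)" "(dpow 1 (xi t) has_vector_derivative dpow 2 (xi t) s) (at s)"
      by (simp_all add: numeral_2_eq_2)
  qed
  have "classical a T N xi (\<lambda>t. dpow 1 (xi t)) (\<lambda>t. dpow 2 (xi t)) (dt T xi) \<sigma> (\<lambda>t. dpow 1 (\<sigma> t))" if N: "max K1 K2 \<le> N" for N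
  proof -
    have N': "K1 \<le> N" "K2 \<le> N" using N by auto
    have "jet a N N (xi t) (dpow 1 (xi t)) (dpow 2 (xi t)) \<and> holder a N (dt T xi t) \<and> periodic1 (dt T xi t)
      \<and> solves_ell (\<lambda>s. (norm (dpow 2 (xi t) s))\<^sup>2) (\<sigma> t) (dpow 1 (\<sigma> t))
      \<and> (\<forall>s. dt T xi t s = flux (\<sigma> t) (dpow 1 (\<sigma> t)) (xi t) (dpow 1 (xi t)) (dpow 2 (xi t)) s)
      \<and> (\<forall>s. ((\<lambda>t. xi t s) has_vector_derivative dt T xi t s) (at t within {0..T}))" if t: "t \<in> {0..T}" for t
    proof (intro conjI allI)
      show "jet a N N (xi t) (dpow 1 (xi t)) (dpow 2 (xi t))"
        unfolding jet_def using C2[OF t] d[OF t] order_trans[OF K1(1)[OF t, of 0] N'(1)] order_trans[OF K1(1)[OF t, of 1] N'(1)]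
          order_trans[OF K1(1)[OF t, of 2] N'(1)] holder_mono[OF K1(2)[OF t] N'(1)] by (simp add: C_S1_def)
      show "holder a N (dt T xi t)" using holder_mono[OF K2(1)[OF t] N'(2)] by simp
      show "periodic1 (dt T xi t)" using C0[OF t] by (simp add: C_S1_def)
      show "solves_ell (\<lambda>s. (norm (dpow 2 (xi t) s))\<^sup>2) (\<sigma> t) (dpow 1 (\<sigma> t))"
      proof -
        have "dpow 2 (\<sigma> t) s = (norm (dpow 2 (xi t) s))\<^sup>2 * \<sigma> t s - 1" for s using sg(4)[OF t, of s] by simp
        then show ?thesis unfolding solves_ell_def using sg(1,2,3)[OF t] by metis
      qed
      fix s
      \<comment> \<open>The product rule and uniqueness of derivatives turn the divergence form of
        the equation into \<open>flux\<close>.\<close>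
      have "((\<lambda>r. \<sigma> t r *\<^sub>R dpow 1 (xi t) r) has_vector_derivative (\<sigma> t s *\<^sub>R dpow 2 (xi t) s + dpow 1 (\<sigma> t) s *\<^sub>R dpow 1 (xi t) s)) (at s)"
        using sg(2)[OF t] d(2)[OF t] by (intro has_vector_derivative_scaleR) (simp add: has_real_derivative_iff_has_vector_derivative)
      from vector_derivative_unique_at[OF this sg(5)[OF t]]
      show "dt T xi t s = flux (\<sigma> t) (dpow 1 (\<sigma> t)) (xi t) (dpow 1 (xi t)) (dpow 2 (xi t)) s"
        by (simp add: flux_def)
      show "((\<lambda>t. xi t s) has_vector_derivative dt T xi t s) (at t within {0..T})"
        unfolding dt_def using df[OF t] by (simp add: vector_derivative_works)
    qed
    moreover have "norm (xi t s - xi t' s) \<le> N * \<bar>t - t'\<bar> powr (a / 2)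
      \<and> norm (dpow 1 (xi t) s - dpow 1 (xi t') s) \<le> N * \<bar>t - t'\<bar> powr (a / 2)
      \<and> norm (dpow 2 (xi t) s - dpow 2 (xi t') s) \<le> N * \<bar>t - t'\<bar> powr (a / 2)
      \<and> norm (dt T xi t s - dt T xi t' s) \<le> N * \<bar>t - t'\<bar> powr (a / 2)" if t: "t \<in> {0..T}" "t' \<in> {0..T}" for t t' s
    proof -
      have m: "K1 * \<bar>t - t'\<bar> powr (a / 2) \<le> N * \<bar>t - t'\<bar> powr (a / 2)" "K2 * \<bar>t - t'\<bar> powr (a / 2) \<le> N * \<bar>t - t'\<bar> powr (a / 2)"
        using N' by (auto intro: mult_right_mono)
      show ?thesis
        using order_trans[OF K1(3)[OF t, of 0 s] m(1)] order_trans[OF K1(3)[OF t, of 1 s] m(1)] order_trans[OF K1(3)[OF t, of 2 s] m(1)]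
          order_trans[OF K2(2)[OF t, of 0 s] m(2)] by simp
    qed
    ultimately show ?thesis unfolding classical_def by blast
  qed
  then show thesis using that i by blast
qed

theorem theorem3p2:
  fixes a :: real
  assumes "0 < a" and "a < 1" and "CARD('d::finite) \<ge> 2"
  shows "\<exists>Tf :: real \<Rightarrow> real. (\<forall>r. Tf r > 0) \<and>
    (\<forall>xi0 :: real \<Rightarrow> real ^ 'd.
       C_S1 2 a xi0 \<and> (\<forall>s. norm (dpow 1 xi0 s) = 1) \<and> integral {0..1} xi0 = 0 \<longrightarrow>
       (let T = Tf (norm_S1 2 a xi0) in
          (\<exists>xi. is_solution a T xi0 xi)
          \<and> (\<forall>xi1 xi2. is_solution a T xi0 xi1 \<and> is_solution a T xi0 xi2 \<longrightarrow>
                (\<forall>t\<in>{0..T}. \<forall>s. xi1 t s = xi2 t s))))"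
proof (intro exI[of _ "\<lambda>r. lifespan a (max 1 r)"] conjI allI impI)
  note a = assms(1,2)
  have T: "0 < lifespan a (max 1 r)" for r using lifespan(1)[OF a] by simp
  then show "0 < lifespan a (max 1 r)" for r .
  fix xi0 :: "real \<Rightarrow> real ^ 'd"
  assume h: "C_S1 2 a xi0 \<and> (\<forall>s. norm (dpow 1 xi0 s) = 1) \<and> integral {0..1} xi0 = 0"
  \<comment> \<open>The constants were built for R \<ge> 1; the maximum also gives a positive
    lifespan for every real argument.\<close>
  define R where "R = max 1 (norm_S1 2 a xi0)"
  have R: "1 \<le> R" "norm_S1 2 a xi0 \<le> R" by (auto simp: R_def)
  have c: "C_S1 2 a xi0" using h by simp
  have "\<forall>j<2. \<forall>s. (dpow j xi0 has_vector_derivative dpow (Suc j) xi0 s) (at s)"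
    using c by (simp add: C_S1_def)
  from this[rule_format, of 0] this[rule_format, of 1]
  have d: "(xi0 has_vector_derivative dpow 1 xi0 s) (at s)" "(dpow 1 xi0 has_vector_derivative dpow 2 xi0 s) (at s)" for s
    by (simp_all add: numeral_2_eq_2)
  have i: "init a R xi0 (dpow 1 xi0) (dpow 2 xi0)"
    unfolding init_def using R d h norm_S1_bounds(1)[OF c a(1), of 0] holder_mono[OF norm_S1_bounds(2)[OF c a(1)] R(2)]
    by (auto simp: C_S1_def intro: order_trans)
  let ?T = "lifespan a R"
  have "\<exists>xi. is_solution a ?T xi0 xi"
    using existence_core[OF a R(1) i] classical_is_solution[OF a] T[of "norm_S1 2 a xi0", folded R_def] by blast
  moreover have "xi1 t s = xi2 t s"
    if s1: "is_solution a ?T xi0 xi1" and s2: "is_solution a ?T xi0 xi2" and t: "t \<in> {0..?T}" for xi1 xi2 t s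
  proof -
    have T': "0 < ?T" using T[of "norm_S1 2 a xi0"] by (simp add: R_def)
    obtain K x1 x2 xt \<sigma> \<sigma>1 where x: "\<And>N. K \<le> N \<Longrightarrow> classical a ?T N xi1 x1 x2 xt \<sigma> \<sigma>1" "xi1 0 = xi0"
      using is_solution_classical[OF a T' s1] by metis
    obtain L y1 y2 yt \<tau> \<tau>1 where y: "\<And>N. L \<le> N \<Longrightarrow> classical a ?T N xi2 y1 y2 yt \<tau> \<tau>1" "xi2 0 = xi0"
      using is_solution_classical[OF a T' s2] by metis
    \<comment> \<open>A common constant for both solutions, at least 1 as the energy argument
      requires.\<close>
    define N where "N = max 1 (max K L)"
    have N: "1 \<le> N" "K \<le> N" "L \<le> N" by (auto simp: N_def)
    show ?thesis
      by (rule classical_unique[OF a T' N(1) x(1)[OF N(2)] y(1)[OF N(3)] _ t]) (simp add: x(2) y(2))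
  qed
  ultimately show "let T = lifespan a (max 1 (norm_S1 2 a xi0)) in (\<exists>xi. is_solution a T xi0 xi)
          \<and> (\<forall>xi1 xi2. is_solution a T xi0 xi1 \<and> is_solution a T xi0 xi2 \<longrightarrow> (\<forall>t\<in>{0..T}. \<forall>s. xi1 t s = xi2 t s))"
    unfolding R_def Let_def by blast
qed

end
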